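(* Let $d\ge2$ be an integer, $d\le p<\infty$ and $1\le r<\infty$. Then for every $\tilde p$ with $p<\tilde p<\infty$ there exists a constant $\delta_{\tilde p,d}>0$ such that for all $T>0$ and all $u_0\in\dot H^{\frac dp-1}_{\mathcal L^{p,r}}(\mathbb R^d)$ with $\mathrm{div}(u_0)=0$ satisfying $$(\ast)\qquad\sup_{0<t<T}t^{\frac12(1-\frac d{\tilde p})}\big\|e^{t\Delta}u_0\big\|_{\mathcal L^{\tilde p,\infty}}\le\delta_{\tilde p,d},$$ the Navier-Stokes equations have a unique mild solution $u\in\bigcap_{p<q<\infty}\mathcal K^q_{d,1,T}\cap L^\infty\big([0,T];\dot H^{\frac dp-1}_{\mathcal L^{p,r}}(\mathbb R^d)\big)$ with initial datum $u_0$. In particular, for arbitrary (divergence-free) $u_0\in\dot H^{\frac dp-1}_{\mathcal L^{p,r}}(\mathbb R^d)$ the inequality $(\ast)$ holds when $T=T(u_0)$ is small enough; and there exists a constant $\sigma_{\tilde p,d}>0$ such that one can take $T=\infty$ whenever $\|u_0\|_{\dot B^{\frac d{\tilde p}-1,\infty}_{\mathcal L^{\tilde p,\infty}}}\le\sigma_{\tilde p,d}$.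
   Context: Fourier transform: $\hat f(\xi)=\mathcal Ff(\xi)=(2\pi)^{-d/2}\int_{\mathbb R^d}e^{-ix\cdot\xi}f(x)\,dx$. For $1\le p\le\infty$, $p'$ is defined by $\frac1p+\frac1{p'}=1$. Lorentz spaces: for measurable $f$ on $\mathbb R^d$, $f^*(t)=\inf\{\tau:|\{x:|f(x)|>\tau\}|\le t\}$; for $1\le p,r\le\infty$, $\|f\|_{L^{p,r}}=\big(\int_0^\infty(t^{1/p}f^*(t))^r\frac{dt}t\big)^{1/r}$ if $r<\infty$ and $\|f\|_{L^{p,\infty}}=\sup_{t>0}t^{1/p}f^*(t)$; $L^{p,r}$ is the set of $f$ for which this is finite. Fourier-Lorentz spaces: $\mathcal L^{p,r}(\mathbb R^d)=\mathcal F^{-1}(L^{p',r}(\mathbb R^d))$ with $\|f\|_{\mathcal L^{p,r}}=\|\hat f\|_{L^{p',r}}$. Sobolev-Fourier-Lorentz spaces: for $s\in\mathbb R$, $\dot H^s_{\mathcal L^{p,r}}=\dot\Lambda^{-s}\mathcal L^{p,r}$, where $\dot\Lambda=\sqrt{-\Delta}$ is the Fourier multiplier with symbol $|\xi|$; i.e. $u\in\dot H^s_{\mathcal L^{p,r}}$ iff $\hat u$ is a measurable function with $|\xi|^s\hat u(\xi)\in L^{p',r}$, and $\|u\|_{\dot H^s_{\mathcal L^{p,r}}}=\||\xi|^s\hat u\|_{L^{p',r}}$. For vector fields $u=(u_1,\dots,u_d)$ with all $u_i\in X$, $\|u\|_X=(\sum_i\|u_i\|_X^2)^{1/2}$. Besov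 space: with a standard homogeneous Littlewood-Paley decomposition $(\dot\Delta_j)_{j\in\mathbb Z}$, $\|f\|_{\dot B^{\sigma,\infty}_{\mathcal L^{\tilde p,\infty}}}=\sup_{j\in\mathbb Z}2^{j\sigma}\|\dot\Delta_jf\|_{\mathcal L^{\tilde p,\infty}}$. Space $\mathcal K^q_{d,1,T}$ for $d<q<\infty$, $0<T\le\infty$: with $\alpha=1-\frac dq$, the space of (measurable, vector-valued) functions $u(t,x)$ on $(0,T)\times\mathbb R^d$ with $\sup_{0<t<T}t^{\alpha/2}\|u(t)\|_{\mathcal L^{q,1}}<\infty$ and $\lim_{t\to0}t^{\alpha/2}\|u(t)\|_{\mathcal L^{q,1}}=0$. Navier-Stokes equations on $\mathbb R^d$: $\partial_tu=\Delta u-\nabla\cdot(u\otimes u)-\nabla\pi$ ($\pi$ the pressure), $\mathrm{div}\,u=0$, $u(0,\cdot)=u_0$. A mild solution on $[0,T]$ with divergence-free initial datum $u_0$ is a $u$ satisfying $u(t)=e^{t\Delta}u_0-\int_0^te^{(t-\tau)\Delta}\mathbb P\nabla\cdot(u(\tau)\otimes u(\tau))\,d\tau$, where $(u\otimes v)_{ij}=u_iv_j$, $(\nabla\cdot F)_i=\sum_j\partial_jF_{ij}$, $\mathbb P$ is the Leray projection (Fourier multiplier with matrix symbol $\delta_{jk}-\xi_j\xi_k/|\xi|^2$), and $e^{t\Delta}$ is the heat semigroup (Fourier multiplier $e^{-t|\xi|^2}$). Products are understood via $\widehat{fg}=(2\pi)^{-d/2}\hat f*\hat g$. *)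

theory Defs
  imports "HOL-Analysis.Analysis"
begin

definition pderiv_dir :: "'n \<Rightarrow> (real ^ 'n::finite \<Rightarrow> 'b::real_normed_vector) \<Rightarrow> real ^ 'n \<Rightarrow> 'b" where
  "pderiv_dir j f = (\<lambda>x. frechet_derivative f (at x) (axis j 1))"

text \<open>Iterated partial derivatives, indexed by lists of directions instead of multi-indices.\<close>

definition iter_pderiv :: "'n list \<Rightarrow> (real ^ 'n::finite \<Rightarrow> 'b::real_normed_vector) \<Rightarrow> real ^ 'n \<Rightarrow> 'b" where
  "iter_pderiv js f = foldr pderiv_dir js f"

definition smooth_fun :: "(real ^ 'n::finite \<Rightarrow> 'b::real_normed_vector) \<Rightarrow> bool" where
  "smooth_fun f \<longleftrightarrow> (\<forall>js x. iter_pderiv js f differentiable (at x))"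

definition schwartz :: "(real ^ 'n::finite \<Rightarrow> complex) set" where
  "schwartz = {f. smooth_fun f \<and>
     (\<forall>js (k::nat). bounded (range (\<lambda>x. (1 + norm x) ^ k * norm (iter_pderiv js f x))))}"

definition schwartz_seminorm :: "nat \<Rightarrow> (real ^ 'n::finite \<Rightarrow> complex) \<Rightarrow> real" where
  "schwartz_seminorm N f =
     (SUP (js, x) \<in> {js. length js \<le> N} \<times> UNIV. (1 + norm x) ^ N * norm (iter_pderiv js f x))"

type_synonym 'n dist = "(real ^ 'n \<Rightarrow> complex) \<Rightarrow> complex"

text \<open>Distributions are functionals on all functions, normalised to be \<open>0\<close> off the Schwartz
  space, so that equality of functionals is equality of distributions.\<close>

definition tempered :: "'n::finite dist \<Rightarrow> bool" where
  "tempered u \<longleftrightarrow>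
     (\<forall>f. f \<notin> schwartz \<longrightarrow> u f = 0) \<and>
     (\<forall>f\<in>schwartz. \<forall>g\<in>schwartz. u (\<lambda>x. f x + g x) = u f + u g) \<and>
     (\<forall>c. \<forall>f\<in>schwartz. u (\<lambda>x. c * f x) = c * u f) \<and>
     (\<exists>N C. \<forall>f\<in>schwartz. norm (u f) \<le> C * schwartz_seminorm N f)"

definition fun_dist :: "(real ^ 'n::finite \<Rightarrow> complex) \<Rightarrow> 'n dist" where
  "fun_dist g = (\<lambda>f. if f \<in> schwartz then LINT x|lebesgue. g x * f x else 0)"

text \<open>The distribution \<open>u\<close> is (given by) the measurable function \<open>g\<close>.\<close>

definition is_fun :: "(real ^ 'n::finite \<Rightarrow> complex) \<Rightarrow> 'n dist \<Rightarrow> bool" where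
  "is_fun g u \<longleftrightarrow> g \<in> borel_measurable lebesgue \<and>
     (\<forall>f\<in>schwartz. integrable lebesgue (\<lambda>x. g x * f x)) \<and> u = fun_dist g"

definition dist_pderiv :: "'n \<Rightarrow> 'n::finite dist \<Rightarrow> 'n dist" where
  "dist_pderiv j u = (\<lambda>f. if f \<in> schwartz then - u (pderiv_dir j f) else 0)"

definition fourier :: "(real ^ 'n::finite \<Rightarrow> complex) \<Rightarrow> real ^ 'n \<Rightarrow> complex" where
  "fourier f \<xi> = complex_of_real ((2 * pi) powr (- real CARD('n) / 2)) *
     (LINT x|lebesgue. exp (- \<i> * complex_of_real (x \<bullet> \<xi>)) * f x)"

definition inv_fourier :: "(real ^ 'n::finite \<Rightarrow> complex) \<Rightarrow> real ^ 'n \<Rightarrow> complex" where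
  "inv_fourier f x = fourier f (- x)"

definition dist_fourier :: "'n::finite dist \<Rightarrow> 'n dist" where
  "dist_fourier u = (\<lambda>f. if f \<in> schwartz then u (fourier f) else 0)"

definition dist_inv_fourier :: "'n::finite dist \<Rightarrow> 'n dist" where
  "dist_inv_fourier u = (\<lambda>f. if f \<in> schwartz then u (inv_fourier f) else 0)"

definition has_fourier_fun :: "'n::finite dist \<Rightarrow> bool" where
  "has_fourier_fun u \<longleftrightarrow> tempered u \<and> (\<exists>g. is_fun g (dist_fourier u))"

text \<open>A representative of the Fourier transform of \<open>u\<close>, unique up to null sets; meaningful only
  if \<open>has_fourier_fun u\<close>.\<close>

definition ft :: "'n::finite dist \<Rightarrow> real ^ 'n \<Rightarrow> complex" where
  "ft u = (SOME g. is_fun g (dist_fourier u))"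

definition multiplier :: "(real ^ 'n::finite \<Rightarrow> complex) \<Rightarrow> 'n dist \<Rightarrow> 'n dist" where
  "multiplier m u = dist_inv_fourier (fun_dist (\<lambda>\<xi>. m \<xi> * ft u \<xi>))"

definition heat :: "real \<Rightarrow> 'n::finite dist \<Rightarrow> 'n dist" where
  "heat t = multiplier (\<lambda>\<xi>. complex_of_real (exp (- t * (norm \<xi>)\<^sup>2)))"

definition dist_prod :: "'n::finite dist \<Rightarrow> 'n dist \<Rightarrow> 'n dist" where
  "dist_prod u v = dist_inv_fourier (fun_dist (\<lambda>\<xi>.
     complex_of_real ((2 * pi) powr (- real CARD('n) / 2)) *
     (LINT \<eta>|lebesgue. ft u (\<xi> - \<eta>) * ft v \<eta>)))"

definition leray_symbol :: "'n \<Rightarrow> 'n \<Rightarrow> real ^ 'n::finite \<Rightarrow> complex" where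
  "leray_symbol j k \<xi> =
     complex_of_real ((if j = k then 1 else 0) - \<xi> $ j * \<xi> $ k / (norm \<xi>)\<^sup>2)"

definition leray :: "('n \<Rightarrow> 'n::finite dist) \<Rightarrow> 'n \<Rightarrow> 'n dist" where
  "leray v j = (\<lambda>f. \<Sum>k\<in>UNIV. multiplier (leray_symbol j k) (v k) f)"

definition divergence :: "('n \<Rightarrow> 'n::finite dist) \<Rightarrow> 'n dist" where
  "divergence v = (\<lambda>f. \<Sum>j\<in>UNIV. dist_pderiv j (v j) f)"

definition div_free :: "('n \<Rightarrow> 'n::finite dist) \<Rightarrow> bool" where
  "div_free v \<longleftrightarrow> divergence v = (\<lambda>f. 0)"

definition tensor_prod :: "('n \<Rightarrow> 'n::finite dist) \<Rightarrow> ('n \<Rightarrow> 'n dist) \<Rightarrow> 'n \<Rightarrow> 'n \<Rightarrow> 'n dist" where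
  "tensor_prod u v i j = dist_prod (u i) (v j)"

definition tensor_div :: "('n \<Rightarrow> 'n \<Rightarrow> 'n::finite dist) \<Rightarrow> 'n \<Rightarrow> 'n dist" where
  "tensor_div F i = divergence (F i)"

definition rearrangement :: "(real ^ 'n::finite \<Rightarrow> complex) \<Rightarrow> real \<Rightarrow> ennreal" where
  "rearrangement f t =
     (INF \<tau> \<in> {\<tau>::real. 0 \<le> \<tau> \<and> emeasure lebesgue {x. norm (f x) > \<tau>} \<le> ennreal t}. ennreal \<tau>)"

text \<open>Powers with positive exponent on \<open>[0,\<infinity>]\<close>.\<close>

definition epow :: "ennreal \<Rightarrow> real \<Rightarrow> ennreal" where
  "epow x a = (if x = \<infinity> then \<infinity> else ennreal (enn2real x powr a))"

text \<open>Since \<open>inverse \<infinity> = 0\<close> in \<open>[0,\<infinity>]\<close>, the factor \<open>t\<^bsup>1/p\<^esup>\<close> is \<open>1\<close> for \<open>p = \<infinity>\<close>.\<close>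

definition lorentz_norm :: "ennreal \<Rightarrow> ennreal \<Rightarrow> (real ^ 'n::finite \<Rightarrow> complex) \<Rightarrow> ennreal" where
  "lorentz_norm p r f =
     (let w = (\<lambda>t. ennreal (t powr enn2real (inverse p)) * rearrangement f t) in
      if r = \<infinity> then (SUP t\<in>{0<..}. w t)
      else epow (\<integral>\<^sup>+t\<in>{0<..}. epow (w t) (enn2real r) * ennreal (1 / t) \<partial>lborel) (1 / enn2real r))"

definition lorentz_space :: "ennreal \<Rightarrow> ennreal \<Rightarrow> (real ^ 'n::finite \<Rightarrow> complex) set" where
  "lorentz_space p r = {f \<in> borel_measurable lebesgue. lorentz_norm p r f < \<infinity>}"

definition conj_exp :: "ennreal \<Rightarrow> ennreal" where
  "conj_exp p = inverse (1 - inverse p)"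

text \<open>The distributions in these spaces are those whose Fourier transform is a function, so
  that \<open>ft\<close> is meaningful.\<close>

definition FL_norm :: "ennreal \<Rightarrow> ennreal \<Rightarrow> 'n::finite dist \<Rightarrow> ennreal" where
  "FL_norm p r u = lorentz_norm (conj_exp p) r (ft u)"

definition FL_space :: "ennreal \<Rightarrow> ennreal \<Rightarrow> 'n::finite dist set" where
  "FL_space p r = {u. has_fourier_fun u \<and> ft u \<in> lorentz_space (conj_exp p) r}"

definition HFL_norm :: "real \<Rightarrow> ennreal \<Rightarrow> ennreal \<Rightarrow> 'n::finite dist \<Rightarrow> ennreal" where
  "HFL_norm s p r u =
     lorentz_norm (conj_exp p) r (\<lambda>\<xi>. complex_of_real (norm \<xi> powr s) * ft u \<xi>)"

definition HFL_space :: "real \<Rightarrow> ennreal \<Rightarrow> ennreal \<Rightarrow> 'n::finite dist set" where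
  "HFL_space s p r = {u. has_fourier_fun u \<and>
     (\<lambda>\<xi>. complex_of_real (norm \<xi> powr s) * ft u \<xi>) \<in> lorentz_space (conj_exp p) r}"

definition vec_norm :: "('n::finite dist \<Rightarrow> ennreal) \<Rightarrow> ('n \<Rightarrow> 'n dist) \<Rightarrow> ennreal" where
  "vec_norm N u = epow (\<Sum>i\<in>UNIV. (N (u i))\<^sup>2) (1 / 2)"

text \<open>\<open>\<psi>\<close> is the symbol of \<open>\<Delta>\<^sub>0\<close> in a homogeneous Littlewood-Paley decomposition.\<close>

definition littlewood_paley :: "(real ^ 'n::finite \<Rightarrow> real) \<Rightarrow> bool" where
  "littlewood_paley \<psi> \<longleftrightarrow> smooth_fun \<psi> \<and>
     (\<exists>a b. 0 < a \<and> a < b \<and> (\<forall>\<xi>. \<psi> \<xi> \<noteq> 0 \<longrightarrow> a \<le> norm \<xi> \<and> norm \<xi> \<le> b)) \<and>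
     (\<forall>\<xi>. \<xi> \<noteq> 0 \<longrightarrow> ((\<lambda>j::int. \<psi> ((2 powi (- j)) *\<^sub>R \<xi>)) has_sum 1) UNIV)"

definition lp_block :: "(real ^ 'n::finite \<Rightarrow> real) \<Rightarrow> int \<Rightarrow> 'n dist \<Rightarrow> 'n dist" where
  "lp_block \<psi> j = multiplier (\<lambda>\<xi>. complex_of_real (\<psi> ((2 powi (- j)) *\<^sub>R \<xi>)))"

text \<open>The Besov norm with third index \<open>\<infinity>\<close> over the Fourier-Lorentz space with indices \<open>p\<close>, \<open>r\<close>.\<close>

definition besov_norm ::
    "(real ^ 'n::finite \<Rightarrow> real) \<Rightarrow> real \<Rightarrow> ennreal \<Rightarrow> ennreal \<Rightarrow> 'n dist \<Rightarrow> ennreal" where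
  "besov_norm \<psi> s p r u =
     (SUP j::int. ennreal (2 powr (real_of_int j * s)) * FL_norm p r (lp_block \<psi> j u))"

definition K_space :: "real \<Rightarrow> ereal \<Rightarrow> (real \<Rightarrow> 'n \<Rightarrow> 'n::finite dist) set" where
  "K_space q T = {u.
     (\<exists>U :: real \<Rightarrow> 'n \<Rightarrow> real ^ 'n \<Rightarrow> complex.
        (\<forall>i. (\<lambda>(t, x). U t i x) \<in>
           borel_measurable (lebesgue_on ({t. 0 < t \<and> ereal t < T} \<times> UNIV))) \<and>
        (\<forall>t i. 0 < t \<and> ereal t < T \<longrightarrow> is_fun (U t i) (u t i))) \<and>
     (\<forall>t i. 0 < t \<and> ereal t < T \<longrightarrow> u t i \<in> FL_space (ennreal q) 1) \<and>
     (SUP t\<in>{t. 0 < t \<and> ereal t < T}.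
        ennreal (t powr ((1 - real CARD('n) / q) / 2)) * vec_norm (FL_norm (ennreal q) 1) (u t)) < \<infinity> \<and>
     ((\<lambda>t. ennreal (t powr ((1 - real CARD('n) / q) / 2)) * vec_norm (FL_norm (ennreal q) 1) (u t))
        \<longlongrightarrow> 0) (at_right 0)}"

text \<open>\<open>L\<^sup>\<infinity>([0,T]; X)\<close> for a space \<open>X\<close> of distributions with norm \<open>N\<close>. Measurability in
  time is tested against Schwartz functions; it is equivalent to strong measurability when \<open>X\<close> is
  separable. For \<open>T = \<infinity>\<close> the interval is \<open>[0,\<infinity>)\<close>.\<close>

definition Linf_time ::
    "ereal \<Rightarrow> 'n::finite dist set \<Rightarrow> ('n dist \<Rightarrow> ennreal) \<Rightarrow> (real \<Rightarrow> 'n \<Rightarrow> 'n dist) set" where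
  "Linf_time T X N = {u.
     (\<forall>i. \<forall>f\<in>schwartz.
        (\<lambda>t. u t i f) \<in> borel_measurable (lebesgue_on {t. 0 \<le> t \<and> ereal t \<le> T})) \<and>
     (\<exists>M::real. AE t in lebesgue_on {t. 0 \<le> t \<and> ereal t \<le> T}.
        (\<forall>i. u t i \<in> X) \<and> vec_norm N (u t) \<le> ennreal M)}"

text \<open>The Duhamel integral is taken in the space of tempered distributions, i.e. it is tested
  against Schwartz functions.\<close>

definition mild_solution ::
    "ereal \<Rightarrow> ('n \<Rightarrow> 'n::finite dist) \<Rightarrow> (real \<Rightarrow> 'n \<Rightarrow> 'n dist) \<Rightarrow> bool" where
  "mild_solution T u0 u \<longleftrightarrow>
     (\<forall>t i. 0 \<le> t \<and> ereal t \<le> T \<longrightarrow>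
        tempered (u t i) \<and>
        (\<forall>f\<in>schwartz.
           set_integrable lebesgue {0..t}
             (\<lambda>\<tau>. heat (t - \<tau>) (leray (tensor_div (tensor_prod (u \<tau>) (u \<tau>))) i) f) \<and>
           u t i f = heat t (u0 i) f -
             (LINT \<tau>:{0..t}|lebesgue.
                heat (t - \<tau>) (leray (tensor_div (tensor_prod (u \<tau>) (u \<tau>))) i) f)))"

definition solution_in_class ::
    "real \<Rightarrow> real \<Rightarrow> ereal \<Rightarrow> ('n \<Rightarrow> 'n::finite dist) \<Rightarrow> (real \<Rightarrow> 'n \<Rightarrow> 'n dist) \<Rightarrow> bool" where
  "solution_in_class p r T u0 u \<longleftrightarrow>
     mild_solution T u0 u \<and>
     u \<in> (\<Inter>q\<in>{p<..}. K_space q T) \<and>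
     u \<in> Linf_time T (HFL_space (real CARD('n) / p - 1) (ennreal p) (ennreal r))
                     (HFL_norm (real CARD('n) / p - 1) (ennreal p) (ennreal r))"

text \<open>Two solutions on \<open>[0,T]\<close> are identified when they agree at every time in \<open>[0,T]\<close>.\<close>

definition unique_solution_in_class ::
    "real \<Rightarrow> real \<Rightarrow> ereal \<Rightarrow> ('n \<Rightarrow> 'n::finite dist) \<Rightarrow> bool" where
  "unique_solution_in_class p r T u0 \<longleftrightarrow>
     (\<exists>u. solution_in_class p r T u0 u \<and>
        (\<forall>v. solution_in_class p r T u0 v \<longrightarrow> (\<forall>t. 0 \<le> t \<and> ereal t \<le> T \<longrightarrow> v t = u t)))"

definition admissible_datum :: "real \<Rightarrow> real \<Rightarrow> ('n \<Rightarrow> 'n::finite dist) \<Rightarrow> bool" where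
  "admissible_datum p r u0 \<longleftrightarrow>
     (\<forall>i. u0 i \<in> HFL_space (real CARD('n) / p - 1) (ennreal p) (ennreal r)) \<and> div_free u0"

definition heat_flow_sup :: "real \<Rightarrow> ereal \<Rightarrow> ('n \<Rightarrow> 'n::finite dist) \<Rightarrow> ennreal" where
  "heat_flow_sup pt T u0 =
     (SUP t\<in>{t. 0 < t \<and> ereal t < T}.
        ennreal (t powr ((1 - real CARD('n) / pt) / 2)) *
        vec_norm (FL_norm (ennreal pt) \<infinity>) (\<lambda>i. heat t (u0 i)))"

end

theory Submission
 imports Defs "HOL-Probability.Distributions"
begin

text \<open>The proof lives on the Fourier side. For \<open>F \<ge> 0\<close> let \<open>wbd s A F\<close> mean that
 \<open>F\<close> has integral at most \<open>A |E|\<^sup>s\<close> over every set \<open>E\<close> of finite measure; with \<open>s = 1/q\<close> this is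
 the weak norm that corresponds to the Fourier-Lorentz space with indices \<open>q\<close>, \<open>\<infinity>\<close>, and \<open>s = 0\<close>
 gives the integral norm. The Picard iterates are dominated by those of a monotone equation \<open>W = lin + duh W\<close> for
 nonnegative functions, in which all absolute values are taken inside the Duhamel integral. Smallness of
 \<open>lin\<close> in the weak norm with index \<open>pt\<close>, and hence in the integral norm, bounds the iterates \<open>W\<^sub>k\<close>
 uniformly, and \<open>|u\<^sub>k\<^sub>+\<^sub>1 - u\<^sub>k| + W\<^sub>k \<le> W\<^sub>k\<^sub>+\<^sub>1\<close> makes the \<open>u\<^sub>k\<close> converge
 pointwise. Strong Lorentz bounds come from interpolating two weak ones.

 For uniqueness the mild equation is tested against Schwartz functions \<open>g\<close> with \<open>|g| \<le> 1\<close>: a bound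
 \<open>A (\<integral>|g|)\<^sup>s\<close> on the pairing with the difference of two solutions yields \<open>wbd s A\<close> for its modulus. The
 resulting estimate is a contraction near \<open>t = 0\<close>, where the norms in the space \<open>K\<close> are small, and then on time
 steps of a fixed length.\<close>

section \<open>Integration with respect to Lebesgue measure\<close>

text \<open>The constant \<delta> may depend only on pt and the dimension. This is possible because
  smallness is used at just two indices, 0 and \<theta> = 1/pt, where it closes the quadratic
  iteration. At an index s between \<theta> and 1/p the Duhamel bound is linear in the bound at s,
  with a coefficient no worse than at \<theta>, so bounds of any size persist. The data space sits
  at the endpoint 1/p with a second index r that weak bounds do not see; it is reached by
  interpolating the Duhamel term between indices on both sides of 1/p. The upper one exists because
  convolution adds indices. Finiteness of r enters through the vanishing norms of high-frequency
  tails, which gives smallness for short times. Uniqueness meets another obstacle: a solution has a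
  Fourier representative at each time separately, and nothing makes these jointly measurable, so
  Fubini's theorem does not apply to them. What the definition of a mild solution does provide is
  the time integral of each pairing with a test function; hence the detour through duality.\<close>

type_synonym 'n cfun = "real^'n \<Rightarrow> complex"
type_synonym 'n efun = "real^'n \<Rightarrow> ennreal"

abbreviation BM :: "('a::topological_space \<Rightarrow> 'b::topological_space) set" where
 "BM \<equiv> borel_measurable borel"

abbreviation LM :: "('a::euclidean_space \<Rightarrow> 'b::topological_space) set" where
 "LM \<equiv> borel_measurable lebesgue"

abbreviation nn_lborel :: "('a::euclidean_space \<Rightarrow> ennreal) \<Rightarrow> ennreal" (binder "NN " 10) where
 "nn_lborel f \<equiv> nn_integral lborel f"

abbreviation nns :: "'a::euclidean_space set \<Rightarrow> ('a \<Rightarrow> ennreal) \<Rightarrow> ennreal" where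
 "nns E f \<equiv> set_nn_integral lborel E f"

abbreviation enorm :: "'a::real_normed_vector \<Rightarrow> ennreal" where
 "enorm x \<equiv> ennreal (norm x)"

abbreviation nf :: "('a \<Rightarrow> 'b::real_normed_vector) \<Rightarrow> 'a \<Rightarrow> ennreal" where
 "nf f \<equiv> \<lambda>x. enorm (f x)"

abbreviation cplx :: "real \<Rightarrow> complex" where
 "cplx \<equiv> complex_of_real"

section \<open>Affine changes of variables\<close>

lemma lborel_integral_affine:
 fixes f :: "'a::euclidean_space => 'b::{banach,second_countable_topology}"
 assumes "c \<noteq> 0" and [measurable]: "f \<in> BM"
 shows "(LINT x|lborel. f x) = \<bar>c\<bar> ^ DIM('a) *\<^sub>R (LINT x|lborel. f (t + c *\<^sub>R x))"
proof -
 have "(LINT x|lborel. f x) = (LINT x|density (distr lborel borel (%x. t + c *\<^sub>R x)) (%_. ennreal (\<bar>c\<bar>^DIM('a))). f x)" using lborel_affine[OF assms(1), of t] by (simp add: ennreal_power)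
 also have "... = \<bar>c\<bar> ^ DIM('a) *\<^sub>R (LINT x|lborel. f (t + c *\<^sub>R x))" by (subst integral_density) (auto simp: integral_distr)
 finally show ?thesis .
qed

lemma lborel_integrable_affine_iff:
 fixes f :: "'a::euclidean_space => 'b::{banach,second_countable_topology}"
 assumes "c \<noteq> 0" and [measurable]: "f \<in> BM"
 shows "integrable lborel (%x. f (t + c *\<^sub>R x)) \<longleftrightarrow> integrable lborel f"
proof -
 have "integrable lborel f \<longleftrightarrow> integrable (density (distr lborel borel (%x. t + c *\<^sub>R x)) (%_. ennreal (\<bar>c\<bar>^DIM('a)))) f" using lborel_affine[OF assms(1), of t] by (simp add: ennreal_power)
 also have "... \<longleftrightarrow> integrable lborel (%x. f (t + c *\<^sub>R x))"
 proof (subst integrable_density)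
  have "integrable lborel (%x. \<bar>c\<bar> ^ DIM('a) *\<^sub>R f (t + c *\<^sub>R x)) ==>
   integrable lborel (%x. (1 / \<bar>c\<bar> ^ DIM('a)) *\<^sub>R \<bar>c\<bar> ^ DIM('a) *\<^sub>R f (t + c *\<^sub>R x))" by (rule integrable_scaleR_right)
  thus "integrable (distr lborel borel (%x. t + c *\<^sub>R x)) (%x. \<bar>c\<bar> ^ DIM('a) *\<^sub>R f x) \<longleftrightarrow>
   integrable lborel (%x. f (t + c *\<^sub>R x))" using assms(1) by (auto simp: integrable_distr_eq)
 qed auto
 finally show ?thesis by simp
qed

lemma nn_integral_lborel_affine:
 fixes f :: "'a::euclidean_space => ennreal"
 assumes "c \<noteq> 0" and [measurable]: "f \<in> BM"
 shows "(NN x. f x) = ennreal (\<bar>c\<bar> ^ DIM('a)) * (NN x. f (t + c *\<^sub>R x))"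
proof -
 have "(NN x. f x) = (\<integral>\<^sup>+x. f x \<partial>density (distr lborel borel (%x. t + c *\<^sub>R x)) (%_. ennreal (\<bar>c\<bar>^DIM('a))))" using lborel_affine[OF assms(1), of t] by (simp add: ennreal_power)
 also have "... = ennreal (\<bar>c\<bar> ^ DIM('a)) * (NN x. f (t + c *\<^sub>R x))" by (subst nn_integral_density) (auto simp: nn_integral_distr nn_integral_cmult)
 finally show ?thesis .
qed

lemma nn_integral_lborel_shift:
 fixes f :: "'a::euclidean_space => ennreal"
 assumes [measurable]: "f \<in> BM"
 shows "(NN x. f (a + x)) = (NN x. f x)"
  and "(NN x. f (a - x)) = (NN x. f x)"
  and "(NN x. f (x - a)) = (NN x. f x)" using nn_integral_lborel_affine[of 1 f a] nn_integral_lborel_affine[of "-1" f a]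
  nn_integral_lborel_affine[of 1 f "-a"] by (simp_all del: nn_integral_indicator)

lemma AE_lborel_reflect:
 fixes P :: "'a::euclidean_space => bool"
 assumes "AE x in lborel. P x"
 shows "AE x in lborel. P (a - x)"
proof -
 from AE_E[OF assms] obtain N where N: "{x \<in> space lborel. \<not> P x} \<subseteq> N" "emeasure lborel N = 0" "N \<in> sets lborel" by blast
 have [measurable]: "N \<in> sets borel" using N(3) by simp
 have "(NN x. indicator N (a - x)) = (NN x. indicator N x)" by (rule nn_integral_lborel_shift(2)) simp
 also have "... = 0" using N by simp
 finally have "AE x in lborel. indicator N (a - x) = (0::ennreal)" by (subst (asm) nn_integral_0_iff_AE) auto
 thus ?thesis
 proof (rule AE_mp, intro AE_I2 impI)
  fix x assume "indicator N (a - x) = (0::ennreal)"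
  thus "P (a - x)" using N(1) by (auto simp: indicator_def split: if_splits)
 qed
qed

lemma ennreal_le_suminf: "f k <= (\<Sum>i. f i :: ennreal)" using sum_le_suminf[OF summableI, of "{k}" f] by simp

text \<open>A bound on a multiplier that depends only on the shell of width \<rho> containing x
  becomes a series. Replacing each shell by the enclosing ball only enlarges the sum, and balls have
  a simple volume. Applied to polynomial weights and to the heat multiplier.\<close>

lemma nn_integral_shell_le:
 fixes F :: "'a::euclidean_space => ennreal"
 assumes "\<rho> > 0" and m: "\<And>x. m x <= ennreal (a (nat \<lfloor>norm x / \<rho>\<rfloor>))"
  and [measurable]: "F \<in> BM"
 shows "(NN x. m x * F x) <=
  (\<Sum>k. ennreal (a k) * (NN x. F x * indicator (ball 0 (\<rho> * (real k + 1))) x))"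
proof -
 have "m x * F x <= (\<Sum>k. ennreal (a k) * (F x * indicator (ball 0 (\<rho> * (real k + 1))) x))" for x
 proof -
  let ?k = "nat \<lfloor>norm x / \<rho>\<rfloor>"
  have "norm x / \<rho> < real ?k + 1" using assms(1) by linarith
  hence "x \<in> ball 0 (\<rho> * (real ?k + 1))" using assms(1) by (simp add: field_simps)
  hence "m x * F x <= ennreal (a ?k) * (F x * indicator (ball 0 (\<rho> * (real ?k + 1))) x)" using m[of x] by (simp add: mult_right_mono)
  also have "... <= (\<Sum>k. ennreal (a k) * (F x * indicator (ball 0 (\<rho> * (real k + 1))) x))" by (rule ennreal_le_suminf)
  finally show ?thesis .
 qed
 hence "(NN x. m x * F x) <=
   (NN x. (\<Sum>k. ennreal (a k) * (F x * indicator (ball 0 (\<rho> * (real k + 1))) x)))" by (intro nn_integral_mono) auto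
 also have "... = (\<Sum>k. ennreal (a k) * (NN x. F x * indicator (ball 0 (\<rho> * (real k + 1))) x))"
 proof (subst nn_integral_suminf)
  have [measurable]: "ball 0 r \<in> sets (borel :: 'a measure)" for r :: real by simp
  show "(%x. ennreal (a i) * (F x * indicator (ball 0 (\<rho> * (real i + 1))) x)) \<in> borel_measurable lborel" for i by measurable
  show "(\<Sum>i. (NN x. ennreal (a i) * (F x * indicator (ball 0 (\<rho> * (real i + 1))) x))) =
   (\<Sum>k. ennreal (a k) * (NN x. F x * indicator (ball 0 (\<rho> * (real k + 1))) x))" by (intro suminf_cong nn_integral_cmult) measurable
 qed
 finally show ?thesis .
qed

text \<open>Along any sequence tending to z the normalised remainder is at most 2 H by the mean
  value inequality, so dominated convergence applies. Convexity of U is what the mean value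
  inequality asks for; openness removes the restriction to U at the end.\<close>

lemma has_derivative_lebesgue_integral:
 fixes G :: "'a::real_normed_vector => 'b => 'c::{banach,second_countable_topology}"
 assumes U: "open U" "convex U" "z \<in> U"
  and int: "\<And>y. y \<in> U ==> integrable M (G y)"
  and der: "\<And>y x. y \<in> U ==> x \<in> space M ==> ((%y. G y x) has_derivative D y x) (at y)"
  and bnd: "\<And>y x v. y \<in> U ==> x \<in> space M ==> norm (D y x v) <= H x * norm v"
  and H: "integrable M H" "\<And>x. x \<in> space M ==> 0 <= H x"
  and meas: "\<And>v. (%x. D z x v) \<in> borel_measurable M"
 shows "((%y. LINT x|M. G y x) has_derivative (%v. LINT x|M. D z x v)) (at z)"
proof -
 have Dint: "integrable M (%x. D z x v)" for v by (rule Bochner_Integration.integrable_bound[OF integrable_mult_left[OF H(1), of "norm v"]])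
   (use bnd[OF U(3)] H(2) meas in auto)
 have lin: "linear (D z x)" if "x \<in> space M" for x using der[OF U(3) that] has_derivative_linear by blast
 have bl: "bounded_linear (%v. LINT x|M. D z x v)"
 proof (rule bounded_linear_intro[where K = "integral\<^sup>L M H"])
  show "(LINT x|M. D z x (v + w)) = (LINT x|M. D z x v) + (LINT x|M. D z x w)" for v w by (subst Bochner_Integration.integral_add[symmetric, OF Dint Dint],
    rule Bochner_Integration.integral_cong) (auto simp: lin linear_add)
  show "(LINT x|M. D z x (r *\<^sub>R v)) = r *\<^sub>R (LINT x|M. D z x v)" for r v by (subst integral_scaleR_right[symmetric],
    rule Bochner_Integration.integral_cong) (auto simp: lin linear_cmul)
  show "norm (LINT x|M. D z x v) <= norm v * integral\<^sup>L M H" for v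
  proof -
   have "norm (LINT x|M. D z x v) <= (LINT x|M. norm (D z x v))" by (rule integral_norm_bound)
   also have "... <= (LINT x|M. H x * norm v)" by (rule integral_mono) (use bnd[OF U(3)] Dint H in auto)
   finally show ?thesis by (simp add: mult.commute)
  qed
 qed
 have "((%y. LINT x|M. G y x) has_derivative (%v. LINT x|M. D z x v)) (at z within U)" unfolding has_derivative_iff_norm tendsto_at_iff_sequentially
 proof (intro conjI bl allI impI)
  fix X assume X: "\<forall>i. X i \<in> U - {z}" "X \<longlonglongrightarrow> z"
  define R where "R i x = (G (X i) x - G z x - D z x (X i - z)) /\<^sub>R norm (X i - z)" for i x
  have Rb: "norm (R i x) <= 2 * H x" if x: "x \<in> space M" for i x
  proof -
   have "norm (G (X i) x - G z x) <= H x * norm (X i - z)"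
   proof (rule differentiable_bound[OF U(2)])
    show "((%y. G y x) has_derivative D y x) (at y within U)" if "y \<in> U" for y using der[OF that x] has_derivative_at_withinI by blast
    show "onorm (D y x) <= H x" if "y \<in> U" for y by (rule onorm_bound) (use bnd[OF that x] H(2)[OF x] in auto)
   qed (use X U in auto)
   moreover have "norm (D z x (X i - z)) <= H x * norm (X i - z)" using bnd[OF U(3) x] .
   ultimately have "norm (G (X i) x - G z x - D z x (X i - z)) <= 2 * H x * norm (X i - z)" using norm_triangle_ineq4[of "G (X i) x - G z x" "D z x (X i - z)"] by linarith
   moreover have "norm (X i - z) > 0" using X by auto
   ultimately show ?thesis by (simp add: R_def divide_simps mult_ac)
  qed
  have Rint: "integrable M (R i)" for i unfolding R_def using X U int Dint by (intro integrable_scaleR_right Bochner_Integration.integrable_diff) auto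
  have lim: "(%i. LINT x|M. R i x) \<longlonglongrightarrow> (LINT x|M. 0)"
  proof (rule integral_dominated_convergence[where w = "%x. 2 * H x"])
   show "AE x in M. (%i. R i x) \<longlonglongrightarrow> 0"
   proof (rule AE_I2)
    fix x assume x: "x \<in> space M"
    have "((%y. G y x) has_derivative D z x) (at z within U)" using der[OF U(3) x] has_derivative_at_withinI by blast
    hence "(((%y. norm (G y x - G z x - D z x (y - z)) / norm (y - z)) \<circ> X) \<longlongrightarrow> 0) sequentially" using X unfolding has_derivative_iff_norm tendsto_at_iff_sequentially by blast
    hence "(%i. norm (R i x)) \<longlonglongrightarrow> 0" by (simp add: R_def o_def divide_inverse mult.commute)
    thus "(%i. R i x) \<longlonglongrightarrow> 0" by (rule tendsto_norm_zero_cancel)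
   qed
   show "AE x in M. norm (R i x) <= 2 * H x" for i using Rb by (intro AE_I2)
  qed (use Rint H in \<open>auto intro: borel_measurable_integrable\<close>)
  have "(LINT x|M. R i x) = ((LINT x|M. G (X i) x) - (LINT x|M. G z x) - (LINT x|M. D z x (X i - z))) /\<^sub>R norm (X i - z)" for i unfolding R_def using X U int Dint by (subst integral_scaleR_right, subst Bochner_Integration.integral_diff, auto)
  with lim have "(%i. norm (((LINT x|M. G (X i) x) - (LINT x|M. G z x) - (LINT x|M. D z x (X i - z))) /\<^sub>R norm (X i - z))) \<longlonglongrightarrow> 0" by (intro tendsto_norm_zero) simp
  thus "((%y. norm ((LINT x|M. G y x) - (LINT x|M. G z x) - (LINT x|M. D z x (y - z))) / norm (y - z)) \<circ> X) \<longlonglongrightarrow> 0" by (simp add: o_def divide_inverse mult.commute)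
 qed
 thus ?thesis by (simp add: at_within_open[OF U(3,1)])
qed

section \<open>Schwartz functions\<close>

lemma pderiv_dirI: "(f has_derivative D) (at x) ==> pderiv_dir j f x = D (axis j 1)" unfolding pderiv_dir_def using frechet_derivative_at by metis

lemma has_derivative_pderiv_dir:
 fixes f :: "real ^ 'n::finite => 'b::real_normed_vector"
 assumes "f differentiable (at x)"
 shows "(f has_derivative (%v. \<Sum>j\<in>UNIV. (v $ j) *\<^sub>R pderiv_dir j f x)) (at x)"
proof -
 let ?D = "frechet_derivative f (at x)"
 have D: "(f has_derivative ?D) (at x)" using assms frechet_derivative_works by blast
 hence lin: "linear ?D" by (rule has_derivative_linear)
 have "?D v = (\<Sum>j\<in>UNIV. (v $ j) *\<^sub>R pderiv_dir j f x)" for v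
 proof -
  have "?D v = ?D (\<Sum>j\<in>UNIV. (v $ j) *\<^sub>R axis j 1)" using basis_expansion[of v] by (simp add: scalar_mult_eq_scaleR)
  also have "... = (\<Sum>j\<in>UNIV. (v $ j) *\<^sub>R ?D (axis j 1))" using lin by (simp add: linear_sum linear_cmul)
  finally show ?thesis by (simp add: pderiv_dir_def)
 qed
 hence "?D = (%v. \<Sum>j\<in>UNIV. (v $ j) *\<^sub>R pderiv_dir j f x)" by (rule ext)
 with D show ?thesis by simp
qed

text \<open>Iterated derivatives of a concrete function are awkward to compute. It suffices to find
  a class P of differentiable functions with rapid decay that is closed under single partial
  derivatives; every iterated derivative of f then stays in P.\<close>

lemma schwartz_coinduct:
 assumes "f \<in> P"
  and diff: "\<And>g x. g \<in> P ==> g differentiable (at x)"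
  and der: "\<And>g j. g \<in> P ==> pderiv_dir j g \<in> P"
  and bnd: "\<And>g k. g \<in> P ==> \<exists>C. \<forall>x. (1 + norm x) ^ k * norm (g x) <= C"
 shows "f \<in> schwartz"
proof -
 have *: "iter_pderiv js f \<in> P" for js by (induction js) (auto simp: iter_pderiv_def assms)
 have "bounded (range (%x. (1 + norm x) ^ k * norm (iter_pderiv js f x)))" for js k
 proof -
  obtain C where "\<forall>x. (1 + norm x) ^ k * norm (iter_pderiv js f x) <= C" using bnd[OF *] by blast
  thus ?thesis unfolding bounded_iff by (intro exI[of _ C]) auto
 qed
 with * diff show ?thesis by (simp add: schwartz_def smooth_fun_def)
qed

lemma schwartz_differentiable: "f \<in> schwartz ==> f differentiable (at x)" unfolding schwartz_def smooth_fun_def iter_pderiv_def by (drule CollectD, drule conjunct1, drule spec[of _ "[]"]) simp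

lemma schwartz_pderiv: "f \<in> schwartz ==> pderiv_dir j f \<in> schwartz"
proof -
 assume f: "f \<in> schwartz"
 have "iter_pderiv js (pderiv_dir j f) = iter_pderiv (js @ [j]) f" for js by (simp add: iter_pderiv_def)
 with f show ?thesis by (simp add: schwartz_def smooth_fun_def)
qed

lemma schwartz_decay:
 assumes "f \<in> schwartz"
 shows "\<exists>C>0. \<forall>x. (1 + norm x) ^ k * norm (f x) <= C"
proof -
 have "bounded (range (%x. (1 + norm x) ^ k * norm (iter_pderiv [] f x)))" using assms unfolding schwartz_def by blast
 then obtain B where "\<forall>x. \<bar>(1 + norm x) ^ k * norm (f x)\<bar> <= B" unfolding bounded_iff iter_pderiv_def by auto
 thus ?thesis by (intro exI[of _ "max B 1"]) (auto simp: max_def intro: order_trans[OF abs_ge_self] order_trans)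
qed

lemma schwartz_has_derivative:
 "f \<in> schwartz ==> (f has_derivative (%v. \<Sum>j\<in>UNIV. (v $ j) *\<^sub>R pderiv_dir j f x)) (at x)" by (intro has_derivative_pderiv_dir schwartz_differentiable)

lemma schwartz_continuous: "f \<in> schwartz ==> continuous_on S f" using schwartz_differentiable differentiable_imp_continuous_within by (metis continuous_at_imp_continuous_on)

lemma schwartz_borel: "f \<in> schwartz ==> f \<in> BM" by (intro borel_measurable_continuous_onI schwartz_continuous)

lemma schwartz_add:
 assumes "f \<in> schwartz" "g \<in> schwartz"
 shows "(%x. f x + g x) \<in> schwartz"
proof (rule schwartz_coinduct[where P = "{%x. f x + g x | f g. f \<in> schwartz \<and> g \<in> schwartz}"])
 fix h k assume "h \<in> {%x. f x + g x | f g. f \<in> schwartz \<and> (g::real^'a => complex) \<in> schwartz}"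
 then obtain f g where h: "h = (%x. f x + g x)" "f \<in> schwartz" "g \<in> schwartz" by blast
 obtain C C' where "\<forall>x. (1 + norm x) ^ k * norm (f x) <= C" "\<forall>x. (1 + norm x) ^ k * norm (g x) <= C'" using schwartz_decay h by metis
 hence "(1 + norm x) ^ k * norm (h x) <= C + C'" for x using norm_triangle_ineq[of "f x" "g x"] unfolding h(1) by (smt (verit, best) distrib_left mult_left_mono norm_ge_zero zero_le_power)
 thus "\<exists>C. \<forall>x. (1 + norm x) ^ k * norm (h x) <= C" by blast
next
 fix h :: "real^'a => complex" and j assume "h \<in> {%x. f x + g x | f g. f \<in> schwartz \<and> g \<in> schwartz}"
 then obtain f g where h: "h = (%x. f x + g x)" "f \<in> schwartz" "g \<in> schwartz" by blast
 have "pderiv_dir j h = (%x. pderiv_dir j f x + pderiv_dir j g x)"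
 proof
  fix x show "pderiv_dir j h x = pderiv_dir j f x + pderiv_dir j g x" unfolding h(1) by (subst pderiv_dirI[OF has_derivative_add[OF schwartz_has_derivative[OF h(2)] schwartz_has_derivative[OF h(3)]]])
    (simp add: axis_def if_distrib[of "%c. c *\<^sub>R _"] cong: if_cong)
 qed
 thus "pderiv_dir j h \<in> {%x. f x + g x | f g. f \<in> schwartz \<and> g \<in> schwartz}" using h schwartz_pderiv by blast
qed (use assms schwartz_differentiable in \<open>auto intro!: differentiable_add\<close>)

lemma schwartz_cmult:
 assumes "f \<in> schwartz"
 shows "(%x. c * f x) \<in> schwartz"
proof (rule schwartz_coinduct[where P = "{%x. c * f x | f. f \<in> schwartz}"])
 fix h k assume "h \<in> {%x. c * f x | f. (f::real^'a => complex) \<in> schwartz}"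
 then obtain f where h: "h = (%x. c * f x)" "f \<in> schwartz" by blast
 obtain C where C: "\<And>x. (1 + norm x) ^ k * norm (f x) <= C" using schwartz_decay h by metis
 have "(1 + norm x) ^ k * norm (h x) <= norm c * C" for x using mult_left_mono[OF C[of x], of "norm c"] by (simp add: h(1) norm_mult mult_ac)
 thus "\<exists>C. \<forall>x. (1 + norm x) ^ k * norm (h x) <= C" by blast
next
 fix h :: "real^'a => complex" and j assume "h \<in> {%x. c * f x | f. f \<in> schwartz}"
 then obtain f where h: "h = (%x. c * f x)" "f \<in> schwartz" by blast
 have "pderiv_dir j h = (%x. c * pderiv_dir j f x)"
 proof
  fix x show "pderiv_dir j h x = c * pderiv_dir j f x" unfolding h(1) by (subst pderiv_dirI[OF has_derivative_mult_right[OF schwartz_has_derivative[OF h(2)]]])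
    (simp add: axis_def if_distrib[of "%c. c *\<^sub>R _"] cong: if_cong)
 qed
 thus "pderiv_dir j h \<in> {%x. c * f x | f. f \<in> schwartz}" using h schwartz_pderiv by blast
qed (use assms schwartz_differentiable in \<open>auto intro!: differentiable_mult\<close>)

lemma schwartz_uminus: "f \<in> schwartz ==> (%x. - f x) \<in> schwartz" using schwartz_cmult[of f "-1"] by simp

lemma schwartz_reflect:
 assumes "f \<in> schwartz"
 shows "(%x. f (- x)) \<in> schwartz"
proof (rule schwartz_coinduct[where P = "{%x. f (- x) | f. f \<in> schwartz}"])
 fix h k assume "h \<in> {%x. f (- x) | f. (f::real^'a => complex) \<in> schwartz}"
 then obtain f where h: "h = (%x. f (- x))" "f \<in> schwartz" by blast
 obtain C where C: "\<And>x. (1 + norm x) ^ k * norm (f x) <= C" using schwartz_decay h by metis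
 have "(1 + norm x) ^ k * norm (h x) <= C" for x using C[of "- x"] by (simp add: h(1))
 thus "\<exists>C. \<forall>x. (1 + norm x) ^ k * norm (h x) <= C" by blast
next
 fix h :: "real^'a => complex" and j assume "h \<in> {%x. f (- x) | f. f \<in> schwartz}"
 then obtain f where h: "h = (%x. f (- x))" "f \<in> schwartz" by blast
 have "pderiv_dir j h = (%x. (%y. - pderiv_dir j f y) (- x))"
 proof
  fix x :: "real^'a"
  have "((%x. f (- x)) has_derivative (%v. \<Sum>j\<in>UNIV. ((- v) $ j) *\<^sub>R pderiv_dir j f (- x))) (at x)" by (rule has_derivative_compose[OF _ schwartz_has_derivative[OF h(2)], of uminus uminus])
    (auto intro!: derivative_eq_intros)
  from pderiv_dirI[OF this, of j]
  show "pderiv_dir j h x = (%y. - pderiv_dir j f y) (- x)" unfolding h(1) by (simp add: axis_def if_distrib[of "%c. (- c) *\<^sub>R _"] sum_negf if_distrib[of "%c. c *\<^sub>R _"] cong: if_cong)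
 qed
 thus "pderiv_dir j h \<in> {%x. f (- x) | f. f \<in> schwartz}" using schwartz_uminus[OF schwartz_pderiv[OF h(2), of j]] by (intro CollectI exI[of _ "%y. - pderiv_dir j f y"]) simp
next
 fix h :: "real^'a => complex" and x assume "h \<in> {%x. f (- x) | f. f \<in> schwartz}"
 then obtain f where h: "h = (%x. f (- x))" "f \<in> schwartz" by blast
 have "((%x. f (- x)) has_derivative (%v. \<Sum>j\<in>UNIV. ((- v) $ j) *\<^sub>R pderiv_dir j f (- x))) (at x)" by (rule has_derivative_compose[OF _ schwartz_has_derivative[OF h(2)], of uminus uminus])
    (auto intro!: derivative_eq_intros)
 thus "h differentiable at x" unfolding h(1) differentiable_def by blast
qed (use assms in auto)

lemma pderiv_coord_mult:
 assumes "f differentiable (at x)"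
 shows "((%x. cplx (x $ i) * f x) has_derivative
    (%v. cplx (x $ i) * (\<Sum>j\<in>UNIV. (v $ j) *\<^sub>R pderiv_dir j f x) + cplx (v $ i) * f x)) (at x)"
proof -
 have "((%x. cplx (x $ i)) has_derivative (%v. cplx (v $ i))) (at x)" by (intro bounded_linear_imp_has_derivative bounded_linear_compose[OF bounded_linear_of_real] bounded_linear_vec_nth)
 from has_derivative_mult[OF this has_derivative_pderiv_dir[OF assms]] show ?thesis by simp
qed

lemma schwartz_coord_mult:
 assumes "f \<in> schwartz"
 shows "(%x. cplx (x $ i) * f x) \<in> schwartz"
\<comment> \<open>The Leibniz rule leaves a term without the coordinate, so the class contains an
  additional Schwartz summand in order to be closed.\<close>
proof (rule schwartz_coinduct[where P = "{%x. cplx (x $ i) * f x + g x | f g. f \<in> schwartz \<and> g \<in> schwartz}"])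
 have "(%x. 0 * f x) \<in> schwartz" using schwartz_cmult[OF assms] .
 thus "(%x. cplx (x $ i) * f x) \<in> {%x. cplx (x $ i) * f x + g x | f g. f \<in> schwartz \<and> g \<in> schwartz}" using assms by (intro CollectI exI[of _ f] exI[of _ "%x. 0 * f x"]) auto
next
 fix h k assume "h \<in> {%x. cplx (x $ i) * f x + g x | f g. f \<in> schwartz \<and> (g::real^'a => complex) \<in> schwartz}"
 then obtain f g where h: "h = (%x. cplx (x $ i) * f x + g x)" "f \<in> schwartz" "g \<in> schwartz" by blast
 obtain C C' where C: "\<And>x. (1 + norm x) ^ Suc k * norm (f x) <= C" "\<And>x. (1 + norm x) ^ k * norm (g x) <= C'" using schwartz_decay h by metis
 have "(1 + norm x) ^ k * norm (h x) <= C + C'" for x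
 proof -
  have "norm (h x) <= \<bar>x $ i\<bar> * norm (f x) + norm (g x)" using norm_triangle_ineq[of "cplx (x $ i) * f x" "g x"] by (simp add: h(1) norm_mult)
  also have "\<bar>x $ i\<bar> * norm (f x) <= (1 + norm x) * norm (f x)" using component_le_norm_cart[of x i] by (intro mult_right_mono) auto
  finally have "(1 + norm x) ^ k * norm (h x) <= (1 + norm x) ^ k * ((1 + norm x) * norm (f x) + norm (g x))" by (intro mult_left_mono) auto
  also have "... <= C + C'" using C(1)[of x] C(2)[of x] by (simp add: algebra_simps)
  finally show ?thesis .
 qed
 thus "\<exists>C. \<forall>x. (1 + norm x) ^ k * norm (h x) <= C" by blast
next
 fix h :: "real^'a => complex" and j
 assume "h \<in> {%x. cplx (x $ i) * f x + g x | f g. f \<in> schwartz \<and> g \<in> schwartz}"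
 then obtain f g where h: "h = (%x. cplx (x $ i) * f x + g x)" "f \<in> schwartz" "g \<in> schwartz" by blast
 let ?c = "if j = i then 1 else 0 :: complex"
 have "pderiv_dir j h = (%x. cplx (x $ i) * pderiv_dir j f x + (?c * f x + pderiv_dir j g x))"
 proof
  fix x show "pderiv_dir j h x = cplx (x $ i) * pderiv_dir j f x + (?c * f x + pderiv_dir j g x)" unfolding h(1) by (subst pderiv_dirI[OF has_derivative_add[OF pderiv_coord_mult[OF schwartz_differentiable[OF h(2)]] schwartz_has_derivative[OF h(3)]]])
    (auto simp: axis_def if_distrib[of "%c. c *\<^sub>R _"] cong: if_cong)
 qed
 moreover have "(%x. ?c * f x + pderiv_dir j g x) \<in> schwartz" using h by (intro schwartz_add schwartz_cmult schwartz_pderiv)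
 ultimately show "pderiv_dir j h \<in> {%x. cplx (x $ i) * f x + g x | f g. f \<in> schwartz \<and> g \<in> schwartz}" using schwartz_pderiv[OF h(2), of j] by (intro CollectI exI[of _ "pderiv_dir j f"] exI[of _ "%x. ?c * f x + pderiv_dir j g x"]) simp
next
 fix h :: "real^'a => complex" and x
 assume "h \<in> {%x. cplx (x $ i) * f x + g x | f g. f \<in> schwartz \<and> g \<in> schwartz}"
 then obtain f g where h: "h = (%x. cplx (x $ i) * f x + g x)" "f \<in> schwartz" "g \<in> schwartz" by blast
 show "h differentiable at x" unfolding h(1) using has_derivative_add[OF pderiv_coord_mult[OF schwartz_differentiable[OF h(2)]] schwartz_has_derivative[OF h(3)]] unfolding differentiable_def by blast
qed

section \<open>The Fourier transform\<close>

text \<open>On the shell with index k the weight is at most (k+1)^-(n+2) and the enclosing ball has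
  volume of order (k+1)^n, so the exponent n + 2 leaves the convergent series of 1/(k+1)^2.\<close>

lemma integrable_inverse_power_norm:
 "integrable lborel (%x::real^'n. 1 / (1 + norm x) ^ (CARD('n::finite) + 2))"
proof -
 let ?N = "CARD('n) + 2"
 let ?w = "unit_ball_vol (real CARD('n))"
 have "(NN x. ennreal (1 / (1 + norm (x::real^'n)) ^ ?N) * 1) <=
   (\<Sum>k. ennreal (1 / (1 + real k) ^ ?N) * (NN x. 1 * indicator (ball (0::real^'n) (1 * (real k + 1))) x))"
 proof (rule nn_integral_shell_le[where F = "%x. 1" and \<rho> = 1 and a = "%k. 1 / (1 + real k) ^ ?N"])
  fix x :: "real^'n"
  have "(1 + real (nat \<lfloor>norm x / 1\<rfloor>)) ^ ?N <= (1 + norm x) ^ ?N" by (intro power_mono) auto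
  moreover have "0 < (1 + real (nat \<lfloor>norm x / 1\<rfloor>)) ^ ?N" by (intro zero_less_power) linarith
  ultimately show "ennreal (1 / (1 + norm x) ^ ?N) <= ennreal (1 / (1 + real (nat \<lfloor>norm x / 1\<rfloor>)) ^ ?N)" by (intro ennreal_leI frac_le[OF zero_le_one order_refl])
 qed simp_all
 also have "... = (\<Sum>k. ennreal (?w * inverse (real (Suc k) ^ 2)))"
 proof (intro suminf_cong)
  fix k
  have "ennreal (1 / (1 + real k) ^ ?N) * (NN x. 1 * indicator (ball (0::real^'n) (1 * (real k + 1))) x)
    = ennreal (1 / (1 + real k) ^ ?N * (?w * (real k + 1) ^ CARD('n)))" by (simp add: emeasure_ball ennreal_mult'[symmetric])
  also have "1 / (1 + real k) ^ ?N * (?w * (real k + 1) ^ CARD('n)) = ?w * inverse (real (Suc k) ^ 2)"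
  proof -
   have "1 / (A ^ CARD('n) * A ^ 2) * (?w * A ^ CARD('n)) = ?w * inverse (A ^ 2)" if "A > 0" for A using that by (simp add: field_simps)
   from this[of "1 + real k"] show ?thesis by (simp only: power_add add.commute[of "real k" 1] of_nat_Suc)
  qed
  finally show "ennreal (1 / (1 + real k) ^ ?N) * (NN x. 1 * indicator (ball (0::real^'n) (1 * (real k + 1))) x)
    = ennreal (?w * inverse (real (Suc k) ^ 2))" .
 qed
 also have "... < \<infinity>"
 proof -
  have "summable (%k. ?w * inverse (real (Suc k) ^ 2))" using inverse_power_summable[of 2, where 'a = real] summable_Suc_iff[of "%n. inverse (real n ^ 2)"] by (intro summable_mult) simp
  thus ?thesis by (subst suminf_ennreal2) auto
 qed
 finally show ?thesis by (intro integrableI_bounded) auto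
qed

lemma integrable_if_decay:
 fixes f :: "real^'n::finite => 'b::{banach,second_countable_topology}"
 assumes "f \<in> BM" "\<And>x. (1 + norm x) ^ (CARD('n) + 2) * norm (f x) <= C"
 shows "integrable lborel f"
proof (rule Bochner_Integration.integrable_bound)
 show "integrable lborel (%x::real^'n. C * (1 / (1 + norm x) ^ (CARD('n) + 2)))" by (intro integrable_mult_right integrable_inverse_power_norm)
 show "AE x in lborel. norm (f x) <= norm (C * (1 / (1 + norm x) ^ (CARD('n) + 2)))"
 proof (rule AE_I2)
  fix x :: "real^'n"
  have "(1 + norm x) ^ (CARD('n) + 2) > 0" by (simp add: add_pos_nonneg)
  hence "norm (f x) <= C * (1 / (1 + norm x) ^ (CARD('n) + 2))" using assms(2)[of x] by (simp add: pos_le_divide_eq mult.commute)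
  thus "norm (f x) <= norm (C * (1 / (1 + norm x) ^ (CARD('n) + 2)))" unfolding real_norm_def by (rule order_trans[OF _ abs_ge_self])
 qed
qed (use assms in simp)

lemma schwartz_integrable: "(f :: real^'a::finite => complex) \<in> schwartz ==> integrable lborel f" using schwartz_decay[of f "CARD('a) + 2"] integrable_if_decay[OF schwartz_borel[of f]] by blast

lemma schwartz_bounded: "f \<in> schwartz ==> \<exists>C>0. \<forall>x. norm (f x) <= C" using schwartz_decay[of f 0] by auto

abbreviation fconst :: "'n::finite itself => real" where
 "fconst _ \<equiv> (2 * pi) powr (- real CARD('n) / 2)"

abbreviation wave :: "real ^ 'n::finite => real ^ 'n => complex" where
 "wave x \<xi> \<equiv> exp (- \<i> * cplx (x \<bullet> \<xi>))"

lemma norm_wave [simp]: "norm (wave x z) = 1" by (simp add: norm_exp_eq_Re)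

lemma fourier_lborel:
 fixes f :: "'n::finite cfun"
 assumes [measurable]: "f \<in> BM"
 shows "fourier f z = cplx (fconst TYPE('n)) * (LINT x|lborel. wave x z * f x)" unfolding fourier_def by (subst integral_completion) auto

lemma integrable_wave_mult:
 assumes "integrable lborel f"
 shows "integrable lborel (%x. wave x z * f x)" by (rule Bochner_Integration.integrable_bound[OF assms])
   (use assms in \<open>auto simp: norm_mult intro: borel_measurable_integrable\<close>)

lemma norm_fourier_le:
 fixes f :: "'n::finite cfun"
 assumes "integrable lborel f"
 shows "norm (fourier f z) <= fconst TYPE('n) * (LINT x|lborel. norm (f x))"
proof -
 have [measurable]: "f \<in> BM" using borel_measurable_integrable[OF assms] by simp
 have "norm (LINT x|lborel. wave x z * f x) <= (LINT x|lborel. norm (wave x z * f x))" by (rule integral_norm_bound)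
 thus ?thesis by (simp add: fourier_lborel norm_mult mult_left_mono)
qed

lemma has_derivative_wave:
 "((%y. wave x y) has_derivative (%v. wave x z * (- \<i> * cplx (x \<bullet> v)))) (at z)"
proof -
 have "((%y. - \<i> * cplx (x \<bullet> y)) has_derivative (%v. - \<i> * cplx (x \<bullet> v))) (at z)" by (intro bounded_linear_imp_has_derivative bounded_linear_const_mult
    bounded_linear_compose[OF bounded_linear_of_real] bounded_linear_inner_right)
 from has_derivative_compose[OF this DERIV_exp[THEN has_field_derivative_imp_has_derivative]]
 show ?thesis by simp
qed

lemma has_derivative_wave_left:
 "((%y. wave y z) has_derivative (%v. wave x z * (- \<i> * cplx (v \<bullet> z)))) (at x)" using has_derivative_wave[of z x] by (simp add: inner_commute)

lemma schwartz_coord_integrable: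
 fixes f :: "'n::finite cfun"
 assumes "f \<in> schwartz"
 shows "integrable lborel (%x. norm x * norm (f x))"
proof -
 obtain C where C: "\<And>x. (1 + norm x) ^ (CARD('n) + 3) * norm (f x) <= C" using schwartz_decay[OF assms] by blast
 have "(1 + norm x) ^ (CARD('n) + 2) * norm (norm x * norm (f x)) <= C" for x
 proof -
  have "(1 + norm x) ^ (CARD('n) + 2) * norm (norm x * norm (f x)) <= (1 + norm x) ^ (CARD('n) + 2) * ((1 + norm x) * norm (f x))" by (intro mult_left_mono) (auto simp: mult_right_mono)
  also have "... = (1 + norm x) ^ (CARD('n) + 3) * norm (f x)" by (simp add: numeral_3_eq_3 mult_ac)
  finally show ?thesis using C[of x] by linarith
 qed
 moreover have "(%x. norm x * norm (f x)) \<in> BM" using schwartz_borel[OF assms] by measurable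
 ultimately show ?thesis by (intro integrable_if_decay)
qed

lemma fourier_has_derivative:
 fixes f :: "'n::finite cfun"
 assumes f: "f \<in> schwartz"
 shows "(fourier f has_derivative (%v. cplx (fconst TYPE('n)) *
   (LINT x|lborel. wave x z * (- \<i> * cplx (x \<bullet> v)) * f x))) (at z)"
proof -
 note [measurable] = schwartz_borel[OF f]
 have "((%z. LINT x|lborel. wave x z * f x) has_derivative
   (%v. LINT x|lborel. wave x z * (- \<i> * cplx (x \<bullet> v)) * f x)) (at z)"
 proof (rule has_derivative_lebesgue_integral[where U = UNIV and H = "%x. norm x * norm (f x)"])
  show "((%y. wave x y * f x) has_derivative (%v. wave x y * (- \<i> * cplx (x \<bullet> v)) * f x)) (at y)" for y x by (rule has_derivative_mult_left[OF has_derivative_wave])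
  show "norm (wave x y * (- \<i> * cplx (x \<bullet> v)) * f x) <= norm x * norm (f x) * norm v" for x y v using mult_right_mono[OF Cauchy_Schwarz_ineq2[of x v], of "norm (f x)"] by (simp add: norm_mult mult_ac)
  show "integrable lborel (%x. wave x y * f x)" for y by (intro integrable_wave_mult schwartz_integrable f)
 qed (use f in \<open>auto intro: schwartz_coord_integrable\<close>)
 moreover have "fourier f = (%z. cplx (fconst TYPE('n)) * (LINT x|lborel. wave x z * f x))" by (rule ext, rule fourier_lborel) measurable
 ultimately show ?thesis by (simp only:) (rule has_derivative_mult_right)
qed

lemma pderiv_fourier:
 assumes f: "f \<in> schwartz"
 shows "pderiv_dir j (fourier f) z = fourier (%x. - \<i> * (cplx (x $ j) * f x)) z" using schwartz_borel[OF f] by (subst pderiv_dirI[OF fourier_has_derivative[OF f]]) (simp add: fourier_lborel inner_axis mult_ac)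

text \<open>By translation invariance the integral of h(t e_j + x) does not depend on t;
  differentiating under the integral at t = 0 gives the claim. This is integration by parts without
  iterated integrals over coordinates.\<close>

lemma integral_pderiv_zero:
 fixes h :: "'n::finite cfun"
 assumes h: "integrable lborel h" "\<And>x. (h has_derivative D x) (at x)"
  and hj: "(%x. D x (axis j 1)) \<in> BM"
  and dec: "\<And>x. (1 + norm x) ^ (CARD('n) + 2) * norm (D x (axis j 1)) <= C"
 shows "(LINT x|lborel. D x (axis j 1)) = 0"
proof -
 let ?N = "CARD('n) + 2"
 note [measurable] = hj
 have hm[measurable]: "h \<in> BM" using borel_measurable_integrable[OF h(1)] by simp
 have "((%t::real. LINT x|lborel. h (t *\<^sub>R axis j 1 + x)) has_derivative
   (%s. LINT x|lborel. s *\<^sub>R D (0 *\<^sub>R axis j 1 + x) (axis j 1))) (at 0)"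
 proof (rule has_derivative_lebesgue_integral[where U = "ball 0 1" and H = "%x. 2 ^ ?N * C * (1 / (1 + norm x) ^ ?N)"
    and D = "%t x s. s *\<^sub>R D (t *\<^sub>R axis j 1 + x) (axis j 1)"])
  show "integrable lborel (%x. h (y *\<^sub>R axis j 1 + x))" for y using lborel_integrable_affine_iff[of 1 h "y *\<^sub>R axis j 1"] h(1) by simp
  show "((%y. h (y *\<^sub>R axis j 1 + x)) has_derivative (%s. s *\<^sub>R D (y *\<^sub>R axis j 1 + x) (axis j 1))) (at y)" for y x
  proof -
   have "((%y. y *\<^sub>R axis j 1 + x) has_derivative (%s. s *\<^sub>R axis j 1)) (at y)" by (auto intro!: derivative_eq_intros)
   from has_derivative_compose[OF this h(2)]
   have "((%y. h (y *\<^sub>R axis j 1 + x)) has_derivative (%s. D (y *\<^sub>R axis j 1 + x) (s *\<^sub>R axis j 1))) (at y)" .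
   moreover have "linear (D (y *\<^sub>R axis j 1 + x))" using h(2) has_derivative_linear by blast
   ultimately show ?thesis by (simp add: linear_cmul)
  qed
  fix y :: real and x :: "real^'n" and s :: real
  assume y: "y \<in> ball 0 1"
  let ?y = "y *\<^sub>R axis j 1 + x"
  have "norm x <= norm ?y + norm (y *\<^sub>R axis j (1::real) :: real^'n)" using norm_triangle_ineq4[of ?y "y *\<^sub>R axis j 1"] by simp
  moreover have "norm (y *\<^sub>R axis j (1::real) :: real^'n) = \<bar>y\<bar>" by (simp add: norm_axis_1)
  moreover have "\<bar>y\<bar> < 1" using y by (simp add: dist_norm)
  ultimately have "norm x <= norm ?y + 1" by simp
  hence "1 + norm x <= 1 + (norm ?y + 1)" by simp
  also have "... <= 2 * (1 + norm ?y)" by simp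
  finally have "1 + norm x <= 2 * (1 + norm ?y)" .
  \<comment> \<open>A shift by less than 1 changes 1 + |x| by a factor of at most 2, so at the price
    of 2^N one integrable function dominates all derivatives near t = 0.\<close>
  hence "(1 + norm x) ^ ?N <= 2 ^ ?N * (1 + norm ?y) ^ ?N" by (metis power_mono power_mult_distrib add_nonneg_nonneg norm_ge_zero zero_le_one)
  hence "(1 + norm x) ^ ?N * norm (D ?y (axis j 1)) <= 2 ^ ?N * (1 + norm ?y) ^ ?N * norm (D ?y (axis j 1))" by (intro mult_right_mono) auto
  also have "... <= 2 ^ ?N * C" using dec[of ?y] by (simp add: mult.assoc)
  finally have *: "norm (D ?y (axis j 1)) <= 2 ^ ?N * C * (1 / (1 + norm x) ^ ?N)" by (simp add: pos_le_divide_eq add_pos_nonneg mult.commute)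
  show "norm (s *\<^sub>R D ?y (axis j 1)) <= 2 ^ ?N * C * (1 / (1 + norm x) ^ ?N) * norm s" using mult_left_mono[OF *, of "\<bar>s\<bar>"] unfolding norm_scaleR real_norm_def mult.commute[of "2 ^ ?N * C * (1 / (1 + norm x) ^ ?N)" "\<bar>s\<bar>"] by simp
 next
  have "0 <= C" using dec[of 0] order_trans[of 0 "norm (D 0 (axis j 1))" C] by simp
  thus "0 <= 2 ^ ?N * C * (1 / (1 + norm x) ^ ?N)" for x :: "real^'n" by simp
  show "integrable lborel (%x::real^'n. 2 ^ ?N * C * (1 / (1 + norm x) ^ ?N))" by (intro integrable_mult_right integrable_inverse_power_norm)
 qed auto
 moreover have "(LINT x|lborel. h (t *\<^sub>R axis j 1 + x)) = (LINT x|lborel. h x)" for t using lborel_integral_affine[of 1 h "t *\<^sub>R axis j 1"] by simp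
 ultimately have "((%t::real. LINT x|lborel. h x) has_derivative
   (%s. LINT x|lborel. s *\<^sub>R D (0 *\<^sub>R axis j 1 + x) (axis j 1))) (at 0)" by simp
 hence "(%s. LINT x|lborel. s *\<^sub>R D (0 *\<^sub>R axis j 1 + x) (axis j 1)) = (%s::real. 0)" by (rule has_derivative_unique) (rule has_derivative_const)
 from fun_cong[OF this, of 1] show ?thesis by simp
qed

text \<open>The vanishing integral is applied to the product of f with the plane wave; the two terms
  of the product rule give the two sides.\<close>

lemma fourier_pderiv:
 fixes f :: "'n::finite cfun"
 assumes f: "f \<in> schwartz"
 shows "fourier (pderiv_dir j f) z = \<i> * cplx (z $ j) * fourier f z"
proof -
 note [measurable] = schwartz_borel[OF f] schwartz_borel[OF schwartz_pderiv[OF f]]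
 define D where "D x v = wave x z * (\<Sum>j\<in>UNIV. (v $ j) *\<^sub>R pderiv_dir j f x) + wave x z * (- \<i> * cplx (v \<bullet> z)) * f x" for x v
 have Dj: "D x (axis j 1) = wave x z * (pderiv_dir j f x + (- \<i> * cplx (z $ j)) * f x)" for x
 proof -
  have "axis j 1 \<bullet> z = z $ j" by (simp add: inner_axis')
  moreover have "(\<Sum>k\<in>UNIV. (axis j 1 $ k) *\<^sub>R pderiv_dir k f x) = pderiv_dir j f x" by (simp add: axis_def if_distrib[of "%c. c *\<^sub>R _"] cong: if_cong)
  ultimately show ?thesis unfolding D_def by (simp only:) (simp add: algebra_simps)
 qed
 have sch: "(%x. pderiv_dir j f x + (- \<i> * cplx (z $ j)) * f x) \<in> schwartz" by (intro schwartz_add schwartz_cmult schwartz_pderiv f)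
 obtain C where C: "\<And>x. (1 + norm x) ^ (CARD('n) + 2) * norm (pderiv_dir j f x + (- \<i> * cplx (z $ j)) * f x) <= C" using schwartz_decay[OF sch] by blast
 have "(LINT x|lborel. D x (axis j 1)) = 0"
 proof (rule integral_pderiv_zero)
  show "integrable lborel (%x. wave x z * f x)" by (intro integrable_wave_mult schwartz_integrable f)
  show "((%x. wave x z * f x) has_derivative D x) (at x)" for x using has_derivative_mult[OF has_derivative_wave_left schwartz_has_derivative[OF f]] unfolding D_def[abs_def] .
  show "(1 + norm x) ^ (CARD('n) + 2) * norm (D x (axis j 1)) <= C" for x using C[of x] unfolding Dj by (simp add: norm_mult)
 qed (simp add: Dj)
 hence "0 = (LINT x|lborel. wave x z * pderiv_dir j f x + (- \<i> * cplx (z $ j)) * (wave x z * f x))" unfolding Dj by (simp add: algebra_simps)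
 also have "... = (LINT x|lborel. wave x z * pderiv_dir j f x) + (- \<i> * cplx (z $ j)) * (LINT x|lborel. wave x z * f x)" by (subst Bochner_Integration.integral_add[OF integrable_wave_mult[OF schwartz_integrable[OF schwartz_pderiv[OF f]]]
    integrable_mult_right[OF integrable_wave_mult[OF schwartz_integrable[OF f]]]]) simp
 finally have "(LINT x|lborel. wave x z * pderiv_dir j f x) = \<i> * cplx (z $ j) * (LINT x|lborel. wave x z * f x)" by (simp add: algebra_simps)
 thus ?thesis by (simp add: fourier_lborel mult_ac)
qed

text \<open>One factor 1 + |x| is traded for one derivative of f: |x| is at most the sum of the
  |x_j|, and x_j times the transform is, up to a unit factor, the transform of a partial derivative.
  The induction therefore runs over all Schwartz functions at once.\<close>

lemma fourier_decay:
 fixes f :: "'n::finite cfun"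
 assumes "f \<in> schwartz"
 shows "\<exists>C. \<forall>x. (1 + norm x) ^ k * norm (fourier f x) <= C" using assms
proof (induction k arbitrary: f)
 case 0
 thus ?case using norm_fourier_le[OF schwartz_integrable[OF 0]] by auto
next
 case (Suc k)
 obtain C where C: "\<And>x. (1 + norm x) ^ k * norm (fourier f x) <= C" using Suc by blast
 have "\<forall>j. \<exists>C. \<forall>x. (1 + norm x) ^ k * norm (fourier (pderiv_dir j f) x) <= C" using Suc schwartz_pderiv by blast
 then obtain B where B: "\<And>j x. (1 + norm x) ^ k * norm (fourier (pderiv_dir j f) x) <= B j" by metis
 have "(1 + norm x) ^ Suc k * norm (fourier f x) <= C + (\<Sum>j\<in>UNIV. B j)" for x
 proof -
  have "(1 + norm x) ^ Suc k * norm (fourier f x) <= (1 + norm x) ^ k * ((1 + (\<Sum>j\<in>UNIV. \<bar>x $ j\<bar>)) * norm (fourier f x))" unfolding power_Suc2 mult.assoc using norm_le_l1_cart[of x] by (intro mult_left_mono mult_right_mono) auto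
  also have "... = (1 + norm x) ^ k * norm (fourier f x) + (\<Sum>j\<in>UNIV. (1 + norm x) ^ k * norm (fourier (pderiv_dir j f) x))" by (simp add: fourier_pderiv[OF Suc.prems] norm_mult algebra_simps sum_distrib_left)
  also have "... <= C + (\<Sum>j\<in>UNIV. B j)" by (intro add_mono sum_mono C B)
  finally show ?thesis .
 qed
 thus ?case by blast
qed

lemma schwartz_fourier:
 assumes "f \<in> schwartz"
 shows "fourier f \<in> schwartz"
proof (rule schwartz_coinduct[where P = "fourier ` schwartz"])
 show "pderiv_dir j g \<in> fourier ` schwartz" if g: "g \<in> fourier ` schwartz" for g :: "real^'a => complex" and j
 proof -
  obtain f where f: "g = fourier f" "f \<in> schwartz" using g by auto
  have "pderiv_dir j g = fourier (%x. - \<i> * (cplx (x $ j) * f x))" unfolding f(1) by (rule ext, rule pderiv_fourier[OF f(2)])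
  thus ?thesis using schwartz_cmult[OF schwartz_coord_mult[OF f(2)]] by blast
 qed
qed (use assms fourier_decay fourier_has_derivative in \<open>auto simp: differentiable_def\<close>, blast)

lemma inv_fourier_eq: "inv_fourier f = (%x. fourier f (- x))" by (simp add: inv_fourier_def fun_eq_iff)

lemma schwartz_inv_fourier: "f \<in> schwartz ==> inv_fourier f \<in> schwartz" unfolding inv_fourier_eq by (intro schwartz_reflect schwartz_fourier)

lemma inv_fourier_pderiv:
 "f \<in> schwartz ==> inv_fourier (pderiv_dir j f) x = - \<i> * cplx (x $ j) * inv_fourier f x" by (simp add: inv_fourier_def fourier_pderiv)

section \<open>Gaussians and mollification\<close>

text \<open>Polynomials times a Gaussian, generated by the operations that differentiation produces;
  this is the class handed to \<open>schwartz_coinduct\<close>.\<close>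

inductive_set gauss_poly :: "real => (real ^ 'n::finite => complex) set" for a :: real where
 base: "(%x. cplx (exp (- a * (x \<bullet> x)))) \<in> gauss_poly a"
| cmult: "f \<in> gauss_poly a ==> (%x. c * f x) \<in> gauss_poly a"
| add: "f \<in> gauss_poly a ==> g \<in> gauss_poly a ==> (%x. f x + g x) \<in> gauss_poly a"
| coord: "f \<in> gauss_poly a ==> (%x. cplx (x $ i) * f x) \<in> gauss_poly a"

lemma has_derivative_gauss:
 "((%x::real^'n::finite. cplx (exp (- a * (x \<bullet> x)))) has_derivative
  (%v. cplx (exp (- a * (x \<bullet> x)) * (- 2 * a * (x \<bullet> v))))) (at x)"
proof -
 have "((%x::real^'n. - a * (x \<bullet> x)) has_derivative (%v. - a * (x \<bullet> v + v \<bullet> x))) (at x)" by (intro has_derivative_mult_right has_derivative_inner has_derivative_ident)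
 from has_derivative_compose[OF this DERIV_exp[THEN has_field_derivative_imp_has_derivative]]
 have "((%x::real^'n. exp (- a * (x \<bullet> x))) has_derivative (%v. exp (- a * (x \<bullet> x)) * (- 2 * a * (x \<bullet> v)))) (at x)" by (simp add: inner_commute algebra_simps)
 thus ?thesis by (rule has_derivative_of_real)
qed

text \<open>With b = a/(k+1) the factor 1 + |x| is bounded by a multiple of exp(b |x|^2); its k-th
  power is still absorbed because k b is at most a.\<close>

lemma gauss_decay:
 assumes "a > 0"
 shows "\<exists>C. \<forall>x::real^'n::finite. (1 + norm x) ^ k * exp (- a * (x \<bullet> x)) <= C"
proof -
 define b where "b = a / (real k + 1)"
 have b: "b > 0" using assms by (simp add: b_def)
 have 1: "1 + norm x <= (2 + 1 / b) * exp (b * (x \<bullet> x))" for x :: "real^'n"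
 proof -
  have "norm x <= 1 + norm x ^ 2" using sum_squares_bound[of "norm x" 1] by (auto simp: power2_eq_square) (smt (verit) zero_le_square)
  hence "1 + norm x <= 2 + (x \<bullet> x)" by (simp add: power2_norm_eq_inner)
  also have "... <= (2 + 1 / b) * (1 + b * (x \<bullet> x))" using b by (simp add: field_simps)
  also have "... <= (2 + 1 / b) * exp (b * (x \<bullet> x))" using b by (intro mult_left_mono exp_ge_add_one_self) auto
  finally show ?thesis .
 qed
 have "(1 + norm x) ^ k * exp (- a * (x \<bullet> x)) <= (2 + 1 / b) ^ k" for x :: "real^'n"
 proof -
  have "(1 + norm x) ^ k <= ((2 + 1 / b) * exp (b * (x \<bullet> x))) ^ k" using 1[of x] by (intro power_mono) auto
  also have "... = (2 + 1 / b) ^ k * exp (real k * (b * (x \<bullet> x)))" by (simp add: power_mult_distrib exp_of_nat_mult)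
  also have "... <= (2 + 1 / b) ^ k * exp (a * (x \<bullet> x))"
  proof -
   have "real k * b <= a" using assms by (simp add: b_def field_simps)
   hence "real k * (b * (x \<bullet> x)) <= a * (x \<bullet> x)" by (metis inner_ge_zero mult.assoc mult_right_mono)
   thus ?thesis using b by (intro mult_left_mono) auto
  qed
  finally have "(1 + norm x) ^ k * exp (- a * (x \<bullet> x)) <= (2 + 1 / b) ^ k * exp (a * (x \<bullet> x)) * exp (- a * (x \<bullet> x))" by (rule mult_right_mono) simp
  thus ?thesis by (simp add: mult.assoc flip: exp_add)
 qed
 thus ?thesis by blast
qed

lemma gauss_poly_props:
 fixes f :: "'n::finite cfun"
 assumes "f \<in> gauss_poly a" "a > 0"
 shows "(\<forall>x. f differentiable (at x)) \<and> (\<forall>j. pderiv_dir j f \<in> gauss_poly a) \<and>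
  (\<forall>k. \<exists>C. \<forall>x. (1 + norm x) ^ k * norm (f x) <= C)" using assms(1)
proof induction
 case base
 have "pderiv_dir j (%x::real^'n. cplx (exp (- a * (x \<bullet> x)))) =
   (%x. cplx (- 2 * a) * (cplx (x $ j) * cplx (exp (- a * (x \<bullet> x)))))" for j by (rule ext, subst pderiv_dirI[OF has_derivative_gauss]) (simp add: inner_axis)
 moreover have "(%x::real^'n. cplx (- 2 * a) * (cplx (x $ j) * cplx (exp (- a * (x \<bullet> x))))) \<in> gauss_poly a" for j by (intro gauss_poly.intros)
 moreover have "(%x::real^'n. cplx (exp (- a * (x \<bullet> x)))) differentiable (at x)" for x using has_derivative_gauss differentiable_def by blast
 moreover have "\<exists>C. \<forall>x::real^'n. (1 + norm x) ^ k * norm (cplx (exp (- a * (x \<bullet> x)))) <= C" for k using gauss_decay[OF assms(2), of k] by (simp only: norm_of_real abs_exp_cancel)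
 ultimately show ?case by simp
next
 case (cmult f c)
 have "pderiv_dir j (%x. c * f x) = (%x. c * pderiv_dir j f x)" for j using cmult.IH by (intro ext, subst pderiv_dirI[OF has_derivative_mult_right[OF has_derivative_pderiv_dir]])
    (auto simp: axis_def if_distrib[of "%c. c *\<^sub>R _"] cong: if_cong)
 moreover have "\<exists>C. \<forall>x. (1 + norm x) ^ k * norm (c * f x) <= C" for k
 proof -
  obtain C where C: "\<And>x. (1 + norm x) ^ k * norm (f x) <= C" using cmult.IH by meson
  have "(1 + norm x) ^ k * norm (c * f x) <= norm c * C" for x using mult_left_mono[OF C[of x], of "norm c"] by (simp add: norm_mult mult_ac)
  thus ?thesis by blast
 qed
 ultimately show ?case using cmult.IH by (auto intro: gauss_poly.cmult differentiable_mult)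
next
 case (add f g)
 have "pderiv_dir j (%x. f x + g x) = (%x. pderiv_dir j f x + pderiv_dir j g x)" for j using add.IH by (intro ext, subst pderiv_dirI[OF has_derivative_add[OF has_derivative_pderiv_dir has_derivative_pderiv_dir]])
    (auto simp: axis_def if_distrib[of "%c. c *\<^sub>R _"] cong: if_cong)
 moreover have "\<exists>C. \<forall>x. (1 + norm x) ^ k * norm (f x + g x) <= C" for k
 proof -
  obtain C D where C: "\<And>x. (1 + norm x) ^ k * norm (f x) <= C" "\<And>x. (1 + norm x) ^ k * norm (g x) <= D" using add.IH by meson
  have "(1 + norm x) ^ k * norm (f x + g x) <= C + D" for x using mult_left_mono[OF norm_triangle_ineq[of "f x" "g x"], of "(1 + norm x) ^ k"] C[of x] by (simp add: distrib_left)
  thus ?thesis by blast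
 qed
 ultimately show ?case using add.IH by (auto intro: gauss_poly.add differentiable_add)
next
 case (coord f i)
 let ?c = "%j. if j = i then 1 else 0 :: complex"
 have "pderiv_dir j (%x. cplx (x $ i) * f x) = (%x. cplx (x $ i) * pderiv_dir j f x + ?c j * f x)" for j using coord.IH by (intro ext, subst pderiv_dirI[OF pderiv_coord_mult])
    (auto simp: axis_def if_distrib[of "%c. c *\<^sub>R _"] cong: if_cong)
 moreover have "(%x. cplx (x $ i) * pderiv_dir j f x + ?c j * f x) \<in> gauss_poly a" for j using coord by (intro gauss_poly.add gauss_poly.cmult gauss_poly.coord) auto
 moreover have "\<exists>C. \<forall>x. (1 + norm x) ^ k * norm (cplx (x $ i) * f x) <= C" for k
 proof -
  obtain C where C: "\<And>x. (1 + norm x) ^ Suc k * norm (f x) <= C" using coord.IH by meson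
  have "(1 + norm x) ^ k * norm (cplx (x $ i) * f x) <= C" for x
  proof -
   have "\<bar>x $ i\<bar> * norm (f x) <= (1 + norm x) * norm (f x)" using component_le_norm_cart[of x i] by (intro mult_right_mono) auto
   hence "(1 + norm x) ^ k * norm (cplx (x $ i) * f x) <= (1 + norm x) ^ k * ((1 + norm x) * norm (f x))" by (simp add: norm_mult mult_left_mono)
   also have "... <= C" using C[of x] by (simp add: mult_ac)
   finally show ?thesis .
  qed
  thus ?thesis by blast
 qed
 moreover have "(%x. cplx (x $ i) * f x) differentiable (at x)" for x using pderiv_coord_mult[of f x i] coord.IH unfolding differentiable_def by blast
 ultimately show ?case by auto
qed

definition gauss :: "real => real ^ 'n::finite => complex" where
 "gauss a x = cplx (exp (- a * (x \<bullet> x)))"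

lemma gauss_schwartz: "a > 0 ==> (gauss a :: 'n::finite cfun) \<in> schwartz"
proof (rule schwartz_coinduct[where P = "gauss_poly a"])
 assume a: "a > 0"
 show "gauss a \<in> gauss_poly a" unfolding gauss_def[abs_def] by (rule gauss_poly.base)
 fix g :: "'n cfun" assume "g \<in> gauss_poly a"
 note * = gauss_poly_props[OF this a]
 show "g differentiable at x" for x using * by blast
 show "pderiv_dir j g \<in> gauss_poly a" for j using * by blast
 show "\<exists>C. \<forall>x. (1 + norm x) ^ k * norm (g x) <= C" for k using * by blast
qed

lemma gauss_borel[measurable]: "gauss a \<in> BM" unfolding gauss_def[abs_def] by measurable

lemma gauss_integral:
 "(LINT x|lborel. gauss (1/2) (x :: real^'n::finite)) = cplx ((2 * pi) powr (real CARD('n) / 2))"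
proof -
 \<comment> \<open>The one-dimensional integral is read off from the total mass 1 of the normal
   density.\<close>
 have n1: "(NN t. ennreal (exp (- (t^2) / 2))) = ennreal (sqrt (2 * pi))"
 proof -
  interpret prob_space "density lborel (normal_density 0 1)" by (rule prob_space_normal_density) simp
  have "1 = (NN t. ennreal (normal_density 0 1 t))" using emeasure_space_1 by (simp add: emeasure_density)
  also have "... = (NN t. ennreal (1 / sqrt (2 * pi)) * ennreal (exp (- (t^2) / 2)))" by (simp add: normal_density_def ennreal_mult'[symmetric])
  also have "... = ennreal (1 / sqrt (2 * pi)) * (NN t. ennreal (exp (- (t^2) / 2)))" by (rule nn_integral_cmult) simp
  finally have *: "1 = ennreal (1 / sqrt (2 * pi)) * (NN t. ennreal (exp (- (t^2) / 2)))" .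
  have "ennreal (sqrt (2 * pi)) = ennreal (sqrt (2 * pi)) * ennreal (1 / sqrt (2 * pi)) * (NN t. ennreal (exp (- (t^2) / 2)))" using arg_cong[OF *, of "%y. ennreal (sqrt (2 * pi)) * y"] by (simp add: mult.assoc)
  also have "ennreal (sqrt (2 * pi)) * ennreal (1 / sqrt (2 * pi)) = 1" by (subst ennreal_mult'[symmetric]) auto
  finally show ?thesis by simp
 qed
 have "(NN x. ennreal (exp (- (1/2) * ((x :: real^'n) \<bullet> x)))) =
   (NN x. (\<Prod>b\<in>Basis. ennreal (exp (- (((x :: real^'n) \<bullet> b)^2) / 2))))"
 proof (intro nn_integral_cong)
  fix x :: "real^'n"
  have "exp (- (1/2) * (x \<bullet> x)) = (\<Prod>b\<in>Basis. exp (- ((x \<bullet> b)^2) / 2))" by (subst euclidean_inner[of x x]) (simp add: power2_eq_square exp_sum[symmetric] sum_negf sum_divide_distrib)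
  thus "ennreal (exp (- (1/2) * (x \<bullet> x))) = (\<Prod>b\<in>Basis. ennreal (exp (- ((x \<bullet> b)^2) / 2)))" by (simp add: prod_ennreal)
 qed
 also have "... = (\<Prod>b\<in>(Basis::(real^'n) set). (NN t. ennreal (exp (- (t^2) / 2))))" by (rule nn_integral_lborel_prod) auto
 also have "... = ennreal (sqrt (2 * pi) ^ CARD('n))" unfolding n1 by (simp add: ennreal_power)
 also have "sqrt (2 * pi) ^ CARD('n) = (2 * pi) powr (real CARD('n) / 2)" by (simp add: powr_half_sqrt[symmetric] powr_powr flip: powr_realpow)
 finally have "(LINT x|lborel. exp (- (1/2) * ((x :: real^'n) \<bullet> x))) = (2 * pi) powr (real CARD('n) / 2)" by (subst integral_eq_nn_integral) auto
 thus ?thesis unfolding gauss_def by (simp add: integral_complex_of_real del: of_real_exp)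
qed

lemma fconst_gauss: "cplx (fconst TYPE('n)) * (LINT x|lborel. gauss (1/2) (x :: real^'n::finite)) = 1"
proof -
 have "fconst TYPE('n) * (2 * pi) powr (real CARD('n) / 2) = 1" by (simp flip: powr_add)
 thus ?thesis unfolding gauss_integral by (simp flip: of_real_mult)
qed

text \<open>The Fourier transform of the Gaussian satisfies the same first order system as the Gaussian.\<close>

lemma fourier_gauss_half: "fourier (gauss (1/2)) = (gauss (1/2) :: 'n::finite cfun)"
proof
 let ?g = "gauss (1/2) :: 'n cfun"
 let ?e = "%x::real^'n. cplx (exp (- (- (1/2)) * (x \<bullet> x)))"
 fix z :: "real^'n"
 have gs: "?g \<in> schwartz" by (rule gauss_schwartz) simp
 have pd: "pderiv_dir j ?g x = - (cplx (x $ j) * ?g x)" for j x unfolding gauss_def[abs_def] by (subst pderiv_dirI[OF has_derivative_gauss]) (simp add: inner_axis)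
 have pf: "pderiv_dir j (fourier ?g) x = - cplx (x $ j) * fourier ?g x" for j x
 proof -
  have "pderiv_dir j (fourier ?g) x = fourier (%x. \<i> * pderiv_dir j ?g x) x" by (simp add: pderiv_fourier[OF gs] pd)
  also have "... = \<i> * fourier (pderiv_dir j ?g) x" using schwartz_borel[OF schwartz_pderiv[OF gs, of j]] schwartz_borel[OF schwartz_cmult[OF schwartz_pderiv[OF gs, of j]], of \<i>] by (simp add: fourier_lborel mult.left_commute[of _ "\<i>"])
  finally show ?thesis by (simp add: fourier_pderiv[OF gs] mult.assoc)
 qed
 have "\<exists>c. \<forall>x\<in>UNIV. fourier ?g x * ?e x = c"
 proof (rule has_derivative_zero_constant)
  fix x :: "real^'n"
  have "((%x. fourier ?g x * ?e x) has_derivative (%v. fourier ?g x * cplx (exp (- (- (1/2)) * (x \<bullet> x)) * (- 2 * (- (1/2)) * (x \<bullet> v))) +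
    (\<Sum>j\<in>UNIV. (v $ j) *\<^sub>R pderiv_dir j (fourier ?g) x) * ?e x)) (at x)" by (rule has_derivative_mult[OF schwartz_has_derivative[OF schwartz_fourier[OF gs]] has_derivative_gauss])
  also have "(%v. fourier ?g x * cplx (exp (- (- (1/2)) * (x \<bullet> x)) * (- 2 * (- (1/2)) * (x \<bullet> v))) +
    (\<Sum>j\<in>UNIV. (v $ j) *\<^sub>R pderiv_dir j (fourier ?g) x) * ?e x) = (%v. 0)"
  proof
   fix v :: "real^'n"
   have "(\<Sum>j\<in>UNIV. (v $ j) *\<^sub>R pderiv_dir j (fourier ?g) x) = - cplx (x \<bullet> v) * fourier ?g x" unfolding pf inner_vec_def by (simp add: scaleR_conv_of_real sum_distrib_left sum_negf mult_ac)
   thus "fourier ?g x * cplx (exp (- (- (1/2)) * (x \<bullet> x)) * (- 2 * (- (1/2)) * (x \<bullet> v))) +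
    (\<Sum>j\<in>UNIV. (v $ j) *\<^sub>R pderiv_dir j (fourier ?g) x) * ?e x = 0" by simp
  qed
  finally show "((%x. fourier ?g x * ?e x) has_derivative (%v. 0)) (at x within UNIV)" by simp
 qed simp
 then obtain c where c: "\<And>x. fourier ?g x * ?e x = c" by blast
 have "c = fourier ?g 0" using c[of 0] by simp
 also have "... = cplx (fconst TYPE('n)) * (LINT x|lborel. gauss (1/2) (x::real^'n))" by (subst fourier_lborel) simp_all
 also have "... = 1" by (rule fconst_gauss)
 finally have 1: "fourier ?g z * ?e z = 1" using c by simp
 have 2: "?e z * ?g z = 1" unfolding gauss_def by (simp flip: of_real_mult exp_add)
 have "fourier ?g z = fourier ?g z * (?e z * ?g z)" unfolding 2 by simp
 also have "... = ?g z" unfolding mult.assoc[symmetric] 1 by simp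
 finally show "fourier ?g z = ?g z" .
qed

text \<open>Convolution with a Gaussian of width e, with the scaling moved into f: the kernel stays
  fixed, and the limit of vanishing width is a dominated convergence.\<close>

definition moll :: "real => ('n::finite cfun) => 'n cfun" where
 "moll e f x = cplx (fconst TYPE('n)) * (LINT z|lborel. f (x + e *\<^sub>R z) * gauss (1/2) z)"

lemma norm_moll_le:
 fixes f :: "'n::finite cfun"
 assumes "\<And>x. norm (f x) <= B"
 shows "norm (moll e f x) <= B"
proof -
 have B: "0 <= B" using assms norm_ge_zero order_trans by blast
 have gi: "integrable lborel (gauss (1/2) :: 'n cfun)" by (intro schwartz_integrable gauss_schwartz) simp
 hence gi': "integrable lborel (%z::real^'n. norm (gauss (1/2) z))" by (rule integrable_norm)
 have "norm (LINT z|lborel. f (x + e *\<^sub>R z) * gauss (1/2) z) <= (LINT z|lborel. B * norm (gauss (1/2) (z::real^'n)))"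
 proof (cases "integrable lborel (%z. f (x + e *\<^sub>R z) * gauss (1/2) z)")
  case True
  have "norm (LINT z|lborel. f (x + e *\<^sub>R z) * gauss (1/2) z) <= (LINT z|lborel. norm (f (x + e *\<^sub>R z) * gauss (1/2) z))" by (rule integral_norm_bound)
  also have "... <= (LINT z|lborel. B * norm (gauss (1/2) (z::real^'n)))" by (rule integral_mono[OF integrable_norm[OF True] integrable_mult_right[OF gi']])
    (simp add: norm_mult mult_right_mono assms)
  finally show ?thesis .
 next
  \<comment> \<open>A non-integrable integrand has integral 0 by convention.\<close>
  case False
  thus ?thesis using B by (simp add: not_integrable_integral_eq)
 qed
 hence "norm (moll e f x) <= fconst TYPE('n) * (LINT z|lborel. B * norm (gauss (1/2) (z::real^'n)))" unfolding moll_def by (simp add: norm_mult mult_left_mono)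
 also have "... = B * (fconst TYPE('n) * (LINT z|lborel. norm (gauss (1/2) (z::real^'n))))" by simp
 also have "fconst TYPE('n) * (LINT z|lborel. norm (gauss (1/2) (z::real^'n))) = 1"
 proof -
  have "cplx (LINT z|lborel. norm (gauss (1/2) (z::real^'n))) = (LINT z|lborel. gauss (1/2) (z::real^'n))"
  proof -
   have "(LINT z|lborel. gauss (1/2) (z::real^'n)) = (LINT z|lborel. cplx (norm (gauss (1/2) (z::real^'n))))" by (rule Bochner_Integration.integral_cong) (simp_all add: gauss_def del: of_real_exp)
   thus ?thesis by (simp only: integral_complex_of_real)
  qed
  hence "cplx (fconst TYPE('n) * (LINT z|lborel. norm (gauss (1/2) (z::real^'n)))) = cplx 1" using fconst_gauss[where 'n = 'n] by (simp only: of_real_mult of_real_1)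
  thus ?thesis by (simp only: of_real_eq_iff)
 qed
 finally show ?thesis by simp
qed

lemma moll_tendsto:
 fixes f :: "'n::finite cfun"
 assumes f: "\<And>x. norm (f x) <= B" "continuous_on UNIV f" and e: "d \<longlonglongrightarrow> 0"
 shows "(%k. moll (d k) f x) \<longlonglongrightarrow> f x"
proof -
 have [measurable]: "f \<in> BM" using f(2) by (rule borel_measurable_continuous_onI)
 have gi: "integrable lborel (gauss (1/2) :: 'n cfun)" by (intro schwartz_integrable gauss_schwartz) simp
 have "(%k. LINT z|lborel. f (x + d k *\<^sub>R z) * gauss (1/2) z) \<longlonglongrightarrow> (LINT z|lborel. f x * gauss (1/2) (z::real^'n))"
 proof (rule integral_dominated_convergence[where w = "%z::real^'n. B * norm (gauss (1/2) z)"])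
  show "AE z in lborel. (%k. f (x + d k *\<^sub>R z) * gauss (1/2) z) \<longlonglongrightarrow> f x * gauss (1/2) z"
  proof (rule AE_I2)
   fix z :: "real^'n"
   have "(%k. x + d k *\<^sub>R z) \<longlonglongrightarrow> x + 0 *\<^sub>R z" by (intro tendsto_intros e)
   hence "(%k. f (x + d k *\<^sub>R z)) \<longlonglongrightarrow> f x" using f(2) by (intro continuous_on_tendsto_compose[OF f(2)]) auto
   thus "(%k. f (x + d k *\<^sub>R z) * gauss (1/2) z) \<longlonglongrightarrow> f x * gauss (1/2) z" by (intro tendsto_intros)
  qed
  show "integrable lborel (%z::real^'n. B * norm (gauss (1/2) z))" using gi by (intro integrable_mult_right integrable_norm)
 qed (use f in \<open>auto simp: norm_mult mult_right_mono\<close>)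
 from tendsto_mult_left[OF this, of "cplx (fconst TYPE('n))"]
 show ?thesis using fconst_gauss[where 'n = 'n] by (simp add: moll_def mult.left_commute)
qed

section \<open>Fourier inversion\<close>

text \<open>Fubini's theorem for a bounded kernel; the kernels in question are the plane waves of
  the transform and of its inverse.\<close>

lemma integral_kernel_swap:
 fixes f g :: "'a::euclidean_space => complex"
 assumes f: "integrable lborel f" and g: "integrable lborel g"
  and [measurable]: "(%(x, y). k x y) \<in> borel_measurable (borel \<Otimes>\<^sub>M borel)"
  and k: "\<And>x y. norm (k x y) <= 1"
 shows "(LINT x|lborel. (LINT y|lborel. k x y * f y) * g x) = (LINT y|lborel. f y * (LINT x|lborel. k x y * g x))"
proof -
 have [measurable]: "f \<in> BM" "g \<in> BM" using borel_measurable_integrable[OF f] borel_measurable_integrable[OF g] by simp_all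
 have 1: "integrable (lborel \<Otimes>\<^sub>M lborel) (%(x, y). f y * g x)"
 proof (rule lborel_pair.Fubini_integrable)
  show "integrable lborel (%x. LINT y|lborel. norm (case (x, y) of (x, y) => f y * g x))" using g by (simp add: norm_mult)
 qed (use f in auto)
 have "integrable (lborel \<Otimes>\<^sub>M lborel) (%(x, y). k x y * f y * g x)"
 proof (rule Bochner_Integration.integrable_bound[OF 1])
  show "AE z in lborel \<Otimes>\<^sub>M lborel. norm (case z of (x, y) => k x y * f y * g x) <= norm (case z of (x, y) => f y * g x)"
  proof (rule AE_I2)
   fix z :: "'a \<times> 'a"
   obtain x y where z: "z = (x, y)" by (cases z)
   have "norm (k x y) * (norm (f y) * norm (g x)) <= 1 * (norm (f y) * norm (g x))" by (intro mult_right_mono k) auto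
   thus "norm (case z of (x, y) => k x y * f y * g x) <= norm (case z of (x, y) => f y * g x)" by (simp add: z norm_mult mult.assoc)
  qed
 qed measurable
 from lborel_pair.Fubini_integral[OF this]
 have "(LINT y|lborel. LINT x|lborel. k x y * f y * g x) = (LINT x|lborel. LINT y|lborel. k x y * f y * g x)" .
 moreover have "(LINT x|lborel. k x y * f y * g x) = f y * (LINT x|lborel. k x y * g x)" for y
 proof -
  have "(LINT x|lborel. k x y * f y * g x) = (LINT x|lborel. f y * (k x y * g x))" by (simp add: mult_ac)
  thus ?thesis by simp
 qed
 moreover have "(LINT y|lborel. k x y * f y * g x) = (LINT y|lborel. k x y * f y) * g x" for x by simp
 ultimately show ?thesis by simp
qed

lemma fourier_multiplication:
 fixes f g :: "'n::finite cfun"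
 assumes f: "integrable lborel f" and g: "integrable lborel g"
 shows "(LINT x|lborel. fourier f x * g x) = (LINT y|lborel. f y * fourier g y)"
  and "(LINT x|lborel. inv_fourier f x * g x) = (LINT y|lborel. f y * inv_fourier g y)"
proof -
 have [measurable]: "f \<in> BM" "g \<in> BM" using borel_measurable_integrable[OF f] borel_measurable_integrable[OF g] by simp_all
 define c where "c = cplx (fconst TYPE('n))"
 have fl: "fourier h x = c * (LINT y|lborel. wave y x * h y)" if "h \<in> BM" for h :: "'n cfun" and x using fourier_lborel[OF that] by (simp add: c_def)
 have "(LINT x|lborel. (LINT y|lborel. wave y x * f y) * g x) = (LINT y|lborel. f y * (LINT x|lborel. wave y x * g x))" by (rule integral_kernel_swap[OF f g, where k = "%x y. wave y x"]) (unfold split_beta' borel_prod, intro borel_measurable_continuous_onI continuous_intros, rule eq_refl, rule norm_wave)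
 also have "(%y. LINT x|lborel. wave y x * g x) = (%y. LINT x|lborel. wave x y * g x)" by (simp add: inner_commute)
 finally show "(LINT x|lborel. fourier f x * g x) = (LINT y|lborel. f y * fourier g y)" by (simp add: fl mult.assoc mult.left_commute[of _ c])
 have "(LINT x|lborel. (LINT y|lborel. wave y (- x) * f y) * g x) = (LINT y|lborel. f y * (LINT x|lborel. wave y (- x) * g x))" by (rule integral_kernel_swap[OF f g, where k = "%x y. wave y (- x)"]) (unfold split_beta' borel_prod, intro borel_measurable_continuous_onI continuous_intros, rule eq_refl, rule norm_wave)
 also have "(%y. LINT x|lborel. wave y (- x) * g x) = (%y. LINT x|lborel. wave x (- y) * g x)" by (simp add: inner_commute)
 finally show "(LINT x|lborel. inv_fourier f x * g x) = (LINT y|lborel. f y * inv_fourier g y)" unfolding inv_fourier_def by (simp only: fl[OF \<open>f \<in> BM\<close>] fl[OF \<open>g \<in> BM\<close>] mult.assoc mult.left_commute[of _ c] integral_mult_right_zero)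
qed

lemma fourier_gauss_scale:
 fixes y :: "real^'n::finite"
 assumes "e > 0"
 shows "fourier (gauss (e\<^sup>2 / 2)) y = cplx ((1 / e) ^ CARD('n)) * gauss (1/2) ((1 / e) *\<^sub>R y)"
proof -
 have "(LINT x|lborel. wave x y * gauss (e\<^sup>2 / 2) x) =
  \<bar>1 / e\<bar> ^ DIM(real^'n) *\<^sub>R (LINT x|lborel. wave (0 + (1 / e) *\<^sub>R x) y * gauss (e\<^sup>2 / 2) (0 + (1 / e) *\<^sub>R x))" by (rule lborel_integral_affine) (use assms in auto)
 also have "(%x. wave (0 + (1 / e) *\<^sub>R x) y * gauss (e\<^sup>2 / 2) (0 + (1 / e) *\<^sub>R x)) =
   (%x. wave x ((1 / e) *\<^sub>R y) * gauss (1/2) x)" using assms by (intro ext) (simp add: gauss_def power2_eq_square)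
 finally have "fourier (gauss (e\<^sup>2 / 2)) y = cplx ((1 / e) ^ CARD('n)) * fourier (gauss (1/2)) ((1 / e) *\<^sub>R y)" using assms by (simp add: fourier_lborel scaleR_conv_of_real[where 'a = complex] mult_ac)
 thus ?thesis by (simp only: fourier_gauss_half)
qed

text \<open>The inversion integral, damped by a Gaussian because the double integral without damping
  does not converge absolutely. Moving the transform from f to the damped wave produces a rescaled
  and translated Gaussian, which is the mollifier.\<close>

lemma fourier_gauss_moll:
 fixes f :: "'n::finite cfun"
 assumes f: "integrable lborel f" and e: "d > 0"
 shows "cplx (fconst TYPE('n)) * (LINT w|lborel. fourier f w * (wave w (- x) * gauss (d\<^sup>2 / 2) w)) = moll d f x"
proof -
 have [measurable]: "f \<in> BM" using borel_measurable_integrable[OF f] by simp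
 have gi: "integrable lborel (%w. wave w (- x) * gauss (d\<^sup>2 / 2) w)" by (intro integrable_wave_mult schwartz_integrable gauss_schwartz) (use e in auto)
 have 1: "fourier (%w. wave w (- x) * gauss (d\<^sup>2 / 2) w) y = fourier (gauss (d\<^sup>2 / 2)) (y - x)" for y
 proof -
  have "wave w y * (wave w (- x) * gauss (d\<^sup>2 / 2) w) = wave w (y - x) * gauss (d\<^sup>2 / 2) w" for w
  proof -
   have "wave w y * wave w (- x) = wave w (y - x)" by (simp add: mult_exp_exp inner_diff_right algebra_simps)
   thus ?thesis by (simp only: mult.assoc[symmetric])
  qed
  thus ?thesis using fourier_lborel[of "%w. wave w (- x) * gauss (d\<^sup>2 / 2) w" y] fourier_lborel[of "gauss (d\<^sup>2 / 2)" "y - x"] by (simp only: mem_Collect_eq) measurable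
 qed
 have "(LINT w|lborel. fourier f w * (wave w (- x) * gauss (d\<^sup>2 / 2) w)) =
   (LINT y|lborel. f y * (cplx ((1 / d) ^ CARD('n)) * gauss (1/2) ((1 / d) *\<^sub>R (y - x))))" using fourier_multiplication(1)[OF f gi] by (simp only: 1 fourier_gauss_scale[OF e])
 also have "... = \<bar>d\<bar> ^ DIM(real^'n) *\<^sub>R (LINT z|lborel. f (x + d *\<^sub>R z) *
   (cplx ((1 / d) ^ CARD('n)) * gauss (1/2) ((1 / d) *\<^sub>R ((x + d *\<^sub>R z) - x))))" by (rule lborel_integral_affine) (use e in auto)
 also have "... = (LINT z|lborel. f (x + d *\<^sub>R z) * gauss (1/2) z)" using e by (simp add: scaleR_conv_of_real[where 'a = complex] mult.left_commute power_divide)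
 finally show ?thesis by (simp add: moll_def)
qed

text \<open>The damped inversion integrals converge to the inversion integral by dominated
  convergence, and to f(x) because they are mollifications of f.\<close>

lemma inv_fourier_fourier:
 fixes f :: "'n::finite cfun"
 assumes f: "f \<in> schwartz"
 shows "inv_fourier (fourier f) = f"
proof
 fix x
 note [measurable] = schwartz_borel[OF f] schwartz_borel[OF schwartz_fourier[OF f]]
 define e where "e k = 1 / (real k + 1)" for k
 have e: "e k > 0" for k by (simp add: e_def)
 have e0: "e \<longlonglongrightarrow> 0" unfolding e_def using LIMSEQ_inverse_real_of_nat by (simp add: field_simps)
 obtain B where B: "\<And>x. norm (f x) <= B" using schwartz_bounded[OF f] by blast
 let ?c = "cplx (fconst TYPE('n))"
 have "(%k. LINT z|lborel. fourier f z * (wave z (- x) * gauss ((e k)\<^sup>2 / 2) z)) \<longlonglongrightarrow>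
   (LINT z|lborel. fourier f z * (wave z (- x) * 1))"
 proof (rule integral_dominated_convergence[where w = "%z. norm (fourier f z)"])
  show "integrable lborel (%z. norm (fourier f z))" by (intro integrable_norm schwartz_integrable schwartz_fourier f)
  show "AE z in lborel. (%k. fourier f z * (wave z (- x) * gauss ((e k)\<^sup>2 / 2) z)) \<longlonglongrightarrow> fourier f z * (wave z (- x) * 1)"
  proof (rule AE_I2)
   fix z :: "real^'n"
   have "(%k. exp (- ((e k)\<^sup>2 / 2) * (z \<bullet> z))) \<longlonglongrightarrow> exp (- (0\<^sup>2 / 2) * (z \<bullet> z))" by (intro tendsto_intros e0) auto
   hence "(%k. gauss ((e k)\<^sup>2 / 2) z) \<longlonglongrightarrow> 1" unfolding gauss_def using tendsto_of_real[where 'a = complex] by (fastforce simp del: of_real_exp)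
   thus "(%k. fourier f z * (wave z (- x) * gauss ((e k)\<^sup>2 / 2) z)) \<longlonglongrightarrow> fourier f z * (wave z (- x) * 1)" by (intro tendsto_intros)
  qed
  show "AE z in lborel. norm (fourier f z * (wave z (- x) * gauss ((e k)\<^sup>2 / 2) z)) <= norm (fourier f z)" for k
  proof (rule AE_I2)
   fix z :: "real^'n"
   have "norm (gauss ((e k)\<^sup>2 / 2) z) <= 1" by (simp add: gauss_def del: of_real_exp)
   thus "norm (fourier f z * (wave z (- x) * gauss ((e k)\<^sup>2 / 2) z)) <= norm (fourier f z)" by (simp add: norm_mult mult_left_le)
  qed
 qed measurable
 from tendsto_mult_left[OF this, of ?c]
 have "(%k. moll (e k) f x) \<longlonglongrightarrow> ?c * (LINT z|lborel. fourier f z * (wave z (- x) * 1))" by (simp only: fourier_gauss_moll[OF schwartz_integrable[OF f] e])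
 moreover have "(%k. moll (e k) f x) \<longlonglongrightarrow> f x" by (rule moll_tendsto[OF B schwartz_continuous[OF f] e0])
 ultimately have "?c * (LINT z|lborel. fourier f z * (wave z (- x) * 1)) = f x" by (rule LIMSEQ_unique)
 thus "inv_fourier (fourier f) x = f x" unfolding inv_fourier_def by (subst fourier_lborel) (simp_all add: mult.commute)
qed

lemma fourier_reflect:
 fixes f :: "'n::finite cfun"
 assumes [measurable]: "f \<in> BM"
 shows "fourier (%x. f (- x)) z = fourier f (- z)" using lborel_integral_affine[of "-1" "%x. wave x (- z) * f x" 0] by (simp add: fourier_lborel)

lemma fourier_inv_fourier:
 assumes f: "f \<in> schwartz"
 shows "fourier (inv_fourier f) = f"
proof
 fix x
 have "fourier (inv_fourier f) x = inv_fourier (fourier f) x" unfolding inv_fourier_eq by (rule fourier_reflect[OF schwartz_borel[OF schwartz_fourier[OF f]]])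
 thus "fourier (inv_fourier f) x = f x" by (simp add: inv_fourier_fourier[OF f])
qed

text \<open>All derivatives fall on h. The decay survives because f vanishes outside the ball of
  radius R, and for y in that ball 1 + |x| is at most (1 + R)(1 + |x - y|).\<close>

lemma schwartz_conv:
 fixes f h :: "'n::finite cfun"
 assumes f: "integrable lborel f" "\<And>y. norm y > R ==> f y = 0" and h: "h \<in> schwartz" and R: "0 <= R"
 shows "(%x. LINT y|lborel. f y * h (x - y)) \<in> schwartz"
proof (rule schwartz_coinduct[where P = "{%x. LINT y|lborel. f y * h (x - y) | h. h \<in> schwartz}"])
 have [measurable]: "f \<in> BM" using borel_measurable_integrable[OF f(1)] by simp
 have der: "((%x. LINT y|lborel. f y * h (x - y)) has_derivative
   (%v. LINT y|lborel. f y * (\<Sum>j\<in>UNIV. (v $ j) *\<^sub>R pderiv_dir j h (x - y)))) (at x)"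
  if h: "h \<in> schwartz" for h and x :: "real^'n"
 proof -
  note [measurable] = schwartz_borel[OF h] schwartz_borel[OF schwartz_pderiv[OF h]]
  obtain B where B: "\<And>x. norm (h x) <= B" using schwartz_bounded[OF h] by blast
  have "\<forall>j. \<exists>C. \<forall>x. norm (pderiv_dir j h x) <= C" using schwartz_bounded[OF schwartz_pderiv[OF h]] by blast
  then obtain C where C: "\<And>j x. norm (pderiv_dir j h x) <= C j" by metis
  hence C0: "0 <= C j" for j using norm_ge_zero order_trans by blast
  show ?thesis
  proof (rule has_derivative_lebesgue_integral[where U = UNIV and H = "%y. norm (f y) * (\<Sum>j\<in>UNIV. C j)"])
   show "integrable lborel (%ya. f ya * h (y - ya))" for y
   proof (rule Bochner_Integration.integrable_bound[OF integrable_mult_right[OF f(1), of "cplx B"]])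
    show "AE x in lborel. norm (f x * h (y - x)) <= norm (cplx B * f x)" using B[of "y - _"] by (intro AE_I2) (simp add: norm_mult mult.commute[of "norm (f _)"] mult_right_mono order_trans[OF _ abs_ge_self])
   qed measurable
   show "((%y. f x * h (y - x)) has_derivative (%v. f x * (\<Sum>j\<in>UNIV. (v $ j) *\<^sub>R pderiv_dir j h (y - x)))) (at y)" for y x
   proof -
    have "((%y. y - x) has_derivative (%v. v)) (at y)" by (auto intro!: derivative_eq_intros)
    from has_derivative_mult_right[OF has_derivative_compose[OF this schwartz_has_derivative[OF h]]]
    show ?thesis .
   qed
   show "norm (f x * (\<Sum>j\<in>UNIV. (v $ j) *\<^sub>R pderiv_dir j h (y - x))) <= norm (f x) * (\<Sum>j\<in>UNIV. C j) * norm v" for y x v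
   proof -
    have "norm (\<Sum>j\<in>UNIV. (v $ j) *\<^sub>R pderiv_dir j h (y - x)) <= (\<Sum>j\<in>UNIV. C j * norm v)"
    proof (rule order_trans[OF norm_sum], rule sum_mono)
    fix j
    have "\<bar>v $ j\<bar> * norm (pderiv_dir j h (y - x)) <= norm v * C j" by (intro mult_mono component_le_norm_cart C) auto
    thus "norm ((v $ j) *\<^sub>R pderiv_dir j h (y - x)) <= C j * norm v" by (simp add: mult.commute)
    qed
    thus ?thesis by (simp add: norm_mult mult.assoc mult_left_mono flip: sum_distrib_right)
   qed
   show "integrable lborel (%y. norm (f y) * (\<Sum>j\<in>UNIV. C j))" by (intro integrable_mult_left integrable_norm f)
   show "0 <= norm (f x) * (\<Sum>j\<in>UNIV. C j)" for x by (intro mult_nonneg_nonneg sum_nonneg C0) auto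
  qed auto
 qed
 fix g assume "g \<in> {%x. LINT y|lborel. f y * h (x - y) | h. h \<in> schwartz}"
 then obtain h where h: "g = (%x. LINT y|lborel. f y * h (x - y))" "h \<in> schwartz" by blast
 show "g differentiable (at x)" for x using der[OF h(2)] unfolding h(1) differentiable_def by blast
 show "pderiv_dir j g \<in> {%x. LINT y|lborel. f y * h (x - y) | h. h \<in> schwartz}" for j
 proof -
  have "pderiv_dir j g = (%x. LINT y|lborel. f y * pderiv_dir j h (x - y))" unfolding h(1) by (rule ext, subst pderiv_dirI[OF der[OF h(2)]])
    (simp add: axis_def if_distrib[of "%c. c *\<^sub>R _"] cong: if_cong)
  thus ?thesis using schwartz_pderiv[OF h(2)] by (intro CollectI exI[of _ "pderiv_dir j h"]) simp
 qed
 show "\<exists>C. \<forall>x. (1 + norm x) ^ k * norm (g x) <= C" for k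
 proof -
  obtain C where C: "\<And>x. (1 + norm x) ^ k * norm (h x) <= C" using schwartz_decay[OF h(2)] by blast
  hence C0: "0 <= C" by (rule order_trans[rotated]) simp
  have "(1 + norm x) ^ k * norm (g x) <= (1 + R) ^ k * C * (LINT y|lborel. norm (f y))" for x
  proof -
   have "norm (f y * h (x - y)) <= (1 + R) ^ k * C / (1 + norm x) ^ k * norm (f y)" for y
   proof (cases "norm y > R")
    case False
    have "1 + norm x <= (1 + norm y) * (1 + norm (x - y))"
    proof -
    have "(1 + norm y) * (1 + norm (x - y)) = 1 + norm y + norm (x - y) + norm y * norm (x - y)" by (simp add: algebra_simps)
    moreover have "0 <= norm y * norm (x - y)" by simp
    moreover have "norm x <= norm y + norm (x - y)" using norm_triangle_ineq[of y "x - y"] by simp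
    ultimately show ?thesis by linarith
    qed
    also have "... <= (1 + R) * (1 + norm (x - y))" using False by (intro mult_right_mono) auto
    finally have "(1 + norm x) ^ k <= (1 + R) ^ k * (1 + norm (x - y)) ^ k" unfolding power_mult_distrib[symmetric] by (intro power_mono) auto
    hence "(1 + norm x) ^ k * norm (h (x - y)) <= (1 + R) ^ k * ((1 + norm (x - y)) ^ k * norm (h (x - y)))" by (metis mult.assoc mult_right_mono norm_ge_zero)
    also have "... <= (1 + R) ^ k * C" using C R by (intro mult_left_mono) auto
    finally have "norm (h (x - y)) <= (1 + R) ^ k * C / (1 + norm x) ^ k" by (intro mult_imp_le_div_pos zero_less_power) (auto simp: mult.commute add_pos_nonneg)
    from mult_right_mono[OF this norm_ge_zero[of "f y"]]
    show ?thesis by (simp add: norm_mult mult.commute[of "norm (f y)"])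
   qed (simp add: f(2))
   hence "norm (g x) <= (LINT y|lborel. (1 + R) ^ k * C / (1 + norm x) ^ k * norm (f y))" unfolding h(1) using f(1) C0 R by (intro order_trans[OF integral_norm_bound] integral_mono_AE' AE_I2 integrable_mult_right integrable_norm) auto
   thus ?thesis by (simp add: pos_le_divide_eq add_pos_nonneg mult_ac)
  qed
  thus ?thesis by blast
 qed
qed (use h in blast)

lemma moll_schwartz:
 fixes f :: "'n::finite cfun"
 assumes f: "integrable lborel f" "\<And>y. norm y > R ==> f y = 0" "0 <= R" and e: "d > 0"
 shows "moll d f \<in> schwartz"
proof -
 have [measurable]: "f \<in> BM" using borel_measurable_integrable[OF f(1)] by simp
 let ?a = "1 / (2 * d\<^sup>2)"
 have "moll d f = (%x. cplx (fconst TYPE('n) * (1 / d) ^ CARD('n)) * (LINT y|lborel. f y * gauss ?a (x - y)))"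
 proof
  fix x
  have "(LINT y|lborel. f y * gauss ?a (x - y)) = \<bar>d\<bar> ^ DIM(real^'n) *\<^sub>R (LINT z|lborel. f (x + d *\<^sub>R z) * gauss ?a (x - (x + d *\<^sub>R z)))" by (rule lborel_integral_affine) (use e in auto)
  also have "... = cplx (d ^ CARD('n)) * (LINT z|lborel. f (x + d *\<^sub>R z) * gauss (1/2) z)" using e by (simp add: gauss_def scaleR_conv_of_real[where 'a = complex] power2_eq_square)
  finally show "moll d f x = cplx (fconst TYPE('n) * (1 / d) ^ CARD('n)) * (LINT y|lborel. f y * gauss ?a (x - y))" using e by (simp add: moll_def power_divide)
 qed
 moreover have "(%x. LINT y|lborel. f y * gauss ?a (x - y)) \<in> schwartz" by (rule schwartz_conv[OF f(1,2) gauss_schwartz f(3)]) (use e in auto)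
 ultimately show ?thesis using schwartz_cmult by auto
qed

text \<open>A single Gaussian dominates all mollifications with d at most 1, which is the kind of
  domination that \<open>density_principle\<close> works with. Where f does not vanish, |x| is at
  most R + |z|, so half of the decay of the kernel in z turns into decay in x.\<close>

lemma moll_envelope:
 fixes f :: "'n::finite cfun"
 assumes f: "f \<in> BM" "\<And>x. norm (f x) <= 1" "\<And>y. norm y > R ==> f y = 0" and e: "0 < d" "d <= 1"
 shows "norm (moll d f x) <= fconst TYPE('n) * exp (R\<^sup>2 / 4) * (LINT z|lborel. norm (gauss (1/4) (z::real^'n))) * exp (- (1/8) * (x \<bullet> x))"
proof -
 note [measurable] = f(1)
 have gi: "integrable lborel (%z::real^'n. norm (gauss (1/4) z))" by (intro integrable_norm schwartz_integrable gauss_schwartz) simp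
 have "norm (LINT z|lborel. f (x + d *\<^sub>R z) * gauss (1/2) z) <=
   (LINT z|lborel. exp (R\<^sup>2 / 4) * exp (- (1/8) * (x \<bullet> x)) * norm (gauss (1/4) (z::real^'n)))"
 proof (intro order_trans[OF integral_norm_bound] integral_mono_AE' AE_I2)
  show "integrable lborel (%z::real^'n. exp (R\<^sup>2 / 4) * exp (- (1/8) * (x \<bullet> x)) * norm (gauss (1/4) z))" by (intro integrable_mult_right gi)
  fix z :: "real^'n"
  show "norm (f (x + d *\<^sub>R z) * gauss (1/2) z) <= exp (R\<^sup>2 / 4) * exp (- (1/8) * (x \<bullet> x)) * norm (gauss (1/4) z)"
  proof (cases "norm (x + d *\<^sub>R z) > R")
   case False
   have "norm x <= norm (x + d *\<^sub>R z) + norm (d *\<^sub>R z)" using norm_triangle_ineq4[of "x + d *\<^sub>R z" "d *\<^sub>R z"] by simp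
   also have "... <= R + norm z" using False e by (intro add_mono) (auto simp: mult_left_le_one_le)
   finally have "(norm x)\<^sup>2 <= (R + norm z)\<^sup>2" by (intro power_mono) auto
   also have "... <= 2 * R\<^sup>2 + 2 * (norm z)^2" using sum_squares_bound[of R "norm z"] by (simp add: power2_sum)
   finally have "- (1/2) * (z \<bullet> z) <= R\<^sup>2 / 4 + (- (1/8) * (x \<bullet> x)) + (- (1/4) * (z \<bullet> z))" by (simp add: power2_norm_eq_inner)
   hence "exp (- (1/2) * (z \<bullet> z)) <= exp (R\<^sup>2 / 4) * exp (- (1/8) * (x \<bullet> x)) * exp (- (1/4) * (z \<bullet> z))" by (simp flip: exp_add)
   moreover have "norm (f (x + d *\<^sub>R z) * gauss (1/2) z) <= 1 * norm (gauss (1/2) z)" unfolding norm_mult by (intro mult_right_mono f) auto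
   ultimately show ?thesis by (simp add: gauss_def del: of_real_exp)
  qed (simp add: f)
 qed (use f in auto)
 hence "fconst TYPE('n) * norm (LINT z|lborel. f (x + d *\<^sub>R z) * gauss (1/2) z) <=
   fconst TYPE('n) * (exp (R\<^sup>2 / 4) * exp (- (1/8) * (x \<bullet> x)) * (LINT z|lborel. norm (gauss (1/4) (z::real^'n))))" by (intro mult_left_mono) auto
 thus ?thesis by (simp add: moll_def norm_mult mult_ac)
qed

section \<open>Weak bounds by duality with Schwartz functions\<close>

definition good :: "('n::finite cfun) => bool" where
 "good g \<longleftrightarrow> g \<in> LM \<and> (\<forall>f\<in>schwartz. integrable lebesgue (%x. g x * f x))"

lemma AE_lebesgue_iff: "(AE x in lebesgue. P x) \<longleftrightarrow> (AE x in lborel. P x)" by (rule AE_completion_iff)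

lemma lebesgue_borel: "f \<in> BM ==> f \<in> LM" by (metis measurable_completion sets_lborel space_lborel measurable_cong_sets)

lemma lebesgue_ex_borel:
 fixes f :: "'a::euclidean_space => complex"
 assumes f: "f \<in> LM"
 shows "\<exists>g\<in>BM. AE x in lborel. f x = g x"
proof -
 have "(%x. Re (f x)) \<in> LM" "(%x. Im (f x)) \<in> LM" using f by measurable
 from this[THEN completion_ex_borel_measurable_real]
 obtain g h where "g \<in> borel_measurable lborel" "AE x in lborel. Re (f x) = g x"
  "h \<in> borel_measurable lborel" "AE x in lborel. Im (f x) = h x" by blast
 thus ?thesis by (intro bexI[of _ "%x. Complex (g x) (h x)"])
    (auto simp: complex_eq_iff Complex_eq elim!: AE_mp)
qed

text \<open>A Gaussian is itself a test function. Hence Gaussian-dominated sequences may be passed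
  to the limit under the integral against any good function.\<close>

lemma weight_integrable_if_good:
 assumes "good g" "a > 0"
 shows "integrable lebesgue (%x. norm (g x) * exp (- a * (x \<bullet> x)))"
proof -
 have "integrable lebesgue (%x. norm (g x * gauss a x))" using assms gauss_schwartz[OF assms(2)] by (intro integrable_norm) (auto simp: good_def)
 thus ?thesis by (simp add: norm_mult gauss_def del: of_real_exp)
qed

text \<open>The limits that Q has to survive are those dominated by a Gaussian, since good functions
  are integrable against Gaussians. Mollification reaches the continuous functions of bounded
  support; almost everywhere approximation by continuous functions reaches the measurable
  ones.\<close>

lemma density_principle:
 fixes Q :: "('n::finite cfun) => bool"
 assumes schw: "\<And>g. g \<in> schwartz ==> (\<And>x. norm (g x) <= 1) ==> Q g"
  and lim: "\<And>f h K a. a > 0 ==> (\<And>k. Q (h k)) ==> (\<And>k. h k \<in> LM) ==>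
   (\<And>k x. norm (h k x) <= K * exp (- a * (x \<bullet> x))) ==> (AE x in lebesgue. (%k. h k x) \<longlonglongrightarrow> f x) ==>
   f \<in> LM ==> Q f"
  and f: "f \<in> LM" "\<And>x. norm (f x) <= 1" "\<And>x. norm x > R ==> f x = 0" and R: "0 <= R"
 shows "Q f"
proof -
 have cont: "Q f" if f: "continuous_on UNIV f" "\<And>x. norm (f x) <= 1" "\<And>x. norm x > R ==> f x = 0" "0 <= R" for f R
 proof -
  have [measurable]: "f \<in> BM" using f(1) by (rule borel_measurable_continuous_onI)
  define e where "e k = 1 / (real k + 1)" for k
  have e: "e k > 0" "e k <= 1" for k by (simp_all add: e_def)
  have e0: "e \<longlonglongrightarrow> 0" unfolding e_def using LIMSEQ_inverse_real_of_nat by (simp add: field_simps)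
  have fi: "integrable lborel f"
  proof (rule Bochner_Integration.integrable_bound)
   show "integrable lborel (%x::real^'n. indicator (cball 0 R) x :: real)" by (intro integrable_real_indicator) (auto simp: emeasure_cball f(4))
   show "AE x in lborel. norm (f x) <= norm (indicator (cball 0 R) x :: real)" using f by (intro AE_I2) (auto simp: indicator_def)
  qed simp
  have ms: "moll (e k) f \<in> schwartz" for k by (rule moll_schwartz[OF fi f(3,4) e(1)])
  show ?thesis
  proof (rule lim[where h = "%k. moll (e k) f" and a = "1/8"
    and K = "fconst TYPE('n) * exp (R\<^sup>2 / 4) * (LINT z|lborel. norm (gauss (1/4) (z::real^'n)))"])
   show "Q (moll (e k) f)" for k by (rule schw[OF ms]) (rule norm_moll_le[OF f(2)])
   show "moll (e k) f \<in> LM" for k by (intro lebesgue_borel schwartz_borel ms)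
   show "AE x in lebesgue. (%k. moll (e k) f x) \<longlonglongrightarrow> f x" by (intro AE_I2 moll_tendsto[OF f(2,1) e0])
   show "f \<in> LM" by (intro lebesgue_borel) simp
   show "norm (moll (e k) f x) <= fconst TYPE('n) * exp (R\<^sup>2 / 4) * (LINT z|lborel. norm (gauss (1/4) (z::real^'n))) * exp (- (1/8) * (x \<bullet> x))" for k x by (rule moll_envelope[OF \<open>f \<in> BM\<close> f(2,3) e])
  qed simp
 qed
 have "f measurable_on UNIV" by (rule lebesgue_measurable_imp_measurable_on) (use f in auto)
 then obtain N g where N: "negligible N" "\<And>n::nat. continuous_on UNIV (g n)" "\<And>x. x \<notin> N ==> (%n. g n x) \<longlonglongrightarrow> f x" unfolding measurable_on_def by auto
 \<comment> \<open>The approximating continuous functions need not be bounded by 1 or have bounded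
   support. Retraction to the unit disc and a cutoff that is 1 on the ball of radius R repair this,
   and both fix f.\<close>
 define ct where "ct x = cplx (max 0 (min 1 (R + 1 - norm x)))" for x :: "real^'n"
 define h where "h k x = ct x * (g k x / cplx (max 1 (norm (g k x))))" for k x
 have ct: "norm (ct x) <= 1" for x by (auto simp: ct_def)
 have T: "norm (z / cplx (max 1 (norm z))) <= 1" for z by (auto simp: norm_divide max_def)
 have h1: "norm (h k x) <= 1" for k x unfolding h_def norm_mult using mult_mono[OF ct[of x] T[of "g k x"]] by simp
 have h0: "h k x = 0" if "norm x > R + 1" for k x using that by (simp add: h_def ct_def)
 have hc: "continuous_on UNIV (h k)" for k unfolding h_def[abs_def] ct_def by (intro continuous_intros N(2)) (auto simp: max_def)
 show ?thesis
 proof (rule lim[where h = h and a = 1 and K = "exp ((R + 1)\<^sup>2)"])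
  show "Q (h k)" for k by (rule cont[where R = "R + 1"]) (use hc h1 h0 R in auto)
  show "h k \<in> LM" for k by (intro lebesgue_borel borel_measurable_continuous_onI hc)
  show "norm (h k x) <= exp ((R + 1)\<^sup>2) * exp (- 1 * (x \<bullet> x))" for k x
  proof (cases "norm x > R + 1")
   case False
   hence "(norm x)\<^sup>2 <= (R + 1)\<^sup>2" by (intro power_mono) auto
   hence "1 <= exp ((R + 1)\<^sup>2 + - 1 * (x \<bullet> x))" by (simp add: power2_norm_eq_inner)
   with h1[of k x] show ?thesis unfolding exp_add by linarith
  qed (simp add: h0)
  show "AE x in lebesgue. (%k. h k x) \<longlonglongrightarrow> f x"
  proof (rule AE_mp[OF AE_not_in])
   show "N \<in> null_sets lebesgue" using N(1) negligible_iff_null_sets by blast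
   show "AE x in lebesgue. x \<notin> N \<longrightarrow> (%k. h k x) \<longlonglongrightarrow> f x"
   proof (intro AE_I2 impI)
    fix x assume "x \<notin> N"
    hence "(%k. g k x / cplx (max 1 (norm (g k x)))) \<longlonglongrightarrow> f x / cplx (max 1 (norm (f x)))" by (intro tendsto_intros N(3)) (auto simp: max_def)
    hence "(%k. h k x) \<longlonglongrightarrow> ct x * (f x / cplx (max 1 (norm (f x))))" unfolding h_def by (rule tendsto_mult_left)
    moreover have "ct x * (f x / cplx (max 1 (norm (f x)))) = f x"
    proof (cases "norm x > R")
    case False
    hence "ct x = 1" by (simp add: ct_def)
    moreover have "max 1 (norm (f x)) = 1" using f(2)[of x] by simp
    ultimately show ?thesis by simp
    qed (simp add: f(3))
    ultimately show "(%k. h k x) \<longlonglongrightarrow> f x" by simp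
   qed
  qed
 qed (use f in auto)
qed

text \<open>Testing G against its conjugate phase on E turns a bound for Schwartz test functions
  into a bound for the integral of |G| over E. The right-hand side is continuous in the integral of
  the modulus of the test function because s is positive.\<close>

lemma weak_bound_by_schwartz_bounded:
 fixes G :: "'n::finite cfun"
 assumes G: "good G" and A: "0 <= A" and s: "0 < s"
  and bnd: "\<And>g. g \<in> schwartz ==> (\<And>x. norm (g x) <= 1) ==>
   norm (LINT x|lebesgue. G x * g x) <= A * (LINT x|lebesgue. norm (g x)) powr s"
  and E: "E \<in> sets lebesgue" "E \<subseteq> cball 0 R" and R: "0 <= R"
 shows "(\<integral>\<^sup>+x\<in>E. enorm (G x) \<partial>lebesgue) <= ennreal (A * measure lebesgue E powr s)"
proof -
 have Gm[measurable]: "G \<in> LM" using G by (simp add: good_def)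
 define f where "f x = indicator E x * (if G x = 0 then 0 else cnj (G x) / cplx (norm (G x)))" for x
 have "(%z. if z = 0 then 0 else cnj z / cplx (norm z)) \<in> BM" by (intro measurable_If borel_measurable_divide borel_measurable_continuous_onI continuous_intros) auto
 from measurable_compose[OF Gm this]
 have fm: "f \<in> LM" unfolding f_def[abs_def] using E(1) by (intro borel_measurable_times borel_measurable_indicator) auto
 have f1: "norm (f x) <= 1" for x by (auto simp: f_def indicator_def norm_divide)
 have "norm (LINT x|lebesgue. G x * f x) <= A * (LINT x|lebesgue. norm (f x)) powr s"
 proof (rule density_principle[where Q = "%f. norm (LINT x|lebesgue. G x * f x) <= A * (LINT x|lebesgue. norm (f x)) powr s" and R = R])
  show "norm (f x) <= 1" for x by (rule f1)
  show "f x = 0" if "norm x > R" for x using E(2) that by (auto simp: f_def indicator_def)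
  fix f h K a
  assume a: "(a::real) > 0" and Q: "\<And>k. norm (LINT x|lebesgue. G x * h k x) <= A * (LINT x|lebesgue. norm (h k x)) powr s"
   and hm[measurable]: "\<And>k::nat. h k \<in> LM" and hb: "\<And>k x. norm (h k x) <= K * exp (- a * (x \<bullet> x))"
   and l: "AE x in lebesgue. (%k. h k x) \<longlonglongrightarrow> f x" and [measurable]: "f \<in> LM"
  have 1: "(%k. LINT x|lebesgue. G x * h k x) \<longlonglongrightarrow> (LINT x|lebesgue. G x * f x)"
  proof (rule integral_dominated_convergence[where w = "%x. K * (norm (G x) * exp (- a * (x \<bullet> x)))"])
   show "integrable lebesgue (%x. K * (norm (G x) * exp (- a * (x \<bullet> x))))" by (intro integrable_mult_right weight_integrable_if_good G a)
   show "AE x in lebesgue. (%k. G x * h k x) \<longlonglongrightarrow> G x * f x" using l by eventually_elim (rule tendsto_mult_left)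
   show "AE x in lebesgue. norm (G x * h k x) <= K * (norm (G x) * exp (- a * (x \<bullet> x)))" for k using mult_left_mono[OF hb norm_ge_zero] by (intro AE_I2) (simp add: norm_mult mult.left_commute[of _ K])
  qed measurable
  have 2: "(%k. LINT x|lebesgue. norm (h k x)) \<longlonglongrightarrow> (LINT x|lebesgue. norm (f x))"
  proof (rule integral_dominated_convergence[where w = "%x. K * exp (- a * (x \<bullet> x))"])
   have "integrable lborel (%x::real^'n. norm (gauss a x))" by (intro integrable_norm schwartz_integrable gauss_schwartz a)
   hence "integrable lebesgue (%x::real^'n. norm (gauss a x))" by (subst integrable_completion) auto
   thus "integrable lebesgue (%x::real^'n. K * exp (- a * (x \<bullet> x)))" by (intro integrable_mult_right) (simp add: gauss_def del: of_real_exp)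
   show "AE x in lebesgue. (%k. norm (h k x)) \<longlonglongrightarrow> norm (f x)" using l by eventually_elim (rule tendsto_norm)
  qed (use hb in \<open>measurable, auto\<close>)
  show "norm (LINT x|lebesgue. G x * f x) <= A * (LINT x|lebesgue. norm (f x)) powr s"
  proof (rule LIMSEQ_le)
   show "(%k. norm (LINT x|lebesgue. G x * h k x)) \<longlonglongrightarrow> norm (LINT x|lebesgue. G x * f x)" by (intro tendsto_norm 1)
   show "(%k. A * (LINT x|lebesgue. norm (h k x)) powr s) \<longlonglongrightarrow> A * (LINT x|lebesgue. norm (f x)) powr s" using s by (intro tendsto_mult_left tendsto_powr' 2 tendsto_const) auto
  qed (use Q in auto)
 qed (use bnd fm R in auto)
 moreover have Gf: "G x * f x = cplx (indicator E x * norm (G x))" for x using complex_norm_square[of "G x"] by (auto simp: f_def indicator_def power2_eq_square nonzero_divide_eq_eq)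
 moreover have "(LINT x|lebesgue. norm (f x)) <= measure lebesgue E"
 proof -
  have fin: "emeasure lebesgue E < \<infinity>"
  proof -
   have "emeasure lebesgue E <= emeasure lebesgue (cball (0::real^'n) R)" by (intro emeasure_mono E) auto
   also have "... < \<infinity>" by (simp add: emeasure_cball R)
   finally show ?thesis .
  qed
  have "(LINT x|lebesgue. norm (f x)) <= (LINT x|lebesgue. indicator E x)" by (intro integral_mono_AE' AE_I2 integrable_real_indicator E fin) (auto simp: f_def indicator_def norm_divide)
  also have "... = measure lebesgue E" using E by simp
  finally show ?thesis .
 qed
 ultimately have le: "norm (LINT x|lebesgue. cplx (indicator E x * norm (G x))) <= A * measure lebesgue E powr s" using A s by (smt (verit, best) mult_left_mono powr_mono2 integral_nonneg_AE AE_I2 norm_ge_zero Bochner_Integration.integral_cong)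
 have int: "integrable lebesgue (%x. indicator E x * norm (G x))"
 proof (rule Bochner_Integration.integrable_bound)
  show "integrable lebesgue (%x. exp (R\<^sup>2) * (norm (G x) * exp (- 1 * (x \<bullet> x))))" by (intro integrable_mult_right weight_integrable_if_good G) simp
  show "AE x in lebesgue. norm (indicator E x * norm (G x)) <= norm (exp (R\<^sup>2) * (norm (G x) * exp (- 1 * (x \<bullet> x))))"
  proof (intro AE_I2)
   fix x :: "real^'n"
   show "norm (indicator E x * norm (G x)) <= norm (exp (R\<^sup>2) * (norm (G x) * exp (- 1 * (x \<bullet> x))))"
   proof (cases "x \<in> E")
    case True
    hence "(norm x)\<^sup>2 <= R\<^sup>2" using E(2) by (intro power_mono) auto
    hence "1 <= exp (R\<^sup>2) * exp (- 1 * (x \<bullet> x))" by (simp add: power2_norm_eq_inner flip: exp_add)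
    hence "1 * norm (G x) <= (exp (R\<^sup>2) * exp (- 1 * (x \<bullet> x))) * norm (G x)" by (rule mult_right_mono) simp
    thus ?thesis using True by (simp add: mult_ac)
   qed simp
  qed
 qed (use E in measurable)
 have "(\<integral>\<^sup>+x\<in>E. enorm (G x) \<partial>lebesgue) = (\<integral>\<^sup>+x. ennreal (indicator E x * norm (G x)) \<partial>lebesgue)" by (intro nn_integral_cong) (auto simp: indicator_def)
 also have "... = ennreal (LINT x|lebesgue. indicator E x * norm (G x))" by (rule nn_integral_eq_integral[OF int]) auto
 also have "... <= ennreal (A * measure lebesgue E powr s)" using le by (intro ennreal_leI) (simp only: integral_complex_of_real norm_of_real abs_le_iff)
 finally show ?thesis .
qed

text \<open>The bound on E \<inter> B does not involve the radius of the ball B, so monotone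
  convergence removes the boundedness of E.\<close>

lemma weak_bound_by_schwartz:
 fixes G :: "'n::finite cfun"
 assumes G: "good G" and A: "0 <= A" and s: "0 < s"
  and bnd: "\<And>g. g \<in> schwartz ==> (\<And>x. norm (g x) <= 1) ==>
   norm (LINT x|lebesgue. G x * g x) <= A * (LINT x|lebesgue. norm (g x)) powr s"
  and E: "E \<in> sets lebesgue" "emeasure lebesgue E < \<infinity>"
 shows "(\<integral>\<^sup>+x\<in>E. enorm (G x) \<partial>lebesgue) <= ennreal (A * measure lebesgue E powr s)"
proof -
 have Gm[measurable]: "G \<in> LM" using G by (simp add: good_def)
 have "(\<integral>\<^sup>+x\<in>E. enorm (G x) \<partial>lebesgue) = (\<integral>\<^sup>+x. (SUP k. enorm (G x) * indicator (E \<inter> cball 0 (real k)) x) \<partial>lebesgue)"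
 proof (intro nn_integral_cong)
  fix x :: "real^'n"
  obtain k :: nat where k: "norm x <= real k" using real_arch_simple by blast
  show "enorm (G x) * indicator E x = (SUP k. enorm (G x) * indicator (E \<inter> cball 0 (real k)) x)"
  proof (rule antisym)
   have "enorm (G x) * indicator E x <= enorm (G x) * indicator (E \<inter> cball 0 (real k)) x" using k by (auto simp: indicator_def)
   also have "... <= (SUP k. enorm (G x) * indicator (E \<inter> cball 0 (real k)) x)" by (rule SUP_upper) simp
   finally show "enorm (G x) * indicator E x <= (SUP k. enorm (G x) * indicator (E \<inter> cball 0 (real k)) x)" .
   show "(SUP k. enorm (G x) * indicator (E \<inter> cball 0 (real k)) x) <= enorm (G x) * indicator E x" by (intro SUP_least) (auto simp: indicator_def)
  qed
 qed
 also have "... = (SUP k. \<integral>\<^sup>+x. enorm (G x) * indicator (E \<inter> cball 0 (real k)) x \<partial>lebesgue)"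
 proof (rule nn_integral_monotone_convergence_SUP)
  show "incseq (%k x. enorm (G x) * indicator (E \<inter> cball 0 (real k)) x)" by (auto simp: incseq_def le_fun_def indicator_def)
  show "(%x. enorm (G x) * indicator (E \<inter> cball 0 (real k)) x) \<in> LM" for k using E(1) by (intro borel_measurable_times_ennreal borel_measurable_indicator) (auto simp: measurable_compose[OF Gm])
 qed
 also have "... <= ennreal (A * measure lebesgue E powr s)"
 proof (rule SUP_least)
  fix k
  have "(\<integral>\<^sup>+x. enorm (G x) * indicator (E \<inter> cball 0 (real k)) x \<partial>lebesgue) <= ennreal (A * measure lebesgue (E \<inter> cball 0 (real k)) powr s)" by (rule weak_bound_by_schwartz_bounded[OF G A s bnd, where R = "real k"]) (use E(1) in auto)
  also have "... <= ennreal (A * measure lebesgue E powr s)" using E A s by (intro ennreal_leI mult_left_mono powr_mono2 measure_mono_fmeasurable) (auto simp: fmeasurable_def)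
  finally show "(\<integral>\<^sup>+x. enorm (G x) * indicator (E \<inter> cball 0 (real k)) x \<partial>lebesgue) <= ennreal (A * measure lebesgue E powr s)" .
 qed
 finally show ?thesis .
qed

text \<open>This is the weak bound with A = 0 on every ball. It makes the function that represents a
  distribution unique up to null sets.\<close>

lemma good_zero_if_orthogonal:
 fixes G :: "'n::finite cfun"
 assumes G: "good G" and z: "\<And>g. g \<in> schwartz ==> (LINT x|lebesgue. G x * g x) = 0"
 shows "AE x in lebesgue. G x = 0"
proof -
 have Gm[measurable]: "G \<in> LM" using G by (simp add: good_def)
 have "AE x in lebesgue. x \<in> cball 0 (real k) \<longrightarrow> G x = 0" for k
 proof -
  have "(\<integral>\<^sup>+x\<in>cball 0 (real k). enorm (G x) \<partial>lebesgue) <= ennreal (0 * measure lebesgue (cball (0::real^'n) (real k)) powr 1)" by (rule weak_bound_by_schwartz[OF G]) (auto simp: z emeasure_cball)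
  hence "(\<integral>\<^sup>+x\<in>cball 0 (real k). enorm (G x) \<partial>lebesgue) = 0" by simp
  hence "AE x in lebesgue. enorm (G x) * indicator (cball 0 (real k)) x = 0" by (subst (asm) nn_integral_0_iff_AE) (auto intro!: borel_measurable_times_ennreal borel_measurable_indicator measurable_compose[OF Gm])
  thus ?thesis by eventually_elim (auto simp: indicator_def)
 qed
 hence "AE x in lebesgue. \<forall>k. x \<in> cball 0 (real k) \<longrightarrow> G x = 0" unfolding AE_all_countable by blast
 thus ?thesis
 proof eventually_elim
  case (elim x)
  obtain k :: nat where "norm x <= real k" using real_arch_simple by blast
  thus ?case using elim by auto
 qed
qed

section \<open>Distributions given by their Fourier transform\<close>

text \<open>The distribution with Fourier transform g. Multipliers, derivatives, products and sums
  of such distributions are again of this form, so computations with distributions become pointwise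
  computations with g.\<close>

definition Finv :: "('n::finite cfun) => 'n dist" where
 "Finv g = dist_inv_fourier (fun_dist g)"

lemma Finv_apply: "f \<in> schwartz ==> Finv g f = (LINT x|lebesgue. g x * inv_fourier f x)" by (simp add: Finv_def dist_inv_fourier_def fun_dist_def schwartz_inv_fourier)

lemma Finv_outside: "f \<notin> schwartz ==> Finv g f = 0" by (simp add: Finv_def dist_inv_fourier_def)

lemma is_fun_iff: "is_fun g u \<longleftrightarrow> good g \<and> u = fun_dist g" by (auto simp: is_fun_def good_def)

lemma dist_fourier_Finv: "dist_fourier (Finv g) = fun_dist g" by (rule ext) (simp add: dist_fourier_def fun_dist_def Finv_apply schwartz_fourier inv_fourier_fourier)

lemma is_fun_Finv: "good g ==> is_fun g (dist_fourier (Finv g))" by (simp add: is_fun_iff dist_fourier_Finv)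

lemma goodI_integrable:
 fixes g :: "'n::finite cfun"
 assumes "integrable lebesgue g"
 shows "good g" unfolding good_def
proof (intro conjI ballI)
 show [measurable]: "g \<in> LM" using assms by (rule borel_measurable_integrable)
 fix f :: "'n cfun" assume f: "f \<in> schwartz"
 have [measurable]: "f \<in> LM" by (intro lebesgue_borel schwartz_borel f)
 obtain B where B: "\<And>x. norm (f x) <= B" using schwartz_bounded[OF f] by blast
 hence B0: "0 <= B" using norm_ge_zero order_trans by blast
 show "integrable lebesgue (%x. g x * f x)" by (rule Bochner_Integration.integrable_bound[OF integrable_mult_right[OF assms, of "cplx B"]])
    (use mult_right_mono[OF B norm_ge_zero] B0 in \<open>auto intro!: AE_I2 simp: norm_mult mult.commute[of "norm (g _)"]\<close>)
qed

lemma good_cong_AE: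
 assumes "good g" "AE x in lebesgue. g x = h x"
 shows "good h"
proof -
 have g: "g \<in> LM" using assms by (simp add: good_def)
 hence h: "h \<in> LM" using assms(2) by (rule borel_measurable_AE)
 show ?thesis unfolding good_def
 proof (intro conjI ballI h)
  fix f :: "real^'a => complex" assume f: "f \<in> schwartz"
  hence fm: "f \<in> LM" by (intro lebesgue_borel schwartz_borel)
  have "integrable lebesgue (%x. g x * f x)" using assms(1) f by (simp add: good_def)
  moreover have "integrable lebesgue (%x. g x * f x) \<longleftrightarrow> integrable lebesgue (%x. h x * f x)" by (rule integrable_cong_AE) (use g h fm assms(2) in \<open>auto elim: AE_mp\<close>)
  ultimately show "integrable lebesgue (%x. h x * f x)" by simp
 qed
qed

lemma good_mult_bounded:
 assumes "good g" "m \<in> LM" "\<And>x. norm (m x) <= B"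
 shows "good (%x. m x * g x)" unfolding good_def
proof (intro conjI ballI)
 have g[measurable]: "g \<in> LM" using assms by (simp add: good_def)
 note assms(2)[measurable]
 show "(%x. m x * g x) \<in> LM" by measurable
 fix f :: "real^'a => complex" assume f: "f \<in> schwartz"
 have [measurable]: "f \<in> LM" by (intro lebesgue_borel schwartz_borel f)
 have i: "integrable lebesgue (%x. g x * f x)" using assms(1) f by (simp add: good_def)
 have B0: "0 <= B" using assms(3) norm_ge_zero order_trans by blast
 show "integrable lebesgue (%x. m x * g x * f x)"
 proof (rule Bochner_Integration.integrable_bound[OF integrable_mult_right[OF i, of "cplx B"]])
  show "AE x in lebesgue. norm (m x * g x * f x) <= norm (cplx B * (g x * f x))"
  proof (rule AE_I2)
   fix x
   show "norm (m x * g x * f x) <= norm (cplx B * (g x * f x))" using mult_right_mono[OF assms(3)[of x], of "norm (g x) * norm (f x)"] B0 by (simp add: norm_mult mult.assoc)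
  qed
 qed measurable
qed

lemma good_coord: 
 fixes g :: "'n::finite cfun"
 assumes "good g" 
 shows "good (%x. cplx (x $ j) * g x)" unfolding good_def
proof (intro conjI ballI)
 have g[measurable]: "g \<in> LM" using assms by (simp add: good_def)
 have [measurable]: "(%x::real^'n. cplx (x $ j)) \<in> LM" by (intro lebesgue_borel borel_measurable_continuous_onI continuous_intros)
 show "(%x. cplx (x $ j) * g x) \<in> LM" by measurable
 fix f :: "'n cfun" assume f: "f \<in> schwartz"
 hence "integrable lebesgue (%x. g x * (cplx (x $ j) * f x))" using assms schwartz_coord_mult[OF f] by (simp add: good_def)
 thus "integrable lebesgue (%x. cplx (x $ j) * g x * f x)" by (simp add: mult_ac)
qed

lemma good_add:
 assumes "good g" "good h"
 shows "good (%x. g x + h x)" using assms unfolding good_def by (auto simp: distrib_right intro!: Bochner_Integration.integrable_add)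

lemma good_cmult: "good g ==> good (%x. c * g x)" unfolding good_def by (auto simp: mult.assoc intro!: integrable_mult_right)

lemma good_diff: "good g ==> good h ==> good (%x. g x - h x)" using good_add[of g "%x. - 1 * h x"] good_cmult[of h "-1"] by simp

lemma good_zero: "good (%x. 0)" by (simp add: good_def)

lemma good_sum: "(\<And>i. i \<in> I ==> good (g i)) ==> good (%x. \<Sum>i\<in>I. g i x)" by (induction I rule: infinite_finite_induct) (auto intro: good_add good_zero)

lemma good_integrable: "good g ==> f \<in> schwartz ==> integrable lebesgue (%x. g x * f x)" by (simp add: good_def)

lemma is_fun_unique:
 assumes "is_fun g u" "is_fun h u"
 shows "AE x in lebesgue. g x = h x"
proof -
 have g: "good g" "good h" using assms by (simp_all add: is_fun_iff)
 have "AE x in lebesgue. g x - h x = 0"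
 proof (rule good_zero_if_orthogonal[OF good_diff[OF g]])
  fix f :: "real^'a => complex" assume f: "f \<in> schwartz"
  have "fun_dist g f = fun_dist h f" using assms by (simp add: is_fun_iff)
  hence "(LINT x|lebesgue. g x * f x) = (LINT x|lebesgue. h x * f x)" using f by (simp add: fun_dist_def)
  thus "(LINT x|lebesgue. (g x - h x) * f x) = 0" using good_integrable[OF g(1) f] good_integrable[OF g(2) f] by (simp add: left_diff_distrib)
 qed
 thus ?thesis by eventually_elim simp
qed

lemma ft_is_fun: "is_fun g (dist_fourier u) ==> is_fun (ft u) (dist_fourier u)" using someI[of "%g. is_fun g (dist_fourier u)" g] unfolding ft_def by blast

lemma ft_AE: "is_fun g (dist_fourier u) ==> AE x in lebesgue. ft u x = g x" using ft_is_fun is_fun_unique by blast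

lemma ft_Finv: "good g ==> AE x in lebesgue. ft (Finv g) x = g x" by (intro ft_AE is_fun_Finv)

lemma good_ft_Finv: 
 assumes "good g" 
 shows "good (ft (Finv g))" using ft_is_fun[OF is_fun_Finv[OF assms]] unfolding is_fun_iff by blast

lemma Finv_cong_AE:
 assumes "g \<in> LM" "AE x in lebesgue. g x = h x"
 shows "Finv g = Finv h"
proof
 fix f
 have h: "h \<in> LM" using assms by (rule borel_measurable_AE)
 show "Finv g f = Finv h f"
 proof (cases "f \<in> schwartz")
  case True
  hence "inv_fourier f \<in> LM" by (intro lebesgue_borel schwartz_borel schwartz_inv_fourier)
  thus ?thesis unfolding Finv_apply[OF True] using assms h by (intro integral_cong_AE) (auto elim: AE_mp)
 qed (simp add: Finv_outside)
qed

lemma Finv_ft: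
 assumes "has_fourier_fun u"
 shows "Finv (ft u) = u" "good (ft u)"
proof -
 obtain g where "is_fun g (dist_fourier u)" using assms by (auto simp: has_fourier_fun_def)
 from ft_is_fun[OF this] have 1: "good (ft u)" "dist_fourier u = fun_dist (ft u)" by (simp_all add: is_fun_iff)
 show "good (ft u)" by fact
 show "Finv (ft u) = u"
 proof
  fix f
  show "Finv (ft u) f = u f"
  proof (cases "f \<in> schwartz")
   case True
   have "Finv (ft u) f = fun_dist (ft u) (inv_fourier f)" by (simp add: Finv_apply[OF True] fun_dist_def schwartz_inv_fourier[OF True])
   also have "... = dist_fourier u (inv_fourier f)" by (simp add: 1)
   also have "... = u f" by (simp add: dist_fourier_def schwartz_inv_fourier[OF True] fourier_inv_fourier[OF True])
   finally show ?thesis .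
  next
   case False
   thus ?thesis using assms by (simp add: Finv_outside has_fourier_fun_def tempered_def)
  qed
 qed
qed

lemma multiplier_eq: "multiplier m u = Finv (%x. m x * ft u x)" by (simp add: multiplier_def Finv_def)

text \<open>\<open>ft\<close> returns an arbitrary representative, so every operator defined through
  it is rewritten in terms of a known function that agrees with it almost everywhere.\<close>

lemma multiplier_AE:
 assumes "AE x in lebesgue. ft u x = g x" "g \<in> LM" "m \<in> LM"
 shows "multiplier m u = Finv (%z. m z * g z)" unfolding multiplier_eq by (rule Finv_cong_AE[symmetric]) (use assms in \<open>auto elim: AE_mp\<close>)

lemma multiplier_Finv:
 assumes "good g" "m \<in> LM"
 shows "multiplier m (Finv g) = Finv (%x. m x * g x)" using assms by (intro multiplier_AE ft_Finv) (auto simp: good_def)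

lemma Finv_sum:
 assumes "finite I" "\<And>i. i \<in> I ==> good (g i)"
 shows "(%f. \<Sum>i\<in>I. Finv (g i) f) = Finv (%x. \<Sum>i\<in>I. g i x)"
proof
 fix f
 show "(\<Sum>i\<in>I. Finv (g i) f) = Finv (%x. \<Sum>i\<in>I. g i x) f"
 proof (cases "f \<in> schwartz")
  case True
  thus ?thesis using assms by (simp add: Finv_apply sum_distrib_right good_integrable schwartz_inv_fourier)
 qed (simp add: Finv_outside)
qed

lemma dist_pderiv_Finv:
 "dist_pderiv j (Finv g) = Finv (%z. \<i> * (cplx (z $ j) * g z))"
proof
 fix f
 show "dist_pderiv j (Finv g) f = Finv (%z. \<i> * (cplx (z $ j) * g z)) f"
 proof (cases "f \<in> schwartz")
  case True
  have "(LINT x|lebesgue. g x * inv_fourier (pderiv_dir j f) x) = (LINT x|lebesgue. - (\<i> * (cplx (x $ j) * g x) * inv_fourier f x))" by (intro Bochner_Integration.integral_cong) (simp_all add: inv_fourier_pderiv[OF True] mult_ac)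
  thus ?thesis by (simp add: dist_pderiv_def True Finv_apply schwartz_pderiv)
 qed (simp add: Finv_outside dist_pderiv_def)
qed

lemma lebesgue_reflect_AE:
 fixes f :: "'a::euclidean_space => complex"
 assumes "AE x in lebesgue. f x = g x" "g \<in> BM"
 shows "AE x in lebesgue. f (a - x) = g (a - x)" "(%x. f (a - x)) \<in> LM"
proof -
 show 1: "AE x in lebesgue. f (a - x) = g (a - x)" using assms(1) unfolding AE_lebesgue_iff by (rule AE_lborel_reflect)
 have "(%x. g (a - x)) \<in> LM" by (intro lebesgue_borel measurable_compose[OF _ assms(2)]) simp
 thus "(%x. f (a - x)) \<in> LM" by (rule borel_measurable_AE) (use 1 in \<open>auto elim: AE_mp\<close>)
qed

definition cconv :: "('n::finite cfun) => ('n cfun) => 'n cfun" where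
 "cconv g h x = (LINT y|lborel. g (x - y) * h y)"

text \<open>Changing both factors on null sets leaves the convolution integral unchanged at every
  point z, since reflections preserve null sets. Borel representatives are used because composition
  with z - y keeps them measurable.\<close>

lemma dist_prod_AE:
 fixes u v :: "'n::finite dist"
 assumes "AE x in lebesgue. ft u x = g x" "AE x in lebesgue. ft v x = h x"
  and [measurable]: "g \<in> BM" "h \<in> BM"
 shows "dist_prod u v = Finv (%z. cplx (fconst TYPE('n)) * cconv g h z)"
proof -
 have "(LINT y|lebesgue. ft u (z - y) * ft v y) = cconv g h z" for z
 proof -
  have "AE x in lebesgue. h x = ft v x" using assms(2) by eventually_elim simp
  hence v: "ft v \<in> LM" by (rule borel_measurable_AE[rotated]) (intro lebesgue_borel, simp)
  have m: "(%y. g (z - y) * h y) \<in> BM" by measurable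
  have "(LINT y|lebesgue. ft u (z - y) * ft v y) = (LINT y|lebesgue. g (z - y) * h y)"
  proof (rule integral_cong_AE[OF borel_measurable_times[OF lebesgue_reflect_AE(2)[OF assms(1,3)] v] lebesgue_borel[OF m]])
   show "AE y in lebesgue. ft u (z - y) * ft v y = g (z - y) * h y" using lebesgue_reflect_AE(1)[OF assms(1,3), of z] assms(2) by eventually_elim simp
  qed
  thus ?thesis unfolding cconv_def using m by (simp add: integral_completion)
 qed
 thus ?thesis unfolding dist_prod_def Finv_def by simp
qed

section \<open>The nonlinear term on the Fourier side\<close>

lemma leray_symbol_le: "norm (leray_symbol j k x) <= 2"
proof -
 have "\<bar>x $ j * x $ k / (norm x)^2\<bar> <= 1"
 proof (cases "x = 0")
  case False
  have "\<bar>x $ j\<bar> * \<bar>x $ k\<bar> <= norm x * norm x" by (intro mult_mono component_le_norm_cart) auto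
  thus ?thesis using False by (simp add: abs_mult power2_eq_square divide_le_eq)
 qed simp
 moreover have "\<bar>(if b then 1 else 0) - q\<bar> <= 2" if "\<bar>q\<bar> <= 1" for b and q :: real using that by (cases b) auto
 ultimately have "\<bar>(if j = k then 1 else 0) - x $ j * x $ k / (norm x)^2\<bar> <= 2" by blast
 thus ?thesis unfolding leray_symbol_def norm_of_real .
qed

lemma leray_symbol_borel[measurable]: "leray_symbol j k \<in> BM"
proof -
 have [measurable]: "(%x::real^'a. x $ i) \<in> BM" for i by (intro borel_measurable_continuous_onI continuous_intros)
 show ?thesis unfolding leray_symbol_def[abs_def] by measurable
qed

text \<open>The Fourier transform of the Leray projection of the divergence of u tensor u, where u
  has Fourier transform g.\<close>

definition nonlin :: "('n => 'n::finite cfun) => 'n => 'n cfun" where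
 "nonlin g i x = (\<Sum>k\<in>UNIV. leray_symbol i k x * (\<Sum>j\<in>UNIV. \<i> * (cplx (x $ j) *
   (cplx (fconst TYPE('n)) * cconv (g k) (g j) x))))"

lemma heat_symbol_borel: "(%x::real^'n::finite. cplx (exp (- t * (norm x)^2))) \<in> BM" by (intro borel_measurable_continuous_onI continuous_intros)

lemma good_nonlin:
 assumes "\<And>k j. good (cconv (g k) (g j))"
 shows "good (nonlin g i)" unfolding nonlin_def[abs_def] by (intro good_sum good_mult_bounded[OF _ _ leray_symbol_le] good_cmult good_coord assms lebesgue_borel leray_symbol_borel)

lemma heat_nonlin:
 fixes u :: "'n => 'n::finite dist"
 assumes u: "\<And>i. AE x in lebesgue. ft (u i) x = g i x" and g: "\<And>i. g i \<in> BM"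
  and gc: "\<And>k j. good (cconv (g k) (g j))"
 shows "heat t (leray (tensor_div (tensor_prod u u)) i) = Finv (%z. cplx (exp (- t * (norm z)^2)) * nonlin g i z)"
proof -
 let ?F = "%k z. \<Sum>j\<in>UNIV. \<i> * (cplx (z $ j) * (cplx (fconst TYPE('n)) * cconv (g k) (g j) z))"
 have gF: "good (%z. \<i> * (cplx (z $ j) * (cplx (fconst TYPE('n)) * cconv (g k) (g j) z)))" for k j by (intro good_cmult good_coord gc)
 have 1: "tensor_div (tensor_prod u u) k = Finv (?F k)" for k unfolding tensor_div_def divergence_def tensor_prod_def dist_prod_AE[OF u u g g] dist_pderiv_Finv by (rule Finv_sum[OF _ gF]) simp
 have gL: "good (%z. leray_symbol i k z * ?F k z)" for k by (intro good_mult_bounded[OF _ _ leray_symbol_le] good_sum gF lebesgue_borel leray_symbol_borel)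
 have 2: "multiplier (leray_symbol i k) (Finv (?F k)) = Finv (%z. leray_symbol i k z * ?F k z)" for k by (intro multiplier_Finv good_sum gF lebesgue_borel leray_symbol_borel)
 have "leray (tensor_div (tensor_prod u u)) i = Finv (nonlin g i)" unfolding leray_def 1 2 nonlin_def[abs_def] by (rule Finv_sum[OF _ gL]) simp
 thus ?thesis unfolding heat_def by (simp only:) (intro multiplier_Finv good_nonlin gc lebesgue_borel heat_symbol_borel)
qed

lemma heat_AE:
 fixes u :: "'n::finite dist"
 assumes "AE x in lebesgue. ft u x = g x" "g \<in> LM"
 shows "heat t u = Finv (%z. cplx (exp (- t * (norm z)^2)) * g z)" unfolding heat_def by (intro multiplier_AE assms lebesgue_borel heat_symbol_borel)

section \<open>Inverse transforms of integrable functions\<close>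

lemma schwartz_le_seminorm:
 fixes f :: "'n::finite cfun"
 assumes f: "f \<in> schwartz"
 shows "(1 + norm x) ^ N * norm (f x) <= schwartz_seminorm N f"
proof -
 have fin: "finite {js::'n list. length js <= N}" using finite_lists_length_le[of "UNIV::'n set" N] by simp
 have "\<forall>js::'n list. \<exists>B. \<forall>x. (1 + norm x) ^ N * norm (iter_pderiv js f x) <= B"
 proof
  fix js :: "'n list"
  have "bounded (range (%x. (1 + norm x) ^ N * norm (iter_pderiv js f x)))" using f unfolding schwartz_def by blast
  then obtain B where "\<forall>x. \<bar>(1 + norm x) ^ N * norm (iter_pderiv js f x)\<bar> <= B" unfolding bounded_iff by auto
  thus "\<exists>B. \<forall>x. (1 + norm x) ^ N * norm (iter_pderiv js f x) <= B" by (meson abs_le_D1)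
 qed
 then obtain B where B: "\<And>js x. (1 + norm x) ^ N * norm (iter_pderiv js f x) <= B js" by metis
 \<comment> \<open>The seminorm is a supremum of reals, hence meaningful only for a bounded family:
   there are finitely many lists of length at most N, and each derivative is bounded
   separately.\<close>
 have "bdd_above ((%(js, x). (1 + norm x) ^ N * norm (iter_pderiv js f x)) ` ({js::'n list. length js <= N} \<times> UNIV))"
 proof (rule bdd_aboveI2)
  fix p assume p: "p \<in> {js::'n list. length js <= N} \<times> (UNIV::(real^'n) set)"
  obtain js x where [simp]: "p = (js, x)" by (cases p)
  have "B js <= (\<Sum>js\<in>{js. length js <= N}. \<bar>B js\<bar>)" by (rule order_trans[OF abs_ge_self], rule member_le_sum) (use p fin in auto)
  thus "(case p of (js, x) => (1 + norm x) ^ N * norm (iter_pderiv js f x)) <= (\<Sum>js\<in>{js. length js <= N}. \<bar>B js\<bar>)" using B[of x js] by simp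
 qed
 from cSUP_upper[OF _ this, of "([], x)"] show ?thesis unfolding schwartz_seminorm_def by (simp add: iter_pderiv_def)
qed

lemma inv_fourier_lborel:
 fixes f :: "'n::finite cfun"
 assumes "f \<in> BM"
 shows "inv_fourier f x = cplx (fconst TYPE('n)) * (LINT z|lborel. wave z (- x) * f z)" unfolding inv_fourier_def by (rule fourier_lborel[OF assms])

text \<open>The pairing is bounded by the integral of |g| and the supremum of the inverse transform
  of f, that supremum by the integral of |f|, and this by the seminorm of order n + 2, whose inverse
  weight is integrable.\<close>

lemma tempered_Finv:
 fixes g :: "'n::finite cfun"
 assumes gi: "integrable lborel g"
 shows "tempered (Finv g)" unfolding tempered_def
proof (intro conjI allI impI ballI)
 have gm: "g \<in> BM" using borel_measurable_integrable[OF gi] by simp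
 have "integrable lebesgue g" using gi gm by (subst integrable_completion) simp_all
 hence gg: "good g" by (rule goodI_integrable)
 note int = good_integrable[OF gg schwartz_inv_fourier]
 show "f \<notin> schwartz ==> Finv g f = 0" for f by (rule Finv_outside)
 show "Finv g (%x. f x + h x) = Finv g f + Finv g h" if f: "f \<in> schwartz" "h \<in> schwartz" for f h
 proof -
  have "inv_fourier (%x. f x + h x) x = inv_fourier f x + inv_fourier h x" for x
  proof -
   have "(LINT z|lborel. wave z (- x) * (f z + h z)) = (LINT z|lborel. wave z (- x) * f z) + (LINT z|lborel. wave z (- x) * h z)" unfolding distrib_left by (rule Bochner_Integration.integral_add[OF integrable_wave_mult[OF schwartz_integrable[OF f(1)]] integrable_wave_mult[OF schwartz_integrable[OF f(2)]]])
   thus ?thesis by (simp only: inv_fourier_lborel[OF schwartz_borel[OF schwartz_add[OF f]]] inv_fourier_lborel[OF schwartz_borel[OF f(1)]]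
    inv_fourier_lborel[OF schwartz_borel[OF f(2)]] distrib_left)
  qed
  thus ?thesis using int[OF f(1)] int[OF f(2)] by (simp add: Finv_apply f schwartz_add distrib_left)
 qed
 show "Finv g (%x. c * f x) = c * Finv g f" if f: "f \<in> schwartz" for c f
 proof -
  have "inv_fourier (%x. c * f x) x = c * inv_fourier f x" for x by (simp add: inv_fourier_lborel schwartz_borel f schwartz_cmult mult.left_commute[of _ c])
  thus ?thesis using int[OF f(1)] by (simp add: Finv_apply f schwartz_cmult mult.left_commute[of _ c])
 qed
 define I where "I = (LINT x|lborel. 1 / (1 + norm (x::real^'n)) ^ (CARD('n) + 2))"
 show "\<exists>N C. \<forall>f\<in>schwartz. norm (Finv g f) <= C * schwartz_seminorm N f"
 proof (intro exI ballI)
  fix f :: "'n cfun" assume f: "f \<in> schwartz"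
  let ?S = "schwartz_seminorm (CARD('n) + 2) f"
  have "(LINT x|lborel. norm (f x)) <= (LINT x|lborel. ?S * (1 / (1 + norm (x::real^'n)) ^ (CARD('n) + 2)))"
  proof (rule integral_mono[OF integrable_norm[OF schwartz_integrable[OF f]] integrable_mult_right[OF integrable_inverse_power_norm]])
   fix x :: "real^'n"
   have "0 < (1 + norm x) ^ (CARD('n) + 2)" by (intro zero_less_power) (simp add: add_pos_nonneg)
   thus "norm (f x) <= ?S * (1 / (1 + norm x) ^ (CARD('n) + 2))" using schwartz_le_seminorm[OF f, of x "CARD('n) + 2"] by (simp add: pos_le_divide_eq mult.commute del: power_Suc power_add)
  qed
  also have "... = ?S * I" unfolding I_def by (rule integral_mult_right_zero)
  finally have 1: "(LINT x|lborel. norm (f x)) <= ?S * I" .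
  have 2: "norm (inv_fourier f x) <= fconst TYPE('n) * (?S * I)" for x unfolding inv_fourier_def by (rule order_trans[OF norm_fourier_le[OF schwartz_integrable[OF f]] mult_left_mono[OF 1]]) simp
  have [measurable]: "inv_fourier f \<in> BM" by (intro schwartz_borel schwartz_inv_fourier f)
  have "norm (Finv g f) = norm (LINT x|lborel. g x * inv_fourier f x)" using gm by (simp add: Finv_apply[OF f] integral_completion)
  also have "... <= (LINT x|lborel. norm (g x * inv_fourier f x))" by (rule integral_norm_bound)
  also have "... <= (LINT x|lborel. norm (g x) * (fconst TYPE('n) * (?S * I)))" using 2 order_trans[OF norm_ge_zero 2] gi by (intro integral_mono_AE' AE_I2 integrable_mult_left integrable_norm) (auto simp: norm_mult intro!: mult_left_mono)
  also have "... = (LINT x|lborel. norm (g x)) * (fconst TYPE('n) * (?S * I))" by simp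
  finally show "norm (Finv g f) <= ((LINT x|lborel. norm (g x)) * fconst TYPE('n) * I) * schwartz_seminorm (CARD('n) + 2) f" by (simp only: mult_ac)
 qed
qed

lemma has_fourier_fun_Finv:
 fixes g :: "'n::finite cfun"
 assumes gi: "integrable lborel g"
 shows "good g" "has_fourier_fun (Finv g)"
proof -
 have gm: "g \<in> BM" using borel_measurable_integrable[OF gi] by simp
 have "integrable lebesgue g" using gi gm by (subst integrable_completion) simp_all
 thus gg: "good g" by (rule goodI_integrable)
 show "has_fourier_fun (Finv g)" unfolding has_fourier_fun_def using tempered_Finv[OF gi] is_fun_Finv[OF gg] by blast
qed

lemma fourier_borel[measurable]:
 fixes g :: "'n::finite cfun"
 assumes [measurable]: "g \<in> BM"
 shows "fourier g \<in> BM"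
proof -
 have "(%x. LINT y|lborel. wave y x * g y) \<in> BM"
 proof (rule lborel.borel_measurable_lebesgue_integral)
  have 1: "(%p::(real^'n)\<times>(real^'n). wave (snd p) (fst p)) \<in> borel_measurable (borel \<Otimes>\<^sub>M borel)" unfolding borel_prod by (intro borel_measurable_continuous_onI continuous_intros)
  have "(%p::(real^'n)\<times>(real^'n). wave (snd p) (fst p) * g (snd p)) \<in> borel_measurable (borel \<Otimes>\<^sub>M borel)" by (intro borel_measurable_times 1 measurable_compose[OF measurable_snd assms])
  thus "(%(x, y). wave y x * g y) \<in> borel_measurable (borel \<Otimes>\<^sub>M lborel)" by (subst measurable_cong_sets[OF sets_pair_measure_cong[OF refl sets_lborel] refl]) (simp add: split_beta')
 qed
 moreover have "fourier g = (%x. cplx (fconst TYPE('n)) * (LINT y|lborel. wave y x * g y))" by (rule ext) (rule fourier_lborel[OF assms])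
 ultimately show ?thesis by simp
qed

text \<open>The space K asks for functions of x, not of frequency; this supplies them. The inverse
  transform of an integrable function is bounded, hence good.\<close>

lemma is_fun_inv_fourier:
 fixes g :: "'n::finite cfun"
 assumes gi: "integrable lborel g"
 shows "is_fun (inv_fourier g) (Finv g)"
proof -
 have gm[measurable]: "g \<in> BM" using borel_measurable_integrable[OF gi] by simp
 have im[measurable]: "inv_fourier g \<in> BM" unfolding inv_fourier_eq by measurable
 have b: "norm (inv_fourier g x) <= fconst TYPE('n) * (LINT x|lborel. norm (g x))" for x unfolding inv_fourier_def by (rule norm_fourier_le[OF gi])
 have one: "good (%x::real^'n. 1)" unfolding good_def
 proof (intro conjI ballI)
  fix f :: "'n cfun" assume f: "f \<in> schwartz"
  show "integrable lebesgue (%x. 1 * f x)" using schwartz_integrable[OF f] schwartz_borel[OF f] by (subst integrable_completion) simp_all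
 qed simp
 have good: "good (inv_fourier g)" using good_mult_bounded[OF one lebesgue_borel[OF im] b] by simp
 moreover have "Finv g = fun_dist (inv_fourier g)"
 proof
  fix f
  show "Finv g f = fun_dist (inv_fourier g) f"
  proof (cases "f \<in> schwartz")
   case True
   note [measurable] = schwartz_borel[OF True] schwartz_borel[OF schwartz_inv_fourier[OF True]]
   show ?thesis using fourier_multiplication(2)[OF gi schwartz_integrable[OF True]] by (simp add: Finv_apply[OF True] fun_dist_def True integral_completion)
  qed (simp add: Finv_outside fun_dist_def)
 qed
 ultimately show ?thesis by (simp add: is_fun_iff)
qed

section \<open>Weak bounds and Young's inequality\<close>

text \<open>Bounding integrals over sets instead of the distribution function makes the bound
  additive, stable under monotone limits and compatible with Tonelli's theorem, all without loss in
  the constant. Sets of infinite measure are excluded because \<open>measure\<close> returns 0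
  there.\<close>

definition wbd :: "real => real => ('a::euclidean_space => ennreal) => bool" where
 "wbd s A F \<longleftrightarrow> (\<forall>E\<in>sets borel. emeasure lborel E < \<infinity> \<longrightarrow>
   (nns E F) <= ennreal (A * measure lborel E powr s))"

lemma wbdD: "wbd s A F ==> E \<in> sets borel ==> emeasure lborel E < \<infinity> ==>
  (nns E F) <= ennreal (A * measure lborel E powr s)" by (auto simp: wbd_def)

lemma wbd_mono_AE:
 assumes "wbd s A F" "AE x in lborel. G x <= F x" "A <= B"
 shows "wbd s B G" unfolding wbd_def
proof (intro ballI impI)
 fix E :: "'a set" assume E: "E \<in> sets borel" "emeasure lborel E < \<infinity>"
 have "nns E G <= nns E F"
 proof (rule nn_integral_mono_AE)
  show "AE x in lborel. G x * indicator E x <= F x * indicator E x" using assms(2) by eventually_elim (rule mult_right_mono, auto)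
 qed
 also have "... <= ennreal (A * measure lborel E powr s)" by (rule wbdD[OF assms(1) E])
 also have "... <= ennreal (B * measure lborel E powr s)" by (intro ennreal_leI mult_right_mono assms(3)) auto
 finally show "nns E G <= ennreal (B * measure lborel E powr s)" .
qed

lemma wbd_mono: "wbd s A F ==> (\<And>x. G x <= F x) ==> A <= B ==> wbd s B G" by (rule wbd_mono_AE) auto

lemma nn_integral_SUP_cball:
 fixes F :: "'a::euclidean_space => ennreal"
 assumes [measurable]: "F \<in> BM"
 shows "(NN x. F x) = (SUP k. (nns (cball 0 (real k)) F))"
proof -
 have m: "(%x. F x * indicator (cball 0 (real k)) x) \<in> borel_measurable lborel" for k by (intro borel_measurable_times_ennreal borel_measurable_indicator) auto
 have "(NN x. F x) = (NN x. (SUP k. F x * indicator (cball 0 (real k)) x))"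
 proof (intro nn_integral_cong antisym)
  fix x :: 'a
  obtain k :: nat where k: "norm x <= real k" using real_arch_simple by blast
  have "F x <= F x * indicator (cball 0 (real k)) x" using k by (auto simp: indicator_def)
  also have "... <= (SUP k. F x * indicator (cball 0 (real k)) x)" by (rule SUP_upper) simp
  finally show "F x <= (SUP k. F x * indicator (cball 0 (real k)) x)" .
  show "(SUP k. F x * indicator (cball 0 (real k)) x) <= F x" by (intro SUP_least) (auto simp: indicator_def)
 qed
 also have "... = (SUP k. (nns (cball 0 (real k)) F))" by (rule nn_integral_monotone_convergence_SUP[OF _ m]) (auto simp: incseq_def le_fun_def indicator_def)
 finally show ?thesis .
qed

lemma wbd_0_iff:
 assumes [measurable]: "F \<in> BM" and A: "0 <= A"
 shows "wbd 0 A F \<longleftrightarrow> (NN x. F x) <= ennreal A"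
proof
 assume w: "wbd 0 A F"
 have "nns (cball 0 (real k)) F <= ennreal A" for k
 proof -
  have "nns (cball 0 (real k)) F <= ennreal (A * measure lborel (cball (0::'a) (real k)) powr 0)" by (rule wbdD[OF w]) (auto simp: emeasure_cball)
  also have "... <= ennreal A" using A by (intro ennreal_leI) (auto simp: powr_def)
  finally show ?thesis .
 qed
 thus "(NN x. F x) <= ennreal A" unfolding nn_integral_SUP_cball[OF assms(1)] by (intro SUP_least)
next
 assume le: "(NN x. F x) <= ennreal A"
 show "wbd 0 A F" unfolding wbd_def
 proof (intro ballI impI)
  fix E :: "'a set" assume E: "E \<in> sets borel" "emeasure lborel E < \<infinity>"
  show "nns E F <= ennreal (A * measure lborel E powr 0)"
  \<comment> \<open>Since \<open>0 powr 0 = 0\<close>, the bound demands integral 0 over null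
    sets.\<close>
  proof (cases "measure lborel E = 0")
   case True
   hence "E \<in> null_sets lborel" using E by (auto simp: null_sets_def measure_def enn2real_eq_0_iff)
   thus ?thesis by (simp add: nn_integral_null_set)
  next
   case False
   have "nns E F <= (NN x. F x)" by (intro nn_integral_mono) (auto simp: indicator_def)
   thus ?thesis using le False by simp
  qed
 qed
qed

lemma wbd_cmult:
 assumes "wbd s A F" "0 <= c" and [measurable]: "F \<in> BM"
 shows "wbd s (c * A) (%x. ennreal c * F x)" unfolding wbd_def
proof (intro ballI impI)
 fix E :: "'a set" assume E[measurable]: "E \<in> sets borel" and fin: "emeasure lborel E < \<infinity>"
 have "nns E (%x. ennreal c * F x) = ennreal c * nns E F" unfolding mult.assoc by (intro nn_integral_cmult) measurable
 also have "... <= ennreal c * ennreal (A * measure lborel E powr s)" by (intro mult_left_mono wbdD[OF assms(1)] E fin) simp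
 also have "... = ennreal (c * A * measure lborel E powr s)" using assms(2) by (simp add: ennreal_mult' mult.assoc)
 finally show "nns E (%x. ennreal c * F x) <= ennreal (c * A * measure lborel E powr s)" .
qed

lemma wbd_add:
 assumes "wbd s A F" "wbd s B G" "0 <= A" "0 <= B"
  and [measurable]: "F \<in> BM" "G \<in> BM"
 shows "wbd s (A + B) (%x. F x + G x)" unfolding wbd_def
proof (intro ballI impI)
 fix E :: "'a set" assume E[measurable]: "E \<in> sets borel" and fin: "emeasure lborel E < \<infinity>"
 have "nns E (%x. F x + G x) = nns E F + nns E G" unfolding distrib_right by (intro nn_integral_add) measurable
 also have "... <= ennreal (A * measure lborel E powr s) + ennreal (B * measure lborel E powr s)" by (intro add_mono wbdD[OF assms(1)] wbdD[OF assms(2)] E fin)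
 also have "... = ennreal ((A + B) * measure lborel E powr s)" using assms(3,4) by (simp add: distrib_right flip: ennreal_plus)
 finally show "nns E (%x. F x + G x) <= ennreal ((A + B) * measure lborel E powr s)" .
qed

lemma wbd_zero: "0 <= A ==> wbd s A (%x. 0)" by (simp add: wbd_def)

lemma wbd_sum:
 assumes "\<And>i. i \<in> I ==> wbd s (A i) (F i)" "\<And>i. i \<in> I ==> 0 <= A i" "\<And>i. i \<in> I ==> F i \<in> BM"
 shows "wbd s (\<Sum>i\<in>I. A i) (%x. \<Sum>i\<in>I. F i x)" using assms by (induction I rule: infinite_finite_induct) (auto intro!: wbd_add wbd_zero sum_nonneg borel_measurable_sum)

lemma wbd_SUP:
 assumes "incseq F" "\<And>k. wbd s A (F k)" and F: "\<And>k. F k \<in> BM"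
 shows "wbd s A (%x. SUP k. F k x)" unfolding wbd_def
proof (intro ballI impI)
 fix E :: "'a set" assume E[measurable]: "E \<in> sets borel" and fin: "emeasure lborel E < \<infinity>"
 note F[measurable]
 have "nns E (%x. (SUP k. F k x)) = (NN x. (SUP k. F k x * indicator E x))" by (intro nn_integral_cong) (auto simp: indicator_def)
 also have "... = (SUP k. (nns E (%x. F k x)))" by (rule nn_integral_monotone_convergence_SUP)
    (use assms(1) in \<open>auto simp: incseq_def le_fun_def indicator_def\<close>)
 also have "... <= ennreal (A * measure lborel E powr s)" by (intro SUP_least wbdD assms(2) E fin)
 finally show "nns E (%x. (SUP k. F k x)) <= ennreal (A * measure lborel E powr s)" .
qed

lemma le_geometric_mean:
 fixes x P Q \<theta> :: real
 assumes "0 <= x" "x <= P" "x <= Q" "0 <= \<theta>" "\<theta> <= 1"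
 shows "x <= P powr (1 - \<theta>) * Q powr \<theta>"
proof (cases "x = 0")
 case False
 hence "x = x powr (1 - \<theta>) * x powr \<theta>" using assms by (simp flip: powr_add)
 also have "... <= P powr (1 - \<theta>) * Q powr \<theta>" using assms by (intro mult_mono powr_mono2) auto
 finally show ?thesis .
qed simp

text \<open>For each set the integral lies below both bounds, hence below their weighted geometric
  mean.\<close>

lemma wbd_interpolate:
 assumes "wbd s1 A F" "wbd s2 B F" "0 <= A" "0 <= B" "0 <= \<theta>" "\<theta> <= 1"
 shows "wbd ((1 - \<theta>) * s1 + \<theta> * s2) (A powr (1 - \<theta>) * B powr \<theta>) F" unfolding wbd_def
proof (intro ballI impI)
 fix E :: "'a set" assume E: "E \<in> sets borel" "emeasure lborel E < \<infinity>"
 let ?I = "nns E F" and ?m = "measure lborel E"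
 have fin: "?I < \<infinity>" using wbdD[OF assms(1) E] by (rule order_le_less_trans) simp
 hence I: "?I = ennreal (enn2real ?I)" by simp
 have "enn2real ?I <= A * ?m powr s1" "enn2real ?I <= B * ?m powr s2" using assms(3,4) by (auto intro!: enn2real_leI wbdD[OF assms(1) E] wbdD[OF assms(2) E])
 hence "enn2real ?I <= (A * ?m powr s1) powr (1 - \<theta>) * (B * ?m powr s2) powr \<theta>" using assms by (intro le_geometric_mean) auto
 also have "... = A powr (1 - \<theta>) * B powr \<theta> * ?m powr ((1 - \<theta>) * s1 + \<theta> * s2)" using assms by (simp add: powr_mult powr_powr powr_add mult_ac)
 finally show "?I <= ennreal (A powr (1 - \<theta>) * B powr \<theta> * ?m powr ((1 - \<theta>) * s1 + \<theta> * s2))" by (subst I) (rule ennreal_leI)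
qed

section \<open>Convolution of nonnegative functions\<close>

definition econv :: "('a::euclidean_space => ennreal) => ('a => ennreal) => 'a => ennreal" where
 "econv F G x = (NN y. F (x - y) * G y)"

lemma econv_commute:
 assumes [measurable]: "F \<in> BM" "G \<in> BM"
 shows "econv F G = econv G F"
proof
 fix x
 show "econv F G x = econv G F x" using nn_integral_lborel_shift(2)[of "%y. F (x - y) * G y" x] unfolding econv_def by (simp add: mult.commute)
qed

lemma measurable_diff_pair:
 assumes "F \<in> BM"
 shows "(%p::'a::euclidean_space\<times>'a. F (fst p - snd p)) \<in> borel_measurable (lborel \<Otimes>\<^sub>M lborel)"
  "(%p::'a::euclidean_space\<times>'a. F (snd p - fst p)) \<in> borel_measurable (lborel \<Otimes>\<^sub>M lborel)" by (auto intro!: measurable_compose[OF _ assms])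

lemma econv_borel[measurable]:
 assumes [measurable]: "F \<in> BM" "G \<in> BM"
 shows "econv F G \<in> BM"
proof -
 have "(%x. (NN y. F (x - y) * G y)) \<in> borel_measurable lborel"
 proof (rule lborel.borel_measurable_nn_integral)
  show "(%(x, y). F (x - y) * G y) \<in> borel_measurable (lborel \<Otimes>\<^sub>M lborel)" unfolding split_beta' by (intro borel_measurable_times_ennreal measurable_diff_pair assms measurable_compose[OF measurable_snd]) simp
 qed
 thus ?thesis by (simp add: econv_def[abs_def])
qed

lemma econv_mono:
 "(\<And>x. F x <= F' x) ==> (\<And>x. G x <= G' x) ==> econv F G z <= econv F' G' z" unfolding econv_def by (intro nn_integral_mono mult_mono) auto

lemma wbd_shift:
 assumes w: "wbd s A F" and [measurable]: "F \<in> BM"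
  and E[measurable]: "E \<in> sets borel" and fin: "emeasure lborel E < \<infinity>"
 shows "(NN z. F (z - y) * indicator E z) <= ennreal (A * measure lborel E powr s)"
  and "(NN z. F (y - z) * indicator E z) <= ennreal (A * measure lborel E powr s)"
proof -
 let ?E = "{x. y + x \<in> E}" and ?E' = "{x. y - x \<in> E}"
 have m[measurable]: "?E \<in> sets borel" "?E' \<in> sets borel" using measurable_sets_borel[of "%x. y + x" borel E] measurable_sets_borel[of "%x. y - x" borel E] by (auto simp: vimage_def)
 have e: "emeasure lborel ?E = emeasure lborel E" "emeasure lborel ?E' = emeasure lborel E"
 proof -
  have "emeasure lborel ?E = (NN x. indicator ?E x)" using m(1) by (simp only: nn_integral_indicator sets_lborel)
  also have "... = (NN x. indicator E (y + x))" by (intro nn_integral_cong) (simp add: indicator_def)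
  also have "... = (NN x. indicator E x)" by (rule nn_integral_lborel_shift) simp
  finally show "emeasure lborel ?E = emeasure lborel E" by simp
  have "emeasure lborel ?E' = (NN x. indicator ?E' x)" using m(2) by (simp only: nn_integral_indicator sets_lborel)
  also have "... = (NN x. indicator E (y - x))" by (intro nn_integral_cong) (simp add: indicator_def)
  also have "... = (NN x. indicator E x)" by (rule nn_integral_lborel_shift) simp
  finally show "emeasure lborel ?E' = emeasure lborel E" by simp
 qed
 have "(NN z. F (z - y) * indicator E z) = (NN x. F (y + x - y) * indicator E (y + x))" by (rule nn_integral_lborel_shift(1)[symmetric]) measurable
 also have "... = nns ?E F" by (intro nn_integral_cong) (auto simp: indicator_def)
 also have "... <= ennreal (A * measure lborel ?E powr s)" by (rule wbdD[OF w m(1)]) (use fin in \<open>simp add: e\<close>)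
 finally show "(NN z. F (z - y) * indicator E z) <= ennreal (A * measure lborel E powr s)" by (simp add: measure_def e)
 have "(NN z. F (y - z) * indicator E z) = (NN x. F (y - (y - x)) * indicator E (y - x))" by (rule nn_integral_lborel_shift(2)[symmetric]) measurable
 also have "... = nns ?E' F" by (intro nn_integral_cong) (auto simp: indicator_def)
 also have "... <= ennreal (A * measure lborel ?E' powr s)" by (rule wbdD[OF w m(2)]) (use fin in \<open>simp add: e\<close>)
 finally show "(NN z. F (y - z) * indicator E z) <= ennreal (A * measure lborel E powr s)" by (simp add: measure_def e)
qed

lemma nn_integral_econv:
 fixes F G H :: "'a::euclidean_space => ennreal"
 assumes [measurable]: "F \<in> BM" "G \<in> BM" "H \<in> BM"
 shows "(NN x. econv F G x * H x) = (NN y. G y * (NN x. F (x - y) * H x))"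
proof -
 have m: "(%(x, y). F (x - y) * G y * H x) \<in> borel_measurable (lborel \<Otimes>\<^sub>M lborel)" unfolding split_beta' by (intro borel_measurable_times_ennreal measurable_diff_pair assms
   measurable_compose[OF measurable_snd] measurable_compose[OF measurable_fst]) auto
 have "(NN x. econv F G x * H x) = (NN x. (NN y. F (x - y) * G y * H x))" unfolding econv_def by (intro nn_integral_cong nn_integral_multc[symmetric]) measurable
 also have "... = (NN y. (NN x. F (x - y) * G y * H x))" by (rule lborel_pair.Fubini'[OF m, symmetric])
 also have "... = (NN y. (NN x. G y * (F (x - y) * H x)))" by (simp add: mult_ac)
 also have "... = (NN y. G y * (NN x. F (x - y) * H x))" by (intro nn_integral_cong nn_integral_cmult) measurable
 finally show ?thesis .
qed

text \<open>Translates of E have the measure of E, so the inner integral is bounded uniformly in y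
  and only the integral of G remains.\<close>

lemma wbd_econv:
 fixes F G :: "'a::euclidean_space => ennreal"
 assumes w: "wbd s A F" and G: "(NN x. G x) <= ennreal B" and A: "0 <= A"
  and [measurable]: "F \<in> BM" "G \<in> BM"
 shows "wbd s (A * B) (econv F G)" unfolding wbd_def
proof (intro ballI impI)
 fix E :: "'a set" assume E[measurable]: "E \<in> sets borel" and fin: "emeasure lborel E < \<infinity>"
 have "nns E (%x. econv F G x) = (NN y. G y * (NN z. F (z - y) * indicator E z))" by (rule nn_integral_econv) measurable
 also have "... <= (NN y. G y * ennreal (A * measure lborel E powr s))" by (intro nn_integral_mono mult_left_mono wbd_shift[OF w _ E fin]) auto
 also have "... = (NN y. G y) * ennreal (A * measure lborel E powr s)" by (rule nn_integral_multc) simp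
 also have "... <= ennreal B * ennreal (A * measure lborel E powr s)" by (intro mult_right_mono G) simp
 also have "... = ennreal (A * B * measure lborel E powr s)" using A by (simp add: ennreal_mult''[symmetric] mult_ac)
 finally show "nns E (%x. econv F G x) <= ennreal (A * B * measure lborel E powr s)" .
qed

section \<open>Layer cake formula and a strong-weak Young inequality\<close>

lemma ennreal_eq_topI:
 assumes "\<And>k::nat. ennreal (real k) <= x"
 shows "x = top"
proof (rule ccontr)
 assume "x \<noteq> top"
 hence "x < top" by (simp add: top.not_eq_extremum)
 then obtain k :: nat where "x < of_nat k" using ennreal_Ex_less_of_nat by auto
 thus False using assms[of k] by (simp add: ennreal_of_nat_eq_real_of_nat)
qed

lemma nn_integral_layer:
 "(NN l. indicator {l. 0 < l \<and> ennreal l < y} l) = y"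
proof (cases y)
 case (real r)
 hence "{l. 0 < l \<and> ennreal l < y} = {0<..<r}" by (auto simp: ennreal_less_iff)
 thus ?thesis using real by simp
next
 case top
 hence "{l. 0 < l \<and> ennreal l < y} = {0<..}" by auto
 moreover have "emeasure lborel {0::real<..} = \<infinity>"
 proof -
  have "ennreal (real k) <= emeasure lborel {0::real<..}" for k
  proof -
   have "ennreal (real k) = emeasure lborel {0<..<real k}" by simp
   also have "... <= emeasure lborel {0::real<..}" by (intro emeasure_mono) auto
   finally show ?thesis .
  qed
  thus ?thesis by (simp add: ennreal_eq_topI)
 qed
 ultimately show ?thesis using top by simp
qed

lemma layer_measurable:
 assumes [measurable]: "F \<in> BM"
 shows "(%(x, l). indicator {l. 0 < l \<and> ennreal l < F x} l :: ennreal) \<in> borel_measurable ((lborel :: 'a::euclidean_space measure) \<Otimes>\<^sub>M (lborel :: real measure))"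
proof -
 have "{p \<in> space (lborel \<Otimes>\<^sub>M lborel). 0 < snd p \<and> ennreal (snd p) < F (fst p)} \<in> sets ((lborel :: 'a measure) \<Otimes>\<^sub>M (lborel :: real measure))" by measurable
 hence "(%p. indicator {p \<in> space (lborel \<Otimes>\<^sub>M lborel). 0 < snd p \<and> ennreal (snd p) < F (fst p)} p :: ennreal) \<in> borel_measurable ((lborel :: 'a measure) \<Otimes>\<^sub>M (lborel :: real measure))" by (rule borel_measurable_indicator)
 thus ?thesis by (simp add: indicator_def split_beta' space_pair_measure)
qed

lemma layer_cake:
 fixes F H :: "'a::euclidean_space => ennreal"
 assumes [measurable]: "F \<in> BM" "H \<in> BM"
 shows "(NN x. F x * H x) = nns {0<..} (%l. (nns {x. ennreal l < F x} H))"
proof -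
 have m: "(%(x, l). indicator {l. 0 < l \<and> ennreal l < F x} l * H x) \<in> borel_measurable (lborel \<Otimes>\<^sub>M lborel)" using layer_measurable[OF assms(1)] measurable_compose[OF measurable_fst assms(2)[folded measurable_lborel1]] unfolding split_beta' by (intro borel_measurable_times_ennreal) auto
 have "(NN x. F x * H x) = (NN x. (NN l. indicator {l. 0 < l \<and> ennreal l < F x} l) * H x)" by (simp only: nn_integral_layer)
 also have "... = (NN x. (NN l. indicator {l. 0 < l \<and> ennreal l < F x} l * H x))"
 proof (intro nn_integral_cong nn_integral_multc[symmetric])
  fix x
  have "{l. 0 < l \<and> ennreal l < F x} \<in> sets borel" by measurable
  thus "indicator {l. 0 < l \<and> ennreal l < F x} \<in> borel_measurable lborel" by simp
 qed
 also have "... = (NN l. (NN x. indicator {l. 0 < l \<and> ennreal l < F x} l * H x))" by (rule lborel_pair.Fubini'[OF m, symmetric])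
 also have "... = nns {0<..} (%l. (nns {x. ennreal l < F x} H))"
 proof (intro nn_integral_cong)
  fix l :: real
  have "{x. ennreal l < F x} \<in> sets borel" by measurable
  hence [measurable]: "indicator {x. ennreal l < F x} \<in> borel_measurable lborel" by simp
  have "(NN x. indicator {l. 0 < l \<and> ennreal l < F x} l * H x) = (NN x. (H x * indicator {x. ennreal l < F x} x) * indicator {0<..} l)" by (intro nn_integral_cong) (auto simp: indicator_def)
  also have "... = nns {x. ennreal l < F x} H * indicator {0<..} l" by (rule nn_integral_multc) measurable
  finally show "(NN x. indicator {l. 0 < l \<and> ennreal l < F x} l * H x) = nns {x. ennreal l < F x} H * indicator {0<..} l" .
 qed
 finally show ?thesis .
qed

definition dist_fn :: "('a::euclidean_space => ennreal) => real => ennreal" where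
 "dist_fn F l = emeasure lborel {x. ennreal l < F x}"

text \<open>Up to a constant the Lorentz norm with second index 1, written through the distribution
  function: with s = 1/q the power 1 - s is the reciprocal of the conjugate exponent. In this form
  it matches the superlevel sets of the layer cake formula.\<close>

definition lor1 :: "real => ('a::euclidean_space => ennreal) => ennreal" where
 "lor1 s F = nns {0<..} (%l. epow (dist_fn F l) (1 - s))"

lemma epow_ennreal: "0 <= x ==> epow (ennreal x) a = ennreal (x powr a)" by (simp add: epow_def)

lemma epow_mono: "0 <= a ==> x <= y ==> epow x a <= epow y a" by (cases x; cases y) (auto simp: epow_def top_unique intro!: powr_mono2 ennreal_leI)

lemma dist_fn_antimono: "l <= l' ==> F \<in> BM ==> dist_fn F l' <= dist_fn F l"
proof -
 assume l: "l <= l'" and [measurable]: "F \<in> BM"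
 have "{x. ennreal l < F x} \<in> sets lborel" using borel_measurable_const[of "ennreal l"] by simp
 thus ?thesis unfolding dist_fn_def using l by (intro emeasure_mono) (auto intro: order_le_less_trans[OF ennreal_leI])
qed

lemma epow_borel[measurable]: "(%x. epow x a) \<in> BM" unfolding epow_def by measurable

text \<open>The distribution function is measurable in the level because it is a partial integral of
  the indicator of the region under the graph.\<close>

lemma epow_dist_fn_borel:
 fixes F :: "'a::euclidean_space => ennreal"
 assumes F: "F \<in> BM"
 shows "(%l. epow (dist_fn F l) a * indicator {0<..} l) \<in> BM"
proof -
 let ?D = "%l. (NN x. indicator {l. 0 < l \<and> ennreal l < F x} l)"
 have "?D \<in> borel_measurable (lborel :: real measure)"
 proof (rule lborel.borel_measurable_nn_integral)
  have "(%p :: real \<times> 'a. (snd p, fst p)) \<in> measurable (lborel \<Otimes>\<^sub>M lborel) (lborel \<Otimes>\<^sub>M lborel)" by (intro measurable_Pair measurable_snd measurable_fst)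
  from measurable_compose[OF this layer_measurable[OF F]]
  show "(%(l, x). indicator {l. 0 < l \<and> ennreal l < F x} l :: ennreal) \<in> borel_measurable ((lborel :: real measure) \<Otimes>\<^sub>M (lborel :: 'a measure))" by (simp add: split_beta')
 qed
 from measurable_compose[OF this epow_borel]
 have "(%l. epow (?D l) a * indicator {0<..} l) \<in> borel_measurable (lborel :: real measure)" by (intro borel_measurable_times_ennreal borel_measurable_indicator) auto
 moreover have "epow (?D l) a * indicator {0<..} l = epow (dist_fn F l) a * indicator {0<..} l" for l
 proof (cases "0 < l")
  case True
  have "{x. ennreal l < F x} \<in> sets borel" using F by measurable
  hence "dist_fn F l = (NN x. indicator {x. ennreal l < F x} x)" unfolding dist_fn_def by (simp only: nn_integral_indicator sets_lborel)
  also have "... = ?D l" by (intro nn_integral_cong) (use True in \<open>simp add: indicator_def\<close>)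
  finally show ?thesis by simp
 qed simp
 ultimately show ?thesis by simp
qed

text \<open>Indices add, and so an index above 1/p is reached from factors below it. The layer cake
  formula reduces F to the indicator of a superlevel set S. The double integral over S and E is
  bounded in two ways, by the weak bound of G on translates of E or on reflected translates of S,
  and a geometric mean of the two yields the power 1 - s of |S| that \<open>lor1\<close> integrates.
  A weak bound on F would leave an integral over the levels that may diverge
  logarithmically.\<close>

lemma young_weak:
 fixes F G :: "'a::euclidean_space => ennreal"
 assumes w: "wbd s A G" and L: "lor1 s F <= ennreal K" and s: "0 < s" "s <= 1/2" and A: "0 <= A" and K: "0 <= K"
  and [measurable]: "F \<in> BM" "G \<in> BM"
 shows "wbd (2 * s) (K * A) (econv F G)" unfolding wbd_def
proof (intro ballI impI)
 fix E :: "'a set" assume E[measurable]: "E \<in> sets borel" and fin: "emeasure lborel E < \<infinity>"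
 let ?e = "measure lborel E"
 have eE: "emeasure lborel E = ennreal ?e" using fin by (simp add: emeasure_eq_ennreal_measure)
 define h where "h y = (NN z. G (z - y) * indicator E z)" for y
 have hm: "h \<in> BM"
 proof -
  have "(%y. (NN z. G (z - y) * indicator E z)) \<in> borel_measurable lborel"
  proof (rule lborel.borel_measurable_nn_integral)
   show "(%(y, z). G (z - y) * indicator E z) \<in> borel_measurable (lborel \<Otimes>\<^sub>M lborel)" unfolding split_beta' by (intro borel_measurable_times_ennreal measurable_diff_pair assms
    measurable_compose[OF measurable_snd, of "indicator E"] borel_measurable_indicator) auto
  qed
  thus ?thesis by (simp add: h_def[abs_def])
 qed
 have h1: "h y <= ennreal (A * ?e powr s)" for y unfolding h_def by (rule wbd_shift(1)[OF w _ E fin]) simp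
 have key: "nns {x. ennreal l < F x} (%y. h y) <= ennreal (A * ?e powr (2 * s)) * epow (dist_fn F l) (1 - s)" for l
 proof -
  let ?S = "{x. ennreal l < F x}"
  have S[measurable]: "?S \<in> sets borel" by measurable
  show ?thesis
  proof (cases "A * ?e = 0")
   case True
   hence 0: "A * ?e powr s = 0" by auto
   have "h y = 0" for y using h1[of y] unfolding 0 by simp
   thus ?thesis by simp
  next
   case False
   show ?thesis
   proof (cases "emeasure lborel ?S = \<infinity>")
    \<comment> \<open>A superlevel set of infinite measure makes the right-hand side
      infinite.\<close>
    case True
    have "A * ?e powr (2 * s) > 0" using False A by (auto simp: less_le)
    hence "ennreal (A * ?e powr (2 * s)) \<noteq> 0" by (simp only: ennreal_eq_0_iff not_le)
    hence "ennreal (A * ?e powr (2 * s)) * top = top" by (simp only: ennreal_mult_top if_False)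
    thus ?thesis using True by (simp only: dist_fn_def epow_def infinity_ennreal_def if_True refl top_greatest)
   next
    case fS: False
    let ?m = "measure lborel ?S"
    have eS: "emeasure lborel ?S = ennreal ?m" using fS by (simp add: emeasure_eq_ennreal_measure)
    let ?I = "nns ?S (%y. h y)"
    have "?I <= (NN y. ennreal (A * ?e powr s) * indicator ?S y)" by (intro nn_integral_mono mult_right_mono h1) simp
    also have "... = ennreal (A * ?e powr s * ?m)" using A by (simp add: nn_integral_cmult_indicator eS ennreal_mult')
    finally have I1: "?I <= ennreal (A * ?e powr s * ?m)" .
    have "?I = (NN y. indicator ?S y * (NN z. G (z - y) * indicator E z))" by (simp add: h_def mult.commute)
    also have "... = (NN z. econv G (indicator ?S) z * indicator E z)" by (rule nn_integral_econv[symmetric]) measurable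
    also have "... <= (NN z. ennreal (A * ?m powr s) * indicator E z)" unfolding econv_def using fS by (intro nn_integral_mono mult_right_mono wbd_shift(2)[OF w _ S]) (auto simp: top.not_eq_extremum)
    also have "... = ennreal (A * ?m powr s * ?e)" using A by (simp add: nn_integral_cmult_indicator eE ennreal_mult')
    finally have I2: "?I <= ennreal (A * ?m powr s * ?e)" .
    have fI: "?I < \<infinity>" using I1 by (rule order_le_less_trans) simp
    hence I: "?I = ennreal (enn2real ?I)" by simp
    \<comment> \<open>The weight is determined by the exponent of |S|, 1 - t + s t = 1 - s, and then
      gives 2 s for |E|. It is at most 1 because s is at most 1/2.\<close>
    define t where "t = s / (1 - s)"
    have t: "0 <= t" "t <= 1" using s by (auto simp: t_def field_simps)
    have "(1 - s) * t = s" using s by (simp add: t_def)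
    hence e1: "s * (1 - t) + t = 2 * s" "1 - t + s * t = 1 - s" by (simp_all add: algebra_simps)
    have "enn2real ?I <= A * ?e powr s * ?m" "enn2real ?I <= A * ?m powr s * ?e" using A by (auto intro!: enn2real_leI I1 I2)
    hence "enn2real ?I <= (A * ?e powr s * ?m) powr (1 - t) * (A * ?m powr s * ?e) powr t" using t by (intro le_geometric_mean) auto
    also have "... <= A * ?e powr (2 * s) * ?m powr (1 - s)"
    proof (cases "?m = 0")
    case True
    thus ?thesis using s t A by (cases "t = 1") auto
    next
    case m0: False
    have "(A * ?e powr s * ?m) powr (1 - t) * (A * ?m powr s * ?e) powr t =
    (A powr (1 - t) * A powr t) * (?e powr (s * (1 - t)) * ?e powr t) * (?m powr (1 - t) * ?m powr (s * t))" using A by (simp add: powr_mult powr_powr mult_ac)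
    also have "... = A * ?e powr (2 * s) * ?m powr (1 - s)" using False A m0 unfolding powr_add[symmetric] e1 by simp
    finally show ?thesis by simp
    qed
    finally have "?I <= ennreal (A * ?e powr (2 * s) * ?m powr (1 - s))" by (subst I) (rule ennreal_leI)
    thus ?thesis using A by (simp add: dist_fn_def eS epow_ennreal ennreal_mult')
   qed
  qed
 qed
 note dm = epow_dist_fn_borel[of F "1 - s"]
 have "nns E (%x. econv F G x) = nns E (%x. econv G F x)" by (simp add: econv_commute)
 also have "... = (NN y. F y * h y)" unfolding h_def by (rule nn_integral_econv) measurable
 also have "... = nns {0<..} (%l. (nns {x. ennreal l < F x} (%y. h y)))" by (rule layer_cake[OF _ hm]) simp
 also have "... <= nns {0<..} (%l. ennreal (A * ?e powr (2 * s)) * epow (dist_fn F l) (1 - s))" by (intro nn_integral_mono mult_right_mono key) simp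
 also have "... = ennreal (A * ?e powr (2 * s)) * lor1 s F" unfolding lor1_def mult.assoc by (rule nn_integral_cmult) (use dm in simp)
 also have "... <= ennreal (A * ?e powr (2 * s)) * ennreal K" by (intro mult_left_mono L) simp
 also have "... = ennreal (K * A * ?e powr (2 * s))" using A K by (simp add: ennreal_mult''[symmetric] mult_ac)
 finally show "nns E (%x. econv F G x) <= ennreal (K * A * ?e powr (2 * s))" .
qed

section \<open>Heat kernel estimates\<close>

lemma ennreal_affine: "0 <= X ==> 0 <= Y ==> 0 <= m ==> ennreal X + ennreal Y * ennreal m = ennreal (X + Y * m)" by (simp add: ennreal_mult)

text \<open>Passes from sets to functions with values in [0,1] with the same constant. By the layer
  cake formula the claim is Jensen's inequality for the concave power s over the levels in (0,1). It
  is proved with the tangent line of that power at I, which integrates to exactly the right-hand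
  side.\<close>

lemma wbd_integral_le_powr:
 fixes F :: "'a::euclidean_space => ennreal"
 assumes w: "wbd s A F" and A: "0 <= A" and s: "0 < s" "s <= 1"
  and [measurable]: "F \<in> BM" "f \<in> BM"
  and f: "\<And>x. 0 <= f x" "\<And>x. f x <= 1" and I: "(NN x. ennreal (f x)) = ennreal I" "0 <= I"
 shows "(NN x. F x * ennreal (f x)) <= ennreal (A * I powr s)"
proof (cases "I = 0")
 case True
 hence "(NN x. ennreal (f x)) = 0" using I by simp
 hence "AE x in lborel. ennreal (f x) = 0" by (subst (asm) nn_integral_0_iff_AE) auto
 hence "(NN x. F x * ennreal (f x)) = (\<integral>\<^sup>+x. 0 \<partial>(lborel::'a measure))" by (intro nn_integral_cong_AE) (auto elim: AE_mp)
 thus ?thesis by simp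
next
 case False
 hence I0: "I > 0" using I by simp
 let ?D = "dist_fn (%x. ennreal (f x))"
 have Dm: "(%l. ?D l * indicator {0<..} l) \<in> BM"
 proof -
  have "(%l. epow (?D l) 1 * indicator {0<..} l) \<in> BM" by (rule epow_dist_fn_borel) simp
  moreover have "epow x 1 = x" for x by (cases x) (auto simp: epow_def)
  ultimately show ?thesis by simp
 qed
 have DI: "nns {0<..} ?D = ennreal I"
 proof -
  have "{x. ennreal l < ennreal (f x)} \<in> sets borel" for l by measurable
  hence "nns {0<..} ?D = nns {0<..} (%l. (nns {x. ennreal l < ennreal (f x)} (%x. 1)))" by (simp add: dist_fn_def)
  also have "... = (NN x. ennreal (f x) * 1)" by (rule layer_cake[symmetric]) auto
  finally show ?thesis using I by simp
 qed
 have key: "nns {x. ennreal l < ennreal (f x)} F * indicator {0<..} l <=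
   ennreal (A * (1 - s) * I powr s) * indicator {0<..<1} l + ennreal (A * s * I powr (s - 1)) * (?D l * indicator {0<..} l)" for l
 proof (cases "0 < l \<and> l < 1")
  case True
  let ?S = "{x. ennreal l < ennreal (f x)}"
  have S[measurable]: "?S \<in> sets borel" by measurable
  have fin: "emeasure lborel ?S < \<infinity>"
  proof -
   have "ennreal l * emeasure lborel ?S = (NN x. ennreal l * indicator ?S x)" by (subst nn_integral_cmult_indicator) auto
   also have "... <= (NN x. ennreal (f x))" by (intro nn_integral_mono) (auto simp: indicator_def)
   also have "... < \<infinity>" using I by simp
   finally show ?thesis using True by (auto simp: ennreal_mult_less_top)
  qed
  let ?m = "measure lborel ?S"
  have eS: "emeasure lborel ?S = ennreal ?m" using fin by (simp add: emeasure_eq_ennreal_measure)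
  have "?m powr s * I powr (1 - s) <= s * ?m + (1 - s) * I"
  proof (cases "?m = 0")
   case False
   hence "?m > 0" by (simp add: less_le)
   thus ?thesis using s I0 by (intro Youngs_inequality_0) auto
  qed (use s I in auto)
  note young = this
  define c where "c = I powr (s - 1)"
  have c: "I powr (1 - s) * c = 1" "I * c = I powr s" "0 <= c" using I0 by (simp_all add: c_def powr_diff flip: powr_add)
  have "?m powr s = (?m powr s * I powr (1 - s)) * c" using c(1) by (simp add: mult.assoc)
  also have "... <= (s * ?m + (1 - s) * I) * c" by (intro mult_right_mono young c)
  also have "... = (1 - s) * (I * c) + s * c * ?m" by (simp add: algebra_simps)
  finally have le: "?m powr s <= (1 - s) * I powr s + s * I powr (s - 1) * ?m" unfolding c(2) unfolding c_def .
  have 1: "A * ?m powr s <= A * (1 - s) * I powr s + A * s * I powr (s - 1) * ?m" using mult_left_mono[OF le A] by (simp add: algebra_simps)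
  have "nns ?S F <= ennreal (A * ?m powr s)" by (rule wbdD[OF w S fin])
  also have "... <= ennreal (A * (1 - s) * I powr s + A * s * I powr (s - 1) * ?m)" by (rule ennreal_leI[OF 1])
  also have "... = ennreal (A * (1 - s) * I powr s) + ennreal (A * s * I powr (s - 1)) * ennreal ?m" using A s by (intro ennreal_affine[symmetric]) auto
  finally show ?thesis using True by (simp add: dist_fn_def eS)
 next
  case False
  show ?thesis
  proof (cases "0 < l")
   case True
   hence "1 <= l" using False by simp
   hence "{x. ennreal l < ennreal (f x)} = {}" using f by (auto simp: ennreal_less_iff not_less intro: order_trans)
   thus ?thesis by simp
  qed simp
 qed
 have "(NN x. F x * ennreal (f x)) = (NN x. ennreal (f x) * F x)" by (simp add: mult.commute)
 also have "... = nns {0<..} (%l. (nns {x. ennreal l < ennreal (f x)} F))" by (rule layer_cake) auto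
 also have "... <= (NN l. ennreal (A * (1 - s) * I powr s) * indicator {0<..<1} l + ennreal (A * s * I powr (s - 1)) * (?D l * indicator {0<..} l))" by (intro nn_integral_mono key)
 also have "... = (\<integral>\<^sup>+l. ennreal (A * (1 - s) * I powr s) * indicator {0<..<1} l \<partial>(lborel :: real measure)) + (NN l. ennreal (A * s * I powr (s - 1)) * (?D l * indicator {0<..} l))" using Dm by (intro nn_integral_add) auto
 also have "(\<integral>\<^sup>+l. ennreal (A * (1 - s) * I powr s) * indicator {0<..<1} l \<partial>(lborel :: real measure)) = ennreal (A * (1 - s) * I powr s)" by (subst nn_integral_cmult_indicator) auto
 also have "(NN l. ennreal (A * s * I powr (s - 1)) * (?D l * indicator {0<..} l)) = ennreal (A * s * I powr (s - 1)) * ennreal I" using Dm DI by (subst nn_integral_cmult) auto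
 also have "ennreal (A * (1 - s) * I powr s) + ennreal (A * s * I powr (s - 1)) * ennreal I = ennreal (A * (1 - s) * I powr s + A * s * I powr (s - 1) * I)" using A s I by (intro ennreal_affine) auto
 also have "A * (1 - s) * I powr s + A * s * I powr (s - 1) * I = A * I powr s"
 proof -
  have "I powr (s - 1) * I = I powr s" using I0 by (simp add: powr_diff)
  thus ?thesis by (simp add: algebra_simps)
 qed
 finally show ?thesis .
qed

lemma summable_powr_exp: "0 <= b ==> summable (%k. (real k + 1) powr b * exp (- real k))"
proof -
 assume b: "0 <= b"
 define c where "c = 1 / (2 * (b + 1))"
 have c: "c > 0" "c * b <= 1/2" using b by (auto simp: c_def field_simps)
 show ?thesis
 proof (rule summable_comparison_test')
  show "summable (%k. (1 + 1 / c) powr b * exp (- (1/2)) ^ k)" by (intro summable_mult summable_geometric) simp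
  fix k :: nat
  have "real k + 1 <= (1 + 1 / c) * (1 + c * real k)" using c by (simp add: field_simps)
  also have "... <= (1 + 1 / c) * exp (c * real k)" using c by (intro mult_left_mono exp_ge_add_one_self) auto
  finally have "(real k + 1) powr b <= ((1 + 1 / c) * exp (c * real k)) powr b" using b by (intro powr_mono2) auto
  also have "... = (1 + 1 / c) powr b * exp (c * b * real k)" using c by (simp add: powr_mult exp_powr_real mult_ac)
  also have "... <= (1 + 1 / c) powr b * exp (1/2 * real k)" using c mult_right_mono[OF c(2), of "real k"] by (intro mult_left_mono) auto
  finally have "(real k + 1) powr b * exp (- real k) <= (1 + 1 / c) powr b * exp (1/2 * real k) * exp (- real k)" by (rule mult_right_mono) simp
  also have "... = (1 + 1 / c) powr b * exp (- (1/2)) ^ k" by (simp add: mult.assoc flip: exp_add exp_of_nat_mult)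
  finally show "norm ((real k + 1) powr b * exp (- real k)) <= (1 + 1 / c) powr b * exp (- (1/2)) ^ k" by simp
 qed
qed

text \<open>The series left by the shells of width h^(-1/2) in \<open>wbd_heat\<close>; a is the
  power of the frequency and d the drop of the index.\<close>

definition heat_const :: "'a::euclidean_space itself => real => real => real" where
 "heat_const _ a d = unit_ball_vol (real DIM('a)) powr d * (\<Sum>k. (real k + 1) powr (a + real DIM('a) * d) * exp (- real k))"

lemma heat_const_nonneg: "0 <= a ==> 0 <= d ==> 0 <= heat_const TYPE('a::euclidean_space) a d" unfolding heat_const_def by (intro mult_nonneg_nonneg suminf_nonneg summable_powr_exp) auto

text \<open>The smoothing estimate of the heat semigroup. On the shell with index k the multiplier
  is at most h^(-a/2) (k+1)^a exp(-k), and on the enclosing ball B the index is lowered by |E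
  \<inter> B|^s \<le> |E|^s' |B|^(s - s').\<close>

lemma wbd_heat:
 fixes F :: "'a::euclidean_space => ennreal"
 assumes w: "wbd s A F" and A: "0 <= A" and [measurable]: "F \<in> BM"
  and a: "0 <= a" and s: "0 <= s'" "s' <= s" and h: "0 < h"
 shows "wbd s' (heat_const TYPE('a) a (s - s') * h powr (- a / 2 - real DIM('a) * (s - s') / 2) * A)
  (%z. ennreal (norm z powr a * exp (- h * (norm z)^2)) * F z)" unfolding wbd_def
proof (intro ballI impI)
 fix E :: "'a set" assume E[measurable]: "E \<in> sets borel" and fin: "emeasure lborel E < \<infinity>"
 let ?n = "real DIM('a)" and ?d = "s - s'" and ?w = "unit_ball_vol (real DIM('a))"
 define \<rho> where "\<rho> = h powr (- 1/2)"
 have \<rho>: "\<rho> > 0" using h by (simp add: \<rho>_def)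
 have h\<rho>: "h * \<rho>\<^sup>2 = 1" using h by (simp add: \<rho>_def power2_eq_square flip: powr_add)
 let ?a = "%k. \<rho> powr a * ((real k + 1) powr a * exp (- real k))"
 have m: "ennreal (norm x powr a * exp (- h * (norm x)^2)) <= ennreal (?a (nat \<lfloor>norm x / \<rho>\<rfloor>))" for x :: 'a
 proof (rule ennreal_leI)
  let ?k = "nat \<lfloor>norm x / \<rho>\<rfloor>"
  have nn: "0 <= norm x / \<rho>" using \<rho> by simp
  hence k: "real ?k <= norm x / \<rho>" "norm x / \<rho> < real ?k + 1" by linarith+
  have "norm x <= \<rho> * (real ?k + 1)" using k(2) \<rho> by (simp add: field_simps)
  hence 1: "norm x powr a <= \<rho> powr a * (real ?k + 1) powr a" using a \<rho> powr_mono2[of a "norm x" "\<rho> * (real ?k + 1)"] by (simp add: powr_mult)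
  \<comment> \<open>The Gaussian decay in k is weakened to exp(-k), which still sums against powers
    of k + 1.\<close>
  have "real ?k <= (real ?k)\<^sup>2" by (cases "?k = 0") (auto simp: power2_eq_square)
  also have "... <= (norm x / \<rho>)\<^sup>2" using k by (intro power_mono) auto
  also have "... = h * (norm x)^2"
  proof -
   have "(norm x / \<rho>)\<^sup>2 = (h * \<rho>\<^sup>2) * (norm x)^2 / \<rho>\<^sup>2" unfolding h\<rho> by (simp add: power_divide)
   thus ?thesis using \<rho> by simp
  qed
  finally have 2: "exp (- h * (norm x)^2) <= exp (- real ?k)" by simp
  show "norm x powr a * exp (- h * (norm x)^2) <= ?a ?k" using mult_mono[OF 1 2] \<rho> by (simp add: mult.assoc)
 qed
 have "nns E (%z. ennreal (norm z powr a * exp (- h * (norm z)^2)) * F z) =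
   (NN z. ennreal (norm z powr a * exp (- h * (norm z)^2)) * (F z * indicator E z))" by (simp add: mult.assoc)
 also have "... <= (\<Sum>k. ennreal (?a k) * (NN x. F x * indicator E x * indicator (ball 0 (\<rho> * (real k + 1))) x))" by (rule nn_integral_shell_le[where a = ?a, OF \<rho> m]) measurable
 also have "... <= (\<Sum>k. ennreal (A * measure lborel E powr s' * ?w powr ?d * \<rho> powr (a + ?n * ?d) * ((real k + 1) powr (a + ?n * ?d) * exp (- real k))))"
 proof (intro suminf_le summableI)
  fix k
  let ?B = "ball (0::'a) (\<rho> * (real k + 1))"
  have B: "measure lborel ?B = ?w * (\<rho> * (real k + 1)) ^ DIM('a)" using \<rho> by (intro content_ball) simp
  have EB: "E \<inter> ?B \<in> sets borel" by simp
  have finEB: "emeasure lborel (E \<inter> ?B) < \<infinity>" by (rule order_le_less_trans[OF _ fin]) (intro emeasure_mono, auto)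
  have le1: "measure lborel (E \<inter> ?B) <= measure lborel E" using fin by (intro measure_mono_fmeasurable) (auto simp: fmeasurable_def)
  have le2: "measure lborel (E \<inter> ?B) <= measure lborel ?B" by (intro measure_mono_fmeasurable) (auto simp: fmeasurable_def emeasure_ball \<rho> less_imp_le)
  have "(NN x. F x * indicator E x * indicator ?B x) = nns (E \<inter> ?B) F" by (intro nn_integral_cong) (auto simp: indicator_def)
  also have "... <= ennreal (A * measure lborel (E \<inter> ?B) powr s)" by (rule wbdD[OF w EB finEB])
  also have "... <= ennreal (A * (measure lborel E powr s' * (?w * (\<rho> * (real k + 1)) ^ DIM('a)) powr ?d))"
  proof (intro ennreal_leI mult_left_mono A)
   have "measure lborel (E \<inter> ?B) powr s = measure lborel (E \<inter> ?B) powr s' * measure lborel (E \<inter> ?B) powr ?d" by (simp flip: powr_add)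
   also have "... <= measure lborel E powr s' * measure lborel ?B powr ?d" using s le1 le2 by (intro mult_mono powr_mono2) auto
   finally show "measure lborel (E \<inter> ?B) powr s <= measure lborel E powr s' * (?w * (\<rho> * (real k + 1)) ^ DIM('a)) powr ?d" unfolding B .
  qed
  also have "(?w * (\<rho> * (real k + 1)) ^ DIM('a)) powr ?d = ?w powr ?d * (\<rho> powr (?n * ?d) * (real k + 1) powr (?n * ?d))"
  proof -
   have "(\<rho> * (real k + 1)) ^ DIM('a) = (\<rho> * (real k + 1)) powr ?n" using \<rho> by (simp add: powr_realpow)
   thus ?thesis using \<rho> by (simp add: powr_mult powr_powr)
  qed
  finally have "ennreal (?a k) * (NN x. F x * indicator E x * indicator ?B x) <=
   ennreal (?a k) * ennreal (A * (measure lborel E powr s' * (?w powr ?d * (\<rho> powr (?n * ?d) * (real k + 1) powr (?n * ?d)))))" by (rule mult_left_mono) simp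
  also have "... = ennreal (?a k * (A * (measure lborel E powr s' * (?w powr ?d * (\<rho> powr (?n * ?d) * (real k + 1) powr (?n * ?d))))))" by (rule ennreal_mult'[symmetric]) (use \<rho> in auto)
  also have "?a k * (A * (measure lborel E powr s' * (?w powr ?d * (\<rho> powr (?n * ?d) * (real k + 1) powr (?n * ?d))))) =
    A * measure lborel E powr s' * ?w powr ?d * \<rho> powr (a + ?n * ?d) * ((real k + 1) powr (a + ?n * ?d) * exp (- real k))" by (simp add: powr_add mult_ac)
  finally show "ennreal (?a k) * (NN x. F x * indicator E x * indicator ?B x) <=
   ennreal (A * measure lborel E powr s' * ?w powr ?d * \<rho> powr (a + ?n * ?d) * ((real k + 1) powr (a + ?n * ?d) * exp (- real k)))" .
 qed
 also have "... = ennreal (\<Sum>k. A * measure lborel E powr s' * ?w powr ?d * \<rho> powr (a + ?n * ?d) * ((real k + 1) powr (a + ?n * ?d) * exp (- real k)))" using A a s by (intro suminf_ennreal2 summable_mult summable_powr_exp) auto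
 also have "(\<Sum>k. A * measure lborel E powr s' * ?w powr ?d * \<rho> powr (a + ?n * ?d) * ((real k + 1) powr (a + ?n * ?d) * exp (- real k))) =
   A * measure lborel E powr s' * ?w powr ?d * \<rho> powr (a + ?n * ?d) * (\<Sum>k. (real k + 1) powr (a + ?n * ?d) * exp (- real k))" using a s by (intro suminf_mult summable_powr_exp) auto
 also have "\<rho> powr (a + ?n * ?d) = h powr (- a / 2 - ?n * ?d / 2)" unfolding \<rho>_def powr_powr by (rule arg_cong[where f = "%y. h powr y"]) (simp add: field_simps)
 finally show "nns E (%z. ennreal (norm z powr a * exp (- h * (norm z)^2)) * F z) <=
  ennreal (heat_const TYPE('a) a ?d * h powr (- a / 2 - ?n * ?d / 2) * A * measure lborel E powr s')" by (simp only: heat_const_def mult_ac)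
qed

text \<open>On each half of the interval one of the two powers is at most its value at t/2. The
  factor 2 pays for replacing t/2 by t in the end, b - a being at least -1.\<close>

lemma beta_integral_le:
 fixes a b :: real
 assumes a: "0 <= a" "a < 1" and b: "0 < b" "b <= 1" and t: "0 < t"
 shows "nns {0<..<t} (%q. ennreal ((t - q) powr (- a) * q powr (b - 1))) <=
  ennreal (2 * (1 / b + 1 / (1 - a)) * t powr (b - a))"
proof -
 have int1: "nns {0..t/2} (%q. ennreal (q powr (b - 1))) = ennreal ((t/2) powr b / b)"
 proof (rule nn_integral_has_integral_lebesgue')
  show "((%q. q powr (b - 1)) has_integral (t/2) powr b / b) {0..t/2}" using has_integral_powr_from_0[of "b - 1" "t/2"] b t by simp
 qed auto
 have int2: "nns {t/2..t} (%q. ennreal ((t - q) powr (- a))) = ennreal ((t/2) powr (1 - a) / (1 - a))"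
 proof -
  have "nns {t/2..t} (%q. ennreal ((t - q) powr (- a))) = (NN q. ennreal ((t - (t - q)) powr (- a)) * indicator {t/2..t} (t - q))" by (rule nn_integral_lborel_shift(2)[symmetric]) measurable
  also have "... = nns {0..t/2} (%q. ennreal (q powr (- a)))" by (intro nn_integral_cong) (auto simp: indicator_def)
  also have "... = ennreal ((t/2) powr (1 - a) / (1 - a))"
  proof (rule nn_integral_has_integral_lebesgue')
   show "((%q. q powr (- a)) has_integral (t/2) powr (1 - a) / (1 - a)) {0..t/2}" using has_integral_powr_from_0[of "- a" "t/2"] a t by simp
  qed auto
  finally show ?thesis .
 qed
 have le: "ennreal ((t - q) powr (- a) * q powr (b - 1)) * indicator {0<..<t} q <=
   ennreal ((t/2) powr (- a)) * (ennreal (q powr (b - 1)) * indicator {0..t/2} q) +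
   ennreal ((t/2) powr (b - 1)) * (ennreal ((t - q) powr (- a)) * indicator {t/2..t} q)" for q
 proof (cases "q \<in> {0<..<t}")
  case True
  show ?thesis
  proof (cases "q <= t/2")
   case le: True
   have "(t - q) powr (- a) <= (t/2) powr (- a)" using le True a t by (intro powr_mono2') auto
   hence "ennreal ((t - q) powr (- a) * q powr (b - 1)) <= ennreal ((t/2) powr (- a)) * ennreal (q powr (b - 1))" by (subst ennreal_mult'[symmetric]) (auto intro!: ennreal_leI mult_right_mono)
   thus ?thesis using le True by (simp add: add_increasing2)
  next
   case gt: False
   have "q powr (b - 1) <= (t/2) powr (b - 1)" using gt True b t by (intro powr_mono2') auto
   hence "ennreal ((t - q) powr (- a) * q powr (b - 1)) <= ennreal ((t/2) powr (b - 1)) * ennreal ((t - q) powr (- a))" by (subst ennreal_mult'[symmetric]) (auto intro!: ennreal_leI simp: mult.commute[of "(t - q) powr (- a)"] mult_right_mono)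
   thus ?thesis using gt True by (simp add: add_increasing)
  qed
 qed simp
 have "nns {0<..<t} (%q. ennreal ((t - q) powr (- a) * q powr (b - 1))) <=
   (NN q. ennreal ((t/2) powr (- a)) * (ennreal (q powr (b - 1)) * indicator {0..t/2} q) +
   ennreal ((t/2) powr (b - 1)) * (ennreal ((t - q) powr (- a)) * indicator {t/2..t} q))" by (intro nn_integral_mono le)
 also have "... = ennreal ((t/2) powr (- a)) * ennreal ((t/2) powr b / b) + ennreal ((t/2) powr (b - 1)) * ennreal ((t/2) powr (1 - a) / (1 - a))" by (subst nn_integral_add) (auto simp: nn_integral_cmult int1 int2)
 also have "... = ennreal ((t/2) powr (b - a) * (1 / b + 1 / (1 - a)))"
 proof -
  have 1: "(t/2) powr (- a) * (t/2) powr b = (t/2) powr (b - a)" "(t/2) powr (b - 1) * (t/2) powr (1 - a) = (t/2) powr (b - a)" by (simp_all flip: powr_add)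
  have "ennreal ((t/2) powr (- a)) * ennreal ((t/2) powr b / b) + ennreal ((t/2) powr (b - 1)) * ennreal ((t/2) powr (1 - a) / (1 - a)) =
   ennreal ((t/2) powr (- a) * (t/2) powr b / b + (t/2) powr (b - 1) * (t/2) powr (1 - a) / (1 - a))"
  proof -
   have e: "ennreal x * ennreal (y / z) = ennreal (x * y / z)" if "0 <= x" "0 <= y" "0 < z" for x y z :: real using that by (simp flip: ennreal_mult)
   show ?thesis using a b by (simp add: e flip: ennreal_plus)
  qed
  thus ?thesis unfolding 1 by (simp add: distrib_left)
 qed
 also have "... <= ennreal (2 * (1 / b + 1 / (1 - a)) * t powr (b - a))"
 proof (rule ennreal_leI)
  have "(t/2) powr (b - a) = t powr (b - a) * (1/2) powr (b - a)" using t by (simp flip: powr_mult)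
  also have "(1/2::real) powr (b - a) <= (1/2) powr (-1)" using a b by (intro powr_mono') auto
  also have "(1/2::real) powr (-1) = 2" by (simp add: powr_minus)
  finally have "(t/2) powr (b - a) <= t powr (b - a) * 2" by (simp add: mult_left_mono)
  thus "(t/2) powr (b - a) * (1 / b + 1 / (1 - a)) <= 2 * (1 / b + 1 / (1 - a)) * t powr (b - a)" using a b mult_right_mono[of "(t/2) powr (b - a)" "t powr (b - a) * 2" "1 / b + 1 / (1 - a)"] by (simp only: mult_ac) simp
 qed
 finally show ?thesis .
qed

section \<open>Rearrangements\<close>

definition rearr :: "('a::euclidean_space => ennreal) => real => ennreal" where
 "rearr F t = (INF q \<in> {q::real. 0 <= q \<and> dist_fn F q <= ennreal t}. ennreal q)"

lemma rearr_le: "0 <= q ==> dist_fn F q <= ennreal t ==> rearr F t <= ennreal q" unfolding rearr_def by (rule INF_lower) simp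

lemma rearr_antimono: "t <= t' ==> rearr F t' <= rearr F t" unfolding rearr_def by (rule INF_superset_mono) (auto intro: order_trans ennreal_leI)

lemma dist_fn_mono_AE:
 assumes "AE x in lborel. F x <= G x" and [measurable]: "F \<in> BM" "G \<in> BM"
 shows "dist_fn F l <= dist_fn G l"
proof -
 have G: "{x. ennreal l < G x} \<in> sets borel" by measurable
 show ?thesis unfolding dist_fn_def
 proof (rule emeasure_mono_AE)
  show "AE x in lborel. x \<in> {x. ennreal l < F x} \<longrightarrow> x \<in> {x. ennreal l < G x}" using assms(1) by eventually_elim (auto intro: less_le_trans)
 qed (use G in simp)
qed

lemma rearr_mono_AE:
 assumes "AE x in lborel. F x <= G x" and "F \<in> BM" "G \<in> BM"
 shows "rearr F t <= rearr G t" unfolding rearr_def by (rule INF_superset_mono) (auto intro: order_trans[OF dist_fn_mono_AE[OF assms]])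

lemma rearrangement_eq:
 fixes f :: "'n::finite cfun"
 assumes f: "f \<in> LM" and ae: "AE x in lebesgue. enorm (f x) = F x"
  and [measurable]: "F \<in> BM"
 shows "rearrangement f t = rearr F t"
proof -
 have "emeasure lebesgue {x. norm (f x) > q} = dist_fn F q" if "0 <= q" for q
 proof -
  have F: "{x. ennreal q < F x} \<in> sets borel" by measurable
  have "{x \<in> space lebesgue. norm (f x) > q} \<in> sets lebesgue" using f by measurable
  hence "emeasure lebesgue {x. norm (f x) > q} = emeasure lebesgue {x. ennreal q < F x}"
  proof (intro emeasure_eq_AE)
   show "AE x in lebesgue. (x \<in> {x. q < norm (f x)}) = (x \<in> {x. ennreal q < F x})" using ae by eventually_elim (metis ennreal_less_iff mem_Collect_eq that)
  qed (use F in simp_all)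
  thus ?thesis using F by (simp add: dist_fn_def)
 qed
 thus ?thesis unfolding rearrangement_def rearr_def by (intro arg_cong[where f = Inf] image_cong) auto
qed

lemma down_closed_borel:
 fixes S :: "real set"
 assumes "\<And>x y. x \<in> S ==> y <= x ==> y \<in> S"
 shows "S \<in> sets borel"
proof -
 have "mono (%t. - indicator S t :: real)" by (intro monoI) (auto simp: indicator_def intro: assms)
 hence [measurable]: "(%t. - indicator S t :: real) \<in> BM" by (rule borel_measurable_mono)
 have "{t \<in> space borel. - indicator S t < (- 1/2 :: real)} \<in> sets borel" by measurable
 moreover have "{t \<in> space borel. - indicator S t < (- 1/2 :: real)} = S" by (auto simp: indicator_def split: if_splits)
 ultimately show ?thesis by simp
qed

text \<open>The rearrangement decreases, so its superlevel sets are closed downwards.\<close>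

lemma rearr_borel[measurable]: "rearr F \<in> BM"
proof (rule borel_measurableI_greater)
 fix a
 show "{x \<in> space borel. a < rearr F x} \<in> sets borel" by (rule down_closed_borel) (auto intro: less_le_trans rearr_antimono)
qed

text \<open>Chebyshev's inequality on the superlevel set. That set is not known to have finite
  measure beforehand, so it is first cut by balls.\<close>

lemma rearr_le_if_wbd:
 fixes F :: "'a::euclidean_space => ennreal"
 assumes w: "wbd s A F" and A: "0 <= A" and s: "s < 1" and t: "0 < t"
  and [measurable]: "F \<in> BM"
 shows "rearr F t <= ennreal (A * t powr (s - 1))"
proof (rule rearr_le)
 let ?q = "A * t powr (s - 1)"
 show "0 <= ?q" using A by simp
 let ?S = "{x. ennreal ?q < F x}"
 have S: "?S \<in> sets borel" by measurable
 have k: "emeasure lborel (?S \<inter> cball 0 (real k)) <= ennreal t" for k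
 proof (rule ccontr)
  assume n: "\<not> emeasure lborel (?S \<inter> cball 0 (real k)) <= ennreal t"
  define E where "E = ?S \<inter> cball (0::'a) (real k)"
  have ES: "ennreal ?q < F x" if "x \<in> E" for x using that by (simp add: E_def)
  have E[measurable]: "E \<in> sets borel" unfolding E_def by (rule sets.Int[OF S]) (rule borel_closed[OF closed_cball])
  have "emeasure lborel E <= emeasure lborel (cball (0::'a) (real k))" by (intro emeasure_mono) (auto simp: E_def)
  also have "... < \<infinity>" by (simp add: emeasure_cball)
  finally have fin: "emeasure lborel E < \<infinity>" .
  hence eE: "emeasure lborel E = ennreal (measure lborel E)" by (simp add: emeasure_eq_ennreal_measure)
  have m: "measure lborel E > t" using n[folded E_def] t unfolding eE by (simp add: not_le ennreal_less_iff)
  have le: "nns E F <= ennreal (A * measure lborel E powr s)" by (rule wbdD[OF w E fin])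
  show False
  proof (cases "A = 0")
   \<comment> \<open>For A = 0 the constant cannot be cancelled; instead F vanishes almost
     everywhere on E although it is positive there.\<close>
   case True
   hence "(NN x. F x * indicator E x) = 0" using le by simp
   hence "AE x in lborel. F x * indicator E x = 0" by (subst (asm) nn_integral_0_iff_AE) auto
   hence "AE x in lborel. x \<notin> E"
    proof eventually_elim
    case (elim x)
    thus ?case using ES[of x] by (cases "x \<in> E") auto
   qed
   hence "emeasure lborel E = 0" using AE_iff_null_sets[of E lborel] E by (simp add: null_sets_def)
   thus False using m t unfolding eE by simp
  next
   case False
   have "ennreal ?q * emeasure lborel E = (NN x. ennreal ?q * indicator E x)" using E by (simp add: nn_integral_cmult_indicator)
   also have "... <= nns E F" by (intro nn_integral_mono) (use ES in \<open>auto simp: indicator_def less_imp_le\<close>)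
   also note le
   finally have "ennreal (?q * measure lborel E) <= ennreal (A * measure lborel E powr s)" unfolding eE using A by (simp add: ennreal_mult)
   hence "A * (t powr (s - 1) * measure lborel E) <= A * measure lborel E powr s" using A by (simp add: mult.assoc)
   hence "t powr (s - 1) * measure lborel E <= measure lborel E powr s" using False A by simp
   moreover have "measure lborel E powr s = measure lborel E powr (s - 1) * measure lborel E" using m t by (simp add: powr_diff)
   ultimately have "t powr (s - 1) <= measure lborel E powr (s - 1)" using m t by simp
   moreover have "measure lborel E powr (s - 1) < t powr (s - 1)" using m t s by (intro powr_less_mono2_neg) auto
   ultimately show False by simp
  qed
 qed
 have "dist_fn F ?q = (NN x. indicator ?S x)" using S by (simp add: dist_fn_def)
 also have "... = (SUP k. (nns (cball 0 (real k)) (%x. indicator ?S x)))" by (rule nn_integral_SUP_cball) (use S in simp)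
 also have "... <= ennreal t"
 proof (rule SUP_least)
  fix i
  have "nns (cball 0 (real i)) (%x. indicator ?S x) = emeasure lborel (?S \<inter> cball 0 (real i))"
  proof -
   have "nns (cball 0 (real i)) (%x. indicator ?S x) = (NN x. indicator (?S \<inter> cball 0 (real i)) x)" by (intro nn_integral_cong) (auto simp: indicator_def)
   also have "... = emeasure lborel (?S \<inter> cball 0 (real i))" unfolding sets_lborel by (rule nn_integral_indicator) (unfold sets_lborel, rule sets.Int[OF S], rule borel_closed[OF closed_cball])
   finally show ?thesis .
  qed
  thus "nns (cball 0 (real i)) (%x. indicator ?S x) <= ennreal t" using k by simp
 qed
 finally show "dist_fn F ?q <= ennreal t" .
qed

lemma dist_fn_borel:
 assumes "F \<in> BM"
 shows "(%l. dist_fn F l * indicator {0<..} l) \<in> BM"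
proof -
 have "epow x 1 = x" for x by (cases x) (auto simp: epow_def)
 thus ?thesis using epow_dist_fn_borel[OF assms, of 1] by simp
qed

text \<open>Tonelli's theorem in the levels l and the measures t: if t is below the distribution
  function at l, then l is at most the rearrangement at t. With different weights \<psi> this is the
  common source of the comparisons with set integrals and with \<open>lor1\<close>.\<close>

lemma layer_rearr:
 assumes F: "F \<in> BM" and [measurable]: "\<psi> \<in> BM"
 shows "(nns {0<..} (%l. (nns {0<..} (%t. \<psi> t * indicator {t. ennreal t < dist_fn F l} t))))
  <= nns {0<..} (%t. \<psi> t * rearr F t)"
proof -
 let ?D = "%l. dist_fn F l * indicator {0<..} l"
 note dist_fn_borel[OF F, measurable]
 define Q where "Q = {p \<in> space ((lborel :: real measure) \<Otimes>\<^sub>M (lborel :: real measure)). 0 < fst p \<and> 0 < snd p \<and> ennreal (snd p) < ?D (fst p)}"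
 have "Q \<in> sets ((lborel :: real measure) \<Otimes>\<^sub>M (lborel :: real measure))" unfolding Q_def by measurable
 hence mQ: "(%p. \<psi> (snd p) * indicator Q p) \<in> borel_measurable ((lborel :: real measure) \<Otimes>\<^sub>M (lborel :: real measure))" by (intro borel_measurable_times_ennreal borel_measurable_indicator measurable_compose[OF measurable_snd]) auto
 have "(%(l, t). \<psi> t * indicator {t. ennreal t < dist_fn F l} t * indicator {0<..} t * indicator {0<..} l) = (%p. \<psi> (snd p) * indicator Q p)" by (rule ext) (simp add: Q_def indicator_def space_pair_measure split_beta')
 with mQ have m: "(%(l, t). \<psi> t * indicator {t. ennreal t < dist_fn F l} t * indicator {0<..} t * indicator {0<..} l) \<in> borel_measurable ((lborel :: real measure) \<Otimes>\<^sub>M (lborel :: real measure))" by (simp only:)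
 have "nns {0<..} (%l. (nns {0<..} (%t. \<psi> t * indicator {t. ennreal t < dist_fn F l} t))) =
  (NN l. (NN t. \<psi> t * indicator {t. ennreal t < dist_fn F l} t * indicator {0<..} t * indicator {0<..} l))" by (intro nn_integral_cong) (auto simp: indicator_def)
 also have "... = (NN t. (NN l. \<psi> t * indicator {t. ennreal t < dist_fn F l} t * indicator {0<..} t * indicator {0<..} l))" by (rule lborel_pair.Fubini'[OF m, symmetric])
 also have "... <= nns {0<..} (%t. \<psi> t * rearr F t)"
 proof (rule nn_integral_mono)
  fix t :: real
  have "(NN l. \<psi> t * indicator {t. ennreal t < dist_fn F l} t * indicator {0<..} t * indicator {0<..} l)
   <= (NN l. (\<psi> t * indicator {0<..} t) * indicator {l. 0 < l \<and> ennreal l <= rearr F t} l)"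
  proof (intro nn_integral_mono)
   fix l :: real
   have "ennreal l <= rearr F t" if l: "0 < l" "ennreal t < dist_fn F l" unfolding rearr_def
   proof (rule INF_greatest)
    fix q assume q: "q \<in> {q. 0 <= q \<and> dist_fn F q <= ennreal t}"
    have "l <= q"
    proof (rule ccontr)
    assume "\<not> l <= q"
    hence "dist_fn F l <= dist_fn F q" using F by (intro dist_fn_antimono) auto
    thus False using l q by auto
    qed
    thus "ennreal l <= ennreal q" by (rule ennreal_leI)
   qed
   thus "\<psi> t * indicator {t. ennreal t < dist_fn F l} t * indicator {0<..} t * indicator {0<..} l <=
    (\<psi> t * indicator {0<..} t) * indicator {l. 0 < l \<and> ennreal l <= rearr F t} l" by (auto simp: indicator_def)
  qed
  also have "... = (\<psi> t * indicator {0<..} t) * emeasure lborel {l. 0 < l \<and> ennreal l <= rearr F t}" by (rule nn_integral_cmult_indicator) (simp, measurable)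
  also have "... <= (\<psi> t * indicator {0<..} t) * rearr F t"
  proof (rule mult_left_mono)
   show "emeasure lborel {l. 0 < l \<and> ennreal l <= rearr F t} <= rearr F t"
   proof (cases "rearr F t")
    case (real r)
    hence "{l. 0 < l \<and> ennreal l <= rearr F t} = {0<..r}" by (auto simp: ennreal_le_iff)
    thus ?thesis using real by simp
   qed simp
  qed simp
  finally show "(NN l. \<psi> t * indicator {t. ennreal t < dist_fn F l} t * indicator {0<..} t * indicator {0<..} l) <= \<psi> t * rearr F t * indicator {0<..} t" by (simp only: mult_ac)
 qed
 finally show ?thesis .
qed

lemma nn_integral_powr_0:
 fixes a c :: real
 assumes "a > -1" "c \<ge> 0"
 shows "nns {0<..c} (%t. ennreal (t powr a)) = ennreal (c powr (a + 1) / (a + 1))"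
  and "nns {0<..<c} (%t. ennreal (t powr a)) = ennreal (c powr (a + 1) / (a + 1))"
proof -
 have 1: "nns {0..c} (%t. ennreal (t powr a)) = ennreal (c powr (a + 1) / (a + 1))" by (rule nn_integral_has_integral_lebesgue'[OF _ has_integral_powr_from_0[OF assms]]) simp
 have "nns {0<..c} (%t. ennreal (t powr a)) = nns {0..c} (%t. ennreal (t powr a))" by (intro nn_integral_cong_AE AE_I[where N = "{0}"]) (auto simp: indicator_def)
 thus "nns {0<..c} (%t. ennreal (t powr a)) = ennreal (c powr (a + 1) / (a + 1))" using 1 by simp
 have "nns {0<..<c} (%t. ennreal (t powr a)) = nns {0..c} (%t. ennreal (t powr a))" by (intro nn_integral_cong_AE AE_I[where N = "{0, c}"]) (auto simp: indicator_def emeasure_lborel_countable split: if_splits)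
 thus "nns {0<..<c} (%t. ennreal (t powr a)) = ennreal (c powr (a + 1) / (a + 1))" using 1 by simp
qed

text \<open>The Hardy-Littlewood inequality: the integral over E is at most the integral of the
  rearrangement over (0, |E|). The factor 1/s comes from integrating t^(s - 1).\<close>

lemma wbd_if_rearr_le:
 fixes F :: "'a::euclidean_space => ennreal"
 assumes r: "\<And>t. 0 < t ==> rearr F t <= ennreal (A * t powr (s - 1))" and A: "0 <= A" and s: "0 < s"
  and [measurable]: "F \<in> BM"
 shows "wbd s (A / s) F" unfolding wbd_def
proof (intro ballI impI)
 fix E :: "'a set" assume E[measurable]: "E \<in> sets borel" and fin: "emeasure lborel E < \<infinity>"
 let ?e = "measure lborel E"
 have eE: "emeasure lborel E = ennreal ?e" using fin by (simp add: emeasure_eq_ennreal_measure)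
 have "nns E F = nns {0<..} (%l. (nns {x. ennreal l < F x} (%x. indicator E x)))" by (rule layer_cake) auto
 also have "... <= nns {0<..} (%l. (nns {0<..} (%t. indicator {0<..<?e} t * indicator {t. ennreal t < dist_fn F l} t)))"
 proof (intro nn_integral_mono mult_right_mono)
  fix l
  have S[measurable]: "{x. ennreal l < F x} \<in> sets borel" by measurable
  have "nns {x. ennreal l < F x} (%x. indicator E x) = emeasure lborel ({x. ennreal l < F x} \<inter> E)"
  proof -
   have "nns {x. ennreal l < F x} (%x. indicator E x) = (NN x. indicator ({x. ennreal l < F x} \<inter> E) x)" by (intro nn_integral_cong) (auto simp: indicator_def)
   also have "... = emeasure lborel ({x. ennreal l < F x} \<inter> E)" by (rule nn_integral_indicator) (use sets.Int[OF S E] in simp)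
   finally show ?thesis .
  qed
  also have "... <= min (ennreal ?e) (dist_fn F l)" unfolding dist_fn_def eE[symmetric] by (auto intro!: emeasure_mono)
  also have "... = (NN t. indicator {t. 0 < t \<and> ennreal t < min (ennreal ?e) (dist_fn F l)} t)" by (rule nn_integral_layer[symmetric])
  also have "... = nns {0<..} (%t. indicator {0<..<?e} t * indicator {t. ennreal t < dist_fn F l} t)" by (intro nn_integral_cong) (auto simp: indicator_def ennreal_less_iff)
  finally show "nns {x. ennreal l < F x} (%x. indicator E x) <= nns {0<..} (%t. indicator {0<..<?e} t * indicator {t. ennreal t < dist_fn F l} t)" .
 qed simp
 also have "... <= nns {0<..} (%t. indicator {0<..<?e} t * rearr F t)" by (rule layer_rearr) auto
 also have "... <= (NN t. ennreal A * (ennreal (t powr (s - 1)) * indicator {0<..<?e} t))"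
 proof (intro nn_integral_mono)
  fix t :: real
  show "indicator {0<..<?e} t * rearr F t * indicator {0<..} t <= ennreal A * (ennreal (t powr (s - 1)) * indicator {0<..<?e} t)" using r[of t] A by (auto simp: indicator_def ennreal_mult')
 qed
 also have "... = ennreal A * ennreal (?e powr (s - 1 + 1) / (s - 1 + 1))" using s by (subst nn_integral_cmult) (auto simp: nn_integral_powr_0)
 also have "... = ennreal (A / s * ?e powr s)" using A s by (simp flip: ennreal_mult')
 finally show "nns E F <= ennreal (A / s * ?e powr s)" .
qed

text \<open>The r-th power of the Lorentz norm, without the outer root so that it can be estimated
  additively; s stands for 1/q and 1 - s for the reciprocal of the conjugate exponent.\<close>

definition lorint :: "real => real => ('a::euclidean_space => ennreal) => ennreal" where
 "lorint s r F = nns {0<..} (%t. epow (ennreal (t powr (1 - s)) * rearr F t) r * ennreal (1 / t))"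

text \<open>The power 1 - s of the distribution function D is itself the integral of (1 - s) t^(-s)
  over (0, D); inserting this and exchanging the integrals brings in the rearrangement.\<close>

lemma lor1_le_lorint:
 assumes s: "0 < s" "s < 1" and F: "F \<in> BM"
 shows "lor1 s F <= ennreal (1 - s) * lorint s 1 F"
proof -
 have "epow (dist_fn F l) (1 - s) = nns {0<..} (%t. ennreal ((1 - s) * t powr (- s)) * indicator {t. ennreal t < dist_fn F l} t)" for l
 proof -
  have base: "(NN t. ennreal ((1 - s) * t powr (- s)) * indicator {0<..<d} t) = ennreal (d powr (1 - s))" if "0 <= d" for d
  proof -
   have "(NN t. ennreal ((1 - s) * t powr (- s)) * indicator {0<..<d} t) = (NN t. ennreal (1 - s) * (ennreal (t powr (- s)) * indicator {0<..<d} t))" using s by (intro nn_integral_cong) (simp add: ennreal_mult' mult.assoc)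
   also have "... = ennreal (1 - s) * ennreal (d powr (- s + 1) / (- s + 1))" using s that by (subst nn_integral_cmult) (auto simp: nn_integral_powr_0)
   finally show ?thesis using s by (simp flip: ennreal_mult' add: add.commute)
  qed
  show ?thesis
  proof (cases "dist_fn F l")
   case (real d)
   hence "nns {0<..} (%t. ennreal ((1 - s) * t powr (- s)) * indicator {t. ennreal t < dist_fn F l} t) =
    (NN t. ennreal ((1 - s) * t powr (- s)) * indicator {0<..<d} t)" by (intro nn_integral_cong) (auto simp: indicator_def ennreal_less_iff)
   thus ?thesis using real by (simp add: base epow_ennreal)
  next
   case top
   have "ennreal (real k) <= nns {0<..} (%t. ennreal ((1 - s) * t powr (- s)) * indicator {t. ennreal t < dist_fn F l} t)" for k
   proof -
    have "ennreal (real k) = ennreal ((real k powr (1 / (1 - s))) powr (1 - s))" using s by (simp add: powr_powr)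
    also have "... = (NN t. ennreal ((1 - s) * t powr (- s)) * indicator {0<..<real k powr (1 / (1 - s))} t)" by (simp add: base)
    also have "... <= nns {0<..} (%t. ennreal ((1 - s) * t powr (- s)) * indicator {t. ennreal t < dist_fn F l} t)" using top by (intro nn_integral_mono) (auto simp: indicator_def)
    finally show ?thesis .
   qed
   hence "nns {0<..} (%t. ennreal ((1 - s) * t powr (- s)) * indicator {t. ennreal t < dist_fn F l} t) = top" by (rule ennreal_eq_topI)
   thus ?thesis using top by (simp add: epow_def)
  qed
 qed
 hence "lor1 s F = nns {0<..} (%l. (nns {0<..} (%t. ennreal ((1 - s) * t powr (- s)) * indicator {t. ennreal t < dist_fn F l} t)))" by (simp add: lor1_def)
 also have "... <= nns {0<..} (%t. ennreal ((1 - s) * t powr (- s)) * rearr F t)" by (rule layer_rearr[OF F]) measurable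
 also have "... = (NN t. ennreal (1 - s) * (epow (ennreal (t powr (1 - s)) * rearr F t) 1 * ennreal (1 / t) * indicator {0<..} t))"
 proof (intro nn_integral_cong)
  fix t :: real
  have e1: "epow x 1 = x" for x by (cases x) (auto simp: epow_def)
  show "ennreal ((1 - s) * t powr (- s)) * rearr F t * indicator {0<..} t =
   ennreal (1 - s) * (epow (ennreal (t powr (1 - s)) * rearr F t) 1 * ennreal (1 / t) * indicator {0<..} t)"
  proof (cases "0 < t")
   case True
   have "ennreal (t powr (1 - s)) * rearr F t * ennreal (1 / t) = ennreal (t powr (1 - s) * (1 / t)) * rearr F t"
   proof -
    have "ennreal (t powr (1 - s) * (1 / t)) = ennreal (t powr (1 - s)) * ennreal (1 / t)" by (rule ennreal_mult) (use True in auto)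
    thus ?thesis by (simp only: mult_ac)
   qed
   also have "t powr (1 - s) * (1 / t) = t powr (- s)" using True by (simp add: powr_diff powr_minus_divide)
   finally show ?thesis using True s by (simp add: e1 ennreal_mult mult.assoc)
  qed simp
 qed
 also have "... = ennreal (1 - s) * lorint s 1 F" unfolding lorint_def by (rule nn_integral_cmult) measurable
 finally show ?thesis .
qed

text \<open>The rearrangement decreases, so on (0, t] it is bounded below by its value at t, and the
  remaining power of the variable is integrated explicitly.\<close>

lemma rearr_le_if_lorint:
 assumes L: "lorint s r F <= ennreal M" and M: "0 <= M" and s: "s < 1" and r: "0 < r" and t: "0 < t"
 shows "rearr F t <= ennreal (((1 - s) * r * M) powr (1 / r) * t powr (s - 1))"
proof -
 have lower: "epow (rearr F t) r * ennreal (t powr ((1 - s) * r) / ((1 - s) * r)) <= ennreal M"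
 proof -
  have sr: "(1 - s) * r > 0" using s r by simp
  have "epow (rearr F t) r * ennreal (t powr ((1 - s) * r - 1 + 1) / ((1 - s) * r - 1 + 1)) =
    epow (rearr F t) r * nns {0<..t} (%q. ennreal (q powr ((1 - s) * r - 1)))" using sr t by (subst nn_integral_powr_0) auto
  also have "... = (NN q. epow (rearr F t) r * (ennreal (q powr ((1 - s) * r - 1)) * indicator {0<..t} q))" by (rule nn_integral_cmult[symmetric]) measurable
  also have "... <= lorint s r F" unfolding lorint_def
  proof (intro nn_integral_mono)
   fix q :: real
   show "epow (rearr F t) r * (ennreal (q powr ((1 - s) * r - 1)) * indicator {0<..t} q) <=
    epow (ennreal (q powr (1 - s)) * rearr F q) r * ennreal (1 / q) * indicator {0<..} q"
   proof (cases "0 < q \<and> q <= t")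
    case True
    have "epow (rearr F t) r * ennreal (q powr ((1 - s) * r)) = epow (ennreal (q powr (1 - s)) * rearr F t) r"
    proof (cases "rearr F t")
    case (real x)
    thus ?thesis using True by (simp add: epow_ennreal powr_mult powr_powr mult.commute flip: ennreal_mult)
    next
    case top
    thus ?thesis using True by (simp add: epow_def ennreal_top_mult ennreal_mult_top)
    qed
    also have "... <= epow (ennreal (q powr (1 - s)) * rearr F q) r" using True r by (intro epow_mono mult_left_mono rearr_antimono) auto
    finally have "epow (rearr F t) r * ennreal (q powr ((1 - s) * r)) * ennreal (1 / q) <= epow (ennreal (q powr (1 - s)) * rearr F q) r * ennreal (1 / q)" by (rule mult_right_mono) simp
    moreover have "ennreal (q powr ((1 - s) * r)) * ennreal (1 / q) = ennreal (q powr ((1 - s) * r - 1))" using True by (simp add: powr_diff flip: ennreal_mult)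
    ultimately show ?thesis using True by (simp add: mult.assoc)
   qed (auto simp: indicator_def)
  qed
  finally show ?thesis using L by (simp add: order_trans)
 qed
 have sr: "(1 - s) * r > 0" using s r by simp
 show ?thesis
 proof (cases "rearr F t")
  case (real x)
  have "ennreal (x powr r * (t powr ((1 - s) * r) / ((1 - s) * r))) <= ennreal M" using lower real sr by (simp add: epow_ennreal flip: ennreal_mult)
  hence "x powr r * (t powr ((1 - s) * r) / ((1 - s) * r)) <= M" using M by simp
  hence "x powr r <= ((1 - s) * r * M) / t powr ((1 - s) * r)" using sr t by (simp add: field_simps)
  hence "(x powr r) powr (1 / r) <= (((1 - s) * r * M) / t powr ((1 - s) * r)) powr (1 / r)" using r by (intro powr_mono2) auto
  also have "(x powr r) powr (1 / r) = x" using r real by (simp add: powr_powr)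
  also have "(((1 - s) * r * M) / t powr ((1 - s) * r)) powr (1 / r) = ((1 - s) * r * M) powr (1 / r) / t powr (1 - s)" using r sr M t by (simp add: powr_divide powr_powr)
  also have "... = ((1 - s) * r * M) powr (1 / r) * t powr (s - 1)" using t powr_minus_divide[of t "1 - s"] by simp
  finally show ?thesis using real by (simp add: ennreal_leI)
 next
  case top
  have "ennreal (t powr ((1 - s) * r) / ((1 - s) * r)) > 0" using sr t by simp
  thus ?thesis using lower top sr t r s by (auto simp: epow_def ennreal_top_mult top_unique split: if_splits)
 qed
qed

lemma nn_integral_powr_inf:
 fixes a c :: real
 assumes "a < -1" "c > 0"
 shows "nns {c..} (%t. ennreal (t powr a)) = ennreal (- (c powr (a + 1)) / (a + 1))" by (rule nn_integral_has_integral_lebesgue'[OF _ has_integral_powr_to_inf[OF assms]]) simp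

text \<open>Real interpolation, split at the point \<rho> where the two weak bounds cross: the one
  with the larger index is integrable near 0, the other near infinity. Both carry the same A through
  the normalisation by powers of \<rho>, so \<rho> disappears from the result.\<close>

lemma lorint_interpolate:
 assumes r1: "\<And>t. 0 < t ==> rearr F t <= ennreal (A * \<rho> powr (s - s1) * t powr (s1 - 1))"
  and r2: "\<And>t. 0 < t ==> rearr F t <= ennreal (A * \<rho> powr (s - s2) * t powr (s2 - 1))"
  and s: "s2 < s" "s < s1" and r: "0 < r" and \<rho>: "0 < \<rho>" and A: "0 <= A"
 shows "lorint s r F <= ennreal (A powr r * (1 / (r * (s1 - s)) + 1 / (r * (s - s2))))"
proof -
 define B where "B = A powr r"
 have gen: "epow (ennreal (t powr (1 - s)) * rearr F t) r * ennreal (1 / t) <= ennreal (B * \<rho> powr (r * (s - z))) * ennreal (t powr (r * (z - s) - 1))"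
  if t: "0 < t" and z: "rearr F t <= ennreal (A * \<rho> powr (s - z) * t powr (z - 1))" for t z
 proof -
  have "ennreal (t powr (1 - s)) * rearr F t <= ennreal (t powr (1 - s)) * ennreal (A * \<rho> powr (s - z) * t powr (z - 1))" by (intro mult_left_mono z) simp
  also have "... = ennreal (A * \<rho> powr (s - z) * (t powr (1 - s) * t powr (z - 1)))" using A by (simp add: mult_ac flip: ennreal_mult)
  also have "t powr (1 - s) * t powr (z - 1) = t powr (z - s)" by (simp flip: powr_add)
  finally have "epow (ennreal (t powr (1 - s)) * rearr F t) r <= epow (ennreal (A * \<rho> powr (s - z) * t powr (z - s))) r" using r by (intro epow_mono) auto
  also have "... = ennreal (B * \<rho> powr (r * (s - z)) * t powr (r * (z - s)))" using A by (simp add: epow_ennreal powr_mult powr_powr B_def mult.commute)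
  finally have "epow (ennreal (t powr (1 - s)) * rearr F t) r * ennreal (1 / t) <= ennreal (B * \<rho> powr (r * (s - z)) * t powr (r * (z - s))) * ennreal (1 / t)" by (rule mult_right_mono) simp
  also have "... = ennreal (B * \<rho> powr (r * (s - z)) * (t powr (r * (z - s)) * (1 / t)))" using t by (simp add: B_def mult_ac flip: ennreal_mult)
  also have "t powr (r * (z - s)) * (1 / t) = t powr (r * (z - s) - 1)" using t by (simp add: powr_diff)
  finally show ?thesis by (simp add: B_def ennreal_mult)
 qed
 have "lorint s r F <= (NN t. ennreal (B * \<rho> powr (r * (s - s1))) * (ennreal (t powr (r * (s1 - s) - 1)) * indicator {0<..\<rho>} t) +
   ennreal (B * \<rho> powr (r * (s - s2))) * (ennreal (t powr (r * (s2 - s) - 1)) * indicator {\<rho>..} t))" unfolding lorint_def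
 proof (intro nn_integral_mono)
  fix t :: real
  show "epow (ennreal (t powr (1 - s)) * rearr F t) r * ennreal (1 / t) * indicator {0<..} t <=
   ennreal (B * \<rho> powr (r * (s - s1))) * (ennreal (t powr (r * (s1 - s) - 1)) * indicator {0<..\<rho>} t) +
   ennreal (B * \<rho> powr (r * (s - s2))) * (ennreal (t powr (r * (s2 - s) - 1)) * indicator {\<rho>..} t)"
  proof (cases "0 < t")
   case True
   show ?thesis
   proof (cases "t <= \<rho>")
    case le: True
    thus ?thesis using gen[OF True r1[OF True]] True by (simp add: add_increasing2)
   next
    case False
    thus ?thesis using gen[OF True r2[OF True]] True by (simp add: add_increasing)
   qed
  qed simp
 qed
 also have "... = ennreal (B * \<rho> powr (r * (s - s1))) * ennreal (\<rho> powr (r * (s1 - s) - 1 + 1) / (r * (s1 - s) - 1 + 1)) +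
   ennreal (B * \<rho> powr (r * (s - s2))) * ennreal (- (\<rho> powr (r * (s2 - s) - 1 + 1)) / (r * (s2 - s) - 1 + 1))"
 proof -
  have "r * (s1 - s) > 0" "r * (s2 - s) < 0" using r s by (auto simp: mult_pos_neg)
  thus ?thesis using \<rho> by (subst nn_integral_add) (auto simp: nn_integral_cmult nn_integral_powr_0 nn_integral_powr_inf)
 qed
 also have "... = ennreal (B * (1 / (r * (s1 - s)) + 1 / (r * (s - s2))))"
 proof -
  have 1: "\<rho> powr (r * (s - s1)) * \<rho> powr (r * (s1 - s)) = 1" "\<rho> powr (r * (s - s2)) * \<rho> powr (r * (s2 - s)) = 1" using \<rho> by (simp_all flip: powr_add add: algebra_simps)
  have eq: "r * (s2 - s) = - (r * (s - s2))" by (simp add: algebra_simps)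
  have p: "r * (s1 - s) > 0" "r * (s - s2) > 0" using r s by auto
  have "ennreal (B * \<rho> powr (r * (s - s1))) * ennreal (\<rho> powr (r * (s1 - s) - 1 + 1) / (r * (s1 - s) - 1 + 1)) =
    ennreal (B * (\<rho> powr (r * (s - s1)) * \<rho> powr (r * (s1 - s))) / (r * (s1 - s)))" using p by (simp add: B_def mult.assoc flip: ennreal_mult)
  moreover have "ennreal (B * \<rho> powr (r * (s - s2))) * ennreal (- (\<rho> powr (r * (s2 - s) - 1 + 1)) / (r * (s2 - s) - 1 + 1)) =
    ennreal (B * (\<rho> powr (r * (s - s2)) * \<rho> powr (r * (s2 - s))) / (r * (s - s2)))" using p by (simp add: B_def mult.assoc eq flip: ennreal_mult)
  ultimately show ?thesis using p unfolding 1 by (simp add: B_def distrib_left flip: ennreal_plus)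
 qed
 finally show ?thesis unfolding B_def .
qed

section \<open>Lorentz norms\<close>

lemma epow_add_le:
 assumes "1 <= r"
 shows "epow (x + y) r <= ennreal (2 powr r) * (epow x r + epow y r)"
proof -
 have *: "epow (u + v) r <= ennreal (2 powr r) * epow v r" if "u <= v" for u v
 proof -
  have "u + v <= 2 * v" using that by (simp add: mult_2 add_right_mono)
  hence "epow (u + v) r <= epow (2 * v) r" using assms by (intro epow_mono) auto
  also have "... = ennreal (2 powr r) * epow v r"
  proof (cases v)
   case (real a)
   hence "2 * v = ennreal (2 * a)" by (simp add: ennreal_mult)
   hence "epow (2 * v) r = ennreal ((2 * a) powr r)" using real by (simp only: epow_ennreal)
   thus ?thesis using real by (simp add: epow_ennreal powr_mult ennreal_mult)
  qed (simp add: epow_def ennreal_mult_top)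
  finally show ?thesis .
 qed
 show ?thesis
 proof (cases "x <= y")
  case True
  thus ?thesis using *[OF True] by (rule_tac order_trans[OF *[OF True]]) (auto intro!: mult_left_mono)
 next
  case False
  hence "y <= x" by simp
  from *[OF this] show ?thesis by (subst add.commute[of x y], rule_tac order_trans) (auto intro!: mult_left_mono)
 qed
qed

lemma epow_mult: "0 <= c ==> epow (ennreal c * x) r = ennreal (c powr r) * epow x r" if "0 < c" using that by (cases x) (auto simp: epow_def powr_mult ennreal_mult[symmetric] ennreal_mult_top)

lemma dist_fn_add_le:
 assumes [measurable]: "F \<in> BM" "G \<in> BM" and "0 <= a" "0 <= b"
 shows "dist_fn (%x. F x + G x) (a + b) <= dist_fn F a + dist_fn G b"
proof -
 have 1: "{x. ennreal a < F x} \<in> sets lborel" "{x. ennreal b < G x} \<in> sets lborel" unfolding sets_lborel by measurable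
 have "{x. ennreal (a + b) < F x + G x} \<subseteq> {x. ennreal a < F x} \<union> {x. ennreal b < G x}"
 proof
  fix x assume x: "x \<in> {x. ennreal (a + b) < F x + G x}"
  show "x \<in> {x. ennreal a < F x} \<union> {x. ennreal b < G x}"
  proof (rule ccontr)
   assume "x \<notin> {x. ennreal a < F x} \<union> {x. ennreal b < G x}"
   hence "F x <= ennreal a" "G x <= ennreal b" by auto
   hence "F x + G x <= ennreal (a + b)" using assms(3,4) by (simp add: add_mono)
   thus False using x by simp
  qed
 qed
 hence "dist_fn (%x. F x + G x) (a + b) <= emeasure lborel ({x. ennreal a < F x} \<union> {x. ennreal b < G x})" unfolding dist_fn_def using 1 by (intro emeasure_mono sets.Un)
 also have "... <= dist_fn F a + dist_fn G b" unfolding dist_fn_def using 1 by (intro emeasure_subadditive)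
 finally show ?thesis .
qed

text \<open>Levels a and b that are admissible at t for the summands give the level a + b,
  admissible at 2 t for the sum. The doubling of t is what costs a constant in the triangle
  inequality below.\<close>

lemma rearr_add_le:
 assumes F: "F \<in> BM" "G \<in> BM" and t: "0 <= t"
 shows "rearr (%x. F x + G x) (2 * t) <= rearr F t + rearr G t"
proof -
 let ?A = "{q::real. 0 <= q \<and> dist_fn F q <= ennreal t}" and ?B = "{q::real. 0 <= q \<and> dist_fn G q <= ennreal t}"
 have ab: "rearr (%x. F x + G x) (2 * t) <= ennreal a + ennreal b" if "a \<in> ?A" "b \<in> ?B" for a b
 proof -
  have "dist_fn (%x. F x + G x) (a + b) <= dist_fn F a + dist_fn G b" using that by (intro dist_fn_add_le F) auto
  also have "... <= ennreal t + ennreal t" using that by (intro add_mono) auto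
  also have "... = ennreal (2 * t)" using t by (simp flip: ennreal_plus)
  finally have "rearr (%x. F x + G x) (2 * t) <= ennreal (a + b)" using that by (intro rearr_le) auto
  thus ?thesis using that by (simp add: ennreal_plus)
 qed
 show ?thesis
 proof (cases "rearr F t = top \<or> rearr G t = top")
  case False
  show ?thesis
  proof (rule ennreal_le_epsilon)
   fix e :: real assume e: "0 < e"
   have "rearr F t < rearr F t + ennreal (e/2)" "rearr G t < rearr G t + ennreal (e/2)" using False e by (auto simp: top.not_eq_extremum ennreal_add_left_cancel_less[of _ 0, simplified])
   then obtain a b where ab': "a \<in> ?A" "ennreal a < rearr F t + ennreal (e/2)" "b \<in> ?B" "ennreal b < rearr G t + ennreal (e/2)" unfolding rearr_def[of F] rearr_def[of G] by (auto simp: INF_less_iff)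
   have "rearr (%x. F x + G x) (2 * t) <= ennreal a + ennreal b" using ab ab' by blast
   also have "... <= (rearr F t + ennreal (e/2)) + (rearr G t + ennreal (e/2))" using ab' by (intro add_mono) auto
   also have "... = rearr F t + rearr G t + (ennreal (e/2) + ennreal (e/2))" by (simp add: ac_simps)
   also have "ennreal (e/2) + ennreal (e/2) = ennreal e" using e by (simp flip: ennreal_plus)
   finally show "rearr (%x. F x + G x) (2 * t) <= rearr F t + rearr G t + ennreal e" .
  qed
 qed auto
qed

lemma lorint_add_le:
 fixes F G :: "'a::euclidean_space => ennreal"
 assumes F: "F \<in> BM" "G \<in> BM" and r: "1 <= r"
 shows "lorint s r (%x. F x + G x) <= ennreal (2 powr ((1 - s) * r) * 2 powr r) * (lorint s r F + lorint s r G)"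
proof -
 define h where "h t = epow (ennreal (t powr (1 - s)) * rearr (%x. F x + G x) t) r * ennreal (1 / t) * indicator {0<..} t" for t
 define f where "f F t = epow (ennreal (t powr (1 - s)) * rearr F t) r * ennreal (1 / t) * indicator {0<..} t" for F :: "'a => ennreal" and t
 let ?c = "ennreal (2 powr ((1 - s) * r) * 2 powr r)"
 have hm: "h \<in> BM" unfolding h_def by measurable
 have fm: "f F \<in> BM" for F unfolding f_def by measurable
 \<comment> \<open>Substituting 2 t for t matches the doubled argument in
   \<open>rearr_add_le\<close>.\<close>
 have "lorint s r (%x. F x + G x) = ennreal (\<bar>2\<bar> ^ DIM(real)) * (NN t. h (0 + 2 *\<^sub>R t))" unfolding lorint_def h_def[symmetric] by (rule nn_integral_lborel_affine[OF _ hm]) simp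
 also have "... = 2 * (NN t. h (2 * t))" by simp
 also have "... = (NN t. 2 * h (2 * t))" by (rule nn_integral_cmult[symmetric]) (simp add: measurable_compose[OF _ hm])
 also have "... <= (NN t. ?c * (f F t + f G t))"
 proof (rule nn_integral_mono)
  fix t :: real
  show "2 * h (2 * t) <= ?c * (f F t + f G t)"
  proof (cases "0 < t")
   case True
   let ?X = "ennreal (t powr (1 - s)) * rearr F t" and ?Y = "ennreal (t powr (1 - s)) * rearr G t"
   have "ennreal ((2 * t) powr (1 - s)) * rearr (%x. F x + G x) (2 * t) <= ennreal ((2 * t) powr (1 - s)) * (rearr F t + rearr G t)" using True by (intro mult_left_mono rearr_add_le F) auto
   also have "... = ennreal (2 powr (1 - s)) * (?X + ?Y)" using True by (simp add: powr_mult ennreal_mult distrib_left mult.assoc)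
   finally have "epow (ennreal ((2 * t) powr (1 - s)) * rearr (%x. F x + G x) (2 * t)) r <= epow (ennreal (2 powr (1 - s)) * (?X + ?Y)) r" using r by (intro epow_mono) auto
   also have "... = ennreal ((2 powr (1 - s)) powr r) * epow (?X + ?Y) r" by (rule epow_mult) auto
   also have "... <= ennreal ((2 powr (1 - s)) powr r) * (ennreal (2 powr r) * (epow ?X r + epow ?Y r))" by (intro mult_left_mono epow_add_le r) simp
   also have "... = ?c * (epow ?X r + epow ?Y r)" by (simp add: powr_powr ennreal_mult mult.assoc)
   finally have "epow (ennreal ((2 * t) powr (1 - s)) * rearr (%x. F x + G x) (2 * t)) r * ennreal (1 / t) <= ?c * (epow ?X r + epow ?Y r) * ennreal (1 / t)" by (rule mult_right_mono) simp
   moreover have "2 * ennreal (1 / (2 * t)) = ennreal (1 / t)"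
   proof -
    have "2 * ennreal (1 / (2 * t)) = ennreal 2 * ennreal (1 / (2 * t))" by simp
    also have "... = ennreal (2 * (1 / (2 * t)))" using True by (intro ennreal_mult[symmetric]) auto
    finally show ?thesis by simp
   qed
   moreover have "2 * h (2 * t) = epow (ennreal ((2 * t) powr (1 - s)) * rearr (%x. F x + G x) (2 * t)) r * (2 * ennreal (1 / (2 * t)))" unfolding h_def using True by (simp add: mult_ac)
   moreover have "?c * (f F t + f G t) = ?c * (epow ?X r + epow ?Y r) * ennreal (1 / t)" unfolding f_def using True by (simp add: distrib_left distrib_right mult_ac)
   ultimately show ?thesis by (simp only:)
  qed (simp add: h_def f_def)
 qed
 also have "... = ?c * (NN t. f F t + f G t)" by (rule nn_integral_cmult) (intro borel_measurable_add, use fm in simp_all)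
 also have "(NN t. f F t + f G t) = (NN t. f F t) + (NN t. f G t)" by (rule nn_integral_add) (simp_all add: fm)
 finally show ?thesis unfolding lorint_def f_def .
qed

lemma lorint_mono_AE:
 assumes "AE x in lborel. F x <= G x" "F \<in> BM" "G \<in> BM" "0 <= r"
 shows "lorint s r F <= lorint s r G" unfolding lorint_def by (intro nn_integral_mono mult_right_mono epow_mono mult_left_mono rearr_mono_AE[OF assms(1-3)] assms(4)) auto

text \<open>Here the finite second index enters, as dominated convergence in t. For each t the
  rearrangement of the tail tends to 0, because every superlevel set has finite measure and so loses
  its mass outside large balls. Weak norms lack this property, and the smallness for short times
  rests on it.\<close>

lemma lorint_tail:
 fixes F :: "'a::euclidean_space => ennreal"
 assumes L: "lorint s r F < \<infinity>" and s: "s < 1" and r: "0 < r" and F: "F \<in> BM"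
 shows "(%k. lorint s r (%x. F x * indicator {x. real k < norm x} x)) \<longlonglongrightarrow> 0"
proof -
 let ?F = "%k x. F x * indicator {x. real k < norm x} x"
 have bs[measurable]: "{x. real k < norm x} \<in> sets (borel :: 'a measure)" for k by (intro borel_open open_Collect_less continuous_intros)
 note F[measurable]
 have Fm: "?F k \<in> BM" for k by measurable
 obtain M where M: "lorint s r F = ennreal M" "0 <= M" using L by (cases "lorint s r F") auto
 have rl: "rearr F t <= ennreal (((1 - s) * r * M) powr (1 / r) * t powr (s - 1))" if "0 < t" for t by (rule rearr_le_if_lorint[OF _ M(2) s r that]) (simp add: M)
 have Dfin: "dist_fn F q < \<infinity>" if q: "0 < q" for q
 proof -
  define K where "K = ((1 - s) * r * M) powr (1 / r)"
  \<comment> \<open>Chosen such that K t^(s - 1) = q K / (K + 1), which lies strictly below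
    q.\<close>
  define t where "t = ((K + 1) / q) powr (1 / (1 - s))"
  have K: "0 <= K" by (simp add: K_def)
  have t: "t > 0" using q K by (simp add: t_def)
  have "t powr (s - 1) = ((K + 1) / q) powr (1 / (1 - s) * (s - 1))" by (simp add: t_def powr_powr)
  also have "1 / (1 - s) * (s - 1) = -1" using s by (simp add: field_simps)
  also have "((K + 1) / q) powr (-1) = q / (K + 1)" using q K by (simp add: powr_minus)
  finally have tp: "t powr (s - 1) = q / (K + 1)" .
  have "K * t powr (s - 1) < q" unfolding tp using q K by (simp add: field_simps)
  hence "rearr F t < ennreal q" using rl[OF t, folded K_def] q by (intro order_le_less_trans[OF rl[OF t, folded K_def] ennreal_lessI]) auto
  then obtain q' where q': "0 <= q'" "dist_fn F q' <= ennreal t" "ennreal q' < ennreal q" unfolding rearr_def by (auto simp: INF_less_iff)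
  hence "q' <= q" by (simp add: ennreal_less_iff)
  hence "dist_fn F q <= dist_fn F q'" by (intro dist_fn_antimono F)
  also note q'(2)
  also have "ennreal t < \<infinity>" by simp
  finally show ?thesis .
 qed
 have Dlim: "(%k. dist_fn (?F k) q) \<longlonglongrightarrow> 0" if q: "0 < q" for q
 proof -
  define S where "S k = {x. ennreal q < F x} \<inter> {x. real k < norm x}" for k
  have S: "S k \<in> sets lborel" for k unfolding S_def sets_lborel by (intro sets.Int bs) measurable
  have eq: "dist_fn (?F k) q = emeasure lborel (S k)" for k unfolding dist_fn_def S_def by (rule arg_cong[where f = "emeasure lborel"]) (use q in \<open>auto simp: indicator_def\<close>)
  have "(%k. emeasure lborel (S k)) \<longlonglongrightarrow> emeasure lborel (\<Inter>k. S k)"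
  proof (rule Lim_emeasure_decseq)
   show "range S \<subseteq> sets lborel" using S by auto
   show "decseq S" unfolding decseq_def S_def by (auto intro: order_le_less_trans[rotated] of_nat_mono)
   show "emeasure lborel (S k) \<noteq> \<infinity>" for k
   proof -
    have "{x. ennreal q < F x} \<in> sets lborel" unfolding sets_lborel by measurable
    hence "emeasure lborel (S k) <= dist_fn F q" unfolding dist_fn_def by (intro emeasure_mono) (auto simp: S_def)
    thus ?thesis using Dfin[OF q] by auto
   qed
  qed
  moreover have "(\<Inter>k. S k) = {}"
  proof -
   have "x \<notin> (\<Inter>k. S k)" for x using real_arch_simple[of "norm x"] by (auto simp: S_def not_less)
   thus ?thesis by blast
  qed
  ultimately show ?thesis by (simp add: eq)
 qed
 have rlim: "(%k. rearr (?F k) t) \<longlonglongrightarrow> 0" if t: "0 < t" for t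
 proof (rule order_tendstoI)
  fix a :: ennreal assume a: "0 < a"
  obtain e where e: "0 < e" "ennreal e < a" using dense[OF a] by (metis ennreal_cases ennreal_less_zero_iff less_top_ennreal neq_top_trans top.not_eq_extremum order_less_imp_le)
  have "\<forall>\<^sub>F k in sequentially. dist_fn (?F k) e < ennreal t" using Dlim[OF e(1)] t by (intro order_tendstoD(2)[OF Dlim[OF e(1)]]) simp
  thus "\<forall>\<^sub>F k in sequentially. rearr (?F k) t < a"
  proof eventually_elim
   case (elim k)
   hence "rearr (?F k) t <= ennreal e" using e by (intro rearr_le) auto
   thus ?case using e(2) by (rule order_le_less_trans)
  qed
 qed simp
 have "(%k. lorint s r (?F k)) \<longlonglongrightarrow> (\<integral>\<^sup>+t. 0 \<partial>(lborel :: real measure))" unfolding lorint_def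
 proof (rule nn_integral_dominated_convergence)
  have le: "AE x in lborel. ?F k x <= F x" for k by (intro AE_I2) (auto simp: indicator_def)
  have "epow (ennreal (t powr (1 - s)) * rearr (?F k) t) r * ennreal (1 / t) * indicator {0<..} t <=
   epow (ennreal (t powr (1 - s)) * rearr F t) r * ennreal (1 / t) * indicator {0<..} t" for k t using r by (intro mult_right_mono epow_mono mult_left_mono rearr_mono_AE[OF le Fm F]) auto
  thus "AE t in lborel. epow (ennreal (t powr (1 - s)) * rearr (?F k) t) r * ennreal (1 / t) * indicator {0<..} t <=
   epow (ennreal (t powr (1 - s)) * rearr F t) r * ennreal (1 / t) * indicator {0<..} t" for k by (intro AE_I2)
  show "(NN t. epow (ennreal (t powr (1 - s)) * rearr F t) r * ennreal (1 / t) * indicator {0<..} t) < \<infinity>" using L by (simp add: lorint_def)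
  show "AE t in lborel. (%k. epow (ennreal (t powr (1 - s)) * rearr (?F k) t) r * ennreal (1 / t) * indicator {0<..} t) \<longlonglongrightarrow> 0"
  proof (intro AE_I2)
   fix t :: real
   show "(%k. epow (ennreal (t powr (1 - s)) * rearr (?F k) t) r * ennreal (1 / t) * indicator {0<..} t) \<longlonglongrightarrow> 0"
   proof (cases "0 < t")
    case True
    have fin: "rearr (?F k) t < top" for k using order_trans[OF rearr_mono_AE[OF _ Fm F] rl[OF True]] by (intro order_le_less_trans[OF order_trans[OF rearr_mono_AE[OF _ Fm F] rl[OF True]]] AE_I2) (auto simp: indicator_def)
    have e2: "(%k. enn2real (rearr (?F k) t)) \<longlonglongrightarrow> 0" by (rule tendsto_enn2real) (use rlim[OF True] in simp_all)
    have "(%k. (t powr (1 - s) * enn2real (rearr (?F k) t)) powr r) \<longlonglongrightarrow> (t powr (1 - s) * 0) powr r" using r by (intro tendsto_powr' tendsto_mult_left e2 tendsto_const) auto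
    hence "(%k. ennreal ((t powr (1 - s) * enn2real (rearr (?F k) t)) powr r * (1 / t))) \<longlonglongrightarrow> ennreal (0 * (1 / t))" using r by (intro tendsto_ennrealI tendsto_mult_right) simp
    moreover have "epow (ennreal (t powr (1 - s)) * rearr (?F k) t) r * ennreal (1 / t) * indicator {0<..} t =
    ennreal ((t powr (1 - s) * enn2real (rearr (?F k) t)) powr r * (1 / t))" for k
    proof (cases "rearr (?F k) t")
    case (real x)
    hence "ennreal (t powr (1 - s)) * rearr (?F k) t = ennreal (t powr (1 - s) * x)" by (simp add: ennreal_mult)
    hence "epow (ennreal (t powr (1 - s)) * rearr (?F k) t) r = ennreal ((t powr (1 - s) * x) powr r)" using real by (simp only: epow_ennreal mult_nonneg_nonneg powr_ge_zero)
    thus ?thesis using True real by (simp flip: ennreal_mult)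
    next
    case top
    thus ?thesis using fin[of k] by simp
    qed
    ultimately show ?thesis by simp
   qed simp
  qed
 qed measurable
 thus ?thesis by simp
qed

lemma lorint_cong_wbd:
 assumes L: "lorint s r F <= ennreal M" and M: "0 <= M" and s: "0 < s" "s < 1" and r: "0 < r"
  and F: "F \<in> BM"
 shows "wbd s (((1 - s) * r * M) powr (1 / r) / s) F" by (rule wbd_if_rearr_le[OF rearr_le_if_lorint[OF L M s(2) r] _ s(1) F]) auto

lemma wbd_lorint_interpolate:
 assumes w: "wbd s1 (A * \<rho> powr (s - s1)) F" "wbd s2 (A * \<rho> powr (s - s2)) F"
  and s: "s2 < s" "s < s1" "s1 < 1" and r: "0 < r" and \<rho>: "0 < \<rho>" and A: "0 <= A"
  and F: "F \<in> BM"
 shows "lorint s r F <= ennreal (A powr r * (1 / (r * (s1 - s)) + 1 / (r * (s - s2))))" using s A F by (intro lorint_interpolate[where \<rho> = \<rho>] rearr_le_if_wbd[OF w(1)] rearr_le_if_wbd[OF w(2)] r \<rho>) auto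

section \<open>Lorentz norms at the conjugate exponent\<close>

lemma conj_exp_inverse:
 assumes "1 < q"
 shows "enn2real (inverse (conj_exp (ennreal q))) = 1 - 1 / q"
proof -
 have "inverse (ennreal q) = ennreal (1 / q)" using assms by (simp add: inverse_ennreal inverse_eq_divide)
 moreover have "1 - ennreal (1 / q) = ennreal (1 - 1 / q)" using assms by (subst ennreal_1[symmetric], subst ennreal_minus) auto
 ultimately have "conj_exp (ennreal q) = inverse (ennreal (1 - 1 / q))" by (simp add: conj_exp_def)
 also have "... = ennreal (1 / (1 - 1 / q))" using assms by (subst inverse_ennreal) (auto simp: inverse_eq_divide)
 finally show ?thesis using assms by (simp add: inverse_ennreal inverse_eq_divide)
qed

lemma lorentz_norm_lorint:
 fixes f :: "'n::finite cfun"
 assumes f: "f \<in> LM" "AE x in lebesgue. enorm (f x) = F x" "F \<in> BM"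
  and q: "1 < q" and r: "0 < r"
 shows "lorentz_norm (conj_exp (ennreal q)) (ennreal r) f = epow (lorint (1 / q) r F) (1 / r)" using r rearrangement_eq[OF f] unfolding lorentz_norm_def Let_def conj_exp_inverse[OF q] lorint_def by simp

lemma lorentz_norm_weak:
 fixes f :: "'n::finite cfun"
 assumes f: "f \<in> LM" "AE x in lebesgue. enorm (f x) = F x" "F \<in> BM"
  and q: "1 < q"
 shows "lorentz_norm (conj_exp (ennreal q)) \<infinity> f = (SUP t\<in>{0<..}. ennreal (t powr (1 - 1 / q)) * rearr F t)" using rearrangement_eq[OF f] unfolding lorentz_norm_def Let_def conj_exp_inverse[OF q] by simp

text \<open>The factor q is the 1/s lost in integrating the rearrangement; the converse direction
  has no loss.\<close>

lemma wbd_if_lorentz_weak: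
 fixes f :: "'n::finite cfun"
 assumes f: "f \<in> LM" "AE x in lebesgue. enorm (f x) = F x" "F \<in> BM"
  and q: "1 < q" and n: "lorentz_norm (conj_exp (ennreal q)) \<infinity> f <= ennreal A" and A: "0 <= A"
 shows "wbd (1 / q) (A * q) F"
proof -
 have "rearr F t <= ennreal (A * t powr (1 / q - 1))" if t: "0 < t" for t
 proof -
  have "ennreal (t powr (1 - 1 / q)) * rearr F t <= (SUP t\<in>{0<..}. ennreal (t powr (1 - 1 / q)) * rearr F t)" by (rule SUP_upper) (use t in simp)
  hence "ennreal (t powr (1 - 1 / q)) * rearr F t <= ennreal A" using n unfolding lorentz_norm_weak[OF f q] by simp
  hence "ennreal (t powr (1 / q - 1)) * (ennreal (t powr (1 - 1 / q)) * rearr F t) <= ennreal (t powr (1 / q - 1)) * ennreal A" by (rule mult_left_mono) simp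
  moreover have "ennreal (t powr (1 / q - 1)) * ennreal (t powr (1 - 1 / q)) = 1" using t by (simp flip: ennreal_mult powr_add)
  moreover have "ennreal (t powr (1 / q - 1)) * ennreal A = ennreal (A * t powr (1 / q - 1))" using A by (subst ennreal_mult[symmetric]) (simp_all add: mult.commute)
  ultimately show ?thesis by (simp only: mult.assoc[symmetric] mult_1_left)
 qed
 from wbd_if_rearr_le[OF this A _ f(3)] q show ?thesis by simp
qed

lemma lorentz_weak_le_if_wbd:
 fixes f :: "'n::finite cfun"
 assumes f: "f \<in> LM" "AE x in lebesgue. enorm (f x) = F x" "F \<in> BM"
  and q: "1 < q" and w: "wbd (1 / q) A F" and A: "0 <= A"
 shows "lorentz_norm (conj_exp (ennreal q)) \<infinity> f <= ennreal A" unfolding lorentz_norm_weak[OF f q]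
proof (rule SUP_least)
 fix t :: real assume t: "t \<in> {0<..}"
 have "ennreal (t powr (1 - 1 / q)) * rearr F t <= ennreal (t powr (1 - 1 / q)) * ennreal (A * t powr (1 / q - 1))" using t q by (intro mult_left_mono rearr_le_if_wbd[OF w A _ _ f(3)]) auto
 also have "... = ennreal (A * (t powr (1 - 1 / q) * t powr (1 / q - 1)))" using A by (simp add: mult_ac flip: ennreal_mult)
 also have "t powr (1 - 1 / q) * t powr (1 / q - 1) = 1" using t by (simp flip: powr_add)
 finally show "ennreal (t powr (1 - 1 / q)) * rearr F t <= ennreal A" by simp
qed

section \<open>The majorant iteration\<close>

abbreviation jm :: "(real => real^'n::finite => 'b::topological_space) => bool" where
 "jm W \<equiv> (%p. W (fst p) (snd p)) \<in> borel_measurable (borel \<Otimes>\<^sub>M borel)"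

lemma jm_comp:
 assumes "jm W" "f \<in> borel_measurable M" "g \<in> borel_measurable M"
 shows "(%x. W (f x) (g x)) \<in> borel_measurable M" using measurable_compose[OF measurable_Pair[OF assms(2,3)] assms(1)] by simp

lemma jm_slice: "jm W ==> W t \<in> BM" by (rule jm_comp) auto

text \<open>Collects the constants of the nonlinear term: 2 from the Leray symbol, the normalisation
  of the convolution, and one summand for each pair of components.\<close>

definition kappa :: "'n::finite itself => real" where
 "kappa _ = 2 * fconst TYPE('n) * (real CARD('n))\<^sup>2"

lemma kappa_nonneg: "0 <= kappa TYPE('n::finite)" by (simp add: kappa_def)

definition kern :: "real => real^'n::finite => real => real" where
 "kern t x q = (if 0 < q \<and> q < t then norm x * exp (- (t - q) * (norm x)^2) else 0)"

lemma kern_nonneg: "0 <= kern t x q" by (simp add: kern_def)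

text \<open>A single integral over time and space, so that its signed counterpart \<open>du\<close>
  is one Bochner integral to which dominated convergence applies directly; the iterated form is
  recovered in \<open>duh_iterated\<close>.\<close>

definition duh :: "(real => 'n::finite efun) => real => 'n efun" where
 "duh W t x = ennreal (kappa TYPE('n)) * (NN y. ennreal (kern t x (fst y)) * (W (fst y) (x - snd y) * W (fst y) (snd y)))"

lemma lborel_pair_eq: "(lborel :: ('a::euclidean_space \<times> 'b::euclidean_space) measure) = lborel \<Otimes>\<^sub>M lborel" by (rule lborel_prod[symmetric])

lemma measurable_kern[measurable (raw)]:
 assumes [measurable]: "f \<in> borel_measurable M" "g \<in> borel_measurable M" "h \<in> borel_measurable M"
 shows "(%x. kern (f x) (g x) (h x)) \<in> borel_measurable M" unfolding kern_def by measurable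

lemma beta_measurable: "(%q. ennreal ((t - q) powr x * q powr y) * indicator {0<..<t} q) \<in> BM" by measurable

lemma measurable_snd_lborel[measurable]: "snd \<in> measurable (M \<Otimes>\<^sub>M (lborel :: 'a::euclidean_space measure)) borel" using measurable_snd[of M "lborel :: 'a measure"] by simp

lemma measurable_fst_snd_borel[measurable]:
 "fst \<in> measurable (borel :: ('a::euclidean_space \<times> 'b::euclidean_space) measure) borel"
 "snd \<in> measurable (borel :: ('a::euclidean_space \<times> 'b::euclidean_space) measure) borel" by (auto intro!: borel_measurable_continuous_onI continuous_intros)

lemma duh_integrand_measurable:
 assumes W: "jm (W :: real => 'n::finite efun)"
 shows "(%y. ennreal (kern t x (fst y)) * (W (fst y) (x - snd y) * W (fst y) (snd y))) \<in> borel_measurable (borel :: (real \<times> (real^'n)) measure)"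
  and "jm (duh W)"
proof -
 note jm_comp[OF W, measurable (raw)]
 show "(%y. ennreal (kern t x (fst y)) * (W (fst y) (x - snd y) * W (fst y) (snd y))) \<in> borel_measurable (borel :: (real \<times> (real^'n)) measure)" by measurable
 show "jm (duh W)" unfolding duh_def by measurable
qed

lemma duh_iterated:
 assumes W: "jm (W :: real => 'n::finite efun)"
 shows "duh W t x = ennreal (kappa TYPE('n)) * (NN q. ennreal (kern t x q) * econv (W q) (W q) x)"
proof -
 note Wm[measurable] = jm_slice[OF W]
 have m: "(%y. ennreal (kern t x (fst y)) * (W (fst y) (x - snd y) * W (fst y) (snd y))) \<in> borel_measurable (lborel \<Otimes>\<^sub>M lborel)" using duh_integrand_measurable(1)[OF W] unfolding lborel_prod by simp
 have "(NN y. ennreal (kern t x (fst y)) * (W (fst y) (x - snd y) * W (fst y) (snd y))) =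
   (NN q. (NN z. ennreal (kern t x q) * (W q (x - z) * W q z)))" unfolding lborel_pair_eq using lborel.nn_integral_fst[OF m] by simp
 also have "... = (NN q. ennreal (kern t x q) * econv (W q) (W q) x)" unfolding econv_def by (intro nn_integral_cong nn_integral_cmult) measurable
 finally show ?thesis by (simp add: duh_def)
qed

lemma jm_econv:
 assumes W: "jm (W :: real => 'n::finite efun)"
 shows "jm (%q. econv (W q) (W q))"
proof -
 note jm_comp[OF W, measurable (raw)]
 show ?thesis unfolding econv_def by measurable
qed

text \<open>The weight \<open>norm x powr e\<close> is needed with \<open>e = 0\<close> for the Picard iteration and with
 \<open>e = n/p - 1\<close> for the bound in the space of initial data.\<close>

lemma wbd_duh:
 fixes W :: "real => 'n::finite efun"
 assumes W: "jm W" and t: "0 < t" and B: "0 <= B"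
  and w: "\<And>q. 0 < q ==> q < t ==> wbd c (B * q powr (b - 1)) (econv (W q) (W q))"
  and b: "0 < b" "b <= 1" and e: "-1 <= e" and c: "0 <= c'" "c' <= c"
  and a: "(1 + e) / 2 + real CARD('n) * (c - c') / 2 < 1"
 defines "a \<equiv> (1 + e) / 2 + real CARD('n) * (c - c') / 2"
 shows "wbd c' (kappa TYPE('n) * heat_const TYPE(real^'n) (1 + e) (c - c') * (2 * (1 / b + 1 / (1 - a))) * B * t powr (b - a))
  (%x. ennreal (norm x powr e) * duh W t x)" unfolding wbd_def
proof (intro ballI impI)
 fix E :: "(real^'n) set" assume E[measurable]: "E \<in> sets borel" and fin: "emeasure lborel E < \<infinity>"
 let ?d = "kappa TYPE('n)" and ?h = "heat_const TYPE(real^'n) (1 + e) (c - c')" and ?m = "measure lborel E powr c'"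
 have h: "0 <= ?h" using e c by (intro heat_const_nonneg) auto
 have a0: "0 <= a" using e c by (simp add: a_def)
 have a1: "a < 1" using a by (simp add: a_def)
 note Wm[measurable] = jm_slice[OF W]
 note em = jm_econv[OF W]
 have pt: "ennreal (norm x powr e) * ennreal (kern t x q) = ennreal (norm x powr (1 + e) * exp (- (t - q) * (norm x)^2)) * indicator {0<..<t} q" for x :: "real^'n" and q
 proof -
  have "norm x powr e * norm x = norm x powr (1 + e)" by (cases "x = 0") (simp_all add: powr_add)
  hence "norm x powr e * (norm x * exp (- (t - q) * (norm x)^2)) = norm x powr (1 + e) * exp (- (t - q) * (norm x)^2)" by (simp only: mult.assoc[symmetric])
  thus ?thesis unfolding kern_def by (subst ennreal_mult[symmetric]) (auto simp: indicator_def)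
 qed
 have mm: "(%(x, q). ennreal (norm x powr e) * ennreal (kern t x q) * econv (W q) (W q) x * indicator E x) \<in> borel_measurable ((lborel :: (real^'n) measure) \<Otimes>\<^sub>M (lborel :: real measure))"
 proof -
  have 1: "fst \<in> measurable ((lborel :: (real^'n) measure) \<Otimes>\<^sub>M (lborel :: real measure)) borel" "snd \<in> measurable ((lborel :: (real^'n) measure) \<Otimes>\<^sub>M (lborel :: real measure)) borel" using measurable_fst[of "lborel :: (real^'n) measure" "lborel :: real measure"] measurable_snd[of "lborel :: (real^'n) measure" "lborel :: real measure"] by simp_all
  show ?thesis unfolding split_beta' by (intro borel_measurable_times_ennreal measurable_compose[OF _ measurable_ennreal] measurable_kern jm_comp[OF em] 1
    powr_real_measurable measurable_compose[OF 1(1), of norm] borel_measurable_const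
    measurable_compose[OF 1(1) borel_measurable_indicator[OF E]]) auto
 qed
 \<comment> \<open>Tonelli's theorem exchanges space and time. Each time slice is then a heat
   estimate with h = t - q, and the remaining time integral is of beta type, convergent because a <
   1 and b > 0.\<close>
 have "(NN x. (NN q. ennreal (norm x powr e) * ennreal (kern t x q) * econv (W q) (W q) x * indicator E x)) =
   (NN q. (NN x. ennreal (norm x powr e) * ennreal (kern t x q) * econv (W q) (W q) x * indicator E x))" by (rule lborel_pair.Fubini'[OF mm, symmetric])
 also have "... <= (NN q. ennreal (?h * B * ?m) * (ennreal ((t - q) powr (- a) * q powr (b - 1)) * indicator {0<..<t} q))"
 proof (rule nn_integral_mono)
  fix q :: real
  show "(NN x. ennreal (norm x powr e) * ennreal (kern t x q) * econv (W q) (W q) x * indicator E x) <=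
   ennreal (?h * B * ?m) * (ennreal ((t - q) powr (- a) * q powr (b - 1)) * indicator {0<..<t} q)"
  proof (cases "q \<in> {0<..<t}")
   case True
   have "wbd c' (?h * (t - q) powr (- (1 + e) / 2 - real DIM(real^'n) * (c - c') / 2) * (B * q powr (b - 1)))
    (%x. ennreal (norm x powr (1 + e) * exp (- (t - q) * (norm x)^2)) * econv (W q) (W q) x)" using True B e c by (intro wbd_heat w) auto
   moreover have ex: "- (1 + e) / 2 - real DIM(real^'n) * (c - c') / 2 = - a" by (simp add: a_def field_simps)
   ultimately have "wbd c' (?h * (t - q) powr (- a) * (B * q powr (b - 1)))
    (%x. ennreal (norm x powr (1 + e) * exp (- (t - q) * (norm x)^2)) * econv (W q) (W q) x)" by (simp only:)
   from wbdD[OF this E fin]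
   have "nns E (%x. ennreal (norm x powr (1 + e) * exp (- (t - q) * (norm x)^2)) * econv (W q) (W q) x) <=
    ennreal (?h * (t - q) powr (- a) * (B * q powr (b - 1)) * ?m)" .
   also have "... = ennreal (?h * B * ?m) * ennreal ((t - q) powr (- a) * q powr (b - 1))" using h B by (subst ennreal_mult[symmetric]) (simp_all add: mult_ac)
   finally show ?thesis using True by (simp add: pt)
  next
   case False
   hence "kern t x q = 0" for x :: "real^'n" by (auto simp: kern_def)
   thus ?thesis by simp
  qed
 qed
 also have "... = ennreal (?h * B * ?m) * nns {0<..<t} (%q. ennreal ((t - q) powr (- a) * q powr (b - 1)))" by (rule nn_integral_cmult) (simp add: beta_measurable)
 also have "... <= ennreal (?h * B * ?m) * ennreal (2 * (1 / b + 1 / (1 - a)) * t powr (b - a))" by (intro mult_left_mono beta_integral_le a0 a1 b t) simp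
 finally have I: "(NN x. (NN q. ennreal (norm x powr e) * ennreal (kern t x q) * econv (W q) (W q) x * indicator E x)) <=
   ennreal (?h * B * ?m) * ennreal (2 * (1 / b + 1 / (1 - a)) * t powr (b - a))" .
 have "nns E (%x. ennreal (norm x powr e) * duh W t x) =
   (NN x. ennreal ?d * (NN q. ennreal (norm x powr e) * ennreal (kern t x q) * econv (W q) (W q) x * indicator E x))"
 proof (intro nn_integral_cong)
  fix x :: "real^'n"
  have m1: "(%q. ennreal (kern t x q) * econv (W q) (W q) x) \<in> borel_measurable lborel" by (intro borel_measurable_times_ennreal measurable_compose[OF _ measurable_ennreal] measurable_kern jm_comp[OF em]) auto
  have "(NN q. ennreal (norm x powr e) * ennreal (kern t x q) * econv (W q) (W q) x * indicator E x) =
    (NN q. (ennreal (norm x powr e) * indicator E x) * (ennreal (kern t x q) * econv (W q) (W q) x))" by (simp only: mult_ac)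
  also have "... = (ennreal (norm x powr e) * indicator E x) * (NN q. ennreal (kern t x q) * econv (W q) (W q) x)" by (rule nn_integral_cmult[OF m1])
  finally show "ennreal (norm x powr e) * duh W t x * indicator E x = ennreal ?d * (NN q. ennreal (norm x powr e) * ennreal (kern t x q) * econv (W q) (W q) x * indicator E x)" unfolding duh_iterated[OF W] by (simp only: mult_ac)
 qed
 also have "... = ennreal ?d * (NN x. (NN q. ennreal (norm x powr e) * ennreal (kern t x q) * econv (W q) (W q) x * indicator E x))" using lborel.borel_measurable_nn_integral[OF mm] by (intro nn_integral_cmult) simp
 also have "... <= ennreal ?d * (ennreal (?h * B * ?m) * ennreal (2 * (1 / b + 1 / (1 - a)) * t powr (b - a)))" by (rule mult_left_mono[OF I]) simp
 also have "... = ennreal (?d * ?h * (2 * (1 / b + 1 / (1 - a))) * B * t powr (b - a) * ?m)"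
 proof -
  have Y: "0 <= 2 * (1 / b + 1 / (1 - a)) * t powr (b - a)" using a1 b by simp
  have "ennreal ?d * (ennreal X * ennreal Y) = ennreal (?d * (X * Y))" if "0 <= X" "0 <= Y" for X Y using that kappa_nonneg[where 'n = 'n] by (simp add: ennreal_mult)
  from this[OF _ Y, of "?h * B * ?m"] h B show ?thesis by (simp add: mult_ac)
 qed
 finally show "nns E (%x. ennreal (norm x powr e) * duh W t x) <=
  ennreal (?d * ?h * (2 * (1 / b + 1 / (1 - a))) * B * t powr (b - a) * ?m)" .
qed

lemma duh_zero: "duh W t (0 :: real^'n::finite) = 0"
proof -
 have "kern t (0 :: real^'n) q = 0" for q by (simp add: kern_def)
 thus ?thesis by (simp add: duh_def)
qed

lemma wbd_duh_unweighted:
 fixes W :: "real => 'n::finite efun"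
 assumes W: "jm W" and t: "0 < t" and B: "0 <= B"
  and w: "\<And>q. 0 < q ==> q < t ==> wbd c (B * q powr (b - 1)) (econv (W q) (W q))"
  and b: "0 < b" "b <= 1" and c: "0 <= c'" "c' <= c" and a: "1 / 2 + real CARD('n) * (c - c') / 2 < 1"
 defines "a \<equiv> 1 / 2 + real CARD('n) * (c - c') / 2"
 shows "wbd c' (kappa TYPE('n) * heat_const TYPE(real^'n) 1 (c - c') * (2 * (1 / b + 1 / (1 - a))) * B * t powr (b - a)) (duh W t)"
proof -
 have "wbd c' (kappa TYPE('n) * heat_const TYPE(real^'n) (1 + 0) (c - c') * (2 * (1 / b + 1 / (1 - ((1 + 0) / 2 + real CARD('n) * (c - c') / 2)))) * B *
   t powr (b - ((1 + 0) / 2 + real CARD('n) * (c - c') / 2))) (%x. ennreal (norm x powr 0) * duh W t x)" by (rule wbd_duh[OF W t B w b _ c]) (use a in auto)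
 \<comment> \<open>Since \<open>0 powr 0 = 0\<close>, the weight is 0 at the origin instead of 1;
   the Duhamel term vanishes there as well.\<close>
 moreover have "(%x. ennreal (norm x powr 0) * duh W t x) = duh W t"
 proof
  fix x :: "real^'n"
  show "ennreal (norm x powr 0) * duh W t x = duh W t x" by (cases "x = 0") (simp_all add: duh_zero)
 qed
 ultimately show ?thesis by (simp add: a_def)
qed

text \<open>With s = 1/q the exponent is that of the space K, so these bounds are invariant under
  the scaling of the equation; for s = 0 the power is t^(-1/2). In contrast to K, the final time T
  is included.\<close>

definition Pb :: "ereal => real => real => (real => 'n::finite efun) => bool" where
 "Pb T s A V \<longleftrightarrow> (\<forall>t. 0 < t \<and> ereal t <= T \<longrightarrow> wbd s (A * t powr (- (1 - real CARD('n) * s) / 2)) (V t))"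

lemma PbD: "Pb T s A V ==> 0 < t ==> ereal t <= T ==> wbd s (A * t powr (- (1 - real CARD('n) * s) / 2)) (V t)"
 for V :: "real => 'n::finite efun" by (simp add: Pb_def)

lemma Pb_mono:
 assumes "Pb T s A V" "\<And>t x. V' t x <= V t x" "A <= A'" "T' <= T"
 shows "Pb T' s A' V'" unfolding Pb_def
proof (intro allI impI)
 fix t assume t: "0 < t \<and> ereal t <= T'"
 hence "wbd s (A * t powr (- (1 - real CARD('a) * s) / 2)) (V t)" using assms(4) by (intro PbD[OF assms(1)]) (auto intro: order_trans)
 thus "wbd s (A' * t powr (- (1 - real CARD('a) * s) / 2)) (V' t)" by (rule wbd_mono[OF _ assms(2)]) (intro mult_right_mono assms(3), simp)
qed

lemma Pb_add:
 fixes V V' :: "real => 'n::finite efun"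
 assumes "Pb T s A V" "Pb T s A' V'" "0 <= A" "0 <= A'" "jm V" "jm V'"
 shows "Pb T s (A + A') (%t x. V t x + V' t x)" using assms unfolding Pb_def distrib_right by (auto intro!: wbd_add jm_slice)

lemma Pb_econv:
 fixes V :: "real => 'n::finite efun"
 assumes "Pb T 0 A0 V" "Pb T s As V" and V: "jm V" and A: "0 <= A0" "0 <= As" and q: "0 < q" "ereal q <= T"
 shows "wbd s (As * A0 * q powr (real CARD('n) * s / 2 - 1)) (econv (V q) (V q))"
proof -
 note [measurable] = jm_slice[OF V]
 have "(NN x. V q x) <= ennreal (A0 * q powr (- 1 / 2))" using PbD[OF assms(1) q] A by (subst (asm) wbd_0_iff) auto
 hence "wbd s (As * q powr (- (1 - real CARD('n) * s) / 2) * (A0 * q powr (- 1 / 2))) (econv (V q) (V q))" using A by (intro wbd_econv PbD[OF assms(2) q]) auto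
 also have "As * q powr (- (1 - real CARD('n) * s) / 2) * (A0 * q powr (- 1 / 2)) = As * A0 * q powr (real CARD('n) * s / 2 - 1)"
 proof -
  have "q powr (- (1 - real CARD('n) * s) / 2) * q powr (- 1 / 2) = q powr (real CARD('n) * s / 2 - 1)"
  proof -
   have "- (1 - real CARD('n) * s) / 2 + - 1 / 2 = real CARD('n) * s / 2 - 1" by (simp add: field_simps)
   thus ?thesis by (simp only: powr_add[symmetric])
  qed
  thus ?thesis by (simp add: mult_ac)
 qed
 finally show ?thesis .
qed

definition K1 :: "'n::finite itself => real => real" where
 "K1 _ \<theta> = kappa TYPE('n) * heat_const TYPE(real^'n) 1 0 * (2 * (1 / (real CARD('n) * \<theta> / 2) + 2))"

definition K0 :: "'n::finite itself => real => real" where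
 "K0 _ \<theta> = kappa TYPE('n) * heat_const TYPE(real^'n) 1 \<theta> * (2 * (1 / (real CARD('n) * \<theta> / 2) + 1 / (1 - (1 / 2 + real CARD('n) * \<theta> / 2))))"

lemma K_nonneg: "0 < \<theta> ==> real CARD('n) * \<theta> < 1 ==> 0 <= K0 TYPE('n::finite) \<theta>" "0 < \<theta> ==> 0 <= K1 TYPE('n) \<theta>" unfolding K0_def K1_def by (auto intro!: mult_nonneg_nonneg heat_const_nonneg kappa_nonneg add_nonneg_nonneg)

text \<open>One factor is measured at index 0 and the other at s, so the estimate is linear in the
  bound at s. The beta integral deteriorates only as s tends to 0, hence one constant serves all s
  from \<theta> upwards.\<close>

lemma Pb_duh_1:
 fixes V :: "real => 'n::finite efun"
 assumes P: "Pb T 0 A0 V" "Pb T s As V" and V: "jm V" and A: "0 <= A0" "0 <= As"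
  and \<theta>: "0 < \<theta>" "\<theta> <= s" and s: "real CARD('n) * s < 1"
 shows "Pb T s (K1 TYPE('n) \<theta> * A0 * As) (duh V)" unfolding Pb_def
proof (intro allI impI)
 fix t assume t: "0 < t \<and> ereal t <= T"
 let ?n = "real CARD('n)"
 have s0: "0 < s" using \<theta> by linarith
 have n0: "0 < ?n" by simp
 have "wbd s (kappa TYPE('n) * heat_const TYPE(real^'n) 1 (s - s) * (2 * (1 / (?n * s / 2) + 1 / (1 - (1 / 2 + ?n * (s - s) / 2)))) * (As * A0) * t powr (?n * s / 2 - (1 / 2 + ?n * (s - s) / 2))) (duh V t)"
 proof (rule wbd_duh_unweighted[OF V])
  fix q assume "0 < q" "q < t"
  hence "ereal q <= T" using t by (metis ereal_less_eq(3) less_imp_le order_trans)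
  thus "wbd s (As * A0 * q powr (?n * s / 2 - 1)) (econv (V q) (V q))" using \<open>0 < q\<close> by (intro Pb_econv[OF P V A]) auto
 qed (use t A s s0 in auto)
 thus "wbd s (K1 TYPE('n) \<theta> * A0 * As * t powr (- (1 - ?n * s) / 2)) (duh V t)"
 proof (rule wbd_mono)
  have "1 / (?n * s / 2) <= 1 / (?n * \<theta> / 2)" using \<theta> s0 n0 by (intro divide_left_mono) auto
  hence "kappa TYPE('n) * heat_const TYPE(real^'n) 1 0 * (2 * (1 / (?n * s / 2) + 2)) <= K1 TYPE('n) \<theta>" unfolding K1_def by (intro mult_left_mono mult_nonneg_nonneg kappa_nonneg heat_const_nonneg) auto
  hence "kappa TYPE('n) * heat_const TYPE(real^'n) 1 0 * (2 * (1 / (?n * s / 2) + 2)) * (As * A0 * t powr (- (1 - ?n * s) / 2)) <= K1 TYPE('n) \<theta> * (As * A0 * t powr (- (1 - ?n * s) / 2))" using A by (intro mult_right_mono) auto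
  note le = this
  have ex: "?n * s / 2 - (1 / 2 + ?n * (s - s) / 2) = - (1 - ?n * s) / 2" by (simp add: field_simps)
  show "kappa TYPE('n) * heat_const TYPE(real^'n) 1 (s - s) * (2 * (1 / (?n * s / 2) + 1 / (1 - (1 / 2 + ?n * (s - s) / 2)))) * (As * A0) * t powr (?n * s / 2 - (1 / 2 + ?n * (s - s) / 2)) <= K1 TYPE('n) \<theta> * A0 * As * t powr (- (1 - ?n * s) / 2)" unfolding ex using le by (simp add: mult_ac)
 qed simp
qed

text \<open>With both factors at index 0 the time integral would diverge at q = 0. One factor is
  therefore taken at \<theta>, and the heat factor lowers the index from \<theta> to 0 at the price
  of the singularity of order 1/2 + n \<theta>/2 < 1 at q = t.\<close>

lemma Pb_duh_0:
 fixes V :: "real => 'n::finite efun"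
 assumes P: "Pb T 0 A0 V" "Pb T \<theta> A\<theta> V" and V: "jm V" and A: "0 <= A0" "0 <= A\<theta>"
  and \<theta>: "0 < \<theta>" "real CARD('n) * \<theta> < 1"
 shows "Pb T 0 (K0 TYPE('n) \<theta> * A0 * A\<theta>) (duh V)" unfolding Pb_def
proof (intro allI impI)
 fix t assume t: "0 < t \<and> ereal t <= T"
 let ?n = "real CARD('n)"
 have "wbd 0 (kappa TYPE('n) * heat_const TYPE(real^'n) 1 (\<theta> - 0) * (2 * (1 / (?n * \<theta> / 2) + 1 / (1 - (1 / 2 + ?n * (\<theta> - 0) / 2)))) * (A\<theta> * A0) * t powr (?n * \<theta> / 2 - (1 / 2 + ?n * (\<theta> - 0) / 2))) (duh V t)"
 proof (rule wbd_duh_unweighted[OF V])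
  fix q assume "0 < q" "q < t"
  hence "ereal q <= T" using t by (metis ereal_less_eq(3) less_imp_le order_trans)
  thus "wbd \<theta> (A\<theta> * A0 * q powr (?n * \<theta> / 2 - 1)) (econv (V q) (V q))" using \<open>0 < q\<close> by (intro Pb_econv[OF P V A]) auto
 qed (use t A \<theta> in auto)
 thus "wbd 0 (K0 TYPE('n) \<theta> * A0 * A\<theta> * t powr (- (1 - ?n * 0) / 2)) (duh V t)" by (simp add: K0_def mult_ac)
qed

definition lin :: "('n::finite => 'n cfun) => real => 'n efun" where
 "lin g t x = ennreal (exp (- t * (norm x)^2)) * (\<Sum>i\<in>UNIV. enorm (g i x))"

primrec Wit :: "('n::finite => 'n cfun) => nat => real => 'n efun" where
 "Wit g 0 = (%t x. 0)"
| "Wit g (Suc k) = (%t x. lin g t x + duh (Wit g k) t x)"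

definition Winf :: "('n::finite => 'n cfun) => real => 'n efun" where
 "Winf g t x = (SUP k. Wit g k t x)"

lemma jm_lin:
 assumes [measurable]: "\<And>i. g i \<in> BM"
 shows "jm (lin g)" unfolding lin_def by measurable

lemma jm_Wit:
 assumes "\<And>i. g i \<in> BM"
 shows "jm (Wit g k)"
proof (induction k)
 case (Suc k)
 thus ?case using jm_lin[OF assms] duh_integrand_measurable(2)[OF Suc] by simp
qed simp

lemma jm_Winf:
 assumes "\<And>i. g i \<in> BM"
 shows "jm (Winf g)" unfolding Winf_def using jm_Wit[OF assms] by (intro borel_measurable_SUP) auto

lemma duh_mono: "(\<And>t x. V t x <= W t x) ==> duh V t x <= duh W t x" unfolding duh_def by (intro mult_left_mono nn_integral_mono mult_mono) auto

lemma Wit_mono_Suc: "Wit g k t x <= Wit g (Suc k) t x"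
proof (induction k arbitrary: t x)
 case (Suc k)
 thus ?case by (auto intro!: add_left_mono duh_mono simp del: Wit.simps simp: Wit.simps(2)[of g "Suc k"] Wit.simps(2)[of g k])
qed simp

lemma Wit_incseq: "incseq (%k. Wit g k t x)" by (rule incseq_SucI) (rule Wit_mono_Suc)

lemma Wit_le_Winf: "Wit g k t x <= Winf g t x" unfolding Winf_def by (rule SUP_upper) simp

lemma SUP_mult_SUP_ennreal:
 fixes f g :: "nat => ennreal"
 assumes "incseq f" "incseq g"
 shows "(SUP k. f k) * (SUP k. g k) = (SUP k. f k * g k)"
proof (rule antisym)
 have "f i * g j <= (SUP k. f k * g k)" for i j by (rule order_trans[OF mult_mono SUP_upper[of "max i j"]]) (auto intro: incseqD[OF assms(1)] incseqD[OF assms(2)])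
 thus "(SUP k. f k) * (SUP k. g k) <= (SUP k. f k * g k)" unfolding SUP_mult_right_ennreal SUP_mult_left_ennreal by (intro SUP_least)
 show "(SUP k. f k * g k) <= (SUP k. f k) * (SUP k. g k)" by (intro SUP_least mult_mono SUP_upper) auto
qed

text \<open>Monotone convergence passes through the product because both factors increase along the
  same index.\<close>

lemma Winf_fixpoint:
 fixes g :: "'n::finite => 'n cfun"
 assumes g: "\<And>i. g i \<in> BM"
 shows "Winf g t x = lin g t x + duh (Winf g) t x"
proof -
 let ?f = "%k y. ennreal (kern t x (fst y)) * (Wit g k (fst y) (x - snd y) * Wit g k (fst y) (snd y))"
 have "duh (Winf g) t x = ennreal (kappa TYPE('n)) * (NN y. (SUP k. ?f k y))" unfolding duh_def
 proof (intro arg_cong2[where f = "(*)"] nn_integral_cong refl)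
  fix y :: "real \<times> (real^'n)"
  have "Winf g (fst y) (x - snd y) * Winf g (fst y) (snd y) = (SUP k. Wit g k (fst y) (x - snd y) * Wit g k (fst y) (snd y))" unfolding Winf_def by (rule SUP_mult_SUP_ennreal) (rule Wit_incseq)+
  thus "ennreal (kern t x (fst y)) * (Winf g (fst y) (x - snd y) * Winf g (fst y) (snd y)) = (SUP k. ?f k y)" by (simp add: SUP_mult_left_ennreal)
 qed
 also have "(NN y. (SUP k. ?f k y)) = (SUP k. (NN y. ?f k y))"
 proof (rule nn_integral_monotone_convergence_SUP)
  show "incseq ?f" by (intro incseq_SucI le_funI mult_left_mono mult_mono Wit_mono_Suc) auto
  show "?f k \<in> borel_measurable lborel" for k using duh_integrand_measurable(1)[OF jm_Wit[OF g]] by simp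
 qed
 finally have "duh (Winf g) t x = (SUP k. duh (Wit g k) t x)" by (simp add: duh_def SUP_mult_left_ennreal)
 hence "lin g t x + duh (Winf g) t x = (SUP k. lin g t x + duh (Wit g k) t x)" by (simp add: ennreal_SUP_add_right)
 also have "... = (SUP k. Wit g (Suc k) t x)" by simp
 also have "... = Winf g t x" unfolding Winf_def
 proof (rule antisym)
  show "(SUP k. Wit g (Suc k) t x) <= (SUP k. Wit g k t x)" by (intro SUP_least SUP_upper) simp
  show "(SUP k. Wit g k t x) <= (SUP k. Wit g (Suc k) t x)" by (rule SUP_mono) (use Wit_mono_Suc in blast)
 qed
 finally show ?thesis by simp
qed

lemma Pb_zero: "0 <= A ==> Pb T s A (%t x. 0)" by (simp add: Pb_def wbd_zero)

text \<open>The bound 2 a is preserved: the quadratic term contributes K (2a)^2, which is at most a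
  under the smallness conditions. Both indices are carried together since the step at 0 draws on
  \<theta> and the step at \<theta> on 0.\<close>

lemma Pb_Wit:
 fixes g :: "'n::finite => 'n cfun"
 assumes g: "\<And>i. g i \<in> BM"
  and L: "Pb T 0 a (lin g)" "Pb T \<theta> a (lin g)" and a: "0 <= a"
  and \<theta>: "0 < \<theta>" "real CARD('n) * \<theta> < 1"
  and small: "4 * K0 TYPE('n) \<theta> * a <= 1" "4 * K1 TYPE('n) \<theta> * a <= 1"
 shows "Pb T 0 (2 * a) (Wit g k)" "Pb T \<theta> (2 * a) (Wit g k)"
proof -
 have "Pb T 0 (2 * a) (Wit g k) \<and> Pb T \<theta> (2 * a) (Wit g k)"
 proof (induction k)
  case 0
  thus ?case using a by (simp add: Pb_zero)
 next
  case (Suc k)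
  note jm = jm_Wit[OF g] jm_lin[OF g] duh_integrand_measurable(2)[OF jm_Wit[OF g]]
  have p: "0 <= K0 TYPE('n) \<theta> * (2 * a) * (2 * a)" "0 <= K1 TYPE('n) \<theta> * (2 * a) * (2 * a)" using K_nonneg \<theta> a by (auto intro!: mult_nonneg_nonneg)
  have "Pb T 0 (a + K0 TYPE('n) \<theta> * (2 * a) * (2 * a)) (Wit g (Suc k))" unfolding Wit.simps using Suc a \<theta> by (intro Pb_add L Pb_duh_0 jm p) auto
  moreover have "Pb T \<theta> (a + K1 TYPE('n) \<theta> * (2 * a) * (2 * a)) (Wit g (Suc k))" unfolding Wit.simps using Suc a \<theta> by (intro Pb_add L Pb_duh_1 jm p) auto
  moreover have "a + K0 TYPE('n) \<theta> * (2 * a) * (2 * a) <= 2 * a" "a + K1 TYPE('n) \<theta> * (2 * a) * (2 * a) <= 2 * a" using mult_right_mono[OF small(1) a] mult_right_mono[OF small(2) a] by (simp_all add: algebra_simps)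
  ultimately show ?case by (auto intro: Pb_mono)
 qed
 thus "Pb T 0 (2 * a) (Wit g k)" "Pb T \<theta> (2 * a) (Wit g k)" by auto
qed

text \<open>The Duhamel bound at index s is linear with factor at most 1/2, so the bound of the
  linear part at most doubles, whatever its size.\<close>

lemma Pb_Wit_other:
 fixes g :: "'n::finite => 'n cfun"
 assumes g: "\<And>i. g i \<in> BM"
  and W: "\<And>k. Pb T 0 (2 * a) (Wit g k)" and a: "0 <= a" and L: "Pb T s A (lin g)" and A: "0 <= A"
  and \<theta>: "0 < \<theta>" "\<theta> <= s" "real CARD('n) * s < 1"
  and small: "4 * K1 TYPE('n) \<theta> * a <= 1"
 shows "Pb T s (2 * A) (Wit g k)"
proof (induction k)
 case 0
 thus ?case using A by (simp add: Pb_zero)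
next
 case (Suc k)
 note jm = jm_Wit[OF g] jm_lin[OF g] duh_integrand_measurable(2)[OF jm_Wit[OF g]]
 have p: "0 <= K1 TYPE('n) \<theta> * (2 * a) * (2 * A)" using K_nonneg \<theta> a A by (auto intro!: mult_nonneg_nonneg)
 have "Pb T s (A + K1 TYPE('n) \<theta> * (2 * a) * (2 * A)) (Wit g (Suc k))" unfolding Wit.simps using Suc a A \<theta> by (intro Pb_add L Pb_duh_1[where \<theta> = \<theta>] jm p W) auto
 moreover have "A + K1 TYPE('n) \<theta> * (2 * a) * (2 * A) <= 2 * A" using mult_right_mono[OF small A] by (simp add: algebra_simps)
 ultimately show ?case by (auto intro: Pb_mono)
qed

lemma Pb_Winf:
 fixes g :: "'n::finite => 'n cfun"
 assumes g: "\<And>i. g i \<in> BM" and "\<And>k. Pb T s A (Wit g k)"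
 shows "Pb T s A (Winf g)" unfolding Pb_def
proof (intro allI impI)
 fix t assume t: "0 < t \<and> ereal t <= T"
 have "wbd s (A * t powr (- (1 - real CARD('n) * s) / 2)) (%x. SUP k. Wit g k t x)" using t assms(2) by (intro wbd_SUP jm_slice[OF jm_Wit[OF g]]) (auto simp: incseq_def le_fun_def Pb_def intro!: incseqD[OF Wit_incseq])
 thus "wbd s (A * t powr (- (1 - real CARD('n) * s) / 2)) (Winf g t)" by (simp add: Winf_def[abs_def])
qed

lemma Pb_interpolate:
 fixes V :: "real => 'n::finite efun"
 assumes "Pb T s1 A V" "Pb T s2 B V" "0 <= A" "0 <= B" "0 <= \<theta>" "\<theta> <= 1"
 shows "Pb T ((1 - \<theta>) * s1 + \<theta> * s2) (A powr (1 - \<theta>) * B powr \<theta>) V" unfolding Pb_def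
proof (intro allI impI)
 fix t assume t: "0 < t \<and> ereal t <= T"
 let ?n = "real CARD('n)"
 let ?s = "(1 - \<theta>) * s1 + \<theta> * s2"
 have "wbd ?s ((A * t powr (- (1 - ?n * s1) / 2)) powr (1 - \<theta>) * (B * t powr (- (1 - ?n * s2) / 2)) powr \<theta>) (V t)" using t assms by (intro wbd_interpolate PbD[OF assms(1)] PbD[OF assms(2)]) auto
 also have "(A * t powr (- (1 - ?n * s1) / 2)) powr (1 - \<theta>) * (B * t powr (- (1 - ?n * s2) / 2)) powr \<theta> =
   A powr (1 - \<theta>) * B powr \<theta> * t powr (- (1 - ?n * ?s) / 2)"
 proof -
  have "- (1 - ?n * s1) / 2 * (1 - \<theta>) + - (1 - ?n * s2) / 2 * \<theta> = - (1 - ?n * ?s) / 2" by (simp add: field_simps)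
  hence "t powr (- (1 - ?n * s1) / 2 * (1 - \<theta>)) * t powr (- (1 - ?n * s2) / 2 * \<theta>) = t powr (- (1 - ?n * ?s) / 2)" by (simp only: powr_add[symmetric])
  thus ?thesis using assms(3,4) by (simp add: powr_mult powr_powr mult_ac)
 qed
 finally show "wbd ?s (A powr (1 - \<theta>) * B powr \<theta> * t powr (- (1 - ?n * ?s) / 2)) (V t)" .
qed

section \<open>Convergence of the Picard iterates\<close>

definition msym :: "'n => 'n => 'n => 'n::finite cfun" where
 "msym i a b x = leray_symbol i a x * (\<i> * (cplx (x $ b) * cplx (fconst TYPE('n))))"

lemma norm_msym: "norm (msym i a b x) <= 2 * fconst TYPE('n) * norm (x :: real^'n::finite)"
proof -
 have "norm (leray_symbol i a x) * \<bar>x $ b\<bar> <= 2 * norm x" by (intro mult_mono leray_symbol_le component_le_norm_cart) auto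
 thus ?thesis using mult_right_mono[of _ _ "fconst TYPE('n)"] by (fastforce simp: msym_def norm_mult mult_ac)
qed

lemma msym_borel[measurable]: "msym i a b \<in> BM" unfolding msym_def[abs_def] by measurable

lemma nonlin_msym: "nonlin g i x = (\<Sum>a\<in>UNIV. \<Sum>b\<in>UNIV. msym i a b x * cconv (g a) (g b) x)" by (simp add: nonlin_def msym_def sum_distrib_left mult_ac)

text \<open>The heat factor of the Duhamel integral, cut off to times in (0, t) so that integrals
  run over the whole line; \<open>kern\<close> is its modulus times |x|.\<close>

definition pre :: "real => real^'n::finite => real => complex" where
 "pre t x q = (if 0 < q \<and> q < t then cplx (exp (- (t - q) * (norm x)^2)) else 0)"

lemma norm_pre: "norm (pre t x q) * norm x = kern t x q" by (simp add: pre_def kern_def del: of_real_exp)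

lemma measurable_pre[measurable (raw)]:
 assumes [measurable]: "f \<in> borel_measurable M" "g \<in> borel_measurable M" "h \<in> borel_measurable M"
 shows "(%x. pre (f x) (g x) (h x)) \<in> borel_measurable M" unfolding pre_def by measurable

lemma pre_sum_le:
 fixes z :: "'n::finite => 'n => complex"
 shows "enorm (pre t x q * (\<Sum>a\<in>UNIV. \<Sum>b\<in>UNIV. msym i a b x * z a b)) <=
  ennreal (2 * fconst TYPE('n) * kern t x q) * (\<Sum>a\<in>UNIV. \<Sum>b\<in>UNIV. enorm (z a b))"
proof -
 define c where "c = fconst TYPE('n)"
 have "norm (\<Sum>a\<in>UNIV. \<Sum>b\<in>UNIV. msym i a b x * z a b) <= (\<Sum>a\<in>UNIV. \<Sum>b\<in>UNIV. 2 * c * norm x * norm (z a b))"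
 proof (intro order_trans[OF norm_sum] sum_mono)
  fix a b
  show "norm (msym i a b x * z a b) <= 2 * c * norm x * norm (z a b)" unfolding norm_mult c_def by (rule mult_right_mono[OF norm_msym norm_ge_zero])
 qed
 hence "norm (pre t x q * (\<Sum>a\<in>UNIV. \<Sum>b\<in>UNIV. msym i a b x * z a b)) <=
   norm (pre t x q) * (\<Sum>a\<in>UNIV. \<Sum>b\<in>UNIV. 2 * c * norm x * norm (z a b))" unfolding norm_mult[of "pre t x q"] by (rule mult_left_mono) simp
 also have "... = (2 * c * (norm (pre t x q) * norm x)) * (\<Sum>a\<in>UNIV. \<Sum>b\<in>UNIV. norm (z a b))" by (simp only: sum_distrib_left mult_ac)
 finally have "enorm (pre t x q * (\<Sum>a\<in>UNIV. \<Sum>b\<in>UNIV. msym i a b x * z a b)) <=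
   ennreal ((2 * fconst TYPE('n) * kern t x q) * (\<Sum>a\<in>UNIV. \<Sum>b\<in>UNIV. norm (z a b)))" unfolding norm_pre c_def by (rule ennreal_leI)
 also have "... = ennreal (2 * fconst TYPE('n) * kern t x q) * (\<Sum>a\<in>UNIV. \<Sum>b\<in>UNIV. enorm (z a b))" by (subst ennreal_mult) (auto intro!: sum_nonneg mult_nonneg_nonneg kern_nonneg simp: sum_nonneg)
 finally show ?thesis .
qed

lemma kappa_kern: "ennreal (kappa TYPE('n::finite)) * (ennreal (kern t (x :: real^'n) q) * P) =
  ennreal (2 * fconst TYPE('n) * kern t x q) * (\<Sum>a\<in>(UNIV::'n set). \<Sum>b\<in>(UNIV::'n set). P)"
proof -
 have "(\<Sum>a\<in>(UNIV::'n set). \<Sum>b\<in>(UNIV::'n set). P) = ennreal ((real CARD('n))\<^sup>2) * P" by (simp add: power2_eq_square ennreal_mult ennreal_of_nat_eq_real_of_nat mult_ac)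
 moreover have "ennreal (kappa TYPE('n)) * (ennreal (kern t x q) * P) = ennreal (kappa TYPE('n) * kern t x q) * P" by (simp add: ennreal_mult kern_nonneg kappa_nonneg mult.assoc)
 moreover have "ennreal (2 * fconst TYPE('n) * kern t x q) * (ennreal ((real CARD('n))\<^sup>2) * P) =
   ennreal (2 * fconst TYPE('n) * kern t x q * (real CARD('n))\<^sup>2) * P" by (simp add: ennreal_mult kern_nonneg mult.assoc)
 ultimately show ?thesis by (simp add: kappa_def mult_ac)
qed

lemma pre_sum_bound:
 fixes z :: "'n::finite => 'n => complex"
 assumes "\<And>a b. enorm (z a b) <= P"
 shows "enorm (pre t x q * (\<Sum>a\<in>UNIV. \<Sum>b\<in>UNIV. msym i a b x * z a b)) <=
  ennreal (kappa TYPE('n)) * (ennreal (kern t x q) * P)" unfolding kappa_kern by (rule order_trans[OF pre_sum_le]) (intro mult_left_mono sum_mono assms, simp)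

text \<open>The difference estimate is kept additive, modulus plus lower majorant below upper
  majorant, because subtracting possibly infinite values would carry no information.\<close>

lemma pre_sum_diff:
 fixes z :: "'n::finite => 'n => complex"
 assumes "\<And>a b. enorm (z a b) + Q <= P"
 shows "enorm (pre t x q * (\<Sum>a\<in>UNIV. \<Sum>b\<in>UNIV. msym i a b x * z a b)) +
  ennreal (kappa TYPE('n)) * (ennreal (kern t x q) * Q) <= ennreal (kappa TYPE('n)) * (ennreal (kern t x q) * P)"
proof -
 let ?c = "ennreal (2 * fconst TYPE('n) * kern t x q)"
 have "enorm (pre t x q * (\<Sum>a\<in>UNIV. \<Sum>b\<in>UNIV. msym i a b x * z a b)) + ennreal (kappa TYPE('n)) * (ennreal (kern t x q) * Q)
  <= ?c * (\<Sum>a\<in>UNIV. \<Sum>b\<in>UNIV. enorm (z a b)) + ?c * (\<Sum>a\<in>(UNIV::'n set). \<Sum>b\<in>(UNIV::'n set). Q)" unfolding kappa_kern by (intro add_mono pre_sum_le order_refl)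
 also have "... = ?c * (\<Sum>a\<in>UNIV. \<Sum>b\<in>UNIV. enorm (z a b) + Q)" by (simp only: distrib_left[symmetric] sum.distrib)
 also have "... <= ?c * (\<Sum>a\<in>(UNIV::'n set). \<Sum>b\<in>(UNIV::'n set). P)" by (intro mult_left_mono sum_mono assms) simp
 finally show ?thesis unfolding kappa_kern .
qed

definition duint :: "('n => real => 'n::finite cfun) => 'n => real => real^'n => real \<times> (real^'n) => complex" where
 "duint u i t x y = pre t x (fst y) * (\<Sum>a\<in>UNIV. \<Sum>b\<in>UNIV. msym i a b x * (u a (fst y) (x - snd y) * u b (fst y) (snd y)))"

definition du :: "('n => real => 'n::finite cfun) => 'n => real => 'n cfun" where
 "du u i t x = (LINT y|lborel. duint u i t x y)"

lemma duint_borel: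
 assumes u: "\<And>a. jm (u a)"
 shows "duint u i t x \<in> BM" unfolding duint_def by (intro borel_measurable_times measurable_pre borel_measurable_sum jm_comp[OF u] borel_measurable_const) auto

lemma du_jm:
 fixes u :: "'n => real => 'n::finite cfun"
 assumes u: "\<And>a. jm (u a)"
 shows "jm (du u i)"
proof -
 note jm_comp[OF u, measurable (raw)]
 show ?thesis unfolding du_def duint_def by measurable
qed

lemma duint_bound:
 fixes u :: "'n => real => 'n::finite cfun"
 assumes "\<And>a t x. enorm (u a t x) <= V t x"
 shows "enorm (duint u i t x y) <= ennreal (kappa TYPE('n)) * (ennreal (kern t x (fst y)) * (V (fst y) (x - snd y) * V (fst y) (snd y)))" unfolding duint_def by (intro pre_sum_bound) (auto simp: norm_mult ennreal_mult intro!: mult_mono assms)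

lemma duint_nn_bound:
 fixes u :: "'n => real => 'n::finite cfun"
 assumes "\<And>a t x. enorm (u a t x) <= V t x" and V: "jm V"
 shows "(NN y. enorm (duint u i t x y)) <= duh V t x"
proof -
 have "(NN y. enorm (duint u i t x y)) <= (NN y. ennreal (kappa TYPE('n)) * (ennreal (kern t x (fst y)) * (V (fst y) (x - snd y) * V (fst y) (snd y))))" by (intro nn_integral_mono duint_bound assms)
 also have "... = duh V t x" unfolding duh_def using duh_integrand_measurable(1)[OF V] by (intro nn_integral_cmult) simp
 finally show ?thesis .
qed

lemma duint_integrable:
 fixes u :: "'n => real => 'n::finite cfun"
 assumes "\<And>a t x. enorm (u a t x) <= V t x" and V: "jm V" and u: "\<And>a. jm (u a)" and fin: "duh V t x < \<infinity>"
 shows "integrable lborel (duint u i t x)" by (rule integrableI_bounded) (use duint_borel[OF u] order_le_less_trans[OF duint_nn_bound[OF assms(1) V] fin] in auto)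

lemma du_bound:
 fixes u :: "'n => real => 'n::finite cfun"
 assumes "\<And>a t x. enorm (u a t x) <= V t x" and V: "jm V"
 shows "enorm (du u i t x) <= duh V t x"
proof (cases "integrable lborel (duint u i t x)")
 case True
 thus ?thesis unfolding du_def by (rule order_trans[OF integral_norm_bound_ennreal duint_nn_bound]) (use assms in auto)
qed (simp add: du_def not_integrable_integral_eq)

text \<open>The product step of the telescoping induction: x'y' - xy is split as (x' - x)y' + x(y' -
  y), and each difference is paid for by the growth of the majorant.\<close>

lemma product_diff_bound:
 fixes x y x' y' :: complex and v1 v2 w1 w2 :: ennreal
 assumes "enorm (x' - x) + v1 <= w1" "enorm (y' - y) + v2 <= w2"
  "ennreal (norm y') <= w2" "enorm x <= v1"
 shows "enorm (x' * y' - x * y) + v1 * v2 <= w1 * w2"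
proof -
 have "norm (x' * y' - x * y) <= norm (x' - x) * norm y' + norm x * norm (y' - y)"
 proof -
  have e: "x' * y' - x * y = (x' - x) * y' + x * (y' - y)" by (simp add: algebra_simps)
  show ?thesis unfolding e by (rule order_trans[OF norm_triangle_ineq]) (simp add: norm_mult)
 qed
 hence "enorm (x' * y' - x * y) <= enorm (x' - x) * ennreal (norm y') + enorm x * enorm (y' - y)" by (metis ennreal_leI ennreal_mult ennreal_plus mult_nonneg_nonneg norm_ge_zero)
 also have "... <= enorm (x' - x) * w2 + v1 * enorm (y' - y)" by (intro add_mono mult_mono assms order_refl) auto
 finally have "enorm (x' * y' - x * y) + v1 * v2 <= enorm (x' - x) * w2 + (v1 * enorm (y' - y) + v1 * v2)" by (simp add: add.assoc[symmetric] add_right_mono)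
 also have "v1 * enorm (y' - y) + v1 * v2 <= v1 * w2" unfolding distrib_left[symmetric] by (intro mult_left_mono assms) simp
 also have "enorm (x' - x) * w2 + v1 * w2 = (enorm (x' - x) + v1) * w2" by (simp add: distrib_right)
 also have "... <= w1 * w2" by (intro mult_right_mono assms) simp
 finally show ?thesis by (simp add: add_left_mono)
qed

lemma du_diff_bound:
 fixes u :: "'n => real => 'n::finite cfun"
 assumes b: "\<And>a t x. enorm (u a t x) <= V t x" "\<And>a t x. enorm (u' a t x) <= V' t x"
  and jm: "jm V" "jm V'" "\<And>a. jm (u a)" "\<And>a. jm (u' a)"
  and fin: "duh V t x < \<infinity>" "duh V' t x < \<infinity>"
  and d: "AE y in lborel. 0 < fst y \<and> fst y < t \<longrightarrow>
    (\<forall>a. enorm (u' a (fst y) (x - snd y) - u a (fst y) (x - snd y)) + V (fst y) (x - snd y) <= V' (fst y) (x - snd y)) \<and>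
    (\<forall>a. enorm (u' a (fst y) (snd y) - u a (fst y) (snd y)) + V (fst y) (snd y) <= V' (fst y) (snd y))"
 shows "enorm (du u' i t x - du u i t x) + duh V t x <= duh V' t x"
proof -
 let ?k = "%V y. ennreal (kappa TYPE('n)) * (ennreal (kern t x (fst y)) * (V (fst y) (x - snd y) * V (fst y) (snd y)))"
 have km: "?k V \<in> borel_measurable lborel" "?k V' \<in> borel_measurable lborel" using duh_integrand_measurable(1)[OF jm(1)] duh_integrand_measurable(1)[OF jm(2)] by measurable
 have kd: "(NN y. ?k V y) = duh V t x" "(NN y. ?k V' y) = duh V' t x" unfolding duh_def using duh_integrand_measurable(1)[OF jm(1)] duh_integrand_measurable(1)[OF jm(2)] by (subst nn_integral_cmult; simp)+
 have i: "integrable lborel (duint u i t x)" "integrable lborel (duint u' i t x)" using duint_integrable[where u=u, OF b(1) jm(1,3) fin(1)] duint_integrable[where u=u', OF b(2) jm(2,4) fin(2)] by auto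
 have "du u' i t x - du u i t x = (LINT y|lborel. duint u' i t x y - duint u i t x y)" unfolding du_def by (rule Bochner_Integration.integral_diff[symmetric, OF i(2,1)])
 hence "enorm (du u' i t x - du u i t x) <= (NN y. enorm (duint u' i t x y - duint u i t x y))" using integral_norm_bound_ennreal[OF Bochner_Integration.integrable_diff[OF i(2,1)]] by simp
 hence "enorm (du u' i t x - du u i t x) + duh V t x <= (NN y. enorm (duint u' i t x y - duint u i t x y)) + (NN y. ?k V y)" unfolding kd by (rule add_right_mono)
 also have "... = (NN y. enorm (duint u' i t x y - duint u i t x y) + ?k V y)"
 proof (intro nn_integral_add[symmetric] km)
  have [measurable]: "duint u i t x \<in> BM" "duint u' i t x \<in> BM" using duint_borel[where u=u, OF jm(3)] duint_borel[where u=u', OF jm(4)] by auto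
  show "(%y. enorm (duint u' i t x y - duint u i t x y)) \<in> borel_measurable lborel" by measurable
 qed
 also have "... <= (NN y. ?k V' y)"
 proof (rule nn_integral_mono_AE)
  show "AE y in lborel. enorm (duint u' i t x y - duint u i t x y) + ?k V y <= ?k V' y" using d
  proof eventually_elim
   case (elim y)
   let ?z = "%a b. u' a (fst y) (x - snd y) * u' b (fst y) (snd y) - u a (fst y) (x - snd y) * u b (fst y) (snd y)"
   have eq: "duint u' i t x y - duint u i t x y = pre t x (fst y) * (\<Sum>a\<in>UNIV. \<Sum>b\<in>UNIV. msym i a b x * ?z a b)" by (simp add: duint_def right_diff_distrib sum_subtractf)
   show ?case
   proof (cases "0 < fst y \<and> fst y < t")
    case True
    show ?thesis unfolding eq by (rule pre_sum_diff) (use elim True b in \<open>auto intro!: product_diff_bound\<close>)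
   next
    case False
    hence "kern t x (fst y) = 0" "pre t x (fst y) = 0" by (auto simp: kern_def pre_def)
    thus ?thesis unfolding eq by simp
   qed
  qed
 qed
 finally show ?thesis unfolding kd .
qed

primrec uit :: "('n::finite => 'n cfun) => nat => 'n => real => 'n cfun" where
 "uit g 0 = (%i t x. 0)"
| "uit g (Suc k) = (%i t x. cplx (exp (- t * (norm x)^2)) * g i x - du (uit g k) i t x)"

lemma jm_uit:
 assumes g: "\<And>i. g i \<in> BM"
 shows "jm (uit g k i)"
proof (induction k arbitrary: i)
 case (Suc k)
 have "jm (du (uit g k) i)" by (rule du_jm) (rule Suc)
 moreover have "jm (%t x. cplx (exp (- t * (norm x)^2)) * g i x)" using measurable_compose[OF measurable_snd g[of i]] by measurable
 ultimately show ?case by (simp only: uit.simps) (rule borel_measurable_diff)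
qed simp

lemma lin_ge: "enorm (cplx (exp (- t * (norm x)^2)) * g i x) <= lin g t x"
proof -
 have "enorm (g i x) <= (\<Sum>i\<in>UNIV. enorm (g i x))" by (rule member_le_sum) auto
 hence "ennreal (exp (- t * (norm x)^2)) * enorm (g i x) <= lin g t x" unfolding lin_def by (intro mult_left_mono) auto
 thus ?thesis by (simp add: norm_mult ennreal_mult del: of_real_exp)
qed

lemma uit_bound:
 assumes g: "\<And>i. g i \<in> BM"
 shows "enorm (uit g k i t x) <= Wit g k t x"
proof (induction k arbitrary: i t x)
 case (Suc k)
 let ?l = "cplx (exp (- t * (norm x)^2)) * g i x"
 have "enorm (uit g (Suc k) i t x) <= ennreal (norm ?l + norm (du (uit g k) i t x))" unfolding uit.simps by (intro ennreal_leI norm_triangle_ineq4)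
 also have "... = ennreal (norm ?l) + enorm (du (uit g k) i t x)" by (rule ennreal_plus) auto
 also have "... <= lin g t x + duh (Wit g k) t x" by (intro add_mono lin_ge du_bound Suc jm_Wit g)
 finally show ?case by simp
qed simp

lemma AE_pair_finite:
 fixes W :: "real => 'n::finite efun"
 assumes W: "jm W" and ae: "\<And>q. 0 < q ==> q < t ==> AE z in lborel. W q z < \<infinity>"
 shows "AE y in lborel. 0 < fst y \<and> fst y < t \<longrightarrow> W (fst y) (z - snd y) < \<infinity> \<and> W (fst y) (snd y) < \<infinity>" unfolding lborel_pair_eq
proof (rule lborel_pair.AE_pair_measure)
 have [measurable]: "(%y. W (fst y) (z - snd y)) \<in> borel_measurable (borel \<Otimes>\<^sub>M borel)" "(%y. W (fst y) (snd y)) \<in> borel_measurable (borel \<Otimes>\<^sub>M borel)" by (intro jm_comp[OF W]; measurable)+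
 have "{y \<in> space (borel \<Otimes>\<^sub>M borel). 0 < fst y \<and> fst y < t \<longrightarrow> W (fst y) (z - snd y) < \<infinity> \<and> W (fst y) (snd y) < \<infinity>} \<in> sets (borel \<Otimes>\<^sub>M borel)" by measurable
 thus "{y \<in> space (lborel \<Otimes>\<^sub>M lborel). 0 < fst y \<and> fst y < t \<longrightarrow> W (fst y) (z - snd y) < \<infinity> \<and> W (fst y) (snd y) < \<infinity>} \<in> sets (lborel \<Otimes>\<^sub>M lborel)" by (simp add: space_pair_measure cong: sets_pair_measure_cong)
 show "AE x in lborel. AE y in lborel. 0 < fst (x, y) \<and> fst (x, y) < t \<longrightarrow> W (fst (x, y)) (z - snd (x, y)) < \<infinity> \<and> W (fst (x, y)) (snd (x, y)) < \<infinity>"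
 proof (rule AE_I2)
  fix x :: real
  show "AE y in lborel. 0 < fst (x, y) \<and> fst (x, y) < t \<longrightarrow> W (fst (x, y)) (z - snd (x, y)) < \<infinity> \<and> W (fst (x, y)) (snd (x, y)) < \<infinity>"
  proof (cases "0 < x \<and> x < t")
   case True
   hence "AE y in lborel. W x y < \<infinity>" by (intro ae) auto
   with AE_lborel_reflect[OF this, of z] show ?thesis by eventually_elim simp
  qed auto
 qed
qed

lemma AE_finite_if_Pb0:
 fixes W :: "real => 'n::finite efun"
 assumes "Pb T 0 A W" "jm W" "0 <= A" "0 < q" "ereal q <= T"
 shows "AE z in lborel. W q z < \<infinity>"
proof -
 note [measurable] = jm_slice[OF assms(2), of q]
 have "(NN x. W q x) <= ennreal (A * q powr (- 1 / 2))" using PbD[OF assms(1,4,5)] assms(3) by (subst (asm) wbd_0_iff) auto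
 hence "(NN x. W q x) \<noteq> \<infinity>" by (auto simp: top_unique)
 hence "AE x in lborel. W q x \<noteq> \<infinity>" by (intro nn_integral_PInf_AE) auto
 thus ?thesis by eventually_elim (simp add: top.not_eq_extremum)
qed

lemma duh_le_Winf:
 assumes "\<And>i. g i \<in> BM"
 shows "duh (Wit g k) t x <= Winf g t x" "duh (Winf g) t x <= Winf g t x"
proof -
 show "duh (Winf g) t x <= Winf g t x"  using Winf_fixpoint[of g t x, OF assms] le_iff_add add.commute by metis
 thus "duh (Wit g k) t x <= Winf g t x" by (rule order_trans[rotated]) (intro duh_mono Wit_le_Winf)
qed

text \<open>The induction needs finite majorants, so the claim is restricted to points where
  \<open>Winf\<close> is finite. Inside the Duhamel integral the induction hypothesis is then
  available almost everywhere, since \<open>Winf\<close> has a finite integral at every time in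
  range.\<close>

lemma uit_diff_bound:
 fixes g :: "'n::finite => 'n cfun"
 assumes g: "\<And>i. g i \<in> BM" and P: "Pb T 0 A (Winf g)" "0 <= A"
  and "0 < t" "ereal t <= T" "Winf g t x < \<infinity>"
 shows "enorm (uit g (Suc k) i t x - uit g k i t x) + Wit g k t x <= Wit g (Suc k) t x" using assms(4-)
proof (induction k arbitrary: i t x)
 case 0
 have "du (%i t x. 0) i t x = 0" by (simp add: du_def duint_def)
 moreover have "duh (%t x. 0) t x = 0" by (simp add: duh_def)
 ultimately show ?case using lin_ge[of t x g i] by simp
next
 case (Suc k)
 have fin: "duh (Wit g k) t x < \<infinity>" for k using duh_le_Winf(1)[OF g] Suc.prems(3) by (rule order_le_less_trans)
 have d: "enorm (du (uit g (Suc k)) i t x - du (uit g k) i t x) + duh (Wit g k) t x <= duh (Wit g (Suc k)) t x"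
 proof (rule du_diff_bound[OF uit_bound[OF g] uit_bound[OF g] jm_Wit[OF g] jm_Wit[OF g] jm_uit[OF g] jm_uit[OF g] fin fin])
  have "AE y in lborel. 0 < fst y \<and> fst y < t \<longrightarrow> Winf g (fst y) (x - snd y) < \<infinity> \<and> Winf g (fst y) (snd y) < \<infinity>"
  proof (rule AE_pair_finite[OF jm_Winf[OF g]])
   fix q assume "0 < q" "q < t"
   thus "AE x in lborel. Winf g q x < \<infinity>" using Suc.prems by (intro AE_finite_if_Pb0[OF P(1) jm_Winf[OF g] P(2)]) (auto intro: order_trans[of "ereal q" "ereal t" T])
  qed
  thus "AE y in lborel. 0 < fst y \<and> fst y < t \<longrightarrow>
    (\<forall>a. enorm (uit g (Suc k) a (fst y) (x - snd y) - uit g k a (fst y) (x - snd y)) + Wit g k (fst y) (x - snd y) <= Wit g (Suc k) (fst y) (x - snd y)) \<and>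
    (\<forall>a. enorm (uit g (Suc k) a (fst y) (snd y) - uit g k a (fst y) (snd y)) + Wit g k (fst y) (snd y) <= Wit g (Suc k) (fst y) (snd y))"
  proof eventually_elim
   case (elim y)
   show ?case
   proof (intro impI)
    assume y: "0 < fst y \<and> fst y < t"
    hence "ereal (fst y) <= T" using Suc.prems by (auto intro: order_trans[of "ereal (fst y)" "ereal t" T])
    with y elim Suc.IH show "(\<forall>a. enorm (uit g (Suc k) a (fst y) (x - snd y) - uit g k a (fst y) (x - snd y)) + Wit g k (fst y) (x - snd y) <= Wit g (Suc k) (fst y) (x - snd y)) \<and>
    (\<forall>a. enorm (uit g (Suc k) a (fst y) (snd y) - uit g k a (fst y) (snd y)) + Wit g k (fst y) (snd y) <= Wit g (Suc k) (fst y) (snd y))" by blast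
   qed
  qed
 qed
 have "uit g (Suc (Suc k)) i t x - uit g (Suc k) i t x = - (du (uit g (Suc k)) i t x - du (uit g k) i t x)" unfolding uit.simps by algebra
 hence "enorm (uit g (Suc (Suc k)) i t x - uit g (Suc k) i t x) + Wit g (Suc k) t x =
   lin g t x + (enorm (du (uit g (Suc k)) i t x - du (uit g k) i t x) + duh (Wit g k) t x)" by (simp only: norm_minus_cancel Wit.simps(2) add.left_commute)
 also have "... <= lin g t x + duh (Wit g (Suc k)) t x" by (intro add_left_mono d)
 finally show ?case by (simp only: Wit.simps(2))
qed

text \<open>The sum of the difference bounds telescopes on the majorant side, so the increments are
  absolutely summable wherever \<open>Winf\<close> is finite.\<close>

lemma uit_convergent:
 fixes g :: "'n::finite => 'n cfun"
 assumes g: "\<And>i. g i \<in> BM" and P: "Pb T 0 A (Winf g)" "0 <= A"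
  and t: "0 < t" "ereal t <= T" and fin: "Winf g t x < \<infinity>"
 shows "convergent (%k. uit g k i t x)"
proof -
 obtain M where M: "Winf g t x = ennreal M" "0 <= M" using fin by (cases "Winf g t x") auto
 let ?d = "%k. uit g (Suc k) i t x - uit g k i t x"
 have "(\<Sum>k<n. enorm (?d k)) + Wit g 0 t x <= Wit g n t x" for n
 proof (induction n)
  case (Suc n)
  have "(\<Sum>k<Suc n. enorm (?d k)) + Wit g 0 t x = enorm (?d n) + ((\<Sum>k<n. enorm (?d k)) + Wit g 0 t x)" by (simp only: sum.lessThan_Suc add_ac)
  also have "... <= enorm (?d n) + Wit g n t x" by (intro add_left_mono Suc)
  also have "... <= Wit g (Suc n) t x" by (rule uit_diff_bound[OF g P t fin])
  finally show ?case .
 qed simp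
 hence "ennreal (\<Sum>k<n. norm (?d k)) <= ennreal M" for n using order_trans[OF _ Wit_le_Winf] M by (fastforce simp del: Wit.simps(2) uit.simps)
 hence "(\<Sum>k<n. norm (?d k)) <= M" for n using M by (simp del: uit.simps)
 hence "summable (%k. norm (?d k))" by (intro summableI_nonneg_bounded) auto
 hence "summable ?d" by (rule summable_norm_cancel)
 hence "convergent (%n. \<Sum>k<n. ?d k)" by (simp only: summable_iff_convergent)
 moreover have "(\<Sum>k<n. ?d k) = uit g n i t x" for n by (subst sum_lessThan_telescope) simp
 ultimately show ?thesis by simp
qed

text \<open>The default 0 keeps joint measurability and the bound by \<open>Winf\<close> at every
  point. For times in range it changes the limit only where the majorant is infinite, a null set
  under a bound \<open>Pb\<close> at index 0.\<close>

definition usol :: "ereal => ('n::finite => 'n cfun) => 'n => real => 'n cfun" where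
 "usol T g i t x = (if Winf g t x < \<infinity> \<and> 0 < t \<and> ereal t <= T then lim (%k. uit g k i t x) else 0)"

lemma jm_usol:
 fixes g :: "'n::finite => 'n cfun"
 assumes g: "\<And>i. g i \<in> BM"
 shows "jm (usol T g i)"
proof -
 note [measurable] = jm_Winf[OF g] jm_uit[OF g]
 show ?thesis unfolding usol_def by measurable
qed

lemma uit_tendsto_usol:
 fixes g :: "'n::finite => 'n cfun"
 assumes g: "\<And>i. g i \<in> BM" and P: "Pb T 0 A (Winf g)" "0 <= A"
  and t: "0 < t" "ereal t <= T" and fin: "Winf g t x < \<infinity>"
 shows "(%k. uit g k i t x) \<longlonglongrightarrow> usol T g i t x" using uit_convergent[OF assms] t fin by (simp add: usol_def convergent_LIMSEQ_iff)

lemma usol_bound: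
 fixes g :: "'n::finite => 'n cfun"
 assumes g: "\<And>i. g i \<in> BM" and P: "Pb T 0 A (Winf g)" "0 <= A"
 shows "enorm (usol T g i t x) <= Winf g t x"
proof (cases "Winf g t x < \<infinity> \<and> 0 < t \<and> ereal t <= T")
 case True
 have "(%k. enorm (uit g k i t x)) \<longlonglongrightarrow> enorm (usol T g i t x)" using True by (intro tendsto_ennrealI tendsto_norm uit_tendsto_usol[OF g P]) auto
 thus ?thesis by (rule LIMSEQ_le_const2) (intro exI[of _ 0] allI impI order_trans[OF uit_bound[OF g] Wit_le_Winf])
qed (auto simp: usol_def)

text \<open>Dominated convergence with the integrand of \<open>duh (Winf g)\<close>, whose integral
  at (t, x) is finite because it is at most \<open>Winf g t x\<close>.\<close>

lemma usol_fixpoint: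
 fixes g :: "'n::finite => 'n cfun"
 assumes g: "\<And>i. g i \<in> BM" and P: "Pb T 0 A (Winf g)" "0 <= A"
  and t: "0 < t" "ereal t <= T" and fin: "Winf g t x < \<infinity>"
 shows "usol T g i t x = cplx (exp (- t * (norm x)^2)) * g i x - du (usol T g) i t x"
proof -
 let ?w = "%y. ennreal (kappa TYPE('n)) * (ennreal (kern t x (fst y)) * (Winf g (fst y) (x - snd y) * Winf g (fst y) (snd y)))"
 have wm[measurable]: "?w \<in> BM" using duh_integrand_measurable(1)[OF jm_Winf[OF g]] by measurable
 have "(NN y. ?w y) = duh (Winf g) t x" unfolding duh_def using duh_integrand_measurable(1)[OF jm_Winf[OF g]] by (intro nn_integral_cmult) simp
 also have "... < \<infinity>" using duh_le_Winf(2)[OF g] fin by (rule order_le_less_trans)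
 finally have wfin: "(NN y. ?w y) < \<infinity>" .
 hence wae: "AE y in lborel. ?w y \<noteq> \<infinity>" by (intro nn_integral_PInf_AE) auto
 have ae: "AE y in lborel. 0 < fst y \<and> fst y < t \<longrightarrow> Winf g (fst y) (x - snd y) < \<infinity> \<and> Winf g (fst y) (snd y) < \<infinity>"
 proof (rule AE_pair_finite[OF jm_Winf[OF g]])
  fix q assume "0 < q" "q < t"
  thus "AE x in lborel. Winf g q x < \<infinity>" using t by (intro AE_finite_if_Pb0[OF P(1) jm_Winf[OF g] P(2)]) (auto intro: order_trans[of "ereal q" "ereal t" T])
 qed
 have "(%k. du (uit g k) i t x) \<longlonglongrightarrow> du (usol T g) i t x" unfolding du_def
 proof (rule integral_dominated_convergence[where w = "%y. enn2real (?w y)"])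
  show "duint (usol T g) i t x \<in> borel_measurable lborel" using duint_borel[OF jm_usol[OF g]] by simp
  show "duint (uit g k) i t x \<in> borel_measurable lborel" for k using duint_borel[OF jm_uit[OF g]] by simp
  show "integrable lborel (%y. enn2real (?w y))"
  proof (rule integrableI_bounded)
   have "(NN y. enorm (enn2real (?w y))) = (NN y. ?w y)"
   proof (rule nn_integral_cong_AE)
    show "AE y in lborel. enorm (enn2real (?w y)) = ?w y" using wae by eventually_elim (simp add: top.not_eq_extremum)
   qed
   thus "(NN y. enorm (enn2real (?w y))) < \<infinity>" using wfin by simp
  qed measurable
  show "AE y in lborel. norm (duint (uit g k) i t x y) <= enn2real (?w y)" for k using wae
  proof eventually_elim
   case (elim y)
   have "enorm (duint (uit g k) i t x y) <= ?w y" by (rule duint_bound) (rule order_trans[OF uit_bound[OF g] Wit_le_Winf])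
   thus ?case using elim by (metis enn2real_ennreal enn2real_mono norm_ge_zero top.not_eq_extremum infinity_ennreal_def)
  qed
  show "AE y in lborel. (%k. duint (uit g k) i t x y) \<longlonglongrightarrow> duint (usol T g) i t x y" using ae
  proof eventually_elim
   case (elim y)
   show ?case
   proof (cases "0 < fst y \<and> fst y < t")
    case True
    hence "ereal (fst y) <= T" using t by (auto intro: order_trans[of "ereal (fst y)" "ereal t" T])
    thus ?thesis unfolding duint_def using True elim by (intro tendsto_intros uit_tendsto_usol[OF g P]) auto
   next
    case False
    hence "pre t x (fst y) = 0" by (auto simp: pre_def)
    thus ?thesis by (simp add: duint_def)
   qed
  qed
 qed
 hence "(%k. uit g (Suc k) i t x) \<longlonglongrightarrow> cplx (exp (- t * (norm x)^2)) * g i x - du (usol T g) i t x" unfolding uit.simps by (intro tendsto_diff tendsto_const)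
 moreover have "(%k. uit g (Suc k) i t x) \<longlonglongrightarrow> usol T g i t x" using uit_tendsto_usol[OF assms, of i] by (rule LIMSEQ_Suc)
 ultimately show ?thesis by (rule LIMSEQ_unique[rotated])
qed

section \<open>Initial data\<close>

text \<open>The moduli of all components with a frequency weight; for e = n/p - 1 its Lorentz norm
  measures the datum.\<close>

definition Phi :: "real => ('n => 'n::finite cfun) => 'n efun" where
 "Phi e g x = (\<Sum>i\<in>UNIV. ennreal (norm x powr e * norm (g i x)))"

lemma Phi_borel:
 assumes [measurable]: "\<And>i. g i \<in> BM"
 shows "Phi e g \<in> BM" unfolding Phi_def[abs_def] by measurable

lemma AE_nonzero: "AE x in lborel. (x::real^'n::finite) \<noteq> 0" by (rule AE_lborel_singleton)

lemma lin_eq_Phi: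
 assumes "x \<noteq> 0"
 shows "lin g t x = ennreal (norm x powr (- e) * exp (- t * (norm x)^2)) * Phi e g x"
proof -
 have "ennreal (exp (- t * (norm x)^2)) * ennreal c = ennreal (norm x powr (- e) * exp (- t * (norm x)^2)) * ennreal (norm x powr e * c)"
  if "0 <= c" for c using assms that by (simp add: ennreal_mult[symmetric] powr_minus field_simps)
 thus ?thesis unfolding lin_def Phi_def sum_distrib_left by (intro sum.cong) auto
qed

lemma powr_nat_scale:
 fixes t :: real
 assumes "0 < t"
 shows "t powr (- (1 - n * s) / 2 - n * (s - s') / 2) = t powr (- (1 - n * s') / 2)" by (rule arg_cong[where f="(powr) t"]) (simp add: field_simps)

lemma wbd_heat_scaled:
 fixes F :: "'n::finite efun"
 assumes w: "wbd s A F" "0 <= A" "F \<in> BM" and s: "0 <= s'" "s' <= s" "real CARD('n) * s <= 1" and t: "0 < t"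
 shows "wbd s' (heat_const TYPE(real^'n) (1 - real CARD('n) * s) (s - s') * A * t powr (- (1 - real CARD('n) * s') / 2))
  (%x. ennreal (norm x powr (1 - real CARD('n) * s) * exp (- t * (norm x)^2)) * F x)"
proof -
 have d: "real DIM(real^'n) = real CARD('n)" by simp
 have "wbd s' (heat_const TYPE(real^'n) (1 - real CARD('n) * s) (s - s') * t powr (- (1 - real CARD('n) * s) / 2 - real DIM(real^'n) * (s - s') / 2) * A)
  (%x. ennreal (norm x powr (1 - real CARD('n) * s) * exp (- t * (norm x)^2)) * F x)" by (rule wbd_heat[OF w]) (use s t in auto)
 thus ?thesis unfolding d powr_nat_scale[OF t] mult.assoc mult.commute[of A] .
qed

text \<open>Undoing the weight puts the power 1 - n s of the frequency into the heat multiplier. It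
  is nonnegative because n s is at most 1, which for s = 1/p is the condition that p is at least
  n.\<close>

lemma Pb_lin_data:
 fixes g :: "'n::finite => 'n cfun"
 assumes g: "\<And>i. g i \<in> BM" and w: "wbd s A (Phi (real CARD('n) * s - 1) g)" "0 <= A"
  and s: "0 <= s'" "s' <= s" "real CARD('n) * s <= 1"
 shows "Pb T s' (heat_const TYPE(real^'n) (1 - real CARD('n) * s) (s - s') * A) (lin g)" unfolding Pb_def
proof (intro allI impI)
 fix t assume "0 < t \<and> ereal t <= T"
 thus "wbd s' (heat_const TYPE(real^'n) (1 - real CARD('n) * s) (s - s') * A * t powr (- (1 - real CARD('n) * s') / 2)) (lin g t)" using AE_nonzero lin_eq_Phi[of _ g t "real CARD('n) * s - 1"] by (intro wbd_mono_AE[OF wbd_heat_scaled[OF w Phi_borel[OF g] s]]) auto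
qed

text \<open>On a ball of frequencies the multiplier is bounded uniformly in t, so this part of the
  heat flow has no singularity as t tends to 0.\<close>

lemma wbd_low_frequency:
 fixes F :: "'n::finite efun"
 assumes w: "wbd s A F" "0 <= A" and [measurable]: "F \<in> BM" and s: "0 <= s'" "s' <= s" and a: "0 <= a" and t: "0 <= t" and k: "0 <= k"
 shows "wbd s' (k powr a * A * measure lborel (cball (0::real^'n) k) powr (s - s'))
  (%x. ennreal (norm x powr a * exp (- t * (norm x)^2)) * (F x * indicator (cball 0 k) x))" unfolding wbd_def
proof (intro ballI impI)
 fix E :: "(real^'n) set" assume E[measurable]: "E \<in> sets borel" and fin: "emeasure lborel E < \<infinity>"
 let ?B = "cball (0::real^'n) k"
 have finE: "emeasure lborel (E \<inter> ?B) < \<infinity>" using emeasure_mono[of "E \<inter> ?B" E lborel] fin by (auto intro: order_le_less_trans)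
 have "nns E (%x. ennreal (norm x powr a * exp (- t * (norm x)^2)) * (F x * indicator ?B x)) <=
   (NN x. ennreal (k powr a) * (F x * indicator (E \<inter> ?B) x))"
 proof (rule nn_integral_mono)
  fix x :: "real^'n"
  have "norm x powr a * exp (- t * (norm x)^2) <= k powr a * 1" if "norm x <= k" using that a t by (intro mult_mono powr_mono2) auto
  thus "ennreal (norm x powr a * exp (- t * (norm x)^2)) * (F x * indicator ?B x) * indicator E x <= ennreal (k powr a) * (F x * indicator (E \<inter> ?B) x)" by (auto simp: indicator_def intro!: mult_right_mono ennreal_leI)
 qed
 also have "... = ennreal (k powr a) * nns (E \<inter> ?B) F"  by (rule nn_integral_cmult) (simp add: borel_measurable_times_ennreal borel_measurable_indicator)
 also have "... <= ennreal (k powr a) * ennreal (A * measure lborel (E \<inter> ?B) powr s)" by (intro mult_left_mono wbdD[OF w(1)] finE) auto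
 also have "... <= ennreal (k powr a * A * measure lborel ?B powr (s - s') * measure lborel E powr s')"
 proof -
  have "measure lborel (E \<inter> ?B) powr s = measure lborel (E \<inter> ?B) powr (s - s') * measure lborel (E \<inter> ?B) powr s'" by (simp add: powr_add[symmetric])
  also have "... <= measure lborel ?B powr (s - s') * measure lborel E powr s'" using s fin emeasure_cball[of k "0::real^'n"] k by (intro mult_mono powr_mono2 measure_mono_fmeasurable) (auto simp: fmeasurable_def)
  finally show ?thesis using w(2) by (simp add: ennreal_mult[symmetric] mult.assoc mult_left_mono ennreal_leI)
 qed
 finally show "nns E (%x. ennreal (norm x powr a * exp (- t * (norm x)^2)) * (F x * indicator ?B x)) <=
  ennreal (k powr a * A * measure lborel ?B powr (s - s') * measure lborel E powr s')" .
qed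

text \<open>High frequencies are small in the norm of the datum by \<open>lorint_tail\<close>, which
  gives smallness in the scaled norm uniformly in t. Low frequencies are bounded by a constant D,
  and D is below any positive multiple of t^(-x) for short times.\<close>

lemma lin_decay:
 fixes g :: "'n::finite => 'n cfun"
 assumes g: "\<And>i. g i \<in> BM" and L: "lorint s r (Phi (real CARD('n) * s - 1) g) < \<infinity>"
  and s: "0 <= s'" "s' < s" "s < 1" "real CARD('n) * s <= 1" and r: "0 < r" and d: "0 < d"
 shows "\<exists>T0>0. Pb (ereal T0) s' d (lin g)"
proof -
 let ?n = "real CARD('n)" and ?P = "Phi (real CARD('n) * s - 1) g"
 let ?c = "heat_const TYPE(real^'n) (1 - ?n * s) (s - s')"
 note P[measurable] = Phi_borel[OF g, of "?n * s - 1"]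
 have c: "0 <= ?c" using s by (intro heat_const_nonneg) auto
 \<comment> \<open>The size allowed to the high frequencies: the heat constant turns it into at most
   d/2, and the summand 1 avoids division by 0.\<close>
 define y where "y = d / (2 * (?c + 1))"
 have y: "0 < y" and cy: "?c * y <= d / 2" using d c  by (auto simp: y_def) (simp add: field_simps)
 \<comment> \<open>Inverts the constant of the embedding into the weak space, so that a bound M on
   the Lorentz integral becomes the weak bound y.\<close>
 define M where "M = (y * s) powr r / ((1 - s) * r)"
 have M: "0 < M" using y s r by (simp add: M_def)
 have Me: "((1 - s) * r * M) powr (1 / r) / s = y" using y s r by (simp add: M_def powr_powr)
 have "eventually (%k. lorint s r (%x. ?P x * indicator {x. real k < norm x} x) < ennreal M) sequentially" by (rule order_tendstoD(2)[OF lorint_tail[OF L s(3) r P]]) (use M in auto)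
 then obtain k where k: "lorint s r (%x. ?P x * indicator {x. real k < norm x} x) <= ennreal M" unfolding eventually_sequentially using less_imp_le by blast
 have w2: "wbd s y (%x. ?P x * indicator {x. real k < norm x} x)" using lorint_cong_wbd[OF k] M s r unfolding Me by simp
 obtain L' where L': "lorint s r ?P = ennreal L'" "0 <= L'" using L by (cases "lorint s r ?P") auto
 define A where "A = ((1 - s) * r * L') powr (1 / r) / s"
 have A: "0 <= A" "wbd s A ?P" using lorint_cong_wbd[of s r ?P L'] L' s r by (auto simp: A_def)
 define D where "D = real k powr (1 - ?n * s) * A * measure lborel (cball (0::real^'n) (real k)) powr (s - s')"
 have D: "0 <= D" using A by (simp add: D_def)
 define x where "x = (1 - ?n * s') / 2"
 have "?n * s' < ?n * s" using s by (intro mult_strict_left_mono) auto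
 hence "?n * s' < 1" using s(4) by (rule order_less_le_trans)
 hence x: "0 < x" by (simp add: x_def)
 \<comment> \<open>Solves T0^x = d / (2 (D + 1)), whence D \<le> (d/2) t^(-x) up to time T0.\<close>
 define T0 where "T0 = (d / (2 * (D + 1))) powr (1 / x)"
 have T0: "0 < T0" using d D by (simp add: T0_def)
 have "Pb (ereal T0) s' d (lin g)" unfolding Pb_def
 proof (intro allI impI)
  fix t assume t: "0 < t \<and> ereal t <= ereal T0"
  have "t powr x <= T0 powr x" using t x by (intro powr_mono2) auto
  also have "... = d / (2 * (D + 1))" using x d D by (simp add: T0_def powr_powr)
  finally have "D * t powr x <= D * (d / (2 * (D + 1)))" using D by (rule mult_left_mono)
  also have "... <= d / 2" using D d by (simp add: field_simps)
  finally have "D * t powr x * t powr (- x) <= d / 2 * t powr (- x)" by (rule mult_right_mono) simp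
  hence Dt: "D <= d / 2 * t powr (- x)" using t by (simp add: mult.assoc powr_add[symmetric])
  let ?m = "%z::real^'n. ennreal (norm z powr (1 - ?n * s) * exp (- t * (norm z)^2))"
  have e: "- (1 - ?n * s') / 2 = - x" unfolding x_def by (rule minus_divide_left[symmetric])
  have "wbd s' D (%z. ?m z * (?P z * indicator (cball 0 (real k)) z))" unfolding D_def using s t by (intro wbd_low_frequency A) auto
  hence 1: "wbd s' (d / 2 * t powr (- x)) (%z. ?m z * (?P z * indicator (cball 0 (real k)) z))" by (rule wbd_mono[OF _ order_refl Dt])
  have "wbd s' (?c * y * t powr (- x)) (%z. ?m z * (?P z * indicator {x. real k < norm x} z))" unfolding e[symmetric] using s t y by (intro wbd_heat_scaled w2) auto
  hence 2: "wbd s' (d / 2 * t powr (- x)) (%z. ?m z * (?P z * indicator {x. real k < norm x} z))" by (rule wbd_mono[OF _ order_refl mult_right_mono[OF cy]]) simp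
  have "wbd s' (d / 2 * t powr (- x) + d / 2 * t powr (- x)) (%z. ?m z * (?P z * indicator (cball 0 (real k)) z) + ?m z * (?P z * indicator {x. real k < norm x} z))" using d by (intro wbd_add 1 2 borel_measurable_times_ennreal P borel_measurable_indicator) auto
  thus "wbd s' (d * t powr (- (1 - ?n * s') / 2)) (lin g t)" unfolding e
  proof (rule wbd_mono_AE)
   show "AE z in lborel. lin g t z <= ?m z * (?P z * indicator (cball 0 (real k)) z) + ?m z * (?P z * indicator {x. real k < norm x} z)" using AE_nonzero
   proof eventually_elim
    case (elim z)
    thus ?case using lin_eq_Phi[of z g t "?n * s - 1"] by (auto simp: indicator_def)
   qed
  qed simp
 qed
 thus ?thesis using T0 by blast
qed

definition C0 :: "'n::finite itself => real => real" where
 "C0 _ \<theta> = heat_const TYPE(real^'n) 0 \<theta> * 2 powr (1 / 2)"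

text \<open>Half of the time lowers the index from \<theta> to 0, the other half supplies the known
  bound. Thus smallness in the weak norm alone yields smallness in the integral norm; the root of 2
  in \<open>C0\<close> comes from (t/2)^(-1/2).\<close>

lemma Pb_lin_zero:
 fixes g :: "'n::finite => 'n cfun"
 assumes g: "\<And>i. g i \<in> BM" and P: "Pb T \<theta> A (lin g)" "0 <= A" and \<theta>: "0 <= \<theta>"
 shows "Pb T 0 (C0 TYPE('n) \<theta> * A) (lin g)" unfolding Pb_def
proof (intro allI impI)
 let ?n = "real CARD('n)"
 fix t assume t: "0 < t \<and> ereal t <= T"
 hence t2: "0 < t / 2" "ereal (t / 2) <= T" by (auto intro: order_trans[of "ereal (t/2)" "ereal t" T])
 have "wbd 0 (heat_const TYPE(real^'n) 0 (\<theta> - 0) * (t / 2) powr (- 0 / 2 - real DIM(real^'n) * (\<theta> - 0) / 2) * (A * (t / 2) powr (- (1 - ?n * \<theta>) / 2)))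
   (%x. ennreal (norm x powr 0 * exp (- (t / 2) * (norm x)^2)) * lin g (t / 2) x)" using P(2) \<theta> t2 jm_slice[OF jm_lin[OF g]] by (intro wbd_heat PbD[OF P(1)]) auto
 moreover have "(t / 2) powr (- 0 / 2 - ?n * (\<theta> - 0) / 2) * (t / 2) powr (- (1 - ?n * \<theta>) / 2) = (t / 2) powr (- 1 / 2)" unfolding powr_add[symmetric] by (rule arg_cong[where f="(powr) (t / 2)"]) (simp add: field_simps)
 moreover have "(t / 2) powr (- 1 / 2) = 2 powr (1 / 2) * t powr (- 1 / 2)" using t by (simp add: powr_divide powr_minus field_simps)
 ultimately have "wbd 0 (C0 TYPE('n) \<theta> * A * t powr (- (1 - ?n * 0) / 2))
   (%x. ennreal (norm x powr 0 * exp (- (t / 2) * (norm x)^2)) * lin g (t / 2) x)" by (simp add: C0_def mult_ac)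
 thus "wbd 0 (C0 TYPE('n) \<theta> * A * t powr (- (1 - ?n * 0) / 2)) (lin g t)"
 proof (rule wbd_mono_AE)
  show "AE x in lborel. lin g t x <= ennreal (norm x powr 0 * exp (- (t / 2) * (norm x)^2)) * lin g (t / 2) x" using AE_nonzero
  proof eventually_elim
   case (elim x)
   have "exp (- t * (norm x)^2) = exp (- (t / 2) * (norm x)^2) * exp (- (t / 2) * (norm x)^2)" unfolding exp_add[symmetric] by (rule arg_cong[where f=exp]) (simp add: field_simps)
   thus ?case using elim by (simp add: lin_def mult.assoc[symmetric] ennreal_mult[symmetric])
  qed
 qed simp
qed

section \<open>Vector norms and the heat flow condition\<close>

lemma epow_square: "epow (x\<^sup>2) (1 / 2) = x" by (cases x) (auto simp: epow_def ennreal_power powr_half_sqrt)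

lemma component_le_vec_norm: "N (u i) <= vec_norm N u"
proof -
 have "(N (u i))\<^sup>2 <= (\<Sum>i\<in>UNIV. (N (u i))\<^sup>2)" using member_le_sum[of i UNIV "%i. (N (u i))\<^sup>2"] by simp
 from epow_mono[OF _ this, of "1 / 2"] show ?thesis by (simp add: vec_norm_def epow_square)
qed

lemma vec_norm_le:
 fixes u :: "'n::finite => 'n dist"
 assumes "\<And>i. N (u i) <= x"
 shows "vec_norm N u <= of_nat CARD('n) * x"
proof -
 have "(\<Sum>i\<in>UNIV. (N (u i))\<^sup>2) <= (\<Sum>i\<in>(UNIV::'n set). x\<^sup>2)" by (intro sum_mono power_mono assms) simp
 also have "... = of_nat CARD('n) * x\<^sup>2" by simp
 also have "... <= (of_nat CARD('n))\<^sup>2 * x\<^sup>2"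
 proof (rule mult_right_mono)
  have "real CARD('n) <= (real CARD('n))\<^sup>2" by (simp add: power2_eq_square)
  thus "(of_nat CARD('n) :: ennreal) <= (of_nat CARD('n))\<^sup>2" by (simp add: ennreal_of_nat_eq_real_of_nat ennreal_power)
 qed simp
 finally have "(\<Sum>i\<in>UNIV. (N (u i))\<^sup>2) <= (of_nat CARD('n) * x)\<^sup>2" by (simp add: power_mult_distrib)
 from epow_mono[OF _ this, of "1 / 2"] show ?thesis by (simp add: vec_norm_def epow_square)
qed

lemma heat_symbol_le: "0 <= t ==> norm (cplx (exp (- t * (norm x)^2))) <= 1" by (simp del: of_real_exp)

lemma ft_heat:
 assumes u: "has_fourier_fun u" "AE x in lebesgue. ft u x = g x" and t: "0 <= t"
 shows "AE z in lebesgue. ft (heat t u) z = cplx (exp (- t * (norm z)^2)) * g z"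
  "good (%z. cplx (exp (- t * (norm z)^2)) * g z)"
proof -
 have gg: "good g" using good_cong_AE[OF Finv_ft(2)[OF u(1)] u(2)] .
 show 1: "good (%z. cplx (exp (- t * (norm z)^2)) * g z)" by (rule good_mult_bounded[OF gg lebesgue_borel[OF heat_symbol_borel] heat_symbol_le[OF t]])
 show "AE z in lebesgue. ft (heat t u) z = cplx (exp (- t * (norm z)^2)) * g z" using gg ft_Finv[OF 1] heat_AE[OF u(2)] by (simp add: good_def)
qed

lemma good_measurable: "good f ==> f \<in> LM" by (simp add: good_def)

lemma wbd_lin_component:
 assumes g: "\<And>i. g i \<in> BM" and w: "wbd s A (lin g t)"
 shows "wbd s A (%x. enorm (cplx (exp (- t * (norm x)^2)) * g i x))" using w by (rule wbd_mono) (rule lin_ge, simp)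

lemma heat_flow_sup_le:
 fixes u0 :: "'n::finite => 'n dist"
 assumes u: "\<And>i. has_fourier_fun (u0 i)" "\<And>i. AE x in lebesgue. ft (u0 i) x = g i x" and g: "\<And>i. g i \<in> BM"
  and pt: "1 < pt" and P: "Pb T (1 / pt) A (lin g)" "0 <= A"
 shows "heat_flow_sup pt T u0 <= ennreal (real CARD('n) * A)" unfolding heat_flow_sup_def
proof (rule SUP_least)
 let ?n = "real CARD('n)"
 fix t assume "t \<in> {t. 0 < t \<and> ereal t < T}"
 hence t: "0 < t" "ereal t <= T" by auto
 have "FL_norm (ennreal pt) \<infinity> (heat t (u0 i)) <= ennreal (A * t powr (- (1 - ?n * (1 / pt)) / 2))" for i unfolding FL_norm_def using ft_heat[OF u(1) u(2), of t i] t P pt g wbd_lin_component[OF g PbD[OF P(1) t], of i] by (intro lorentz_weak_le_if_wbd[where F="%z. enorm (cplx (exp (- t * (norm z)^2)) * g i z)"]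
    borel_measurable_AE[OF good_measurable[OF ft_heat(2)[OF u(1) u(2), of t i]]]
    measurable_compose[OF _ measurable_ennreal] borel_measurable_norm borel_measurable_times heat_symbol_borel)
   (auto simp del: of_real_exp elim: AE_mp)
 from vec_norm_le[where N="FL_norm (ennreal pt) \<infinity>" and u="%i. heat t (u0 i)", OF this]
 have "ennreal (t powr ((1 - ?n / pt) / 2)) * vec_norm (FL_norm (ennreal pt) \<infinity>) (%i. heat t (u0 i)) <=
   ennreal (t powr ((1 - ?n / pt) / 2)) * (of_nat CARD('n) * ennreal (A * t powr (- (1 - ?n * (1 / pt)) / 2)))" by (rule mult_left_mono) simp
 also have "... = ennreal (t powr ((1 - ?n / pt) / 2) * (?n * (A * t powr (- (1 - ?n * (1 / pt)) / 2))))" using P(2) by (simp add: ennreal_mult ennreal_of_nat_eq_real_of_nat)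
 also have "t powr ((1 - ?n / pt) / 2) * (?n * (A * t powr (- (1 - ?n * (1 / pt)) / 2))) = ?n * A"
 proof -
  have "t powr ((1 - ?n / pt) / 2) * t powr (- (1 - ?n * (1 / pt)) / 2) = 1" unfolding minus_divide_left[symmetric] using t by (simp add: powr_minus)
  thus ?thesis by (simp add: mult_ac)
 qed
 finally show "ennreal (t powr ((1 - ?n / pt) / 2)) * vec_norm (FL_norm (ennreal pt) \<infinity>) (%i. heat t (u0 i)) <= ennreal (?n * A)" .
qed

text \<open>The supremum runs over t < T while \<open>Pb\<close> includes t = T. Evaluating at t/2
  settles this, as the multiplier decreases in time; the constant 2 covers the factor 2^x with x at
  most 1/2.\<close>

lemma Pb_if_heat_flow_sup:
 fixes u0 :: "'n::finite => 'n dist"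
 assumes u: "\<And>i. has_fourier_fun (u0 i)" "\<And>i. AE x in lebesgue. ft (u0 i) x = g i x" and g: "\<And>i. g i \<in> BM"
  and pt: "1 < pt" "real CARD('n) < pt" and h: "heat_flow_sup pt T u0 <= ennreal d" and d: "0 <= d"
 shows "Pb T (1 / pt) (2 * (real CARD('n) * (d * pt))) (lin g)" unfolding Pb_def
proof (intro allI impI)
 let ?n = "real CARD('n)"
 define x where "x = (1 - ?n / pt) / 2"
 have x: "0 < x" "x <= 1 / 2" using pt by (auto simp: x_def)
 have e: "- (1 - ?n * (1 / pt)) / 2 = - x" unfolding x_def minus_divide_left[symmetric] by simp
 fix t assume t: "0 < t \<and> ereal t <= T"
 define t' where "t' = t / 2"
 have t': "0 < t'" "ereal t' < T" using t by (auto simp: t'_def intro: order_less_le_trans[of _ "ereal t"])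
 have le: "ennreal (t' powr x) * vec_norm (FL_norm (ennreal pt) \<infinity>) (%i. heat t' (u0 i)) <= ennreal d" using h t' unfolding heat_flow_sup_def x_def by (auto simp: SUP_le_iff)
 have w: "wbd (1 / pt) (d * t' powr (- x) * pt) (%z. enorm (cplx (exp (- t' * (norm z)^2)) * g i z))" for i
 proof (rule wbd_if_lorentz_weak)
  note ft = ft_heat[OF u(1) u(2), of t' i]
  show "AE z in lebesgue. enorm (ft (heat t' (u0 i)) z) = enorm (cplx (exp (- t' * (norm z)^2)) * g i z)" using ft(1) t' by (auto simp del: of_real_exp elim: AE_mp)
  show "ft (heat t' (u0 i)) \<in> LM" using ft t' by (intro borel_measurable_AE[OF good_measurable[OF ft(2)]]) (auto elim: AE_mp)
  show "(%z. enorm (cplx (exp (- t' * (norm z)^2)) * g i z)) \<in> BM" using g heat_symbol_borel by measurable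
  have "FL_norm (ennreal pt) \<infinity> (heat t' (u0 i)) = ennreal (t' powr (- x)) * (ennreal (t' powr x) * FL_norm (ennreal pt) \<infinity> (heat t' (u0 i)))" using t' by (simp add: mult.assoc[symmetric] ennreal_mult[symmetric] powr_add[symmetric])
  also have "... <= ennreal (t' powr (- x)) * ennreal d" using component_le_vec_norm[of "FL_norm (ennreal pt) \<infinity>" "%i. heat t' (u0 i)" i] by (intro mult_left_mono order_trans[OF _ le]) auto
  finally show "lorentz_norm (conj_exp (ennreal pt)) \<infinity> (ft (heat t' (u0 i))) <= ennreal (d * t' powr (- x))" using d by (simp add: FL_norm_def ennreal_mult mult.commute)
 qed (use d pt in auto)
 have "wbd (1 / pt) (\<Sum>i\<in>(UNIV::'n set). d * t' powr (- x) * pt) (%z. \<Sum>i\<in>UNIV. enorm (cplx (exp (- t' * (norm z)^2)) * g i z))" using d pt g heat_symbol_borel by (intro wbd_sum w) (auto simp del: of_real_exp intro!: measurable_compose[OF _ measurable_ennreal] borel_measurable_norm borel_measurable_times)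
 thus "wbd (1 / pt) (2 * (?n * (d * pt)) * t powr (- (1 - ?n * (1 / pt)) / 2)) (lin g t)" unfolding e
 proof (rule wbd_mono)
  fix z :: "real^'n"
  have "exp (- t * (norm z)^2) <= exp (- t' * (norm z)^2)" using t by (simp add: t'_def mult_right_mono)
  thus "lin g t z <= (\<Sum>i\<in>UNIV. enorm (cplx (exp (- t' * (norm z)^2)) * g i z))" unfolding lin_def sum_distrib_left by (intro sum_mono) (simp add: norm_mult ennreal_mult[symmetric] ennreal_leI mult_right_mono del: of_real_exp)
  have "t' powr (- x) = 2 powr x * t powr (- x)" using t by (simp add: t'_def powr_divide powr_minus field_simps)
  moreover have "2 powr x <= 2 powr 1" using x by (intro powr_mono) auto
  ultimately have "t' powr (- x) <= 2 * t powr (- x)" by (simp add: mult_right_mono)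
  hence "?n * (d * pt) * t' powr (- x) <= ?n * (d * pt) * (2 * t powr (- x))" using d pt by (intro mult_left_mono) auto
  thus "(\<Sum>i\<in>(UNIV::'n set). d * t' powr (- x) * pt) <= 2 * (?n * (d * pt)) * t powr (- x)" by (simp add: mult_ac)
 qed
qed

section \<open>The Duhamel integral as an iterated integral\<close>

lemma integrable_cconv_iff:
 fixes f g :: "'n::finite cfun"
 assumes [measurable]: "f \<in> BM" "g \<in> BM"
  and "econv (nf f) (nf g) z < \<infinity>"
 shows "integrable lborel (%y. f (z - y) * g y)" by (rule integrableI_bounded) (use assms(3) in \<open>auto simp: econv_def norm_mult ennreal_mult\<close>)

lemma norm_cconv_le:
 "enorm (cconv f g z) <= econv (nf f) (nf g) z"
proof (cases "integrable lborel (%y. f (z - y) * g y)")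
 case True
 show ?thesis unfolding cconv_def econv_def by (rule order_trans[OF integral_norm_bound_ennreal[OF True]]) (simp add: norm_mult ennreal_mult)
qed (simp add: cconv_def not_integrable_integral_eq)

lemma jm_cconv:
 fixes u v :: "real => 'n::finite cfun"
 assumes u: "jm u" and v: "jm v"
 shows "jm (%q. cconv (u q) (v q))"
proof -
 note jm_comp[OF u, measurable (raw)] jm_comp[OF v, measurable (raw)]
 show ?thesis unfolding cconv_def by measurable
qed

lemma cconv_borel:
 assumes "f \<in> BM" "g \<in> BM"
 shows "cconv f g \<in> BM" by (rule jm_slice[OF jm_cconv[of "%_. f" "%_. g"]]) (auto intro: measurable_compose[OF measurable_snd] assms)

text \<open>The time slice of the Duhamel integrand after the space convolution. This is the form
  that \<open>mild_solution\<close> integrates over time, whereas \<open>du\<close> integrates both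
  variables at once.\<close>

definition duk :: "('n => real => 'n::finite cfun) => 'n => real => real => 'n cfun" where
 "duk u i t q x = pre t x q * (\<Sum>a\<in>UNIV. \<Sum>b\<in>UNIV. msym i a b x * cconv (u a q) (u b q) x)"

lemma duk_bound:
 fixes u :: "'n => real => 'n::finite cfun"
 assumes "\<And>a t x. enorm (u a t x) <= V t x"
 shows "enorm (duk u i t q x) <= ennreal (kappa TYPE('n)) * (ennreal (kern t x q) * econv (V q) (V q) x)" unfolding duk_def by (intro pre_sum_bound order_trans[OF norm_cconv_le] econv_mono assms)

lemma jm_duk:
 assumes u: "\<And>a. jm (u a)"
 shows "jm (duk u i t)"
proof -
 note jm_cconv[OF u u, measurable]
 show ?thesis unfolding duk_def by measurable
qed

lemma du_eq_duk:
 fixes u :: "'n => real => 'n::finite cfun"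
 assumes b: "\<And>a t z. enorm (u a t z) <= V t z" and V: "jm V" and u: "\<And>a. jm (u a)"
  and fin: "duh V t z < \<infinity>" and z: "z \<noteq> 0"
 shows "du u i t z = (LINT q|lborel. duk u i t q z)"
proof -
 note [measurable] = jm_slice[OF u] jm_slice[OF V]
 have i: "integrable (lborel \<Otimes>\<^sub>M lborel) (duint u i t z)" using duint_integrable[where u=u, OF b V u fin] by (simp add: lborel_pair_eq)
 have km: "(%q. ennreal (kern t z q) * econv (V q) (V q) z) \<in> BM" by (intro borel_measurable_times_ennreal measurable_compose[OF _ measurable_ennreal] measurable_kern jm_comp[OF jm_econv[OF V]]) auto
 have d: "0 < kappa TYPE('n)" by (simp add: kappa_def)
 have "(NN q. ennreal (kern t z q) * econv (V q) (V q) z) \<noteq> \<infinity>" using fin d unfolding duh_iterated[OF V] by (auto simp: ennreal_mult_eq_top_iff ennreal_eq_0_iff)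
 hence "AE q in lborel. ennreal (kern t z q) * econv (V q) (V q) z \<noteq> \<infinity>" using km by (intro nn_integral_PInf_AE) auto
 hence ae: "AE q in lborel. (LINT y|lborel. duint u i t z (q, y)) = duk u i t q z"
 proof eventually_elim
  case (elim q)
  show ?case
  proof (cases "0 < q \<and> q < t")
   case True
   \<comment> \<open>Finiteness of the convolution is extracted from finiteness of its product with
     the kernel, which is positive only away from z = 0.\<close>
   hence "kern t z q > 0" using z by (simp add: kern_def)
   hence "econv (V q) (V q) z \<noteq> \<infinity>" using elim by (auto simp: ennreal_mult_eq_top_iff)
   hence e: "econv (nf (u a q)) (nf (u c q)) z < \<infinity>" for a c using econv_mono[of "%x. enorm (u a q x)" "V q" "%x. enorm (u c q x)" "V q" z] b by (auto simp: top.not_eq_extremum intro: order_le_less_trans)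
   have "integrable lborel (%y. msym i a c z * (u a q (z - y) * u c q y))" for a c by (intro integrable_mult_right integrable_cconv_iff e) auto
   thus ?thesis by (simp add: duint_def duk_def cconv_def Bochner_Integration.integral_sum)
  qed (auto simp: duint_def duk_def pre_def)
 qed
 have "du u i t z = (LINT q|lborel. LINT y|lborel. duint u i t z (q, y))" unfolding du_def lborel_pair_eq by (rule lborel_pair.integral_fst'[OF i, symmetric])
 also have "... = (LINT q|lborel. duk u i t q z)"
 proof (rule integral_cong_AE)
  show "(%q. LINT y|lborel. duint u i t z (q, y)) \<in> borel_measurable lborel" using lborel_pair.integrable_fst'[OF i] by (rule borel_measurable_integrable)
  have "(%q. duk u i t q z) \<in> BM" by (intro jm_comp[OF jm_duk[OF u]]) auto
  thus "(%q. duk u i t q z) \<in> borel_measurable lborel" by simp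
 qed (rule ae)
 finally show ?thesis .
qed

text \<open>Links the pointwise equation in frequency with the tested equation of
  \<open>mild_solution\<close>; absolute convergence is supplied by the integral of the
  majorant.\<close>

lemma du_fubini:
 fixes u :: "'n => real => 'n::finite cfun"
 assumes b: "\<And>a t z. enorm (u a t z) <= V t z" and V: "jm V" and u: "\<And>a. jm (u a)"
  and fin: "(NN z. duh V t z) < \<infinity>"
  and F: "F \<in> BM" "\<And>x. norm (F x) <= B"
 shows "integrable lborel (%w. LINT z|lborel. duk u i t w z * F z)"
  "integrable lborel (%z. du u i t z * F z)"
  "(LINT z|lborel. du u i t z * F z) = (LINT w|lborel. LINT z|lborel. duk u i t w z * F z)"
proof -
 let ?e = "ennreal (kappa TYPE('n))"
 let ?k = "%w z. ennreal (kern t z w) * econv (V w) (V w) z"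
 note [measurable] = F(1)
 have B: "0 <= B" using F(2)[of 0] norm_ge_zero order_trans by blast
 have fm: "(%p. duk u i t (fst p) (snd p) * F (snd p)) \<in> borel_measurable (borel \<Otimes>\<^sub>M borel)" by (intro borel_measurable_times jm_duk u measurable_compose[OF measurable_snd F(1)])
 have km: "(%p. ?k (fst p) (snd p)) \<in> borel_measurable (lborel \<Otimes>\<^sub>M lborel)"
 proof -
  have "(%p. ?k (fst p) (snd p)) \<in> borel_measurable (borel \<Otimes>\<^sub>M borel)" by (intro borel_measurable_times_ennreal measurable_compose[OF _ measurable_ennreal] measurable_kern jm_econv[OF V]) auto
  thus ?thesis by simp
 qed
 have "(NN w. (NN z. ?k w z)) = (NN z. (NN w. ?k w z))" by (rule lborel_pair.Fubini'[symmetric]) (use km in \<open>simp add: split_beta'\<close>)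
 hence "?e * (NN w. (NN z. ?k w z)) = (NN z. ?e * (NN w. ?k w z))"
 proof (subst nn_integral_cmult)
  have "(%q. ?k (snd q) (fst q)) \<in> borel_measurable (borel \<Otimes>\<^sub>M borel)" by (intro borel_measurable_times_ennreal measurable_compose[OF _ measurable_ennreal] measurable_kern jm_comp[OF jm_econv[OF V]]) auto
  hence "(%(z, w). ?k w z) \<in> borel_measurable (lborel \<Otimes>\<^sub>M lborel)" by (simp add: split_beta')
  thus "(%z. (NN w. ?k w z)) \<in> borel_measurable lborel" by (rule lborel.borel_measurable_nn_integral)
 qed simp
 also have "... < \<infinity>" using fin unfolding duh_iterated[OF V] .
 finally have kfin: "?e * (NN w. (NN z. ?k w z)) < \<infinity>" .
 have int: "integrable (lborel \<Otimes>\<^sub>M lborel) (%p. duk u i t (fst p) (snd p) * F (snd p))"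
 proof (rule integrableI_bounded)
  show "(%p. duk u i t (fst p) (snd p) * F (snd p)) \<in> borel_measurable (lborel \<Otimes>\<^sub>M lborel)" using fm by simp
  have "(\<integral>\<^sup>+p. enorm (duk u i t (fst p) (snd p) * F (snd p)) \<partial>(lborel \<Otimes>\<^sub>M lborel)) <=
    (\<integral>\<^sup>+p. (ennreal B * ?e) * ?k (fst p) (snd p) \<partial>(lborel \<Otimes>\<^sub>M lborel))"
  proof (rule nn_integral_mono)
   fix p :: "real \<times> (real^'n)"
   have "enorm (duk u i t (fst p) (snd p) * F (snd p)) = enorm (F (snd p)) * enorm (duk u i t (fst p) (snd p))" by (simp add: norm_mult ennreal_mult mult.commute)
   also have "... <= ennreal B * (?e * ?k (fst p) (snd p))" by (intro mult_mono ennreal_leI F(2) duk_bound b) auto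
   finally show "enorm (duk u i t (fst p) (snd p) * F (snd p)) <= (ennreal B * ?e) * ?k (fst p) (snd p)" by (simp only: mult.assoc)
  qed
  also have "... = (ennreal B * ?e) * (\<integral>\<^sup>+p. ?k (fst p) (snd p) \<partial>(lborel \<Otimes>\<^sub>M lborel))" by (rule nn_integral_cmult[OF km])
  also have "(\<integral>\<^sup>+p. ?k (fst p) (snd p) \<partial>(lborel \<Otimes>\<^sub>M lborel)) = (NN w. (NN z. ?k w z))" using lborel.nn_integral_fst[OF km] by simp
  also have "(ennreal B * ?e) * (NN w. (NN z. ?k w z)) < \<infinity>" using kfin by (simp add: mult.assoc ennreal_mult_less_top)
  finally show "(\<integral>\<^sup>+p. enorm (duk u i t (fst p) (snd p) * F (snd p)) \<partial>(lborel \<Otimes>\<^sub>M lborel)) < \<infinity>" .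
 qed
 show 1: "integrable lborel (%w. LINT z|lborel. duk u i t w z * F z)" using lborel_pair.integrable_fst'[OF int] by simp
 have dm: "(%p. duh V t p) \<in> BM" by (rule jm_slice[OF duh_integrand_measurable(2)[OF V]])
 have "AE z in lborel. duh V t z \<noteq> \<infinity>" using fin dm by (intro nn_integral_PInf_AE) auto
 hence ae: "AE z in lborel. (LINT w|lborel. duk u i t w z * F z) = du u i t z * F z" using AE_nonzero
 proof eventually_elim
  case (elim z)
  thus ?case by (subst du_eq_duk[where u=u, OF b V u]) (auto simp: top.not_eq_extremum)
 qed
 have dum: "(%z. du u i t z * F z) \<in> borel_measurable lborel" using jm_slice[OF du_jm[OF u]] by measurable
 have 2: "integrable lborel (%z. LINT w|lborel. duk u i t w z * F z)" using lborel_pair.integrable_snd[of "%w z. duk u i t w z * F z"] int by (simp add: split_beta')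
 thus "integrable lborel (%z. du u i t z * F z)" using integrable_cong_AE[OF borel_measurable_integrable[OF 2] dum ae] by simp
 have "(LINT z|lborel. du u i t z * F z) = (LINT z|lborel. LINT w|lborel. duk u i t w z * F z)" by (rule integral_cong_AE[OF dum borel_measurable_integrable[OF 2]]) (use ae in \<open>auto elim: AE_mp\<close>)
 also have "... = (LINT w|lborel. LINT z|lborel. duk u i t w z * F z)" by (rule lborel_pair.Fubini_integral) (use int in \<open>simp add: split_beta'\<close>)
 finally show "(LINT z|lborel. du u i t z * F z) = (LINT w|lborel. LINT z|lborel. duk u i t w z * F z)" .
qed

lemma duk_nonlin: "0 < q ==> q < t ==>
 duk u i t q x = cplx (exp (- (t - q) * (norm x)^2)) * nonlin (%a. u a q) i x" by (simp add: duk_def pre_def nonlin_msym del: of_real_exp)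

lemma duk_outside: "\<not> (0 < q \<and> q < t) ==> duk u i t q x = 0" by (auto simp: duk_def pre_def)

lemma lorint_Pb:
 fixes V :: "real => 'n::finite efun"
 assumes P: "Pb T s1 A V" "Pb T s2 A V" and V: "jm V" and A: "0 <= A" and s: "s2 < s" "s < s1" "s1 < 1" and r: "0 < r"
  and t: "0 < t" "ereal t <= T"
 shows "lorint s r (V t) <= ennreal ((A * t powr (- (1 - real CARD('n) * s) / 2)) powr r * (1 / (r * (s1 - s)) + 1 / (r * (s - s2))))"
proof (rule wbd_lorint_interpolate)
 let ?n = "real CARD('n)"
 \<comment> \<open>By scaling, the bounds at all indices cross at the same point \<rho> = t^(-n/2),
   which provides the normalisation that interpolation expects.\<close>
 have e: "A * t powr (- (1 - ?n * z) / 2) = A * t powr (- (1 - ?n * s) / 2) * (t powr (- ?n / 2)) powr (s - z)" for z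
 proof -
  have "t powr (- (1 - ?n * z) / 2) = t powr (- (1 - ?n * s) / 2 + (- ?n / 2) * (s - z))" by (rule arg_cong[where f="(powr) t"]) (simp add: field_simps)
  thus ?thesis by (simp only: powr_add powr_powr mult.assoc)
 qed
 show "wbd s1 (A * t powr (- (1 - ?n * s) / 2) * (t powr (- ?n / 2)) powr (s - s1)) (V t)"
  "wbd s2 (A * t powr (- (1 - ?n * s) / 2) * (t powr (- ?n / 2)) powr (s - s2)) (V t)" unfolding e[symmetric] by (rule PbD[OF P(1) t] PbD[OF P(2) t])+
qed (use s r A t jm_slice[OF V] in auto)

lemma Pb_common:
 assumes "Pb T s1 A V" "Pb T s2 B V"
 shows "Pb T s1 (max A B) V" "Pb T s2 (max A B) V" by (rule Pb_mono[OF assms(1)] Pb_mono[OF assms(2)]; simp)+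

text \<open>The modulus of a Schwartz function, divided by an upper bound of it, has values in
  [0,1], so \<open>wbd_integral_le_powr\<close> makes the pairing absolutely convergent.\<close>

lemma good_if_wbd:
 fixes G :: "'n::finite cfun"
 assumes [measurable]: "G \<in> BM" and w: "wbd s A (nf G)" "0 <= A" and s: "0 < s" "s <= 1"
 shows "good G" unfolding good_def
proof (intro conjI ballI)
 show "G \<in> LM" by (intro lebesgue_borel) simp
 fix f :: "'n cfun" assume f: "f \<in> schwartz"
 note [measurable] = schwartz_borel[OF f]
 obtain C where C: "0 < C" "\<And>x. norm (f x) <= C" using schwartz_bounded[OF f] by blast
 have i: "integrable lborel (%x. norm (f x) / C)" using schwartz_integrable[OF f] by simp
 have I: "(NN x. ennreal (norm (f x) / C)) = ennreal (LINT x|lborel. norm (f x) / C)" using C by (intro nn_integral_eq_integral i) auto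
 have "(NN x. enorm (G x) * ennreal (norm (f x) / C)) <= ennreal (A * (LINT x|lborel. norm (f x) / C) powr s)" using C by (intro wbd_integral_le_powr[OF w s _ _ _ _ I]) (auto intro!: integral_nonneg)
 from neq_top_trans[OF ennreal_neq_top this]
 have "ennreal C * (NN x. enorm (G x) * ennreal (norm (f x) / C)) < \<infinity>" by (simp add: ennreal_mult_less_top less_top)
 also have "ennreal C * (NN x. enorm (G x) * ennreal (norm (f x) / C)) = (NN x. enorm (G x * f x))" using C by (subst nn_integral_cmult[symmetric]) (auto intro!: nn_integral_cong simp: ennreal_mult[symmetric] norm_mult)
 finally have "integrable lborel (%x. G x * f x)" by (intro integrableI_bounded) auto
 thus "integrable lebesgue (%x. G x * f x)" by (subst integrable_completion) auto
qed

section \<open>Existence\<close>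

lemma epow_1: "epow x 1 = x" by (cases x) (auto simp: epow_def)

lemma jm_restrict:
 fixes U :: "real => 'n::finite cfun"
 assumes "jm U"
 shows "(%(t, x). U t x) \<in> borel_measurable (lebesgue_on S)"
proof -
 have "(%p. U (fst p) (snd p)) \<in> BM" using assms by (simp add: borel_prod)
 thus ?thesis unfolding split_beta' by (intro measurable_restrict_space1 lebesgue_borel)
qed

lemma jm_inv_fourier:
 fixes U :: "real => 'n::finite cfun"
 assumes U: "jm U"
 shows "jm (%t. inv_fourier (U t))"
proof -
 note jm_comp[OF U, measurable (raw)]
 show ?thesis unfolding inv_fourier_lborel[OF jm_slice[OF U]] by measurable
qed

lemma LINT_completion:
 fixes f :: "'a::euclidean_space => complex"
 shows "f \<in> BM ==> (LINT x|lebesgue. f x) = (LINT x|lborel. f x)" by (subst integral_completion) auto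

lemma heat_zero: "has_fourier_fun u ==> heat 0 u = u" by (simp add: heat_def multiplier_eq Finv_ft)

lemma midpoint_bounds:
 fixes x y :: real
 shows "0 < x ==> x < y ==> y <= 1 / 2 ==> 0 <= (x + y) / 2 \<and> (x + y) / 2 < y \<and> (x + y) / 2 < 1" by auto

lemma heat_nonlin_duk:
 assumes "\<And>i. W i q \<in> BM" "\<And>i. AE x in lebesgue. ft (w i) x = W i q x"
  and gc: "\<And>j k. good (cconv (W j q) (W k q))" and q: "0 < q" "q < t"
 shows "heat (t - q) (leray (tensor_div (tensor_prod w w)) i) = Finv (duk W i t q)" "good (duk W i t q)"
proof -
 show "heat (t - q) (leray (tensor_div (tensor_prod w w)) i) = Finv (duk W i t q)" unfolding ext[OF duk_nonlin[OF q]] by (rule heat_nonlin[OF assms(2,1) gc])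
 show "good (duk W i t q)" unfolding ext[OF duk_nonlin[OF q]] by (rule good_mult_bounded[OF good_nonlin[OF gc] lebesgue_borel[OF heat_symbol_borel] heat_symbol_le]) (use q in simp)
qed

text \<open>Smallness is assumed at the indices 0 and \<theta> only; assumption \<open>L\<close>
  says that the datum lies in its space, with a norm of any size.\<close>

locale small_data =
 fixes p r \<theta> a :: real and T :: ereal and g :: "'n::finite => 'n cfun" and u0 :: "'n => 'n dist"
 assumes g: "\<And>i. g i \<in> BM"
  and dim: "2 <= CARD('n)" and p: "real CARD('n) <= p" and r: "1 <= r"
  and \<theta>: "0 < \<theta>" "\<theta> < 1 / p"
  and L: "lorint (1 / p) r (Phi (real CARD('n) / p - 1) g) < \<infinity>"
  and a: "0 <= a" "Pb T 0 a (lin g)" "Pb T \<theta> a (lin g)"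
  and small: "4 * K0 TYPE('n) \<theta> * a <= 1" "4 * K1 TYPE('n) \<theta> * a <= 1"
  and T: "0 < T"
  and u0: "\<And>i. has_fourier_fun (u0 i)" "\<And>i. AE x in lebesgue. ft (u0 i) x = g i x"
begin

abbreviation "W \<equiv> Winf g"

lemma basic: "2 <= real CARD('n)" "2 <= p" "0 < p" "real CARD('n) / p <= 1" "1 / p <= 1 / 2"
proof -
 show "2 <= real CARD('n)" using dim by simp
 with p show "2 <= p" by linarith
 thus "0 < p" "1 / p <= 1 / 2" by (auto simp: field_simps)
 thus "real CARD('n) / p <= 1" using p by (simp add: field_simps)
qed

lemma ns: "s < 1 / p ==> real CARD('n) * s < 1"
proof -
 assume "s < 1 / p"
 hence "real CARD('n) * s < real CARD('n) * (1 / p)" using basic by (intro mult_strict_left_mono) auto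
 thus ?thesis using basic(4) by simp
qed

lemma lin_bound:
 assumes s: "0 <= s" "s <= 1 / p"
 shows "\<exists>A\<ge>0. Pb T s A (lin g)"
proof -
 obtain M where M: "lorint (1 / p) r (Phi (real CARD('n) / p - 1) g) = ennreal M" "0 <= M" using L by (cases "lorint (1 / p) r (Phi (real CARD('n) / p - 1) g)") auto
 define A where "A = ((1 - 1 / p) * r * M) powr (1 / r) / (1 / p)"
 have A: "0 <= A" "wbd (1 / p) A (Phi (real CARD('n) * (1 / p) - 1) g)" using lorint_cong_wbd[of "1 / p" r "Phi (real CARD('n) / p - 1) g" M] M basic r Phi_borel[OF g] by (auto simp: A_def)
 have "Pb T s (heat_const TYPE(real^'n) (1 - real CARD('n) * (1 / p)) (1 / p - s) * A) (lin g)" using s basic by (intro Pb_lin_data[OF g A(2,1)]) auto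
 moreover have "0 <= heat_const TYPE(real^'n) (1 - real CARD('n) * (1 / p)) (1 / p - s) * A" using s basic A by (intro mult_nonneg_nonneg heat_const_nonneg) auto
 ultimately show ?thesis by blast
qed

lemma \<theta>_dim: "real CARD('n) * \<theta> < 1" by (rule ns[OF \<theta>(2)])

lemma Wit_zero: "Pb T 0 (2 * a) (Wit g k)" and W_zero: "Pb T 0 (2 * a) W" and W_\<theta>: "Pb T \<theta> (2 * a) W" using Pb_Wit[OF g a(2,3,1) \<theta>(1) \<theta>_dim small] Pb_Winf[OF g] by auto

lemma W_upper:
 assumes "\<theta> <= s" "s < 1 / p" "Pb T' s A (lin g)" "0 <= A" "T' <= T"
 shows "Pb T' s (2 * A) W"
proof (rule Pb_Winf[OF g])
 have "Pb T' 0 (2 * a) (Wit g k)" for k by (rule Pb_mono[OF Wit_zero]) (use assms in auto)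
 from Pb_Wit_other[OF g this a(1) assms(3,4) \<theta>(1) assms(1) ns[OF assms(2)] small(2)] show "Pb T' s (2 * A) (Wit g k)" for k .
qed

lemma W_lower:
 assumes P: "Pb T' 0 A W" "Pb T' \<theta> A W" and A: "0 <= A" and s: "0 <= s" "s <= \<theta>"
 shows "Pb T' s A W"
proof -
 have "A powr (1 - s / \<theta>) * A powr (s / \<theta>) = A" using A by (cases "A = 0") (auto simp: powr_add[symmetric])
 thus ?thesis using Pb_interpolate[OF P A A, of "s / \<theta>"] s \<theta> by simp
qed

lemma W_bound:
 assumes "0 <= s" "s < 1 / p"
 shows "\<exists>A\<ge>0. Pb T s A W"
proof (cases "\<theta> <= s")
 case True
 thus ?thesis using lin_bound[of s] W_upper[of s T] assms by (metis less_imp_le mult_nonneg_nonneg order_refl zero_le_numeral)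
next
 case False
 thus ?thesis using W_lower[OF W_zero W_\<theta>, of s] assms a by (intro exI[of _ "2 * a"]) auto
qed

lemma ex_time: "\<exists>T1>0. ereal T1 <= T" using T by (cases T) (auto intro: exI[of _ 1])

lemma lin_small:
 assumes "0 <= s" "s < 1 / p" "0 < e"
 shows "\<exists>T0>0. ereal T0 <= T \<and> Pb (ereal T0) s e (lin g)"
proof -
 obtain T1 where T1: "0 < T1" "ereal T1 <= T" using ex_time by blast
 have "\<exists>T0>0. Pb (ereal T0) s e (lin g)" using assms basic r L by (intro lin_decay[OF g, of "1 / p" r]) auto
 then obtain T0 where T0: "0 < T0" "Pb (ereal T0) s e (lin g)" by blast
 have "Pb (ereal (min T0 T1)) s e (lin g)" by (rule Pb_mono[OF T0(2)]) auto
 moreover have "ereal (min T0 T1) <= T" by (rule order_trans[OF _ T1(2)]) simp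
 ultimately show ?thesis using T0 T1 by (intro exI[of _ "min T0 T1"]) auto
qed

text \<open>From \<theta> upwards the decay is inherited from the linear part. Below \<theta> the
  iteration is run again on a shorter interval with a smaller radius d, and the indices 0 and
  \<theta> are interpolated.\<close>

lemma W_decay:
 assumes s: "0 <= s" "s < 1 / p" and e: "0 < e"
 shows "\<exists>T0>0. ereal T0 <= T \<and> Pb (ereal T0) s e W"
proof (cases "\<theta> <= s")
 case True
 obtain T0 where "0 < T0" "ereal T0 <= T" "Pb (ereal T0) s (e / 2) (lin g)" using lin_small[OF s, of "e / 2"] e by auto
 thus ?thesis using W_upper[OF True s(2), of "ereal T0" "e / 2"] e by auto
next
 case False
 let ?K = "4 * K0 TYPE('n) \<theta> + 4 * K1 TYPE('n) \<theta> + 1"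
 have K: "0 <= K0 TYPE('n) \<theta>" "0 <= K1 TYPE('n) \<theta>" using K_nonneg[OF \<theta>(1)] \<theta>_dim by auto
 \<comment> \<open>Small enough for both smallness conditions, with d in the place of a, and for 2 d
   \<le> e.\<close>
 define d where "d = min (e / 2) (1 / ?K)"
 have d: "0 < d" "2 * d <= e" "d <= 1 / ?K" using e K by (auto simp: d_def intro!: divide_pos_pos add_nonneg_pos)
 have dK: "?K * d <= 1" using mult_left_mono[OF d(3), of ?K] K by simp
 have sm: "4 * K0 TYPE('n) \<theta> * d <= 1" "4 * K1 TYPE('n) \<theta> * d <= 1" using dK d(1) mult_nonneg_nonneg[OF K(1) less_imp_le[OF d(1)]] mult_nonneg_nonneg[OF K(2) less_imp_le[OF d(1)]] unfolding distrib_right mult.assoc by linarith+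
 obtain T1 where T1: "0 < T1" "ereal T1 <= T" "Pb (ereal T1) 0 d (lin g)" using lin_small[of 0 d] d basic by auto
 obtain T2 where T2: "0 < T2" "ereal T2 <= T" "Pb (ereal T2) \<theta> d (lin g)" using lin_small[of \<theta> d] d \<theta> by auto
 let ?T = "min T1 T2"
 have P: "Pb (ereal ?T) 0 d (lin g)" "Pb (ereal ?T) \<theta> d (lin g)" by (rule Pb_mono[OF T1(3)] Pb_mono[OF T2(3)]; simp)+
 have "Pb (ereal ?T) 0 (2 * d) W" "Pb (ereal ?T) \<theta> (2 * d) W" using Pb_Wit[OF g P _ \<theta>(1) \<theta>_dim sm] d Pb_Winf[OF g] by auto
 from W_lower[OF this, of s] have "Pb (ereal ?T) s (2 * d) W" using d s False by auto
 hence "Pb (ereal ?T) s e W" by (rule Pb_mono) (use d in auto)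
 moreover have "ereal ?T <= T" by (rule order_trans[OF _ T1(2)]) simp
 ultimately show ?thesis using T1 T2 by (intro exI[of _ ?T]) auto
qed

abbreviation "U \<equiv> usol T g"

text \<open>At t = 0 \<open>usol\<close> has its default value 0, so the datum itself is
  inserted.\<close>

definition sol :: "real => 'n => 'n dist" where
 "sol t i = (if t = 0 then u0 i else Finv (U i t))"

lemmas U_bound = usol_bound[OF g W_zero mult_nonneg_nonneg[OF zero_le_numeral a(1)]]
lemmas U_jm = jm_usol[OF g]
lemmas U_borel = jm_slice[OF U_jm]
lemmas W_borel = jm_slice[OF jm_Winf[OF g]]

lemma W_integral:
 assumes "0 < t" "ereal t <= T"
 shows "(NN x. W t x) < \<infinity>" using PbD[OF W_zero assms] a by (subst (asm) wbd_0_iff) (auto intro: W_borel order_le_less_trans)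

lemma U_integrable:
 assumes "0 < t" "ereal t <= T"
 shows "integrable lborel (U i t)"
proof (rule integrableI_bounded)
 show "U i t \<in> borel_measurable lborel" using U_borel by simp
 show "(NN x. enorm (U i t x)) < \<infinity>" by (rule order_le_less_trans[OF nn_integral_mono[OF U_bound] W_integral[OF assms]])
qed

lemma sol_fourier:
 assumes "0 < t" "ereal t <= T"
 shows "AE x in lebesgue. ft (sol t i) x = U i t x" "has_fourier_fun (sol t i)" "ft (sol t i) \<in> LM"
proof -
 note f = has_fourier_fun_Finv[OF U_integrable[OF assms, of i]]
 show "AE x in lebesgue. ft (sol t i) x = U i t x" using ft_Finv[OF f(1)] assms by (simp add: sol_def)
 show "has_fourier_fun (sol t i)" "ft (sol t i) \<in> LM" using f good_measurable[OF good_ft_Finv[OF f(1)]] assms by (simp_all add: sol_def)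
qed

lemma sol_FL_norm:
 assumes t: "0 < t" "ereal t <= T" and q: "1 < q"
 shows "FL_norm (ennreal q) 1 (sol t i) <= lorint (1 / q) 1 (W t)"
proof -
 have "lorentz_norm (conj_exp (ennreal q)) (ennreal 1) (ft (sol t i)) = epow (lorint (1 / q) 1 (nf (U i t))) (1 / 1)" using sol_fourier[OF t, of i] U_borel q by (intro lorentz_norm_lorint) (auto elim: AE_mp)
 also have "... <= lorint (1 / q) 1 (W t)" unfolding div_by_1 epow_1 using U_borel W_borel U_bound by (intro lorint_mono_AE) auto
 finally show ?thesis by (simp add: FL_norm_def)
qed

text \<open>The strong norm with second index 1 at 1/q comes from weak bounds at 0 and at the
  midpoint of 1/q and 1/p; the midpoint still lies in the range below 1/p where the majorant is
  controlled.\<close>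

lemma sol_K_norm:
 assumes q: "p < q" and P: "Pb T' ((1 / q + 1 / p) / 2) A W" "Pb T' 0 A W" and A: "0 <= A"
  and t: "0 < t" "ereal t <= T'" "T' <= T"
 shows "ennreal (t powr ((1 - real CARD('n) / q) / 2)) * vec_norm (FL_norm (ennreal q) 1) (sol t) <=
  ennreal (A * (real CARD('n) * (1 / ((1 / q + 1 / p) / 2 - 1 / q) + 1 / (1 / q))))"
proof -
 let ?C = "1 / ((1 / q + 1 / p) / 2 - 1 / q) + 1 / (1 / q)"
 have q0: "0 < q" "1 < q" "1 / q < 1 / p" "0 < 1 / q" using basic q by (auto simp: field_simps)
 hence C: "0 <= ?C" by (intro add_nonneg_nonneg divide_nonneg_nonneg) auto
 have tT: "ereal t <= T" using t by (meson order_trans)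
 have "lorint (1 / q) 1 (W t) <= ennreal ((A * t powr (- (1 - real CARD('n) * (1 / q)) / 2)) powr 1 * (1 / (1 * ((1 / q + 1 / p) / 2 - 1 / q)) + 1 / (1 * (1 / q - 0))))" using midpoint_bounds[OF q0(4,3) basic(5)] q0 t by (intro lorint_Pb[OF P jm_Winf[OF g] A]) auto
 hence "FL_norm (ennreal q) 1 (sol t i) <= ennreal (A * t powr (- (1 - real CARD('n) / q) / 2) * ?C)" for i using sol_FL_norm[OF t(1) tT q0(2), of i] A by (auto intro: order_trans)
 from vec_norm_le[of "FL_norm (ennreal q) 1", OF this]
 have "ennreal (t powr ((1 - real CARD('n) / q) / 2)) * vec_norm (FL_norm (ennreal q) 1) (sol t) <=
  ennreal (t powr ((1 - real CARD('n) / q) / 2)) * (of_nat CARD('n) * ennreal (A * t powr (- (1 - real CARD('n) / q) / 2) * ?C))" by (rule mult_left_mono) simp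
 also have "... = ennreal (t powr ((1 - real CARD('n) / q) / 2) * (real CARD('n) * (A * t powr (- (1 - real CARD('n) / q) / 2) * ?C)))" using A C by (simp only: ennreal_of_nat_eq_real_of_nat) (subst ennreal_mult[symmetric]; simp)+
 also have "t powr ((1 - real CARD('n) / q) / 2) * (real CARD('n) * (A * t powr (- (1 - real CARD('n) / q) / 2) * ?C)) = A * (real CARD('n) * ?C)"
 proof -
  have "t powr ((1 - real CARD('n) / q) / 2) * t powr (- (1 - real CARD('n) / q) / 2) = 1" unfolding minus_divide_left[symmetric] using t by (simp add: powr_minus)
  thus ?thesis by (simp add: mult_ac)
 qed
 finally show ?thesis .
qed

lemma sol_K_space:
 assumes q: "p < q"
 shows "sol \<in> K_space q T"
proof -
 let ?s = "(1 / q + 1 / p) / 2"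
 define C where "C = real CARD('n) * (1 / (?s - 1 / q) + 1 / (1 / q))"
 have q0: "0 < q" "1 < q" "1 / q < 1 / p" "0 < 1 / q" using basic q by (auto simp: field_simps)
 have s: "0 <= ?s" "?s < 1 / p" using midpoint_bounds[OF q0(4,3) basic(5)] by auto
 have C: "0 < C" using q0 basic unfolding C_def by (intro mult_pos_pos add_pos_pos divide_pos_pos) auto
 let ?N = "%t. ennreal (t powr ((1 - real CARD('n) / q) / 2)) * vec_norm (FL_norm (ennreal q) 1) (sol t)"
 \<comment> \<open>The space K is about functions of x; the inverse transform inherits joint
   measurability from \<open>U\<close>.\<close>
 have 1: "\<exists>V :: real => 'n => real ^ 'n => complex.
    (\<forall>i. (%(t, x). V t i x) \<in> borel_measurable (lebesgue_on ({t. 0 < t \<and> ereal t < T} \<times> UNIV))) \<and>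
    (\<forall>t i. 0 < t \<and> ereal t < T \<longrightarrow> is_fun (V t i) (sol t i))" using jm_restrict[OF jm_inv_fourier[OF U_jm]] is_fun_inv_fourier[OF U_integrable] by (intro exI[of _ "%t i. inv_fourier (U i t)"]) (auto simp: sol_def)
 obtain A1 where A1: "0 <= A1" "Pb T ?s A1 W" using W_bound[OF s] by blast
 note P = Pb_common[OF A1(2) W_zero]
 have "(SUP t\<in>{t. 0 < t \<and> ereal t < T}. ?N t) <= ennreal (max A1 (2 * a) * C)" unfolding C_def by (intro SUP_least sol_K_norm[OF q P]) (use A1 in auto)
 hence 2: "(SUP t\<in>{t. 0 < t \<and> ereal t < T}. ?N t) < \<infinity>" by (rule order_le_less_trans) simp
 have 3: "(?N \<longlongrightarrow> 0) (at_right 0)"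
 proof (rule order_tendstoI)
  fix x :: ennreal assume "0 < x"
  then obtain e where e: "0 < e" "ennreal e < x" by (metis dense ennreal_cases ennreal_less_zero_iff less_trans not_less_iff_gr_or_eq top.extremum_strict)
  define d where "d = e / C"
  have d: "0 < d" "d * C = e" using e C by (auto simp: d_def)
  obtain T1 where T1: "0 < T1" "ereal T1 <= T" "Pb (ereal T1) ?s d W" using W_decay[OF s d(1)] by blast
  obtain T2 where T2: "0 < T2" "ereal T2 <= T" "Pb (ereal T2) 0 d W" using W_decay[of 0 d] d basic by auto
  let ?T = "min T1 T2"
  have "?N t < x" if "0 < t" "t < ?T" for t
  proof -
   have "?N t <= ennreal (d * C)" unfolding C_def by (rule sol_K_norm[OF q Pb_mono[OF T1(3)] Pb_mono[OF T2(3)], where T'="ereal ?T"])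
    (use that d T1 in \<open>auto intro: min.coboundedI1\<close>)
   thus ?thesis using e d by simp
  qed
  thus "\<forall>\<^sub>F t in at_right 0. ?N t < x" using T1 T2 by (auto simp: eventually_at_right[of 0 1] intro!: exI[of _ ?T])
 qed simp
 have 4: "sol t i \<in> FL_space (ennreal q) 1" if t: "0 < t" "ereal t < T" for t i
 proof -
  have tT: "ereal t <= T" using t by simp
  have "FL_norm (ennreal q) 1 (sol t i) <= vec_norm (FL_norm (ennreal q) 1) (sol t)" by (rule component_le_vec_norm)
  moreover have "?N t <= ennreal (max A1 (2 * a) * C)" unfolding C_def by (intro sol_K_norm[OF q P]) (use t A1 in auto)
  hence "?N t \<noteq> \<infinity>" by (auto simp: top_unique)
  hence "vec_norm (FL_norm (ennreal q) 1) (sol t) < \<infinity>" using t by (auto simp: ennreal_mult_eq_top_iff less_top)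
  ultimately have "FL_norm (ennreal q) 1 (sol t i) < \<infinity>" by (rule order_le_less_trans)
  thus ?thesis using sol_fourier[OF t(1) tT, of i] by (simp add: FL_space_def lorentz_space_def FL_norm_def)
 qed
 show ?thesis unfolding K_space_def using 1 2 3 4 by blast
qed

text \<open>The Duhamel term is better than the linear part. With s = 3/(4p) its convolution has
  index s when one factor is measured by its integral, and index 2s = 3/(2p) by
  \<open>young_weak\<close>. These lie on both sides of 1/p, so interpolation reaches the second
  index r at 1/p itself. By scaling the powers of t cancel, and the bound is uniform in
  time.\<close>

lemma weighted_duh: "\<exists>M. \<forall>t. 0 < t \<and> ereal t <= T \<longrightarrow> lorint (1 / p) r (%z. ennreal (norm z powr (real CARD('n) / p - 1)) * duh W t z) <= ennreal M"
proof -
 let ?e = "real CARD('n) / p - 1" and ?s = "3 / (4 * p)"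
 \<comment> \<open>An index strictly between s and 1/p; together with 0 it yields the strong bound
   at s that \<open>young_weak\<close> demands of one factor.\<close>
 define s1 where "s1 = (?s + 1 / p) / 2"
 have s: "0 < ?s" "?s < 1 / p" "1 / p < 2 * ?s" "2 * ?s < 1" "?s < s1" "s1 < 1 / p" "?s <= 1 / 2" "1 / (2 * p) < ?s" "1 / (2 * p) \<ge> 0" "s1 < 1" using basic by (auto simp: s1_def field_simps)
 have e: "-1 <= ?e" "(1 + ?e) / 2 = real CARD('n) / p / 2" "real CARD('n) / p / 2 < 1" using basic by (auto intro: order_less_le_trans[of _ "1/2"])
 note J = jm_Winf[OF g]
 obtain A where A: "0 <= A" "Pb T ?s A W" using W_bound[of ?s] s by auto
 obtain A1' where A1': "0 <= A1'" "Pb T s1 A1' W" using W_bound[of s1] s by auto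
 define A1 where "A1 = max A1' (2 * a)"
 have A1: "0 <= A1" "Pb T s1 A1 W" "Pb T 0 A1 W" using Pb_common[OF A1'(2) W_zero] A1' by (auto simp: A1_def)
 define c1 where "c1 = (1 - ?s) * (1 / (1 * (s1 - ?s)) + 1 / (1 * (?s - 0)))"
 have c1: "0 <= c1" using s unfolding c1_def by (intro mult_nonneg_nonneg add_nonneg_nonneg divide_nonneg_nonneg) auto
 have young: "wbd (2 * ?s) (c1 * A1 * A * q powr (real CARD('n) * ?s - 1)) (econv (W q) (W q))" if q: "0 < q" "ereal q <= T" for q
 proof -
  let ?x = "q powr (- (1 - real CARD('n) * ?s) / 2)"
  have "lorint ?s 1 (W q) <= ennreal ((A1 * ?x) powr 1 * (1 / (1 * (s1 - ?s)) + 1 / (1 * (?s - 0))))" using s q A1 by (intro lorint_Pb[OF A1(2,3) J]) auto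
  hence "ennreal (1 - ?s) * lorint ?s 1 (W q) <= ennreal (1 - ?s) * ennreal (A1 * ?x * (1 / (1 * (s1 - ?s)) + 1 / (1 * (?s - 0))))" using A1 by (intro mult_left_mono) auto
  also have "... = ennreal (c1 * A1 * ?x)" using s A1 unfolding c1_def by (subst ennreal_mult[symmetric]) (auto intro!: mult_nonneg_nonneg add_nonneg_nonneg divide_nonneg_nonneg simp: mult_ac)
  finally have "lor1 ?s (W q) <= ennreal (c1 * A1 * ?x)" using lor1_le_lorint[of ?s "W q"] s W_borel by (auto intro: order_trans)
  from young_weak[OF PbD[OF A(2) q] this] have "wbd (2 * ?s) (c1 * A1 * ?x * (A * ?x)) (econv (W q) (W q))" using s A A1 c1 W_borel by auto
  moreover have "?x * ?x = q powr (real CARD('n) * ?s - 1)" unfolding powr_add[symmetric] by (rule arg_cong[where f="(powr) q"]) (simp add: field_simps)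
  ultimately show ?thesis by (simp add: mult_ac)
 qed
 define h1 where "h1 = kappa TYPE('n) * heat_const TYPE(real^'n) (1 + ?e) 0 * (2 * (1 / (real CARD('n) * ?s / 2) + 1 / (1 - real CARD('n) / p / 2))) * (A * (2 * a))"
 define h2 where "h2 = kappa TYPE('n) * heat_const TYPE(real^'n) (1 + ?e) 0 * (2 * (1 / (real CARD('n) * ?s) + 1 / (1 - real CARD('n) / p / 2))) * (c1 * A1 * A)"
 define H where "H = max \<bar>h1\<bar> \<bar>h2\<bar>"
 have H: "0 <= H" "h1 <= H" "h2 <= H" by (auto simp: H_def)
 show ?thesis
 proof (intro exI allI impI)
  fix t assume t: "0 < t \<and> ereal t <= T"
  have tau: "ereal q <= T" if "q < t" for q using that t by (auto intro: order_trans[of "ereal q" "ereal t"])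
  let ?F = "%z::real^'n. ennreal (norm z powr ?e) * duh W t z"
  define \<rho> where "\<rho> = t powr (- real CARD('n) / 2)"
  have Fm: "?F \<in> BM" using jm_slice[OF duh_integrand_measurable(2)[OF J]] by measurable
  have ea: "(1 + ?e) / 2 + real CARD('n) * (x - x) / 2 = real CARD('n) / p / 2" for x by simp
  have "wbd ?s (h1 * t powr (real CARD('n) * ?s / 2 - real CARD('n) / p / 2)) ?F"
  proof -
   have "wbd ?s (kappa TYPE('n) * heat_const TYPE(real^'n) (1 + ?e) (?s - ?s) * (2 * (1 / (real CARD('n) * ?s / 2) + 1 / (1 - ((1 + ?e) / 2 + real CARD('n) * (?s - ?s) / 2)))) *
    (A * (2 * a)) * t powr (real CARD('n) * ?s / 2 - ((1 + ?e) / 2 + real CARD('n) * (?s - ?s) / 2))) ?F" using t s e basic ns[OF s(2)] A a tau by (intro wbd_duh[OF J] Pb_econv[OF W_zero A(2) J]) auto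
   thus ?thesis unfolding ea h1_def by simp
  qed
  moreover have "wbd (2 * ?s) (h2 * t powr (real CARD('n) * ?s - real CARD('n) / p / 2)) ?F"
  proof -
   have "wbd (2 * ?s) (kappa TYPE('n) * heat_const TYPE(real^'n) (1 + ?e) (2 * ?s - 2 * ?s) * (2 * (1 / (real CARD('n) * ?s) + 1 / (1 - ((1 + ?e) / 2 + real CARD('n) * (2 * ?s - 2 * ?s) / 2)))) *
    (c1 * A1 * A) * t powr (real CARD('n) * ?s - ((1 + ?e) / 2 + real CARD('n) * (2 * ?s - 2 * ?s) / 2))) ?F" using t s e basic ns[OF s(2)] A A1 c1 tau by (intro wbd_duh[OF J] young) auto
   thus ?thesis unfolding ea h2_def by simp
  qed
  moreover have "t powr (real CARD('n) * ?s / 2 - real CARD('n) / p / 2) = \<rho> powr (1 / p - ?s)" "t powr (real CARD('n) * ?s - real CARD('n) / p / 2) = \<rho> powr (1 / p - 2 * ?s)" unfolding \<rho>_def powr_powr by (rule arg_cong[where f="(powr) t"]; simp add: field_simps)+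
  ultimately have "wbd (2 * ?s) (H * \<rho> powr (1 / p - 2 * ?s)) ?F" "wbd ?s (H * \<rho> powr (1 / p - ?s)) ?F" using H by (auto elim!: wbd_mono intro!: mult_right_mono)
  thus "lorint (1 / p) r ?F <= ennreal (H powr r * (1 / (r * (2 * ?s - 1 / p)) + 1 / (r * (1 / p - ?s))))" by (rule wbd_lorint_interpolate[OF _ _ s(2,3,4) _ _ H(1) Fm]) (use r t in \<open>auto simp: \<rho>_def\<close>)
 qed
qed

lemma U_weighted:
 assumes x: "x \<noteq> 0" and t: "0 < t"
 shows "ennreal (norm x powr e * norm (U i t x)) <= Phi e g x + ennreal (norm x powr e) * duh W t x"
proof -
 have "ennreal (norm x powr e * norm (U i t x)) <= ennreal (norm x powr e) * W t x" using U_bound by (simp add: ennreal_mult mult_left_mono)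
 also have "... = ennreal (norm x powr e) * lin g t x + ennreal (norm x powr e) * duh W t x" by (subst Winf_fixpoint[OF g]) (rule distrib_left)
 also have "ennreal (norm x powr e) * lin g t x = ennreal (exp (- t * (norm x)^2)) * Phi e g x" using x by (simp add: lin_eq_Phi[OF x, of g t e] mult.assoc[symmetric] ennreal_mult[symmetric] powr_minus)
 also have "... <= 1 * Phi e g x" using t by (intro mult_right_mono) auto
 finally show ?thesis by (simp add: add_right_mono)
qed

text \<open>The heat multiplier is at most 1, so the linear part is bounded by the datum pointwise;
  the Duhamel part is covered by \<open>weighted_duh\<close>, and \<open>lorint_add_le\<close> joins
  the two.\<close>

lemma sol_HFL:
 "\<exists>M. \<forall>t i. 0 < t \<and> ereal t <= T \<longrightarrow> sol t i \<in> HFL_space (real CARD('n) / p - 1) (ennreal p) (ennreal r) \<and>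
   HFL_norm (real CARD('n) / p - 1) (ennreal p) (ennreal r) (sol t i) <= ennreal M"
proof -
 let ?e = "real CARD('n) / p - 1"
 obtain M1 where M1: "\<And>t. 0 < t ==> ereal t <= T ==> lorint (1 / p) r (%x. ennreal (norm x powr ?e) * duh W t x) <= ennreal M1" using weighted_duh by blast
 let ?c = "ennreal (2 powr ((1 - 1 / p) * r) * 2 powr r)"
 have "?c * (lorint (1 / p) r (Phi ?e g) + ennreal M1) < \<infinity>" using L by (simp add: ennreal_mult_less_top)
 then obtain M2 where M2: "?c * (lorint (1 / p) r (Phi ?e g) + ennreal M1) = ennreal M2" "0 <= M2" by (cases "?c * (lorint (1 / p) r (Phi ?e g) + ennreal M1)") auto
 have "sol t i \<in> HFL_space ?e (ennreal p) (ennreal r) \<and> HFL_norm ?e (ennreal p) (ennreal r) (sol t i) <= ennreal (M2 powr (1 / r))"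
  if t: "0 < t" "ereal t <= T" for t i
 proof -
  let ?F = "%x. ennreal (norm x powr ?e * norm (U i t x))" and ?G = "%x. ennreal (norm x powr ?e) * duh W t x"
  have [measurable]: "U i t \<in> BM" "Phi ?e g \<in> BM" "duh W t \<in> BM" by (intro U_borel Phi_borel g jm_slice[OF duh_integrand_measurable(2)[OF jm_Winf[OF g]]])+
  have wm: "(%x::real^'n. cplx (norm x powr ?e)) \<in> BM" by measurable
  have m: "(%x. cplx (norm x powr ?e) * ft (sol t i) x) \<in> LM" by (intro borel_measurable_times lebesgue_borel[OF wm] sol_fourier(3)[OF t])
  have "lorint (1 / p) r ?F <= lorint (1 / p) r (%x. Phi ?e g x + ?G x)"
  proof (rule lorint_mono_AE)
   show "AE x in lborel. ?F x <= Phi ?e g x + ?G x" using AE_nonzero by eventually_elim (rule U_weighted[OF _ t(1)])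
   show "?F \<in> BM" "(%x. Phi ?e g x + ?G x) \<in> BM" by measurable
  qed (use r in simp)
  also have "... <= ?c * (lorint (1 / p) r (Phi ?e g) + lorint (1 / p) r ?G)" using r by (intro lorint_add_le) measurable
  also have "... <= ennreal M2" unfolding M2(1)[symmetric] by (intro mult_left_mono add_left_mono M1 t) simp
  finally have le: "lorint (1 / p) r ?F <= ennreal M2" .
  have "lorentz_norm (conj_exp (ennreal p)) (ennreal r) (%x. cplx (norm x powr ?e) * ft (sol t i) x) = epow (lorint (1 / p) r ?F) (1 / r)"
  proof (rule lorentz_norm_lorint[OF m])
   show "AE x in lebesgue. enorm (cplx (norm x powr ?e) * ft (sol t i) x) = ?F x" using sol_fourier(1)[OF t, of i] by eventually_elim (simp add: norm_mult)
  qed (use r basic in auto)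
  also have "... <= epow (ennreal M2) (1 / r)" using r le by (intro epow_mono) auto
  also have "... = ennreal (M2 powr (1 / r))" using M2 by (simp add: epow_ennreal)
  finally have "lorentz_norm (conj_exp (ennreal p)) (ennreal r) (%x. cplx (norm x powr ?e) * ft (sol t i) x) <= ennreal (M2 powr (1 / r))" .
  thus ?thesis using sol_fourier(2)[OF t, of i] m by (auto simp: HFL_space_def HFL_norm_def lorentz_space_def intro: order_le_less_trans)
 qed
 thus ?thesis by blast
qed

lemma sol_apply:
 assumes "t \<noteq> 0" "f \<in> schwartz"
 shows "sol t i f = (LINT x|lborel. U i t x * inv_fourier f x)" unfolding sol_def using assms U_borel schwartz_borel[OF schwartz_inv_fourier] by (simp add: Finv_apply) (rule LINT_completion, measurable)

lemma sol_Linf: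
 "sol \<in> Linf_time T (HFL_space (real CARD('n) / p - 1) (ennreal p) (ennreal r)) (HFL_norm (real CARD('n) / p - 1) (ennreal p) (ennreal r))" unfolding Linf_time_def
proof (intro CollectI conjI allI ballI)
 fix i f assume f: "f \<in> (schwartz :: ('n cfun) set)"
 note [measurable] = schwartz_borel[OF schwartz_inv_fourier[OF f]]
 have "(%t. LINT x|lborel. U i t x * inv_fourier f x) \<in> BM"
 proof (rule lborel.borel_measurable_lebesgue_integral)
  have "(%q. U i (fst q) (snd q) * inv_fourier f (snd q)) \<in> borel_measurable (borel \<Otimes>\<^sub>M borel)" by (intro borel_measurable_times U_jm) measurable
  thus "(%(t, x). U i t x * inv_fourier f x) \<in> borel_measurable (borel \<Otimes>\<^sub>M lborel)" by (simp add: split_beta')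
 qed
 hence "(%t. if t = 0 then u0 i f else LINT x|lborel. U i t x * inv_fourier f x) \<in> BM" by measurable
 moreover have "(%t. sol t i f) = (%t. if t = 0 then u0 i f else LINT x|lborel. U i t x * inv_fourier f x)" using sol_apply[OF _ f] by (auto simp: sol_def)
 ultimately show "(%t. sol t i f) \<in> borel_measurable (lebesgue_on {t. 0 <= t \<and> ereal t <= T})" by (auto intro!: measurable_restrict_space1 lebesgue_borel)
next
 let ?X = "HFL_space (real CARD('n) / p - 1) (ennreal p) (ennreal r)" and ?N = "HFL_norm (real CARD('n) / p - 1) (ennreal p) (ennreal r)"
 obtain M where M: "\<And>t i. 0 < t ==> ereal t <= T ==> sol t i \<in> ?X \<and> ?N (sol t i) <= ennreal M" using sol_HFL by blast
 show "\<exists>M::real. AE t in lebesgue_on {t. 0 <= t \<and> ereal t <= T}. (\<forall>i. sol t i \<in> ?X) \<and> vec_norm ?N (sol t) <= ennreal M"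
 proof
  have S: "{t. 0 <= t \<and> ereal t <= T} \<in> sets lebesgue"
  proof (cases T)
   case (real c)
   hence "{t. 0 <= t \<and> ereal t <= T} = {0..c}" by auto
   thus ?thesis by simp
  next
   case PInf
   hence "{t. 0 <= t \<and> ereal t <= T} = {0..}" by auto
   thus ?thesis by simp
  qed (use T in auto)
  have "AE t in lebesgue. t \<noteq> (0::real)" unfolding AE_lebesgue_iff by (rule AE_lborel_singleton)
  hence "AE t in lebesgue. 0 <= t \<and> ereal t <= T \<longrightarrow> (\<forall>i. sol t i \<in> ?X) \<and> vec_norm ?N (sol t) <= ennreal (real CARD('n) * M)"
  proof eventually_elim
   case (elim t)
   show ?case
   proof (intro impI conjI allI)
    assume t: "0 <= t \<and> ereal t <= T"
    with elim have t0: "0 < t" "ereal t <= T" by auto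
    show "sol t i \<in> ?X" for i using M[OF t0] by blast
    have "vec_norm ?N (sol t) <= of_nat CARD('n) * ennreal M" using M[OF t0] by (intro vec_norm_le) blast
    thus "vec_norm ?N (sol t) <= ennreal (real CARD('n) * M)" by (simp add: ennreal_of_nat_eq_real_of_nat ennreal_mult')
   qed
  qed
  thus "AE t in lebesgue_on {t. 0 <= t \<and> ereal t <= T}. (\<forall>i. sol t i \<in> ?X) \<and> vec_norm ?N (sol t) <= ennreal (real CARD('n) * M)" using S by (subst AE_restrict_space_iff) (auto elim: AE_mp)
 qed
qed

lemma good_cconv_U:
 assumes "0 < t" "ereal t <= T"
 shows "good (cconv (U j t) (U k t))"
proof (rule has_fourier_fun_Finv(1), rule integrableI_bounded)
 show "cconv (U j t) (U k t) \<in> borel_measurable lborel" using cconv_borel[OF U_borel U_borel] by simp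
 have "(NN x. enorm (cconv (U j t) (U k t) x)) <= (NN x. econv (W t) (W t) x)" by (intro nn_integral_mono order_trans[OF norm_cconv_le] econv_mono U_bound)
 also have "... < \<infinity>"
 proof -
  have "wbd 0 (2 * a * (2 * a) * t powr (real CARD('n) * 0 / 2 - 1)) (econv (W t) (W t))" using a by (intro Pb_econv[OF W_zero W_zero jm_Winf[OF g] _ _ assms]) auto
  thus ?thesis using a by (subst (asm) wbd_0_iff) (auto intro: econv_borel W_borel order_le_less_trans)
 qed
 finally show "(NN x. enorm (cconv (U j t) (U k t) x)) < \<infinity>" .
qed

lemma sol_nonlin:
 assumes q: "0 < q" "q < t" "ereal t <= T" and f: "f \<in> schwartz"
 shows "heat (t - q) (leray (tensor_div (tensor_prod (sol q) (sol q))) i) f = (LINT x|lborel. duk U i t q x * inv_fourier f x)"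
proof -
 have qT: "ereal q <= T" by (rule order_trans[OF _ q(3)]) (use q in simp)
 have [measurable]: "inv_fourier f \<in> BM" "duk U i t q \<in> BM" by (intro schwartz_borel schwartz_inv_fourier f jm_slice[OF jm_duk] U_jm)+
 show ?thesis unfolding heat_nonlin_duk(1)[where W=U, OF U_borel sol_fourier(1)[OF q(1) qT] good_cconv_U[OF q(1) qT] q(1,2)] Finv_apply[OF f] by (rule LINT_completion) measurable
qed

text \<open>The fixed point equation holds at almost every frequency. It is integrated against the
  inverse transform of the test function, and \<open>du_fubini\<close> brings the time integral
  outside.\<close>

lemma sol_mild_pos:
 fixes i :: 'n
 assumes t: "0 < t" "ereal t <= T" and f: "f \<in> schwartz"
 defines "h \<equiv> %q. heat (t - q) (leray (tensor_div (tensor_prod (sol q) (sol q))) i) f"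
 shows "set_integrable lebesgue {0..t} h \<and> sol t i f = heat t (u0 i) f - (LINT q:{0..t}|lebesgue. h q)"
proof -
 let ?F = "inv_fourier f" and ?G = "%q. LINT z|lborel. duk U i t q z * inv_fourier f z"
 note Fs = schwartz_inv_fourier[OF f]
 have [measurable]: "?F \<in> BM" "U i t \<in> BM" by (intro schwartz_borel Fs U_borel)+
 obtain B where B: "\<And>x. norm (?F x) <= B" using schwartz_bounded[OF Fs] by blast
 have "duh W t z <= W t z" for z by (rule duh_le_Winf(2)[OF g])
 hence dfin: "(NN z. duh W t z) < \<infinity>" by (intro order_le_less_trans[OF nn_integral_mono W_integral[OF t]])
 note fub = du_fubini[where u=U and F="?F" and B=B and i=i, OF U_bound jm_Winf[OF g] U_jm dfin schwartz_borel[OF Fs] B]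
 have "AE q in lborel. q \<noteq> 0 \<and> q \<noteq> t" using AE_lborel_singleton[of "0::real"] AE_lborel_singleton[of t] by eventually_elim simp
 hence ae: "AE q in lebesgue. ?G q = indicator {0..t} q *\<^sub>R h q" unfolding AE_lebesgue_iff
 proof eventually_elim
  case (elim q)
  show ?case
  proof (cases "0 < q \<and> q < t")
   case True
   thus ?thesis using sol_nonlin[of q t f i] t f by (simp add: h_def)
  next
   case False
   thus ?thesis using elim by (auto simp: duk_outside indicator_def)
  qed
 qed
 have Gm: "?G \<in> LM" using borel_measurable_integrable[OF fub(1)] by (intro lebesgue_borel) simp
 note hm = borel_measurable_AE[OF Gm ae]
 have Gi: "integrable lebesgue ?G" using fub(1) borel_measurable_integrable[OF fub(1)] by (subst integrable_completion) auto
 hence 1: "set_integrable lebesgue {0..t} h" unfolding set_integrable_def using integrable_cong_AE[OF Gm hm ae] by simp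
 have "(LINT q:{0..t}|lebesgue. h q) = (LINT q|lebesgue. ?G q)" unfolding set_lebesgue_integral_def using integral_cong_AE[OF Gm hm ae] by simp
 also have "... = (LINT q|lborel. ?G q)" using borel_measurable_integrable[OF fub(1)] by (intro LINT_completion) simp
 also have "... = (LINT z|lborel. du U i t z * ?F z)" by (rule fub(3)[symmetric])
 finally have I: "(LINT q:{0..t}|lebesgue. h q) = (LINT z|lborel. du U i t z * ?F z)" .
 have "heat t (u0 i) = Finv (%z. cplx (exp (- t * (norm z)^2)) * g i z)" by (rule heat_AE[OF u0(2) lebesgue_borel[OF g]])
 hence H: "heat t (u0 i) f = (LINT z|lborel. cplx (exp (- t * (norm z)^2)) * g i z * ?F z)" by (simp only: Finv_apply[OF f])
   (intro LINT_completion borel_measurable_times heat_symbol_borel g schwartz_borel Fs)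
 have Ui: "integrable lborel (%z. U i t z * ?F z)"
 proof (rule Bochner_Integration.integrable_bound)
  show "integrable lborel (%z. B * norm (U i t z))" using U_integrable[OF t] by simp
  show "AE z in lborel. norm (U i t z * ?F z) <= norm (B * norm (U i t z))" using B order_trans[OF norm_ge_zero B] by (auto simp: norm_mult abs_mult mult.commute intro!: mult_right_mono)
 qed measurable
 have "AE z in lborel. W t z \<noteq> \<infinity>" using W_integral[OF t] W_borel by (intro nn_integral_PInf_AE) auto
 hence uae: "AE z in lborel. cplx (exp (- t * (norm z)^2)) * g i z * ?F z = U i t z * ?F z + du U i t z * ?F z"
 proof eventually_elim
  case (elim z)
  hence fin: "W t z < \<infinity>" by (simp add: less_top)
  show ?case unfolding distrib_right[symmetric] by (subst usol_fixpoint[OF g W_zero _ t fin]) (use a in auto)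
 qed
 have "heat t (u0 i) f = (LINT z|lborel. U i t z * ?F z + du U i t z * ?F z)" unfolding H
 proof (rule integral_cong_AE[OF _ _ uae])
  show "(%z. cplx (exp (- t * (norm z)^2)) * g i z * ?F z) \<in> borel_measurable lborel" using heat_symbol_borel[of t] g[of i] by measurable
  show "(%z. U i t z * ?F z + du U i t z * ?F z) \<in> borel_measurable lborel" using jm_slice[OF du_jm[where u=U and i=i, OF U_jm], of t] by measurable
 qed
 also have "... = sol t i f + (LINT q:{0..t}|lebesgue. h q)" unfolding I using t f by (simp add: sol_apply Ui fub(2))
 finally show ?thesis using 1 by simp
qed

lemma sol_mild: "mild_solution T u0 sol" unfolding mild_solution_def
proof (intro allI impI conjI ballI; elim conjE)
 fix t i assume t: "0 <= t" "ereal t <= T"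
 show "tempered (sol t i)" using sol_fourier(2)[of t i] u0(1)[of i] t by (cases "t = 0") (auto simp: sol_def has_fourier_fun_def)
 fix f :: "'n cfun" assume f: "f \<in> schwartz"
 let ?h = "%q. heat (t - q) (leray (tensor_div (tensor_prod (sol q) (sol q))) i) f"
 have "set_integrable lebesgue {0..t} ?h \<and> sol t i f = heat t (u0 i) f - (LINT q:{0..t}|lebesgue. ?h q)"
 proof (cases "t = 0")
  \<comment> \<open>The interval from 0 to 0 is a null set, and the heat operator at time 0 fixes
    the datum.\<close>
  case True
  have e: "(%q. indicator {0..t} q *\<^sub>R ?h q) = (%q. indicator {0} q *\<^sub>R ?h 0)" using True by (auto simp: indicator_def fun_eq_iff)
  show ?thesis unfolding set_integrable_def set_lebesgue_integral_def e using True by (simp add: sol_def heat_zero u0)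
 next
  case False
  thus ?thesis using sol_mild_pos[OF _ t(2) f, of i] t by simp
 qed
 thus "set_integrable lebesgue {0..t} ?h" "sol t i f = heat t (u0 i) f - (LINT q:{0..t}|lebesgue. ?h q)" by auto
qed

theorem sol_in_class: "solution_in_class p r T u0 sol" unfolding solution_in_class_def using sol_mild sol_K_space sol_Linf by auto

end

section \<open>Uniqueness\<close>

lemma AE_finite_if_wbd:
 assumes w: "wbd s A F" and [measurable]: "F \<in> BM"
 shows "AE x in lborel. F x < \<infinity>"
proof -
 have "AE x in lborel. x \<in> cball 0 (real k) \<longrightarrow> F x < \<infinity>" for k
 proof -
  have "(nns (cball 0 (real k)) F) \<noteq> \<infinity>" using wbdD[OF w, of "cball 0 (real k)"] by (auto simp: emeasure_cball top_unique)
  moreover have "(%x. F x * indicator (cball 0 (real k)) x) \<in> borel_measurable lborel" by (simp add: borel_measurable_times_ennreal borel_measurable_indicator)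
  ultimately have "AE x in lborel. F x * indicator (cball 0 (real k)) x \<noteq> \<infinity>" by (intro nn_integral_PInf_AE)
  thus ?thesis by eventually_elim (auto simp: indicator_def less_top)
 qed
 hence "AE x in lborel. \<forall>k. x \<in> cball 0 (real k) \<longrightarrow> F x < \<infinity>" by (subst AE_all_countable) auto
 thus ?thesis
 proof eventually_elim
  case (elim x)
  thus ?case using real_arch_simple[of "norm x"] by auto
 qed
qed

lemma lorint_weak:
 assumes L: "lorint s 1 F <= ennreal K" and K: "0 <= K" and s: "0 < s" "s < 1" and F: "F \<in> BM"
 shows "lor1 s F <= ennreal K" "wbd s (K / s) F"
proof -
 have "lor1 s F <= ennreal (1 - s) * lorint s 1 F" by (rule lor1_le_lorint[OF s F])
 also have "... <= 1 * ennreal K" using s by (intro mult_mono L) auto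
 finally show "lor1 s F <= ennreal K" by simp
 have "wbd s (((1 - s) * 1 * K) powr (1 / 1) / s) F" using K s F by (intro lorint_cong_wbd L) auto
 thus "wbd s (K / s) F" by (rule wbd_mono) (use K s in \<open>auto intro!: divide_right_mono mult_left_le_one_le\<close>)
qed

lemma good_cconv:
 fixes f g :: "'n::finite cfun"
 assumes fg: "f \<in> BM" "g \<in> BM" and s: "0 < s" "s <= 1 / 2" and K: "0 <= K" "0 <= A"
  and b: "lor1 s (nf f) <= ennreal K" "wbd s A (nf g)"
 shows "good (cconv f g)"
proof (rule good_if_wbd)
 show "cconv f g \<in> BM" by (rule cconv_borel[OF fg])
 have "wbd (2 * s) (K * A) (econv (nf f) (nf g))" using fg by (intro young_weak b s K) auto
 thus "wbd (2 * s) (K * A) (nf (cconv f g))" by (rule wbd_mono) (auto intro: norm_cconv_le)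
qed (use s K in auto)

text \<open>Bilinearity: each term keeps one solution and one difference, so that the strong norm
  can fall on the solution and the weak norm on the difference.\<close>

lemma cconv_diff_le:
 fixes f g f' g' :: "'n::finite cfun"
 assumes [measurable]: "f \<in> BM" "g \<in> BM" "f' \<in> BM" "g' \<in> BM"
  and fin: "econv (nf f) (nf g) x < \<infinity>"
   "econv (nf f') (nf g') x < \<infinity>"
 shows "enorm (cconv f g x - cconv f' g' x) <=
  econv (nf g) (%x. enorm (f x - f' x)) x +
  econv (nf f') (%x. enorm (g x - g' x)) x"
proof -
 note i = integrable_cconv_iff[OF assms(1,2) fin(1)] integrable_cconv_iff[OF assms(3,4) fin(2)]
 have "cconv f g x - cconv f' g' x = (LINT y|lborel. f (x - y) * g y - f' (x - y) * g' y)" unfolding cconv_def by (rule Bochner_Integration.integral_diff[OF i, symmetric])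
 hence "enorm (cconv f g x - cconv f' g' x) <= (NN y. enorm (f (x - y) * g y - f' (x - y) * g' y))" using integral_norm_bound_ennreal[OF Bochner_Integration.integrable_diff[OF i]] by simp
 also have "... <= (NN y. enorm (f (x - y) - f' (x - y)) * enorm (g y) + enorm (f' (x - y)) * enorm (g y - g' y))"
 proof (rule nn_integral_mono)
  fix y
  have e: "f (x - y) * g y - f' (x - y) * g' y = (f (x - y) - f' (x - y)) * g y + f' (x - y) * (g y - g' y)" by (simp add: algebra_simps)
  have "norm (f (x - y) * g y - f' (x - y) * g' y) <= norm (f (x - y) - f' (x - y)) * norm (g y) + norm (f' (x - y)) * norm (g y - g' y)" unfolding e by (rule order_trans[OF norm_triangle_ineq]) (simp add: norm_mult)
  thus "enorm (f (x - y) * g y - f' (x - y) * g' y) <= enorm (f (x - y) - f' (x - y)) * enorm (g y) + enorm (f' (x - y)) * enorm (g y - g' y)" by (simp add: ennreal_mult[symmetric] ennreal_plus[symmetric] ennreal_leI del: ennreal_plus)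
 qed
 also have "... = econv (%x. enorm (f x - f' x)) (nf g) x + econv (nf f') (%x. enorm (g x - g' x)) x" unfolding econv_def by (rule nn_integral_add) measurable
 also have "econv (%x. enorm (f x - f' x)) (nf g) = econv (nf g) (%x. enorm (f x - f' x))" by (rule econv_commute) measurable
 finally show ?thesis .
qed

text \<open>Assembles the symbol bound, the heat constant for the drop from index 2 s to s, and two
  terms for each of the n^2 pairs of components.\<close>

definition CU :: "'n::finite itself => real => real" where
 "CU _ s = 2 * fconst TYPE('n) * heat_const TYPE(real^'n) 1 s * (2 * (real CARD('n))\<^sup>2)"

abbreviation xp :: "'n::finite itself => real => real" where
 "xp N s \<equiv> 1 / 2 + real CARD('n) * s / 2"

abbreviation CUk :: "'n::finite itself => real => real => real" where
 "CUk N s h \<equiv> CU N s * h powr (- xp N s)"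

lemma CU_nonneg: "0 <= s ==> 0 <= CU TYPE('n::finite) s" unfolding CU_def by (intro mult_nonneg_nonneg heat_const_nonneg) auto

text \<open>Young's inequality raises the index from s to 2 s and the heat factor brings it back,
  leaving the singularity (t - q)^(-1/2 - n s/2), which is integrable in time once n s < 1.\<close>

lemma duk_diff_wbd:
 fixes U V :: "'n::finite => real => 'n cfun"
 assumes UV: "\<And>a. U a q \<in> BM" "\<And>a. V a q \<in> BM"
  and s: "0 < s" "s <= 1 / 2" and K: "0 <= K" and A: "0 <= A" and B: "0 <= B"
  and lor: "\<And>a. lor1 s (nf (U a q)) <= ennreal K" "\<And>a. lor1 s (nf (V a q)) <= ennreal K"
  and fin: "\<And>a. wbd s B (nf (U a q))" "\<And>a. wbd s B (nf (V a q))"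
  and w: "\<And>a. wbd s A (%x. enorm (U a q x - V a q x))"
  and q: "0 < q" "q < t"
 shows "wbd s (CUk TYPE('n) s (t - q) * K * A) (%x. enorm (duk U i t q x - duk V i t q x))"
proof -
 let ?n = "real CARD('n)"
 define c where "c = 2 * fconst TYPE('n)"
 have c: "0 <= c" by (simp add: c_def)
 note [measurable] = UV
 let ?u = "%a x. enorm (U a q x)" and ?v = "%a x. enorm (V a q x)" and ?w = "%a x. enorm (U a q x - V a q x)"
 have m: "?u a \<in> BM" "?v a \<in> BM" "?w a \<in> BM" for a by measurable
 let ?e = "%a b x. econv (?u b) (?w a) x + econv (?v a) (?w b) x"
 let ?E = "%x. \<Sum>a\<in>UNIV. \<Sum>b\<in>UNIV. ?e a b x"
 have em: "?e a b \<in> BM" for a b using m by (intro borel_measurable_add econv_borel) auto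
 have "wbd (2 * s) (K * A + K * A) (?e a b)" for a b using K A by (intro wbd_add young_weak lor w s m econv_borel) auto
 hence "wbd (2 * s) (\<Sum>a\<in>(UNIV::'n set). \<Sum>b\<in>(UNIV::'n set). K * A + K * A) ?E" using K A em by (intro wbd_sum sum_nonneg borel_measurable_sum) auto
 hence "wbd (2 * s) (2 * ?n\<^sup>2 * (K * A)) ?E" by (simp add: power2_eq_square mult_ac)
 note w2 = this
 have Em: "?E \<in> BM" by (intro borel_measurable_sum em)
 have w3: "wbd s (heat_const TYPE(real^'n) 1 (2 * s - s) * (t - q) powr (- 1 / 2 - real DIM(real^'n) * (2 * s - s) / 2) * (2 * ?n\<^sup>2 * (K * A)))
   (%x. ennreal (norm x powr 1 * exp (- (t - q) * (norm x)^2)) * ?E x)" by (rule wbd_heat[OF w2 _ Em]) (use K A s q in auto)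
 have w4: "wbd s (c * (heat_const TYPE(real^'n) 1 (2 * s - s) * (t - q) powr (- 1 / 2 - real DIM(real^'n) * (2 * s - s) / 2) * (2 * ?n\<^sup>2 * (K * A))))
   (%x. ennreal c * (ennreal (norm x powr 1 * exp (- (t - q) * (norm x)^2)) * ?E x))" by (intro wbd_cmult[OF w3 c] borel_measurable_times_ennreal Em) measurable
 have e: "c * (heat_const TYPE(real^'n) 1 (2 * s - s) * (t - q) powr (- 1 / 2 - real DIM(real^'n) * (2 * s - s) / 2) * (2 * ?n\<^sup>2 * (K * A))) =
   CU TYPE('n) s * (t - q) powr (- (1 / 2 + ?n * s / 2)) * K * A"
 proof -
  have "- 1 / 2 - real DIM(real^'n) * (2 * s - s) / 2 = - (1 / 2 + ?n * s / 2)" "2 * s - s = s" by simp_all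
  thus ?thesis unfolding CU_def c_def by (simp only: mult_ac)
 qed
 show ?thesis using w4 unfolding e
 proof (rule wbd_mono_AE)
  \<comment> \<open>Splitting the difference of two convolutions requires both to converge
    absolutely; \<open>fin\<close> and \<open>lor\<close> guarantee this almost everywhere.\<close>
  have "AE x in lborel. econv (?u a) (?u b) x < \<infinity> \<and> econv (?v a) (?v b) x < \<infinity>" for a b using AE_finite_if_wbd[OF young_weak[OF fin(1) lor(1) s B K m(1) m(1)] econv_borel[OF m(1) m(1)], of a b]
    AE_finite_if_wbd[OF young_weak[OF fin(2) lor(2) s B K m(2) m(2)] econv_borel[OF m(2) m(2)], of a b] by eventually_elim simp
  hence "AE x in lborel. \<forall>a\<in>UNIV. \<forall>b\<in>UNIV. econv (?u a) (?u b) x < \<infinity> \<and> econv (?v a) (?v b) x < \<infinity>" by (intro AE_finite_allI) auto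
  thus "AE x in lborel. enorm (duk U i t q x - duk V i t q x) <= ennreal c * (ennreal (norm x powr 1 * exp (- (t - q) * (norm x)^2)) * ?E x)"
  proof eventually_elim
   case (elim x)
   let ?z = "%a b. cconv (U a q) (U b q) x - cconv (V a q) (V b q) x"
   have d: "duk U i t q x - duk V i t q x = pre t x q * (\<Sum>a\<in>UNIV. \<Sum>b\<in>UNIV. msym i a b x * ?z a b)" by (simp add: duk_def right_diff_distrib sum_subtractf)
   have "enorm (duk U i t q x - duk V i t q x) <= ennreal (2 * fconst TYPE('n) * kern t x q) * (\<Sum>a\<in>UNIV. \<Sum>b\<in>UNIV. enorm (?z a b))" unfolding d by (rule pre_sum_le)
   also have "... <= ennreal (2 * fconst TYPE('n) * kern t x q) * ?E x" by (intro mult_left_mono sum_mono cconv_diff_le UV) (use elim in auto)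
   also have "ennreal (2 * fconst TYPE('n) * kern t x q) = ennreal c * ennreal (norm x powr 1 * exp (- (t - q) * (norm x)^2))" using q c unfolding c_def[symmetric] by (simp add: kern_def ennreal_mult[symmetric])
   finally show ?case by (simp only: mult.assoc)
  qed
 qed simp
qed

lemma norm_LINT_le: "enorm (integral\<^sup>L M f) <= (\<integral>\<^sup>+x. enorm (f x) \<partial>M)" by (cases "integrable M f") (auto intro: integral_norm_bound_ennreal simp: not_integrable_integral_eq)

text \<open>Borel representatives of the transforms, chosen at each time separately, together with
  the two quantitative parts of membership in the space K: a uniform scaled bound and its decay as t
  tends to 0.\<close>

definition K_rep :: "real => ereal => (real => 'n => 'n::finite dist) => ('n => real => 'n cfun) => real => bool" where
 "K_rep s T u U M \<longleftrightarrow>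
  (\<forall>t i. 0 < t \<and> ereal t < T \<longrightarrow> U i t \<in> BM \<and> (AE x in lebesgue. ft (u t i) x = U i t x) \<and> has_fourier_fun (u t i)
   \<and> lorint s 1 (nf (U i t)) <= ennreal (M * t powr (- (1 - real CARD('n) * s) / 2))) \<and>
  (\<forall>e>0. \<exists>T0>0. \<forall>t i. 0 < t \<and> t < T0 \<and> ereal t < T \<longrightarrow>
   lorint s 1 (nf (U i t)) <= ennreal (e * t powr (- (1 - real CARD('n) * s) / 2)))"

lemma K_repD:
 fixes u :: "real => 'n => 'n::finite dist"
 assumes "K_rep s T u U M"
 shows "0 < t ==> ereal t < T ==> U i t \<in> BM \<and> (AE x in lebesgue. ft (u t i) x = U i t x) \<and> has_fourier_fun (u t i)"
  "0 < t ==> ereal t < T ==> lorint s 1 (nf (U i t)) <= ennreal (M * t powr (- (1 - real CARD('n) * s) / 2))"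
  "0 < e ==> \<exists>T0>0. \<forall>t i. 0 < t \<and> t < T0 \<and> ereal t < T \<longrightarrow> lorint s 1 (nf (U i t)) <= ennreal (e * t powr (- (1 - real CARD('n) * s) / 2))" using assms unfolding K_rep_def by blast+

lemma K_rep_mono:
 assumes K: "K_rep s T u U M" and le: "M <= M'"
 shows "K_rep s T u U M'"
proof -
 have "ennreal (M * t powr z) <= ennreal (M' * t powr z)" for t z using le by (intro ennreal_leI mult_right_mono) auto
 thus ?thesis using K unfolding K_rep_def by (meson order_trans)
qed

section \<open>Comparison of two solutions with the same datum\<close>

locale two_solutions =
 fixes s M :: real and T :: ereal and u0 :: "'n::finite => 'n dist" and u v :: "real => 'n => 'n dist"
  and U V :: "'n => real => 'n cfun"
 assumes s: "0 < s" "s <= 1 / 2" and ns: "real CARD('n) * s < 1" and M: "0 <= M"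
  and mild: "mild_solution T u0 u" "mild_solution T u0 v"
  and rep: "K_rep s T u U M" "K_rep s T v V M"
begin

lemmas U = rep(1)[THEN K_repD(1)] and V = rep(2)[THEN K_repD(1)]
 and Ub = rep(1)[THEN K_repD(2)] and Vb = rep(2)[THEN K_repD(2)]
 and Us = rep(1)[THEN K_repD(3)] and Vs = rep(2)[THEN K_repD(3)]

definition x :: "real => real" where "x t = t powr (- (1 - real CARD('n) * s) / 2)"

definition small_diff :: "real => real => bool" where
 "small_diff t A \<longleftrightarrow> (\<forall>a. wbd s A (%z. enorm (U a t z - V a t z)))"

definition lor_le :: "real => real => bool" where
 "lor_le t K \<longleftrightarrow> (\<forall>a. lor1 s (nf (U a t)) <= ennreal K \<and> lor1 s (nf (V a t)) <= ennreal K)"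

lemma x_nonneg: "0 <= x t" by (simp add: x_def)

lemma bounds:
 assumes t: "0 < t" "ereal t < T"
 shows "lor_le t (M * x t)" "wbd s (M * x t / s) (nf (U a t))" "wbd s (M * x t / s) (nf (V a t))"
  "small_diff t (2 * (M * x t / s))"
proof -
 have m: "(nf (U a t)) \<in> BM" "(nf (V a t)) \<in> BM" for a using U[OF t, of a] V[OF t, of a] by (auto intro: measurable_compose[OF _ measurable_ennreal])
 have Mx: "0 <= M * x t" using M x_nonneg by simp
 have s1: "s < 1" using s by simp
 note wU = lorint_weak[OF Ub[OF t, folded x_def] Mx s(1) s1 m(1)] and wV = lorint_weak[OF Vb[OF t, folded x_def] Mx s(1) s1 m(2)]
 show "lor_le t (M * x t)" using wU(1) wV(1) by (simp add: lor_le_def)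
 show "wbd s (M * x t / s) (nf (U a t))" "wbd s (M * x t / s) (nf (V a t))" for a by (rule wU(2) wV(2))+
 have 1: "wbd s (M * x t / s + M * x t / s) (%z. enorm (U a t z) + enorm (V a t z))" for a using Mx s by (intro wbd_add wU(2) wV(2) m) auto
 have 2: "enorm (U a t z - V a t z) <= enorm (U a t z) + enorm (V a t z)" for a z unfolding ennreal_plus[OF norm_ge_zero norm_ge_zero, symmetric] by (intro ennreal_leI norm_triangle_ineq4)
 show "small_diff t (2 * (M * x t / s))" unfolding small_diff_def by (intro allI wbd_mono[OF 1 2]) simp
qed

text \<open>The Duhamel estimate for the difference. Its pairing with a test function h is a time
  integral of scalar pairings, and each of these is bounded by \<open>wbd_integral_le_powr\<close>
  through the power s of the integral of |h|. That power factors out of the time integral, and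
  duality returns a weak bound at time t.\<close>

lemma small_diff_step:
 assumes t: "0 < t" "ereal t < T" and J: "0 <= J"
  and [measurable]: "K \<in> BM" "A \<in> BM"
  and K: "\<And>q. 0 < q ==> q < t ==> 0 <= K q \<and> lor_le q (K q)" and A: "\<And>q. 0 < q ==> q < t ==> 0 <= A q \<and> small_diff q (A q)"
  and int: "nns {0<..<t} (%q. ennreal (CUk TYPE('n) s (t - q) * K q * A q)) <= ennreal J"
 shows "small_diff t J" unfolding small_diff_def
proof
 fix i
 let ?D = "%z. U i t z - V i t z"
 let ?k = "%q. CUk TYPE('n) s (t - q) * K q * A q"
 have [measurable]: "U i t \<in> BM" "V i t \<in> BM" using U[OF t] V[OF t] by auto
 have gU: "good (U i t)" and gV: "good (V i t)" using good_cong_AE[OF Finv_ft(2)] U[OF t] V[OF t] by blast+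
 have gD: "good ?D" by (rule good_diff[OF gU gV])
 have key: "norm (LINT z|lebesgue. ?D z * h z) <= J * (LINT z|lebesgue. norm (h z)) powr s"
  if h: "h \<in> schwartz" "\<And>z. norm (h z) <= 1" for h
 proof -
  note [measurable] = schwartz_borel[OF h(1)]
  \<comment> \<open>The equation is tested with the transform of h, because \<open>Finv\<close>
    pairs with the inverse transform of its argument.\<close>
  define f where "f = fourier h"
  have f: "f \<in> schwartz" "inv_fourier f = h" using h by (auto simp: f_def schwartz_fourier inv_fourier_fourier)
  define I where "I = (LINT z|lborel. norm (h z))"
  have I: "0 <= I" "(NN z. enorm (h z)) = ennreal I" unfolding I_def using schwartz_integrable[OF h(1)] by (auto intro!: nn_integral_eq_integral integral_nonneg)
  have I': "(LINT z|lebesgue. norm (h z)) = I" unfolding I_def by (rule integral_completion) measurable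
  let ?hu = "%q. heat (t - q) (leray (tensor_div (tensor_prod (u q) (u q))) i) f"
  let ?hv = "%q. heat (t - q) (leray (tensor_div (tensor_prod (v q) (v q))) i) f"
  have ap: "w f = (LINT z|lebesgue. W z * h z)" if "has_fourier_fun w" "AE z in lebesgue. ft w z = W z" for w W using Finv_cong_AE[OF good_measurable[OF Finv_ft(2)[OF that(1)]] that(2)] Finv_ft(1)[OF that(1)] Finv_apply[OF f(1), of W] f(2) by simp
  have "(LINT z|lebesgue. ?D z * h z) = u t i f - v t i f" using ap[of "u t i" "U i t"] ap[of "v t i" "V i t"] U[OF t] V[OF t] good_integrable[OF gU h(1)] good_integrable[OF gV h(1)] by (simp add: left_diff_distrib)
  also have "... = - ((LINT q:{0..t}|lebesgue. ?hu q) - (LINT q:{0..t}|lebesgue. ?hv q))" using mild t f(1) unfolding mild_solution_def by auto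
  also have "(LINT q:{0..t}|lebesgue. ?hu q) - (LINT q:{0..t}|lebesgue. ?hv q) = (LINT q:{0..t}|lebesgue. ?hu q - ?hv q)" using mild t f(1) unfolding mild_solution_def by (intro set_integral_diff(2)[symmetric]) auto
  finally have e: "enorm (LINT z|lebesgue. ?D z * h z) <= (\<integral>\<^sup>+q. enorm (indicator {0..t} q *\<^sub>R (?hu q - ?hv q)) \<partial>lebesgue)" unfolding set_lebesgue_integral_def by (simp only: norm_minus_cancel norm_LINT_le)
  also have "... <= (\<integral>\<^sup>+q. ennreal (I powr s) * (ennreal (?k q) * indicator {0<..<t} q) \<partial>lebesgue)"
  proof (rule nn_integral_mono_AE)
   have "AE q in lborel. q \<noteq> 0 \<and> q \<noteq> t" using AE_lborel_singleton[of "0::real"] AE_lborel_singleton[of t] by eventually_elim simp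
   thus "AE q in lebesgue. enorm (indicator {0..t} q *\<^sub>R (?hu q - ?hv q)) <= ennreal (I powr s) * (ennreal (?k q) * indicator {0<..<t} q)" unfolding AE_lebesgue_iff
   proof eventually_elim
    case (elim q)
    show ?case
    proof (cases "0 < q \<and> q < t")
    case True
    hence q: "0 < q" "q < t" "ereal q < T" using t by (auto intro: less_trans[of "ereal q" "ereal t"])
    have KA: "0 <= K q" "0 <= A q" "lor_le q (K q)" "small_diff q (A q)" using K A q by auto
    have B: "0 <= M * x q / s" using M s x_nonneg by simp
    note UV = U[OF q(1,3)] V[OF q(1,3)]
    have gc: "good (cconv (U j q) (U k q))" "good (cconv (V j q) (V k q))" for j k using UV KA bounds(2,3)[OF q(1,3)] unfolding lor_le_def by (intro good_cconv[OF _ _ s KA(1) B]; blast)+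
    have "?hu q = Finv (duk U i t q) f \<and> good (duk U i t q)" using heat_nonlin_duk[of U q "u q", OF _ _ gc(1) q(1,2)] UV by auto
    moreover have "?hv q = Finv (duk V i t q) f \<and> good (duk V i t q)" using heat_nonlin_duk[of V q "v q", OF _ _ gc(2) q(1,2)] UV by auto
    ultimately have "?hu q - ?hv q = (LINT z|lebesgue. (duk U i t q z - duk V i t q z) * h z)" using good_integrable[OF _ h(1)] by (simp add: Finv_apply f left_diff_distrib)
    hence "enorm (?hu q - ?hv q) <= (\<integral>\<^sup>+z. enorm ((duk U i t q z - duk V i t q z) * h z) \<partial>lebesgue)" by (simp only: norm_LINT_le)
    also have "... = (NN z. enorm (duk U i t q z - duk V i t q z) * enorm (h z))" by (simp add: nn_integral_completion norm_mult ennreal_mult)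
    also have "... <= ennreal (?k q * I powr s)"
    proof (rule wbd_integral_le_powr)
    show "wbd s (?k q) (%z. enorm (duk U i t q z - duk V i t q z))" using UV KA B bounds(2,3)[OF q(1,3)] q s unfolding lor_le_def small_diff_def by (intro duk_diff_wbd[where B="M * x q / s"]) auto
    have UVm: "U a q \<in> BM" "V a q \<in> BM" for a using U[OF q(1,3)] V[OF q(1,3)] by blast+
    have [measurable]: "duk U i t q \<in> BM" "duk V i t q \<in> BM" unfolding duk_def[abs_def] by (intro borel_measurable_times borel_measurable_sum measurable_pre msym_borel cconv_borel UVm; simp)+
    show "(%z. enorm (duk U i t q z - duk V i t q z)) \<in> BM" by measurable
    show "0 <= ?k q" using KA CU_nonneg[where 'n='n, of s] s by simp
    qed (use h I s in auto)
    also have "... = ennreal (I powr s) * ennreal (?k q)" using KA CU_nonneg[where 'n='n, of s] s by (simp add: ennreal_mult mult.commute)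
    finally show ?thesis using True by simp
    next
    case False
    thus ?thesis using elim by (auto simp: indicator_def)
    qed
   qed
  qed
  also have "... <= ennreal (I powr s) * ennreal J"
  proof -
   have "(NN q. ennreal (I powr s) * (ennreal (?k q) * indicator {0<..<t} q)) = ennreal (I powr s) * nns {0<..<t} (%q. ennreal (?k q))" by (rule nn_integral_cmult) measurable
   also have "... <= ennreal (I powr s) * ennreal J" by (rule mult_left_mono[OF int]) simp
   finally have "(NN q. ennreal (I powr s) * (ennreal (?k q) * indicator {0<..<t} q)) <= ennreal (I powr s) * ennreal J" .
   thus ?thesis by (simp add: nn_integral_completion)
  qed
  finally show ?thesis unfolding I' using J by (simp add: ennreal_mult[symmetric] mult.commute)
 qed
 show "wbd s J (%z. enorm (?D z))" unfolding wbd_def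
 proof (intro ballI impI)
  fix E :: "(real^'n) set" assume E: "E \<in> sets borel" "emeasure lborel E < \<infinity>"
  hence "(\<integral>\<^sup>+z\<in>E. enorm (?D z) \<partial>lebesgue) <= ennreal (J * measure lebesgue E powr s)" by (intro weak_bound_by_schwartz[OF gD J s(1) key]) (auto intro: sets_completionI_sets)
  thus "nns E (%z. enorm (?D z)) <= ennreal (J * measure lborel E powr s)" using E by (simp add: nn_integral_completion measure_completion)
 qed
qed

lemma exponent_bounds: "0 <= xp TYPE('n) s" "xp TYPE('n) s < 1"
proof -
 show "0 <= xp TYPE('n) s" using s by simp
 show "xp TYPE('n) s < 1" using ns by (simp add: field_simps)
qed

text \<open>A contraction argument shared by the initial interval and the later time steps.
  Differences vanish before t0 and are at most m Y(t) afterwards; the hypothesis on the integral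
  halves the constant, and iteration sends m / 2^k to 0. The weight Y carries the singularity at t =
  0 in the first use and is constant in the second.\<close>

lemma small_diff_zero_step:
 fixes K Y :: "real => real"
 assumes [measurable]: "K \<in> BM" "Y \<in> BM"
  and zero: "\<And>q. 0 < q ==> q < t0 ==> ereal q < T ==> small_diff q 0"
  and K: "\<And>q. 0 < q ==> q < t1 ==> ereal q < T ==> 0 <= K q \<and> lor_le q (K q)" and Y: "\<And>q. 0 <= Y q"
  and init: "\<And>q. 0 < q ==> t0 <= q ==> q < t1 ==> ereal q < T ==> small_diff q (m * Y q)" and m: "0 <= m"
  and int: "\<And>t. 0 < t ==> t0 <= t ==> t < t1 ==>
   (nns {0<..<t} (%q. ennreal (CUk TYPE('n) s (t - q) * K q * (Y q * indicator {t0..} q)))) <= ennreal (Y t / 2)"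
  and t: "0 < t" "t < t1" "ereal t < T"
 shows "small_diff t 0"
proof (cases "t0 <= t")
 case True
 have step: "small_diff t (m / 2 ^ k * Y t)" if "0 < t" "t0 <= t" "t < t1" "ereal t < T" for k t using that
 proof (induction k arbitrary: t)
  case (Suc k)
  let ?m = "m / 2 ^ k"
  have m2: "0 <= ?m" using m by simp
  have lt: "ereal q < T" if "q < t" for q using that Suc.prems by (auto intro: less_trans[of "ereal q" "ereal t"])
  let ?f = "%q. ennreal (CUk TYPE('n) s (t - q) * K q * (Y q * indicator {t0..} q)) * indicator {0<..<t} q"
  have "small_diff t (?m * (Y t / 2))"
  proof (rule small_diff_step[where K=K and A="%q. ?m * (Y q * indicator {t0..} q)"])
   show "0 <= ?m * (Y q * indicator {t0..} q) \<and> small_diff q (?m * (Y q * indicator {t0..} q))" if "0 < q" "q < t" for q using Suc.IH[of q] zero[of q] m m2 Y[of q] lt[of q] that Suc.prems by (cases "t0 <= q") auto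
   have "nns {0<..<t} (%q. ennreal (CUk TYPE('n) s (t - q) * K q * (?m * (Y q * indicator {t0..} q)))) = (NN q. ennreal ?m * ?f q)"
   proof (rule nn_integral_cong)
    fix q
    show "ennreal (CUk TYPE('n) s (t - q) * K q * (?m * (Y q * indicator {t0..} q))) * indicator {0<..<t} q = ennreal ?m * ?f q" unfolding mult.assoc[symmetric] ennreal_mult'[OF m2, symmetric] by (simp only: mult_ac)
   qed
   also have "... = ennreal ?m * (NN q. ?f q)" by (rule nn_integral_cmult) measurable
   also have "... <= ennreal ?m * ennreal (Y t / 2)" by (rule mult_left_mono[OF int[OF Suc.prems(1-3)]]) simp
   also have "... = ennreal (?m * (Y t / 2))" by (rule ennreal_mult[OF m2, symmetric]) (use Y in simp)
   finally show "nns {0<..<t} (%q. ennreal (CUk TYPE('n) s (t - q) * K q * (?m * (Y q * indicator {t0..} q)))) <= ennreal (?m * (Y t / 2))" .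
   show "0 <= K q \<and> lor_le q (K q)" if "0 < q" "q < t" for q using K[of q] lt that Suc.prems by auto
  qed (use Suc.prems m m2 Y in auto)
  thus ?case by (simp add: field_simps)
 qed (use init in auto)
 show ?thesis unfolding small_diff_def wbd_def
 proof (intro allI ballI impI)
  fix a and E :: "(real^'n) set" assume E: "E \<in> sets borel" "emeasure lborel E < \<infinity>"
  have "nns E (%z. enorm (U a t z - V a t z)) <= ennreal (m / 2 ^ k * Y t * measure lborel E powr s)" for k using step[OF t(1) True t(2,3), of k] E unfolding small_diff_def by (intro wbdD) auto
  moreover have "(%k. ennreal (m / 2 ^ k * Y t * measure lborel E powr s)) \<longlonglongrightarrow> ennreal (0 * Y t * measure lborel E powr s)"
  proof (intro tendsto_ennrealI tendsto_mult tendsto_const)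
   have "(%k. m * (1 / 2) ^ k) \<longlonglongrightarrow> m * 0" by (intro tendsto_mult tendsto_const LIMSEQ_realpow_zero) auto
   thus "(%k. m / 2 ^ k) \<longlonglongrightarrow> 0" by (simp add: power_divide)
  qed
  ultimately show "nns E (%z. enorm (U a t z - V a t z)) <= ennreal (0 * measure lborel E powr s)" by (intro LIMSEQ_le_const[of _ _ "nns E (%z. enorm (U a t z - V a t z))"]) auto
 qed
qed (use zero t in auto)

lemma x_borel[measurable]: "x \<in> BM" unfolding x_def[abs_def] by measurable

text \<open>The scale-invariant estimate yields no small factor from a short interval. Smallness
  must come from the solutions themselves, through the decay at t = 0 in the definition of the space
  K.\<close>

lemma small_diff_zero_start: "\<exists>T1>0. \<forall>t. 0 < t \<and> t < T1 \<and> ereal t < T \<longrightarrow> small_diff t 0"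
proof -
 define b where "b = real CARD('n) * s"
 have b: "0 < b" "b <= 1" using s ns by (auto simp: b_def)
 define C where "C = CU TYPE('n) s * (2 * (1 / b + 1 / (1 - xp TYPE('n) s)))"
 have c0: "0 <= CU TYPE('n) s" using s by (intro CU_nonneg) auto
 have C: "0 <= C" unfolding C_def using c0 b exponent_bounds by (intro mult_nonneg_nonneg add_nonneg_nonneg divide_nonneg_nonneg) auto
 \<comment> \<open>Makes C e at most 1/2, where C is the constant left by the beta integral.\<close>
 define e where "e = 1 / (2 * (C + 1))"
 have e: "0 < e" "C * e <= 1 / 2" using C by (auto simp: e_def field_simps)
 obtain T1 T2 where T12: "0 < T1" "0 < T2"
  and 1: "\<forall>t i. 0 < t \<and> t < T1 \<and> ereal t < T \<longrightarrow> lorint s 1 (nf (U i t)) <= ennreal (e * x t)"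
  and 2: "\<forall>t i. 0 < t \<and> t < T2 \<and> ereal t < T \<longrightarrow> lorint s 1 (nf (V i t)) <= ennreal (e * x t)" using Us[OF e(1)] Vs[OF e(1)] unfolding x_def by auto
 let ?T = "min T1 T2"
 have lor: "lor_le t (e * x t)" if t: "0 < t" "t < ?T" "ereal t < T" for t unfolding lor_le_def
 proof
  fix a
  have m: "(nf (U a t)) \<in> BM" "(nf (V a t)) \<in> BM" using U[OF t(1,3), of a] V[OF t(1,3), of a] by (auto intro: measurable_compose[OF _ measurable_ennreal])
  show "lor1 s (nf (U a t)) <= ennreal (e * x t) \<and> lor1 s (nf (V a t)) <= ennreal (e * x t)" using 1 2 t s e x_nonneg[of t] m by (intro conjI lorint_weak(1)) auto
 qed
 have "small_diff t 0" if t: "0 < t" "t < ?T" "ereal t < T" for t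
 proof (rule small_diff_zero_step[where K="%q. e * x q" and Y=x and m="2 * M / s" and ?t0.0=0 and ?t1.0="?T", OF _ _ _ _ x_nonneg _ _ _ t])
  show "0 <= e * x q \<and> lor_le q (e * x q)" if "0 < q" "q < ?T" "ereal q < T" for q using lor[OF that] e x_nonneg by simp
  show "small_diff q (2 * M / s * x q)" if "0 < q" "ereal q < T" for q using bounds(4)[OF that] by (simp add: mult.assoc)
  show "nns {0<..<t} (%q. ennreal (CUk TYPE('n) s (t - q) * (e * x q) * (x q * indicator {0..} q))) <= ennreal (x t / 2)" if t: "0 < t" for t
  proof -
   have xx: "x q * x q = q powr (b - 1)" for q unfolding x_def powr_add[symmetric] b_def by (rule arg_cong[where f="(powr) q"]) (simp add: field_simps)
   have eq: "CUk TYPE('n) s (t - q) * (e * x q) * x q = (CU TYPE('n) s * e) * ((t - q) powr (- xp TYPE('n) s) * q powr (b - 1))" for q unfolding xx[symmetric] by (simp only: mult_ac mult_1_right mult_1_left)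
   have "nns {0<..<t} (%q. ennreal (CUk TYPE('n) s (t - q) * (e * x q) * (x q * indicator {0..} q))) =
    (NN q. ennreal (CU TYPE('n) s * e) * (ennreal ((t - q) powr (- xp TYPE('n) s) * q powr (b - 1)) * indicator {0<..<t} q))"
   proof (rule nn_integral_cong)
    fix q
    show "ennreal (CUk TYPE('n) s (t - q) * (e * x q) * (x q * indicator {0..} q)) * indicator {0<..<t} q =
    ennreal (CU TYPE('n) s * e) * (ennreal ((t - q) powr (- xp TYPE('n) s) * q powr (b - 1)) * indicator {0<..<t} q)"
    proof (cases "0 < q \<and> q < t")
    case True
    hence "indicator {0..} q = (1::real)" "indicator {0<..<t} q = (1::ennreal)" by auto
    thus ?thesis using c0 e by (simp only: mult_1_right eq) (rule ennreal_mult, simp_all)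
    qed simp
   qed
   also have "... = ennreal (CU TYPE('n) s * e) * nns {0<..<t} (%q. ennreal ((t - q) powr (- xp TYPE('n) s) * q powr (b - 1)))" by (rule nn_integral_cmult) measurable
   also have "... <= ennreal (CU TYPE('n) s * e) * ennreal (2 * (1 / b + 1 / (1 - xp TYPE('n) s)) * t powr (b - xp TYPE('n) s))" by (intro mult_left_mono beta_integral_le exponent_bounds b t) simp
   also have "... = ennreal (C * e * t powr (b - xp TYPE('n) s))" using c0 e by (subst ennreal_mult'[symmetric]) (auto simp: C_def mult_ac)
   also have "b - xp TYPE('n) s = - (1 - b) / 2" by (simp add: b_def field_simps)
   also have "t powr (- (1 - b) / 2) = x t" by (simp add: x_def b_def)
   also have "ennreal (C * e * x t) <= ennreal (1 / 2 * x t)" by (intro ennreal_leI mult_right_mono e x_nonneg)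
   finally show ?thesis by simp
  qed
 qed (use M s in auto)
 thus ?thesis using T12 by (intro exI[of _ ?T]) auto
qed

lemma nn_integral_reflected_powr:
 assumes "t0 < t"
 shows "(NN q. ennreal ((t - q) powr (- xp TYPE('n) s)) * indicator {0<..t - t0} (t - q)) = ennreal ((t - t0) powr (1 - xp TYPE('n) s) / (1 - xp TYPE('n) s))"
proof -
 have "(NN q. ennreal ((t - q) powr (- xp TYPE('n) s)) * indicator {0<..t - t0} (t - q)) = (NN y. ennreal (y powr (- xp TYPE('n) s)) * indicator {0<..t - t0} y)" by (rule nn_integral_lborel_shift(2)[where f="%y. ennreal (y powr (- xp TYPE('n) s)) * indicator {0<..t - t0} y"]) measurable
 also have "... = ennreal ((t - t0) powr (- xp TYPE('n) s + 1) / (- xp TYPE('n) s + 1))" using assms exponent_bounds by (intro nn_integral_powr_0) auto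
 finally show ?thesis by (simp add: add.commute)
qed

text \<open>After T1 the solutions are bounded uniformly by their bound at T1, so one step length h
  works at all later times and every t is reached after finitely many steps.\<close>

lemma small_diff_zero:
 assumes t: "0 < t" "ereal t < T"
 shows "small_diff t 0"
proof -
 obtain T1 where T1: "0 < T1" "\<And>t. 0 < t ==> t < T1 ==> ereal t < T ==> small_diff t 0" using small_diff_zero_start by auto
 have c0: "0 <= CU TYPE('n) s" using s by (intro CU_nonneg) auto
 define C where "C = CU TYPE('n) s * (M * x T1)"
 have C: "0 <= C" using c0 M x_nonneg by (simp add: C_def)
 \<comment> \<open>Chosen such that C times the integral of the kernel over a step of length h is at
   most 1/2.\<close>
 define h where "h = ((1 - xp TYPE('n) s) / (2 * (C + 1))) powr (1 / (1 - xp TYPE('n) s))"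
 have h0: "0 < h" using C exponent_bounds by (simp add: h_def)
 have "h powr (1 - xp TYPE('n) s) = (1 - xp TYPE('n) s) / (2 * (C + 1))" using C exponent_bounds by (simp add: h_def powr_powr)
 hence "h powr (1 - xp TYPE('n) s) / (1 - xp TYPE('n) s) = 1 / (2 * (C + 1))" using exponent_bounds by simp
 hence hC: "C * (h powr (1 - xp TYPE('n) s) / (1 - xp TYPE('n) s)) <= 1 / 2" using C by (simp only:) (simp add: field_simps)
 have xle: "x q <= x T1" if "T1 <= q" for q unfolding x_def using that T1(1) ns by (intro powr_mono2') auto
 have "small_diff t 0" if "0 < t" "t < T1 + real k * h" "ereal t < T" for k t using that
 proof (induction k arbitrary: t)
  case 0
  thus ?case using T1 by simp
 next
  case (Suc k)
  let ?t0 = "T1 + real k * h"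
  have t0: "T1 <= ?t0" using h0 by simp
  show ?case
  proof (rule small_diff_zero_step[where K="%q. M * x q" and Y="%_. 1" and m="2 * (M * x T1 / s)" and ?t0.0="?t0" and ?t1.0="?t0 + h", OF _ _ Suc.IH])
   show "0 <= M * x q \<and> lor_le q (M * x q)" if "0 < q" "ereal q < T" for q using bounds(1)[OF that] M x_nonneg by simp
   show "small_diff q (2 * (M * x T1 / s) * 1)" if q: "0 < q" "?t0 <= q" "ereal q < T" for q
   proof -
    have "2 * (M * x q / s) <= 2 * (M * x T1 / s) * 1" using xle[of q] t0 q M s by (auto intro!: divide_right_mono mult_left_mono)
    thus ?thesis using bounds(4)[OF q(1,3)] unfolding small_diff_def by (blast intro: wbd_mono[OF _ order_refl])
   qed
   show "nns {0<..<t} (%q. ennreal (CUk TYPE('n) s (t - q) * (M * x q) * (1 * indicator {?t0..} q))) <= ennreal (1 / 2)"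
    if t: "0 < t" "?t0 <= t" "t < ?t0 + h" for t
   proof (cases "t = ?t0")
    case True
    have "nns {0<..<t} (%q. ennreal (CUk TYPE('n) s (t - q) * (M * x q) * (1 * indicator {?t0..} q))) = (\<integral>\<^sup>+q. 0 \<partial>(lborel :: real measure))" using True by (intro nn_integral_cong) (auto simp: indicator_def)
    thus ?thesis by simp
   next
    case False
    hence t': "?t0 < t" using t by simp
    have "nns {0<..<t} (%q. ennreal (CUk TYPE('n) s (t - q) * (M * x q) * (1 * indicator {?t0..} q))) <=
    (NN q. ennreal C * (ennreal ((t - q) powr (- xp TYPE('n) s)) * indicator {0<..t - ?t0} (t - q)))"
    proof (rule nn_integral_mono)
    fix q
    show "ennreal (CUk TYPE('n) s (t - q) * (M * x q) * (1 * indicator {?t0..} q)) * indicator {0<..<t} q <=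
    ennreal C * (ennreal ((t - q) powr (- xp TYPE('n) s)) * indicator {0<..t - ?t0} (t - q))"
    proof (cases "?t0 <= q \<and> q < t \<and> 0 < q")
    case True
    have "CUk TYPE('n) s (t - q) * (M * x q) <= CUk TYPE('n) s (t - q) * (M * x T1)" by (rule mult_left_mono[OF mult_left_mono[OF xle]]) (use True t0 M c0 in auto)
    also have "CUk TYPE('n) s (t - q) * (M * x T1) = C * (t - q) powr (- xp TYPE('n) s)" unfolding C_def by (simp only: mult_ac)
    finally have "CUk TYPE('n) s (t - q) * (M * x q) <= C * (t - q) powr (- xp TYPE('n) s)" .
    thus ?thesis using True C by (simp add: ennreal_mult[symmetric] ennreal_leI)
    qed (auto simp: indicator_def)
    qed
    also have "... = ennreal C * ennreal ((t - ?t0) powr (1 - xp TYPE('n) s) / (1 - xp TYPE('n) s))" unfolding nn_integral_reflected_powr[OF t', symmetric] by (rule nn_integral_cmult) measurable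
    also have "... = ennreal (C * ((t - ?t0) powr (1 - xp TYPE('n) s) / (1 - xp TYPE('n) s)))" using C exponent_bounds by (simp add: ennreal_mult[symmetric])
    also have "... <= ennreal (C * (h powr (1 - xp TYPE('n) s) / (1 - xp TYPE('n) s)))" using t t' exponent_bounds C by (intro ennreal_leI mult_left_mono divide_right_mono powr_mono2) auto
    also have "... <= ennreal (1 / 2)" by (rule ennreal_leI[OF hC])
    finally show ?thesis .
   qed
  qed (use Suc.prems M s x_nonneg in \<open>auto simp: algebra_simps\<close>)
 qed
 moreover obtain k where "t < T1 + real k * h"
 proof -
  obtain k where "t / h < real k" using reals_Archimedean2 by blast
  hence "t < real k * h" using h0 by (simp add: field_simps)
  thus ?thesis using T1(1) by (intro that[of k]) simp
 qed
 ultimately show ?thesis using t by blast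
qed

lemma solutions_agree_inside:
 assumes t: "0 < t" "ereal t < T"
 shows "u t = v t"
proof
 fix i
 have [measurable]: "U i t \<in> BM" "V i t \<in> BM" using U[OF t] V[OF t] by auto
 have m: "(%z. enorm (U i t z - V i t z)) \<in> BM" by measurable
 have "AE z in lborel. U i t z = V i t z"
 proof -
  have w: "wbd s 0 (%z. enorm (U i t z - V i t z))" using small_diff_zero[OF t] by (simp add: small_diff_def)
  have "(NN z. enorm (U i t z - V i t z)) = 0" unfolding nn_integral_SUP_cball[OF m] using wbdD[OF w] by (auto simp: emeasure_cball intro!: SUP_eq_const)
  hence "AE z in lborel. enorm (U i t z - V i t z) = 0" using m by (subst (asm) nn_integral_0_iff_AE) auto
  thus ?thesis by eventually_elim simp
 qed
 hence "AE z in lebesgue. U i t z = V i t z" by (simp add: AE_lebesgue_iff)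
 moreover have "AE z in lebesgue. ft (u t i) z = U i t z" "AE z in lebesgue. ft (v t i) z = V i t z" using U[OF t] V[OF t] by auto
 ultimately have "AE z in lebesgue. ft (u t i) z = ft (v t i) z" by eventually_elim simp
 hence "Finv (ft (u t i)) = Finv (ft (v t i))" using Finv_ft(2)[of "u t i"] U[OF t] by (intro Finv_cong_AE good_measurable) auto
 thus "u t i = v t i" using Finv_ft(1)[of "u t i"] Finv_ft(1)[of "v t i"] U[OF t] V[OF t] by auto
qed

text \<open>The space K controls only times strictly between 0 and T. At the two ends agreement is
  read off from the mild equation, whose integrands coincide at almost all earlier times.\<close>

theorem solutions_agree:
 assumes t: "0 <= t" "ereal t <= T"
 shows "u t = v t"
proof (intro ext)
 fix i f
 show "u t i f = v t i f"
 proof (cases "f \<in> schwartz")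
  case True
  let ?h = "%w q. heat (t - q) (leray (tensor_div (tensor_prod (w q) (w q))) i) f"
  have "AE q in lborel. q \<noteq> 0 \<and> q \<noteq> t" using AE_lborel_singleton[of "0::real"] AE_lborel_singleton[of t] by eventually_elim simp
  hence "AE q in lebesgue. indicator {0..t} q *\<^sub>R ?h u q = indicator {0..t} q *\<^sub>R ?h v q" unfolding AE_lebesgue_iff
  proof eventually_elim
   case (elim q)
   show ?case
   proof (cases "0 < q \<and> q < t")
    case True
    hence "ereal q < T" using t by (auto intro: less_le_trans[of "ereal q" "ereal t"])
    thus ?thesis using solutions_agree_inside[of q] True by simp
   qed (use elim in \<open>auto simp: indicator_def\<close>)
  qed
  moreover have "set_integrable lebesgue {0..t} (?h u)" "set_integrable lebesgue {0..t} (?h v)" using mild t True unfolding mild_solution_def by auto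
  ultimately have "(LINT q:{0..t}|lebesgue. ?h u q) = (LINT q:{0..t}|lebesgue. ?h v q)" unfolding set_lebesgue_integral_def set_integrable_def by (intro integral_cong_AE borel_measurable_integrable) auto
  thus ?thesis using mild t True unfolding mild_solution_def by auto
 next
  case False
  thus ?thesis using mild t unfolding mild_solution_def tempered_def by metis
 qed
qed

end

lemma K_space_bounds:
 fixes u :: "real => 'n::finite => 'n dist"
 assumes u: "u \<in> K_space q T" and q: "1 < q"
 obtains U M where "0 <= M" "K_rep (1 / q) T u U M"
proof -
 let ?n = "real CARD('n)"
 define z where "z = (1 - ?n / q) / 2"
 have zz: "- (1 - ?n * (1 / q)) / 2 = - z" unfolding z_def minus_divide_left[symmetric] by simp
 let ?N = "%t. ennreal (t powr z) * vec_norm (FL_norm (ennreal q) 1) (u t)"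
 have fl: "u t i \<in> FL_space (ennreal q) 1" if "0 < t" "ereal t < T" for t i using u that by (auto simp: K_space_def)
 have "\<forall>i t. \<exists>g. 0 < t \<and> ereal t < T \<longrightarrow> g \<in> BM \<and> (AE x in lebesgue. ft (u t i) x = g x)"
 proof (intro allI)
  fix i t
  show "\<exists>g. 0 < t \<and> ereal t < T \<longrightarrow> g \<in> BM \<and> (AE x in lebesgue. ft (u t i) x = g x)" using fl[of t i] lebesgue_ex_borel[of "ft (u t i)"] unfolding FL_space_def lorentz_space_def AE_lebesgue_iff by blast
 qed
 then obtain U where U: "\<And>i t. 0 < t ==> ereal t < T ==> U i t \<in> BM \<and> (AE x in lebesgue. ft (u t i) x = U i t x)" by metis
 have key: "lorint (1 / q) 1 (nf (U i t)) <= ennreal (A * t powr (- z))"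
  if t: "0 < t" "ereal t < T" and N: "?N t <= ennreal A" and A: "0 <= A" for t i A
 proof -
  note Ui = U[OF t, of i]
  have fm: "ft (u t i) \<in> LM" using fl[OF t] by (simp add: FL_space_def lorentz_space_def)
  have "lorentz_norm (conj_exp (ennreal q)) (ennreal 1) (ft (u t i)) = epow (lorint (1 / q) 1 (nf (U i t))) (1 / 1)" using Ui by (intro lorentz_norm_lorint[OF fm _ _ q]) (auto elim: AE_mp)
  hence "lorint (1 / q) 1 (nf (U i t)) = FL_norm (ennreal q) 1 (u t i)" by (simp add: epow_1 FL_norm_def)
  also have "... = ennreal (t powr (- z)) * (ennreal (t powr z) * FL_norm (ennreal q) 1 (u t i))" using t by (simp add: mult.assoc[symmetric] ennreal_mult[symmetric] powr_add[symmetric])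
  also have "... <= ennreal (t powr (- z)) * ennreal A" using component_le_vec_norm[of "FL_norm (ennreal q) 1" "u t" i] by (intro mult_left_mono order_trans[OF mult_left_mono N]) auto
  finally show ?thesis using A by (simp add: ennreal_mult mult.commute)
 qed
 have "(SUP t\<in>{t. 0 < t \<and> ereal t < T}. ?N t) < \<infinity>" using u unfolding K_space_def z_def by blast
 then obtain M where M: "(SUP t\<in>{t. 0 < t \<and> ereal t < T}. ?N t) = ennreal M" "0 <= M" by (cases "SUP t\<in>{t. 0 < t \<and> ereal t < T}. ?N t") auto
 have "\<exists>T0>0. \<forall>t i. 0 < t \<and> t < T0 \<and> ereal t < T \<longrightarrow> lorint (1 / q) 1 (nf (U i t)) <= ennreal (e * t powr (- z))" if e: "0 < e" for e
 proof -
  have "(?N \<longlongrightarrow> 0) (at_right 0)" using u unfolding K_space_def z_def by blast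
  hence "\<forall>\<^sub>F t in at_right 0. ?N t < ennreal e" by (rule order_tendstoD) (use e in simp)
  then obtain T0 where "0 < T0" "\<And>t. 0 < t ==> t < T0 ==> ?N t < ennreal e" by (auto simp: eventually_at_right[of 0 1])
  thus ?thesis using e key by (intro exI[of _ T0]) (simp add: less_imp_le)
 qed
 moreover have "lorint (1 / q) 1 (nf (U i t)) <= ennreal (M * t powr (- z))" if "0 < t" "ereal t < T" for t i using that by (intro key M(2)) (auto simp: M(1)[symmetric] intro: SUP_upper)
 moreover have "has_fourier_fun (u t i)" if "0 < t" "ereal t < T" for t i using fl[OF that] by (simp add: FL_space_def)
 ultimately have "K_rep (1 / q) T u U M" unfolding K_rep_def zz using U by simp
 thus ?thesis by (rule that[OF M(2)])
qed

theorem solution_unique: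
 fixes u v :: "real => 'n::finite => 'n dist"
 assumes n: "2 <= CARD('n)" and p: "real CARD('n) <= p"
  and u: "solution_in_class p r T u0 u" and v: "solution_in_class p r T u0 v" and t: "0 <= t" "ereal t <= T"
 shows "u t = v t"
proof -
 \<comment> \<open>Solutions lie in K for every q above p, and each such q satisfies 1/q \<le> 1/2
   and n/q < 1 as the locale requires; 2 p is a convenient one.\<close>
 define q where "q = 2 * p"
 have n2: "2 <= real CARD('n)" using n by simp
 hence q: "p < q" "1 < q" "4 <= q" using p by (auto simp: q_def)
 have ns: "real CARD('n) * (1 / q) < 1" using p n2 by (simp add: q_def field_simps)
 have K: "u \<in> K_space q T" "v \<in> K_space q T" using u v q by (auto simp: solution_in_class_def)
 obtain U M1 where U: "0 <= M1" "K_rep (1 / q) T u U M1" by (rule K_space_bounds[OF K(1) q(2)])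
 obtain V M2 where V: "0 <= M2" "K_rep (1 / q) T v V M2" by (rule K_space_bounds[OF K(2) q(2)])
 interpret two_solutions "1 / q" "max M1 M2" T u0 u v U V
 proof
  show "mild_solution T u0 u" "mild_solution T u0 v" using u v by (auto simp: solution_in_class_def)
  show "K_rep (1 / q) T u U (max M1 M2)" "K_rep (1 / q) T v V (max M1 M2)" by (rule K_rep_mono[OF U(2)] K_rep_mono[OF V(2)]; simp)+
  show "0 < 1 / q" "1 / q <= 1 / 2" using q by (auto simp: field_simps)
 qed (use U ns in auto)
 show ?thesis by (rule solutions_agree[OF t])
qed

section \<open>Besov data and the main theorem\<close>

text \<open>The partition of unity is split at an index m into high and low frequencies. Absolute
  values appear because \<psi> may change sign.\<close>

lemma has_sum_int_le:
 fixes f :: "int => real"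
 assumes "(f has_sum 1) UNIV"
 shows "1 <= (\<Sum>k. ennreal \<bar>f (m + int k)\<bar>) + (\<Sum>k. ennreal \<bar>f (m - 1 - int k)\<bar>)"
proof -
 let ?S = "(\<Sum>k. ennreal \<bar>f (m + int k)\<bar>) + (\<Sum>k. ennreal \<bar>f (m - 1 - int k)\<bar>)"
 have le: "ennreal \<bar>sum f F\<bar> <= ?S" if F: "finite F" for F
 proof -
  let ?P = "{x\<in>F. m <= x}" and ?N = "{x\<in>F. x < m}"
  have nat_le: "(\<Sum>k\<in>A. h k) <= (\<Sum>k. h k :: ennreal)" if "finite A" for A and h :: "nat => ennreal" using that by (intro sum_le_suminf) auto
  have reindexed: "(\<Sum>x\<in>A. h (e x)) <= (\<Sum>k. h k)" if "inj_on e A" "finite A" for A :: "int set" and e :: "int => nat" and h :: "nat => ennreal" using nat_le[of "e ` A" h] that by (simp add: sum.reindex)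
  have "(\<Sum>x\<in>?P. ennreal \<bar>f x\<bar>) = (\<Sum>x\<in>?P. ennreal \<bar>f (m + int (nat (x - m)))\<bar>)" by (rule sum.cong) simp_all
  also have "... <= (\<Sum>k. ennreal \<bar>f (m + int k)\<bar>)" by (rule reindexed[where h="%k. ennreal \<bar>f (m + int k)\<bar>"]) (use F in \<open>auto intro!: inj_onI\<close>)
  finally have p: "(\<Sum>x\<in>?P. ennreal \<bar>f x\<bar>) <= (\<Sum>k. ennreal \<bar>f (m + int k)\<bar>)" .
  have "(\<Sum>x\<in>?N. ennreal \<bar>f x\<bar>) = (\<Sum>x\<in>?N. ennreal \<bar>f (m - 1 - int (nat (m - 1 - x)))\<bar>)" by (rule sum.cong) simp_all
  also have "... <= (\<Sum>k. ennreal \<bar>f (m - 1 - int k)\<bar>)" by (rule reindexed[where h="%k. ennreal \<bar>f (m - 1 - int k)\<bar>"]) (use F in \<open>auto intro!: inj_onI\<close>)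
  finally have n: "(\<Sum>x\<in>?N. ennreal \<bar>f x\<bar>) <= (\<Sum>k. ennreal \<bar>f (m - 1 - int k)\<bar>)" .
  have "ennreal \<bar>sum f F\<bar> <= ennreal (\<Sum>x\<in>F. \<bar>f x\<bar>)" by (intro ennreal_leI sum_abs)
  also have "... = (\<Sum>x\<in>F. ennreal \<bar>f x\<bar>)" by simp
  also have "... = (\<Sum>x\<in>?P \<union> ?N. ennreal \<bar>f x\<bar>)" by (rule sum.cong) auto
  also have "... = (\<Sum>x\<in>?P. ennreal \<bar>f x\<bar>) + (\<Sum>x\<in>?N. ennreal \<bar>f x\<bar>)" using F by (intro sum.union_disjoint) auto
  also have "... <= ?S" by (intro add_mono p n)
  finally show ?thesis .
 qed
 have "((%F. ennreal \<bar>sum f F\<bar>) \<longlongrightarrow> ennreal \<bar>1\<bar>) (finite_subsets_at_top UNIV)" using assms unfolding has_sum_def by (intro tendsto_ennrealI tendsto_rabs)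
 hence "ennreal \<bar>1\<bar> <= ?S" by (rule tendsto_upperbound) (auto intro!: eventually_finite_subsets_at_top_weakI le)
 thus ?thesis by simp
qed

lemma wbd_suminf:
 assumes w: "\<And>k. wbd s (A k) (F k)" "\<And>k. 0 <= A k" "summable A" and [measurable]: "\<And>k. F k \<in> BM"
 shows "wbd s (suminf A) (%x. \<Sum>k. F k x)" unfolding wbd_def
proof (intro ballI impI)
 fix E :: "'a set" assume E[measurable]: "E \<in> sets borel" and fin: "emeasure lborel E < \<infinity>"
 let ?e = "measure lborel E powr s"
 have "nns E (%x. (\<Sum>k. F k x)) = (NN x. (\<Sum>k. F k x * indicator E x))" by simp
 also have "... = (\<Sum>k. (nns E (%x. F k x)))" by (rule nn_integral_suminf) measurable
 also have "... <= (\<Sum>k. ennreal (A k * ?e))" by (intro suminf_le wbdD[OF w(1) E fin]) auto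
 also have "... = ennreal (\<Sum>k. A k * ?e)" using w by (intro suminf_ennreal2 summable_mult2) auto
 also have "(\<Sum>k. A k * ?e) = suminf A * ?e" by (rule suminf_mult2[OF w(3), symmetric])
 finally show "nns E (%x. (\<Sum>k. F k x)) <= ennreal (suminf A * ?e)" .
qed

lemma littlewood_paley_borel:
 assumes "littlewood_paley \<psi>"
 shows "\<psi> \<in> BM" "\<exists>B. \<forall>z. \<bar>\<psi> z\<bar> <= B" "\<exists>a>0. \<forall>z. \<psi> z \<noteq> 0 \<longrightarrow> a <= norm z"
proof -
 obtain a b where ab: "0 < a" "\<And>z. \<psi> z \<noteq> 0 ==> a <= norm z \<and> norm z <= b" using assms unfolding littlewood_paley_def by blast
 thus "\<exists>a>0. \<forall>z. \<psi> z \<noteq> 0 \<longrightarrow> a <= norm z" by blast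
 have "\<psi> differentiable (at x)" for x using assms unfolding littlewood_paley_def smooth_fun_def by (metis foldr_Nil id_apply iter_pderiv_def)
 hence c: "continuous_on UNIV \<psi>" by (simp add: continuous_at_imp_continuous_on differentiable_imp_continuous_within)
 thus "\<psi> \<in> BM" by (rule borel_measurable_continuous_onI)
 have "compact (\<psi> ` cball 0 b)" by (intro compact_continuous_image continuous_on_subset[OF c]) auto
 hence "bounded (\<psi> ` cball 0 b)" by (rule compact_imp_bounded)
 then obtain B where "\<forall>y\<in>\<psi> ` cball 0 b. norm y <= B" unfolding bounded_iff by blast
 hence B: "norm z <= b ==> \<bar>\<psi> z\<bar> <= B" for z by auto
 have "\<bar>\<psi> z\<bar> <= max B 0" for z using B[of z] ab(2)[of z] by (cases "\<psi> z = 0") auto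
 thus "\<exists>B. \<forall>z. \<bar>\<psi> z\<bar> <= B" by blast
qed

definition represents :: "('n => 'n::finite cfun) => ('n => 'n dist) => bool" where
 "represents g u0 \<longleftrightarrow> (\<forall>i. has_fourier_fun (u0 i) \<and> (AE x in lebesgue. ft (u0 i) x = g i x) \<and> g i \<in> BM)"

lemma representsD:
 assumes "represents g u0"
 shows "has_fourier_fun (u0 i)" "AE x in lebesgue. ft (u0 i) x = g i x" "g i \<in> BM" using assms by (auto simp: represents_def)

text \<open>The blocks are summed at fixed t. Those with frequencies above t^(-1/2) are damped by
  the heat multiplier faster than their norms, of order 2^(j \<alpha>), grow; those below form a
  geometric series because \<alpha> is positive.\<close>

lemma Pb_if_besov:
 fixes \<psi> :: "real^'n::finite => real"
 assumes \<psi>: "littlewood_paley \<psi>" and pt: "real CARD('n) < pt"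
 obtains C where "0 < C" "\<And>g (u0 :: 'n => 'n dist) d. represents g u0 ==> 0 <= d ==>
  vec_norm (besov_norm \<psi> (real CARD('n) / pt - 1) (ennreal pt) \<infinity>) u0 <= ennreal d ==> Pb \<infinity> (1 / pt) (C * d) (lin g)"
proof -
 let ?n = "real CARD('n)"
 define \<alpha> where "\<alpha> = 1 - ?n / pt"
 have n1: "1 <= ?n" by simp
 have pt1: "1 < pt" using pt n1 by linarith
 have \<alpha>: "0 < \<alpha>" "\<alpha> <= 1" using pt pt1 by (auto simp: \<alpha>_def)
 note \<psi>m[measurable] = littlewood_paley_borel(1)[OF \<psi>]
 obtain B where B: "\<And>w. \<bar>\<psi> w\<bar> <= B" using littlewood_paley_borel(2)[OF \<psi>] by blast
 obtain a where a: "0 < a" "\<And>w. \<psi> w \<noteq> 0 ==> a <= norm w" using littlewood_paley_borel(3)[OF \<psi>] by blast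
 define z where "z = 2 powr (- \<alpha>)"
 have z: "0 < z" "z < 1" using \<alpha> by (auto simp: z_def powr_less_one)
 define C1 where "C1 = pt * a powr (- \<alpha>)"
 have C1: "0 < C1" using pt1 a by (simp add: C1_def)
 \<comment> \<open>4 is the sum over the high blocks, 1/(1 - z) the one over the low blocks, and n
   counts the components.\<close>
 define C where "C = ?n * (C1 * (4 + 1 / (1 - z)))"
 have C: "0 < C" using C1 z n1 unfolding C_def by (intro mult_pos_pos add_pos_pos) auto
 let ?\<psi> = "%j::int. %w. \<psi> ((2 powi (- j)) *\<^sub>R w)"
 have \<psi>jm: "(%w. ?\<psi> j w) \<in> BM" for j by measurable
 have "Pb \<infinity> (1 / pt) (C * d) (lin g)"
  if rep: "represents g u0" and d: "0 <= d"
   and b: "vec_norm (besov_norm \<psi> (?n / pt - 1) (ennreal pt) \<infinity>) u0 <= ennreal d" for g and u0 :: "'n => 'n dist" and d unfolding Pb_def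
 proof (intro allI impI)
  note u = representsD(1,2)[OF rep] and g = representsD(3)[OF rep]
  note [measurable] = g
  have block: "wbd (1 / pt) (d * 2 powr (real_of_int j * \<alpha>) * pt) (%w. ennreal (\<bar>?\<psi> j w\<bar> * norm (g i w)))" for i j
  proof (rule wbd_if_lorentz_weak)
   let ?m = "%w. cplx (?\<psi> j w)"
   have mm: "?m \<in> LM" using \<psi>jm[of j] by (intro lebesgue_borel) measurable
   have gg: "good (g i)" by (rule good_cong_AE[OF Finv_ft(2)[OF u(1)] u(2)])
   have gm: "good (%w. ?m w * g i w)" by (rule good_mult_bounded[OF gg mm, of B]) (simp add: B)
   have e: "lp_block \<psi> j (u0 i) = Finv (%w. ?m w * g i w)" unfolding lp_block_def by (rule multiplier_AE[OF u(2) good_measurable[OF gg] mm])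
   show "ft (lp_block \<psi> j (u0 i)) \<in> LM" unfolding e by (rule good_measurable[OF good_ft_Finv[OF gm]])
   show "AE x in lebesgue. enorm (ft (lp_block \<psi> j (u0 i)) x) = ennreal (\<bar>?\<psi> j x\<bar> * norm (g i x))" unfolding e using ft_Finv[OF gm] by eventually_elim (simp add: norm_mult)
   show "(%w. ennreal (\<bar>?\<psi> j w\<bar> * norm (g i w))) \<in> BM" using \<psi>jm[of j] by measurable
   let ?p = "2 powr (real_of_int j * \<alpha>)" and ?q = "2 powr (real_of_int j * (?n / pt - 1))"
   have pq: "?p * ?q = 1" unfolding powr_add[symmetric] by (simp add: \<alpha>_def algebra_simps)
   have "FL_norm (ennreal pt) \<infinity> (lp_block \<psi> j (u0 i)) = ennreal (?p * ?q) * FL_norm (ennreal pt) \<infinity> (lp_block \<psi> j (u0 i))" by (simp add: pq)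
   also have "... = ennreal ?p * (ennreal ?q * FL_norm (ennreal pt) \<infinity> (lp_block \<psi> j (u0 i)))" by (simp only: ennreal_mult powr_ge_zero mult.assoc)
   also have "... <= ennreal ?p * ennreal d"
   proof (rule mult_left_mono)
    have "ennreal ?q * FL_norm (ennreal pt) \<infinity> (lp_block \<psi> j (u0 i)) <= besov_norm \<psi> (?n / pt - 1) (ennreal pt) \<infinity> (u0 i)" unfolding besov_norm_def by (rule SUP_upper2[of j]) auto
    also have "... <= ennreal d" by (rule order_trans[OF component_le_vec_norm b])
    finally show "ennreal ?q * FL_norm (ennreal pt) \<infinity> (lp_block \<psi> j (u0 i)) <= ennreal d" .
   qed simp
   finally show "lorentz_norm (conj_exp (ennreal pt)) \<infinity> (ft (lp_block \<psi> j (u0 i))) <= ennreal (d * ?p)" using d by (simp add: FL_norm_def ennreal_mult mult.commute)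
  qed (use pt1 d in auto)
  fix t :: real assume t: "0 < t \<and> ereal t <= \<infinity>"
  \<comment> \<open>As \<psi> vanishes at distances below a from 0, the block j lives at frequencies
    of at least a 2^j; this equals t^(-1/2) for 2^j = y, and m is the first index with 2^m \<ge>
    y.\<close>
  define y where "y = 1 / (a * sqrt t)"
  have y: "0 < y" using a t by (simp add: y_def)
  define m where "m = \<lceil>log 2 y\<rceil>"
  have "log 2 y <= real_of_int m" "real_of_int m - 1 < log 2 y" unfolding m_def by linarith+
  hence m: "y <= 2 powr real_of_int m" "2 powr (real_of_int m - 1) <= y" using y by (auto simp: log_le_iff less_log_iff intro: less_imp_le)
  define e where "e = t powr (- (1 - ?n * (1 / pt)) / 2)"
  have ye: "a powr (- \<alpha>) * e = y powr \<alpha>"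
  proof -
   have "y powr \<alpha> = (a * sqrt t) powr (- \<alpha>)" using a t by (simp add: y_def powr_divide powr_minus field_simps)
   also have "... = a powr (- \<alpha>) * (t powr (1 / 2)) powr (- \<alpha>)" using a t by (simp add: powr_mult powr_half_sqrt)
   also have "(t powr (1 / 2)) powr (- \<alpha>) = e" unfolding e_def powr_powr by (rule arg_cong[where f="(powr) t"]) (simp add: \<alpha>_def field_simps)
   finally show ?thesis by simp
  qed
  define D where "D = C1 * d * e"
  have D: "D = d * y powr \<alpha> * pt" "0 <= D" using C1 d unfolding D_def by (auto simp: C1_def ye[symmetric] e_def)
  let ?x = "%w::real^'n. ennreal (exp (- t * (norm w)^2))"
  have comp: "wbd (1 / pt) (D * (4 + 1 / (1 - z))) (%w. ?x w * enorm (g i w))" for i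
  proof -
   let ?f = "%j w. ?x w * ennreal (\<bar>?\<psi> j w\<bar> * norm (g i w))"
   have fm: "?f j \<in> BM" for j using \<psi>jm[of j] by measurable
   have hi: "wbd (1 / pt) (2 * D * (1 / 2) ^ k) (?f (m + int k))" for k
   proof -
    let ?j = "m + int k" and ?c = "exp (- (4 ^ k :: real))"
    have xle: "?f ?j w <= ennreal ?c * ennreal (\<bar>?\<psi> ?j w\<bar> * norm (g i w))" for w
    proof (cases "?\<psi> ?j w = 0")
    case False
    hence "a <= 2 powi (- ?j) * norm w" using a(2)[OF False] by simp
    moreover have "2 powi (- ?j) = 1 / 2 powr real_of_int ?j" unfolding powr_minus_divide[symmetric] of_int_minus[symmetric] by (rule powr_real_of_int'[symmetric]) auto
    ultimately have "a * 2 powr real_of_int ?j <= norm w" by (simp only: pos_le_divide_eq mult_1 times_divide_eq_left powr_gt_zero zero_neq_numeral simp_thms)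
    moreover have "y * 2 ^ k <= 2 powr (real_of_int ?j)" using m(1) by (simp add: powr_add powr_realpow)
    ultimately have "a * (y * 2 ^ k) <= norm w" using a(1) by (meson less_imp_le mult_left_mono order_trans)
    hence "2 ^ k / sqrt t <= norm w" using a(1) by (simp add: y_def)
    hence "(2 ^ k / sqrt t)\<^sup>2 <= (norm w)\<^sup>2" using t by (intro power_mono) auto
    hence "t * (2 ^ k / sqrt t)\<^sup>2 <= t * (norm w)^2" using t by (intro mult_left_mono) auto
    moreover have "t * (2 ^ k / sqrt t)\<^sup>2 = 4 ^ k" using t by (simp add: power_divide power2_eq_square[of "2 ^ k"] power_mult_distrib[symmetric])
    ultimately have "4 ^ k <= t * (norm w)^2" by simp
    thus ?thesis by (intro mult_right_mono ennreal_leI) auto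
    qed simp
    have "wbd (1 / pt) (?c * (d * 2 powr (real_of_int ?j * \<alpha>) * pt)) (%w. ennreal ?c * ennreal (\<bar>?\<psi> ?j w\<bar> * norm (g i w)))" using \<psi>jm[of ?j] by (intro wbd_cmult block) measurable
    thus ?thesis
    proof (rule wbd_mono[OF _ xle])
    have "(2 powr real_of_int m) powr \<alpha> <= (2 * y) powr \<alpha>" using m(2) \<alpha> by (intro powr_mono2) (auto simp: powr_diff)
    also have "... = 2 powr \<alpha> * y powr \<alpha>" using y by (simp add: powr_mult)
    also have "... <= 2 * y powr \<alpha>" using powr_mono[of \<alpha> 1 2] \<alpha> by (intro mult_right_mono) auto
    finally have 1: "(2 powr real_of_int m) powr \<alpha> <= 2 * y powr \<alpha>" .
    have "2 powr (real k * \<alpha>) <= 2 powr (real k * 1)" using \<alpha> by (intro powr_mono mult_left_mono) auto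
    hence 2: "2 powr (real k * \<alpha>) <= 2 ^ k" by (simp add: powr_realpow)
    have "2 powr (real_of_int ?j * \<alpha>) = (2 powr real_of_int m) powr \<alpha> * 2 powr (real k * \<alpha>)" by (simp add: powr_powr powr_add[symmetric] algebra_simps)
    also have "... <= (2 * y powr \<alpha>) * 2 ^ k" by (intro mult_mono 1 2) auto
    finally have 3: "2 powr (real_of_int ?j * \<alpha>) <= (2 * y powr \<alpha>) * 2 ^ k" .
    \<comment> \<open>The double exponential decay is weakened to 4^(-k), which still beats the
      growth 2^k of the norms.\<close>
    have "4 ^ k < exp (4 ^ k :: real)" using exp_ge_add_one_self[of "4 ^ k"] by linarith
    hence 4: "?c <= 1 / 4 ^ k" by (simp add: exp_minus field_simps)
    have "?c * (d * 2 powr (real_of_int ?j * \<alpha>) * pt) <= 1 / 4 ^ k * (d * ((2 * y powr \<alpha>) * 2 ^ k) * pt)" using d pt1 by (intro mult_mono mult_left_mono mult_right_mono 3 4) auto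
    also have "... = 2 * D * (1 / 2) ^ k"
    proof -
    have "(4::real) ^ k = 2 ^ k * 2 ^ k" by (simp add: power_mult_distrib[symmetric])
    thus ?thesis by (simp add: D(1) power_divide field_simps)
    qed
    finally show "?c * (d * 2 powr (real_of_int ?j * \<alpha>) * pt) <= 2 * D * (1 / 2) ^ k" .
    qed
   qed
   have lo: "wbd (1 / pt) (D * z ^ k) (?f (m - 1 - int k))" for k
   proof (rule wbd_mono[OF block])
    let ?j = "m - 1 - int k"
    show "?f ?j w <= ennreal (\<bar>?\<psi> ?j w\<bar> * norm (g i w))" for w using t mult_right_mono[of "?x w" 1 "ennreal (\<bar>?\<psi> ?j w\<bar> * norm (g i w))"] by simp
    have "2 powr (real_of_int ?j * \<alpha>) = (2 powr (real_of_int m - 1)) powr \<alpha> * 2 powr (- \<alpha> * real k)" by (simp add: powr_powr powr_add[symmetric] algebra_simps)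
    also have "2 powr (- \<alpha> * real k) = z ^ k" unfolding z_def powr_powr[symmetric] by (rule powr_realpow) simp
    also have "(2 powr (real_of_int m - 1)) powr \<alpha> * z ^ k <= y powr \<alpha> * z ^ k" using m(2) \<alpha> z by (intro mult_right_mono powr_mono2) auto
    finally have "d * 2 powr (real_of_int ?j * \<alpha>) * pt <= d * (y powr \<alpha> * z ^ k) * pt" using d pt1 by (intro mult_right_mono mult_left_mono) auto
    thus "d * 2 powr (real_of_int ?j * \<alpha>) * pt <= D * z ^ k" by (simp add: D(1) mult_ac)
   qed
   have shi: "(%k. 2 * D * (1 / 2) ^ k) sums (2 * D * 2)" using geometric_sums[of "1 / 2 :: real"] by (intro sums_mult) simp
   have slo: "(%k. D * z ^ k) sums (D * (1 / (1 - z)))" using geometric_sums[of z] z by (intro sums_mult) simp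
   have sm: "(%w. \<Sum>k. ?f (h k) w) \<in> BM" for h :: "nat => int"
   proof -
    note fm[measurable]
    show ?thesis by measurable
   qed
   have "wbd (1 / pt) (2 * D * 2 + D * (1 / (1 - z))) (%w. (\<Sum>k. ?f (m + int k) w) + (\<Sum>k. ?f (m - 1 - int k) w))"
   proof (rule wbd_add)
    show "wbd (1 / pt) (2 * D * 2) (%w. \<Sum>k. ?f (m + int k) w)" unfolding sums_unique[OF shi] by (rule wbd_suminf[where F="%k. ?f (m + int k)", OF hi _ sums_summable[OF shi] fm]) (use D in simp)
    show "wbd (1 / pt) (D * (1 / (1 - z))) (%w. \<Sum>k. ?f (m - 1 - int k) w)" unfolding sums_unique[OF slo] by (rule wbd_suminf[where F="%k. ?f (m - 1 - int k)", OF lo _ sums_summable[OF slo] fm]) (use D z in simp)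
    show "(%w. \<Sum>k. ?f (m + int k) w) \<in> BM" "(%w. \<Sum>k. ?f (m - 1 - int k) w) \<in> BM" by (rule sm)+
   qed (use D z in auto)
   thus ?thesis
   proof (rule wbd_mono_AE)
    show "AE w in lborel. ?x w * enorm (g i w) <= (\<Sum>k. ?f (m + int k) w) + (\<Sum>k. ?f (m - 1 - int k) w)" using AE_nonzero
    proof eventually_elim
    case (elim w)
    let ?G = "?x w * enorm (g i w)"
    have fe: "?f j w = ?G * ennreal \<bar>?\<psi> j w\<bar>" for j by (simp add: ennreal_mult mult_ac)
    have hs: "((%j. ?\<psi> j w) has_sum 1) UNIV" using \<psi> elim unfolding littlewood_paley_def by blast
    have "?G * 1 <= ?G * ((\<Sum>k. ennreal \<bar>?\<psi> (m + int k) w\<bar>) + (\<Sum>k. ennreal \<bar>?\<psi> (m - 1 - int k) w\<bar>))" by (rule mult_left_mono[OF has_sum_int_le[OF hs]]) simp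
    also have "... = (\<Sum>k. ?f (m + int k) w) + (\<Sum>k. ?f (m - 1 - int k) w)" unfolding fe distrib_left ennreal_suminf_cmult ..
    finally show ?case by simp
    qed
   qed (simp add: algebra_simps)
  qed
  have "wbd (1 / pt) (\<Sum>i\<in>(UNIV::'n set). D * (4 + 1 / (1 - z))) (%w. \<Sum>i\<in>UNIV. ?x w * enorm (g i w))" using D z by (intro wbd_sum comp) (auto intro!: mult_nonneg_nonneg add_nonneg_nonneg)
  moreover have "(\<Sum>i\<in>(UNIV::'n set). D * (4 + 1 / (1 - z))) = C * d * e" by (simp add: C_def D_def mult_ac)
  ultimately show "wbd (1 / pt) (C * d * t powr (- (1 - ?n * (1 / pt)) / 2)) (lin g t)" unfolding e_def[symmetric] lin_def[abs_def] sum_distrib_left by (simp only:)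
 qed
 thus ?thesis by (intro that[OF C])
qed

lemma lorint_zero: "0 < r ==> lorint s r (%x :: 'a::euclidean_space. 0) = 0"
proof -
 assume r: "0 < r"
 have "rearr (%x :: 'a. 0) t = 0" for t using rearr_le[of 0 "%x :: 'a. 0" t] by (simp add: dist_fn_def)
 thus ?thesis using r by (simp add: lorint_def epow_def)
qed

lemma lorint_sum_finite:
 fixes F :: "'i => 'a::euclidean_space => ennreal"
 assumes r: "1 <= r" and "finite I" "\<And>i. i \<in> I ==> lorint s r (F i) < \<infinity>" "\<And>i. i \<in> I ==> F i \<in> BM"
 shows "lorint s r (%x. \<Sum>i\<in>I. F i x) < \<infinity>" using assms(2-)
proof (induction I rule: finite_induct)
 case empty
 thus ?case using r by (simp add: lorint_zero)
next
 case (insert i I)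
 have "lorint s r (%x. F i x + (\<Sum>i\<in>I. F i x)) <= ennreal (2 powr ((1 - s) * r) * 2 powr r) * (lorint s r (F i) + lorint s r (%x. \<Sum>i\<in>I. F i x))" using insert r by (intro lorint_add_le borel_measurable_sum) auto
 also have "... < \<infinity>" using insert by (simp add: ennreal_mult_less_top)
 finally show ?case using insert by simp
qed

text \<open>Fixes Borel representatives of the transforms of the datum and turns membership in the
  data space into finiteness of \<open>lorint\<close>, the form in which the estimates receive
  it.\<close>

lemma admissible_representative:
 fixes u0 :: "'n::finite => 'n dist"
 assumes ad: "admissible_datum p r u0" and p: "1 < p" and r: "1 <= r"
 obtains g where "represents g u0"
  "lorint (1 / p) r (Phi (real CARD('n) / p - 1) g) < \<infinity>"
proof -
 let ?e = "real CARD('n) / p - 1"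
 have h: "has_fourier_fun (u0 i)" "lorentz_norm (conj_exp (ennreal p)) (ennreal r) (%w. cplx (norm w powr ?e) * ft (u0 i) w) < \<infinity>"
  "(%w. cplx (norm w powr ?e) * ft (u0 i) w) \<in> LM" for i using ad by (auto simp: admissible_datum_def HFL_space_def lorentz_space_def)
 have "\<forall>i. \<exists>g. g \<in> BM \<and> (AE x in lebesgue. ft (u0 i) x = g x)" using lebesgue_ex_borel[OF good_measurable[OF Finv_ft(2)[OF h(1)]]] unfolding AE_lebesgue_iff by blast
 then obtain g where g: "\<And>i. g i \<in> BM" "\<And>i. AE x in lebesgue. ft (u0 i) x = g i x" by metis
 note [measurable] = g(1)
 have m: "(%w. ennreal (norm w powr ?e * norm (g i w))) \<in> BM" for i by measurable
 have "lorint (1 / p) r (%w. ennreal (norm w powr ?e * norm (g i w))) < \<infinity>" for i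
 proof -
  have "lorentz_norm (conj_exp (ennreal p)) (ennreal r) (%w. cplx (norm w powr ?e) * ft (u0 i) w) =
   epow (lorint (1 / p) r (%w. ennreal (norm w powr ?e * norm (g i w)))) (1 / r)"
  proof (rule lorentz_norm_lorint[OF h(3) _ m p])
   show "AE w in lebesgue. enorm (cplx (norm w powr ?e) * ft (u0 i) w) = ennreal (norm w powr ?e * norm (g i w))" using g(2)[of i] by eventually_elim (simp add: norm_mult)
  qed (use r in simp)
  thus ?thesis using h(2)[of i] by (auto simp: epow_def less_top split: if_splits)
 qed
 hence "lorint (1 / p) r (Phi ?e g) < \<infinity>" unfolding Phi_def[abs_def] using r m by (intro lorint_sum_finite) auto
 thus ?thesis using h(1) g by (intro that[of g]) (auto simp: represents_def)
qed

theorem theorem6: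
  fixes pt :: real
  assumes "CARD('n::finite) \<ge> 2" and "pt > real CARD('n)"
  shows "\<exists>\<delta>>0.
    (\<forall>p r. real CARD('n) \<le> p \<and> p < pt \<and> 1 \<le> r \<longrightarrow>
      (\<forall>T :: ereal. \<forall>u0 :: 'n \<Rightarrow> 'n dist.
         0 < T \<and> admissible_datum p r u0 \<and> heat_flow_sup pt T u0 \<le> ennreal \<delta> \<longrightarrow>
         unique_solution_in_class p r T u0) \<and>
      (\<forall>u0 :: 'n \<Rightarrow> 'n dist.
         admissible_datum p r u0 \<longrightarrow>
         (\<exists>T0>0. \<forall>T :: real. 0 < T \<and> T \<le> T0 \<longrightarrow> heat_flow_sup pt (ereal T) u0 \<le> ennreal \<delta>))) \<and>
    (\<forall>\<psi> :: real ^ 'n \<Rightarrow> real. littlewood_paley \<psi> \<longrightarrow>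
      (\<exists>\<sigma>>0. \<forall>p r. real CARD('n) \<le> p \<and> p < pt \<and> 1 \<le> r \<longrightarrow>
        (\<forall>u0 :: 'n \<Rightarrow> 'n dist.
           admissible_datum p r u0 \<and>
           vec_norm (besov_norm \<psi> (real CARD('n) / pt - 1) (ennreal pt) \<infinity>) u0 \<le> ennreal \<sigma> \<longrightarrow>
           heat_flow_sup pt \<infinity> u0 \<le> ennreal \<delta> \<and> unique_solution_in_class p r \<infinity> u0)))"
proof -
 let ?n = "real CARD('n)"
 \<comment> \<open>The index of the weak norm in the smallness condition. Since p < pt places it
   below 1/p for all p in question, the constants built from it depend on pt and the dimension
   only.\<close>
 define \<theta> where "\<theta> = 1 / pt"
 have n: "2 <= ?n" using assms(1) by simp
 hence pt: "2 < pt" "1 < pt" using assms(2) by auto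
 have \<theta>: "0 < \<theta>" "?n * \<theta> < 1" using assms(2) pt by (auto simp: \<theta>_def)
 have K: "0 <= K0 TYPE('n) \<theta>" "0 <= K1 TYPE('n) \<theta>" using K_nonneg \<theta> by auto
 have c0: "0 <= C0 TYPE('n) \<theta>" unfolding C0_def using \<theta> by (intro mult_nonneg_nonneg heat_const_nonneg) auto
 \<comment> \<open>One radius that satisfies the smallness conditions of the iteration at both
   indices.\<close>
 define a where "a = 1 / (4 * K0 TYPE('n) \<theta> + 4 * K1 TYPE('n) \<theta> + 1)"
 have a: "0 < a" "4 * K0 TYPE('n) \<theta> * a <= 1" "4 * K1 TYPE('n) \<theta> * a <= 1" using K by (auto simp: a_def divide_simps)
 \<comment> \<open>Undoes the losses between the supremum of the heat flow and the bound a: the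
   factor 2 n pt at index \<theta> and a further factor \<open>C0\<close> at index 0. Dividing by 1
   + C0 serves both indices.\<close>
 define d where "d = a / ((1 + C0 TYPE('n) \<theta>) * (2 * (?n * pt)))"
 have d: "0 < d" using a c0 n pt by (simp add: d_def)
 have cancel: "x / (y * z) * z = x / y" if "z \<noteq> 0" for x y z :: real using that by simp
 have "2 * (?n * (d * pt)) = d * (2 * (?n * pt))" by (simp only: mult_ac)
 also have "... = a / (1 + C0 TYPE('n) \<theta>)" unfolding d_def by (rule cancel) (use n pt in simp)
 finally have A: "2 * (?n * (d * pt)) = a / (1 + C0 TYPE('n) \<theta>)" .
 have A1: "a / (1 + C0 TYPE('n) \<theta>) <= a" "C0 TYPE('n) \<theta> * (a / (1 + C0 TYPE('n) \<theta>)) <= a" using a c0 by (auto simp: field_simps)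
 have unique: "unique_solution_in_class p r T u0"
  if p: "?n <= p" "p < pt" and r: "1 <= r" and T: "0 < T" and ad: "admissible_datum p r u0" and h: "heat_flow_sup pt T u0 <= ennreal d"
  for p r T and u0 :: "'n => 'n dist"
 proof -
  have p1: "1 < p" using p n by linarith
  obtain g where rep: "represents g u0" and L: "lorint (1 / p) r (Phi (?n / p - 1) g) < \<infinity>" by (rule admissible_representative[OF ad p1 r])
  note g = representsD[OF rep]
  have P: "Pb T \<theta> (a / (1 + C0 TYPE('n) \<theta>)) (lin g)" using Pb_if_heat_flow_sup[OF g(1-3) pt(2) assms(2) h] d A by (simp add: \<theta>_def)
  have P0: "Pb T 0 (C0 TYPE('n) \<theta> * (a / (1 + C0 TYPE('n) \<theta>))) (lin g)" using a c0 \<theta> by (intro Pb_lin_zero[OF g(3) P]) auto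
  interpret small_data p r \<theta> a T g u0
  proof
   show "Pb T 0 a (lin g)" "Pb T \<theta> a (lin g)" by (rule Pb_mono[OF P0 order_refl A1(2) order_refl] Pb_mono[OF P order_refl A1(1) order_refl])+
   show "\<theta> < 1 / p" using p p1 by (auto simp: \<theta>_def intro!: divide_strict_left_mono)
  qed (use g L a \<theta> assms(1) p r T in auto)
  show ?thesis unfolding unique_solution_in_class_def using sol_in_class solution_unique[OF assms(1) p(1)] by blast
 qed
 have small: "\<exists>T0>0. \<forall>T :: real. 0 < T \<and> T <= T0 \<longrightarrow> heat_flow_sup pt (ereal T) u0 <= ennreal d"
  if p: "?n <= p" "p < pt" and r: "1 <= r" and ad: "admissible_datum p r u0" for p r and u0 :: "'n => 'n dist"
 proof -
  have p1: "1 < p" using p n by linarith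
  obtain g where rep: "represents g u0" and L: "lorint (1 / p) r (Phi (?n / p - 1) g) < \<infinity>" by (rule admissible_representative[OF ad p1 r])
  note g = representsD[OF rep]
  \<comment> \<open>Returning from components to the vector norm costs the factor n in
    \<open>heat_flow_sup_le\<close>, hence d/n.\<close>
  have "\<exists>T0>0. Pb (ereal T0) \<theta> (d / ?n) (lin g)"
  proof (rule lin_decay[OF g(3), of "1 / p" r])
   show "\<theta> < 1 / p" using p p1 by (auto simp: \<theta>_def intro!: divide_strict_left_mono)
  qed (use g L p p1 r \<theta> d n in \<open>auto simp: field_simps\<close>)
  then obtain T0 where T0: "0 < T0" "Pb (ereal T0) \<theta> (d / ?n) (lin g)" by blast
  have "heat_flow_sup pt (ereal T) u0 <= ennreal d" if "T <= T0" for T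
  proof -
   have "Pb (ereal T) (1 / pt) (d / ?n) (lin g)" using Pb_mono[OF T0(2), of "lin g" "d / ?n" "ereal T"] that by (simp add: \<theta>_def)
   from heat_flow_sup_le[OF g(1-3) pt(2) this] show ?thesis using d n by simp
  qed
  thus ?thesis using T0(1) by blast
 qed
 have besov: "\<exists>c>0. \<forall>p r. ?n <= p \<and> p < pt \<and> 1 <= r \<longrightarrow>
    (\<forall>u0 :: 'n => 'n dist. admissible_datum p r u0 \<and>
    vec_norm (besov_norm \<psi> (?n / pt - 1) (ennreal pt) \<infinity>) u0 <= ennreal c \<longrightarrow>
    heat_flow_sup pt \<infinity> u0 <= ennreal d \<and> unique_solution_in_class p r \<infinity> u0)"
  if \<psi>: "littlewood_paley \<psi>" for \<psi> :: "real ^ 'n => real"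
 proof -
  obtain C where C: "0 < C" "\<And>g (u0 :: 'n => 'n dist) c. represents g u0 ==> 0 <= c ==>
   vec_norm (besov_norm \<psi> (?n / pt - 1) (ennreal pt) \<infinity>) u0 <= ennreal c ==> Pb \<infinity> (1 / pt) (C * c) (lin g)" using Pb_if_besov[OF \<psi> assms(2)] by metis
  \<comment> \<open>C is the loss in passing from the blocks to the weak bound, n the one from
    components to the vector norm.\<close>
  define c where "c = d / (?n * C)"
  have c: "0 < c" "?n * (C * c) = d" using d C(1) n by (auto simp: c_def)
  have "heat_flow_sup pt \<infinity> u0 <= ennreal d"
   if p: "?n <= p" and r: "1 <= r" and ad: "admissible_datum p r u0" and b: "vec_norm (besov_norm \<psi> (?n / pt - 1) (ennreal pt) \<infinity>) u0 <= ennreal c"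
   for p r and u0 :: "'n => 'n dist"
  proof -
   have p1: "1 < p" using p n by linarith
   obtain g where rep: "represents g u0" by (rule admissible_representative[OF ad p1 r])
   note g = representsD[OF rep]
   have "Pb \<infinity> (1 / pt) (C * c) (lin g)" using c by (intro C(2)[OF rep _ b]) auto
   from heat_flow_sup_le[OF g(1-3) pt(2) this] show ?thesis using c C(1) by simp
  qed
  thus ?thesis using c(1) unique[where T=\<infinity>] by (intro exI[of _ c]) auto
 qed
 show ?thesis using d unique small besov by (intro exI[of _ d]) blast
qed

end
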